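(* Let $K=\mathbb{C}(t)$. There is an absolute constant $c>0$ such that the following holds. Let $C\subset \mathbb{A}^n_K$ be an irreducible affine curve of degree $d$ over $K$. Then for every integer $b\geq 1$, $$\dim C(b)\leq \left\lceil \frac{b}{d}\right\rceil,$$ and the number of irreducible components of $C(b)$ of dimension $\lceil b/d\rceil$ is at most $c\,d^3b$.
   Context: For a quasi-affine variety $X\subset \mathbb{A}^n_K$ and an integer $b\ge1$, $X(b)=\{(a_1,\ldots,a_n)\in X(K): a_i\in\mathbb{C}[t],\ \deg a_i<b \text{ for all } i\}$. Identifying polynomials of degree $<b$ with their coefficient vectors in $\mathbb{C}^b$, $X(b)$ is naturally a quasi-affine variety over $\mathbb{C}$ in $\mathbb{A}^{bn}_{\mathbb{C}}$, with equations obtained by expanding the equations of $X$ in powers of $t$; its dimension and irreducible components are those of this variety over $\mathbb{C}$. *)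

theory Defs
  imports
    "HOL-Library.Poly_Mapping"
    "HOL-Library.Extended_Nat"
    "HOL-Computational_Algebra.Polynomial"
    "HOL-Computational_Algebra.Fraction_Field"
    "HOL-Algebra.QuotRing"
    "HOL-Analysis.Abstract_Topology"
begin

section \<open>Polynomial rings\<close>

text \<open>A monomial is a finitely supported exponent function. A type of variables cannot depend on a
  natural number, so the polynomial ring in the variables from a set \<open>I\<close> is carved out of the
  polynomial ring in all variables of type \<open>'i\<close>.\<close>

type_synonym ('i, 'a) mpoly = "('i \<Rightarrow>\<^sub>0 nat) \<Rightarrow>\<^sub>0 'a"

definition mpolys :: "'i set \<Rightarrow> ('i, 'a::comm_ring_1) mpoly set" where
  "mpolys I = {p. \<forall>m\<in>Poly_Mapping.keys p. Poly_Mapping.keys m \<subseteq> I}"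

definition mpoly_ring :: "'i set \<Rightarrow> ('i, 'a::comm_ring_1) mpoly ring" where
  "mpoly_ring I = \<lparr>carrier = mpolys I, mult = (*), one = 1, zero = 0, add = (+)\<rparr>"

definition eval_monom :: "('i \<Rightarrow> 'a::comm_ring_1) \<Rightarrow> ('i \<Rightarrow>\<^sub>0 nat) \<Rightarrow> 'a" where
  "eval_monom x m = (\<Prod>i\<in>Poly_Mapping.keys m. x i ^ Poly_Mapping.lookup m i)"

definition eval_mpoly :: "('i \<Rightarrow> 'a::comm_ring_1) \<Rightarrow> ('i, 'a) mpoly \<Rightarrow> 'a" where
  "eval_mpoly x p = (\<Sum>m\<in>Poly_Mapping.keys p. Poly_Mapping.lookup p m * eval_monom x m)"

lemma mpolys_0 [simp]: "0 \<in> mpolys I"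
  by (simp add: mpolys_def)

lemma mpolys_1 [simp]: "1 \<in> mpolys I"
  by (simp add: mpolys_def)

lemma mpolys_add: "p \<in> mpolys I \<Longrightarrow> q \<in> mpolys I \<Longrightarrow> p + q \<in> mpolys I"
  using Poly_Mapping.keys_add[of p q] by (auto simp: mpolys_def)

lemma mpolys_uminus: "p \<in> mpolys I \<Longrightarrow> - p \<in> mpolys I"
  by (simp add: mpolys_def)

lemma mpolys_mult: "p \<in> mpolys I \<Longrightarrow> q \<in> mpolys I \<Longrightarrow> p * q \<in> mpolys I"
proof -
  assume p: "p \<in> mpolys I" and q: "q \<in> mpolys I"
  show "p * q \<in> mpolys I"
    unfolding mpolys_def
  proof safe
    fix m i
    assume m: "m \<in> Poly_Mapping.keys (p * q)" and i: "i \<in> Poly_Mapping.keys m"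
    from m obtain a b where ab: "a \<in> Poly_Mapping.keys p" "b \<in> Poly_Mapping.keys q" "m = a + b"
      using keys_mult[of p q] by blast
    then have "i \<in> Poly_Mapping.keys a \<union> Poly_Mapping.keys b"
      using i Poly_Mapping.keys_add[of a b] by auto
    then show "i \<in> I"
      using ab p q by (auto simp: mpolys_def)
  qed
qed

lemma cring_mpoly_ring: "cring (mpoly_ring I :: ('i, 'a::comm_ring_1) mpoly ring)"
  (is "cring ?R")
proof (rule cringI)
  show "abelian_group ?R"
  proof (rule abelian_groupI)
    fix p :: "('i, 'a) mpoly"
    assume "p \<in> carrier ?R"
    then show "\<exists>q\<in>carrier ?R. q \<oplus>\<^bsub>?R\<^esub> p = \<zero>\<^bsub>?R\<^esub>"
      by (auto simp: mpoly_ring_def intro!: bexI[of _ "- p"] mpolys_uminus)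
  qed (auto simp: mpoly_ring_def mpolys_add ac_simps)
  show "comm_monoid ?R"
    by (rule comm_monoidI) (auto simp: mpoly_ring_def mpolys_mult ac_simps)
qed (auto simp: mpoly_ring_def distrib_right)

lemma eval_mpoly_superset:
  assumes "finite A" "Poly_Mapping.keys p \<subseteq> A"
  shows "eval_mpoly x p = (\<Sum>m\<in>A. Poly_Mapping.lookup p m * eval_monom x m)"
  unfolding eval_mpoly_def
  by (rule sum.mono_neutral_left) (use assms in \<open>auto simp: in_keys_iff\<close>)

lemma eval_mpoly_0 [simp]: "eval_mpoly x 0 = 0"
  by (simp add: eval_mpoly_def)

lemma eval_mpoly_1 [simp]: "eval_mpoly x 1 = 1"
  by (simp add: eval_mpoly_def eval_monom_def)

lemma eval_mpoly_add: "eval_mpoly x (p + q) = eval_mpoly x p + eval_mpoly x q"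
proof -
  let ?A = "Poly_Mapping.keys p \<union> Poly_Mapping.keys q"
  have "eval_mpoly x (p + q) = (\<Sum>m\<in>?A. Poly_Mapping.lookup (p + q) m * eval_monom x m)"
    by (rule eval_mpoly_superset) (use Poly_Mapping.keys_add[of p q] in auto)
  then show ?thesis
    by (simp add: eval_mpoly_superset[of ?A] lookup_add distrib_right sum.distrib)
qed

lemma eval_monom_add: "eval_monom x (m + m') = eval_monom x m * eval_monom x m'"
proof -
  let ?A = "Poly_Mapping.keys m \<union> Poly_Mapping.keys m'"
  have *: "eval_monom x k = (\<Prod>i\<in>?A. x i ^ Poly_Mapping.lookup k i)"
    if "Poly_Mapping.keys k \<subseteq> ?A" for k
    unfolding eval_monom_def
    by (rule prod.mono_neutral_left) (use that in \<open>auto simp: in_keys_iff\<close>)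
  show ?thesis
    using Poly_Mapping.keys_add[of m m'] by (simp add: * lookup_add power_add prod.distrib)
qed

lemma eval_mpoly_single: "eval_mpoly x (Poly_Mapping.single m c) = c * eval_monom x m"
  by (simp add: eval_mpoly_def)

lemma mpoly_induct [case_names zero single add]:
  fixes p :: "('i, 'a::comm_ring_1) mpoly"
  assumes "P 0" "\<And>m c. P (Poly_Mapping.single m c)" "\<And>p q. P p \<Longrightarrow> P q \<Longrightarrow> P (p + q)"
  shows "P p"
proof -
  have "P (\<Sum>m\<in>A. Poly_Mapping.single m (Poly_Mapping.lookup p m))" for A
    by (induction A rule: infinite_finite_induct) (use assms in auto)
  moreover have "p = (\<Sum>m\<in>Poly_Mapping.keys p. Poly_Mapping.single m (Poly_Mapping.lookup p m))"
    by (rule poly_mapping_eqI)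
       (auto simp: lookup_sum lookup_single when_def in_keys_iff if_distrib cong: if_cong)
  ultimately show ?thesis by metis
qed

lemma eval_mpoly_mult: "eval_mpoly x (p * q) = eval_mpoly x p * eval_mpoly x q"
proof (induction p rule: mpoly_induct)
  case (single m c)
  show ?case
    by (induction q rule: mpoly_induct)
       (simp_all add: mult_single eval_mpoly_single eval_monom_add eval_mpoly_add distrib_left
          distrib_right mult_ac)
qed (simp_all add: eval_mpoly_add distrib_right)

section \<open>Irreducible sets and dimension\<close>

definition chain_dim :: "'a set set \<Rightarrow> enat" where
  "chain_dim \<F> =
     Sup {enat k | k. \<exists>Z :: nat \<Rightarrow> 'a set. (\<forall>i\<le>k. Z i \<in> \<F>) \<and> (\<forall>i<k. Z i \<subset> Z (Suc i))}"

definition ring_krull_dim :: "('a, 'm) ring_scheme \<Rightarrow> enat" where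
  "ring_krull_dim R = chain_dim {Q. primeideal Q R}"

definition irreducible_in :: "'a topology \<Rightarrow> 'a set \<Rightarrow> bool" where
  "irreducible_in X Z \<longleftrightarrow> Z \<subseteq> topspace X \<and> Z \<noteq> {} \<and>
     (\<forall>A B. closedin X A \<and> closedin X B \<and> Z \<subseteq> A \<union> B \<longrightarrow> Z \<subseteq> A \<or> Z \<subseteq> B)"

text \<open>The empty space gets dimension \<open>0\<close> (the supremum of the empty set of extended naturals).\<close>

definition space_krull_dim :: "'a topology \<Rightarrow> enat" where
  "space_krull_dim X = chain_dim {Z. closedin X Z \<and> irreducible_in X Z}"

definition irreducible_components :: "'a topology \<Rightarrow> 'a set set" where
  "irreducible_components X =
     {Z. irreducible_in X Z \<and> (\<forall>Y. irreducible_in X Y \<and> Z \<subseteq> Y \<longrightarrow> Y = Z)}"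

section \<open>Affine space with its Zariski topology\<close>

abbreviation affine_space :: "'i set \<Rightarrow> ('i \<Rightarrow> 'a) set" where
  "affine_space I \<equiv> I \<rightarrow>\<^sub>E UNIV"

definition zero_locus :: "'i set \<Rightarrow> ('i, 'a::comm_ring_1) mpoly set \<Rightarrow> ('i \<Rightarrow> 'a) set" where
  "zero_locus I S = {x \<in> affine_space I. \<forall>f\<in>S. eval_mpoly x f = 0}"

definition zariski :: "'i set \<Rightarrow> ('i \<Rightarrow> 'a::idom) topology" where
  "zariski I = topology (\<lambda>U. \<exists>S\<subseteq>mpolys I. U = affine_space I - zero_locus I S)"

lemma istopology_zariski:
  "istopology (\<lambda>U :: ('i \<Rightarrow> 'a::idom) set. \<exists>S\<subseteq>mpolys I. U = affine_space I - zero_locus I S)"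
  unfolding istopology_def
proof (intro conjI allI impI)
  fix U V :: "('i \<Rightarrow> 'a) set"
  assume "\<exists>S\<subseteq>mpolys I. U = affine_space I - zero_locus I S"
    and "\<exists>S\<subseteq>mpolys I. V = affine_space I - zero_locus I S"
  then obtain S T where ST: "S \<subseteq> mpolys I" "U = affine_space I - zero_locus I S"
    "T \<subseteq> mpolys I" "V = affine_space I - zero_locus I T" by blast
  let ?M = "{f * g | f g. f \<in> S \<and> g \<in> T}"
  have "?M \<subseteq> mpolys I"
    using ST(1,3) by (auto intro!: mpolys_mult)
  moreover have "zero_locus I ?M = zero_locus I S \<union> zero_locus I T"
    unfolding zero_locus_def by (auto simp: eval_mpoly_mult) (metis eval_mpoly_mult mult_eq_0_iff)+
  ultimately show "\<exists>S\<subseteq>mpolys I. U \<inter> V = affine_space I - zero_locus I S"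
    using ST(2,4) by (intro exI[of _ ?M]) auto
next
  fix \<K> :: "('i \<Rightarrow> 'a) set set"
  assume "\<forall>K\<in>\<K>. \<exists>S\<subseteq>mpolys I. K = affine_space I - zero_locus I S"
  then obtain S where S: "\<And>K. K \<in> \<K> \<Longrightarrow> S K \<subseteq> mpolys I \<and> K = affine_space I - zero_locus I (S K)"
    by metis
  have "\<Union>\<K> = affine_space I - zero_locus I (\<Union>(S ` \<K>))"
  proof (intro equalityI subsetI)
    fix x assume "x \<in> \<Union>\<K>"
    then obtain K where "K \<in> \<K>" "x \<in> K" by blast
    then have "x \<in> affine_space I - zero_locus I (S K)"
      using S by blast
    then show "x \<in> affine_space I - zero_locus I (\<Union>(S ` \<K>))"
      using \<open>K \<in> \<K>\<close> unfolding zero_locus_def by blast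
  next
    fix x assume "x \<in> affine_space I - zero_locus I (\<Union>(S ` \<K>))"
    then obtain K where "K \<in> \<K>" "x \<in> affine_space I - zero_locus I (S K)"
      unfolding zero_locus_def by blast
    then show "x \<in> \<Union>\<K>" using S by blast
  qed
  then show "\<exists>T\<subseteq>mpolys I. \<Union>\<K> = affine_space I - zero_locus I T"
    using S by (intro exI[of _ "\<Union>(S ` \<K>)"]) blast
qed

lemma topspace_zariski: "topspace (zariski I :: ('i \<Rightarrow> 'a::idom) topology) = affine_space I"
proof -
  have "(1 :: ('i, 'a) mpoly) \<in> mpolys I \<and> zero_locus I {1 :: ('i, 'a) mpoly} = {}"
    by (auto simp: zero_locus_def)
  then have "openin (zariski I) (affine_space I :: ('i \<Rightarrow> 'a) set)"
    unfolding zariski_def topology_inverse'[OF istopology_zariski]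
    by (intro exI[of _ "{1}"]) auto
  moreover have "U \<subseteq> affine_space I" if "openin (zariski I) U" for U :: "('i \<Rightarrow> 'a) set"
    using that unfolding zariski_def topology_inverse'[OF istopology_zariski] by blast
  ultimately show ?thesis
    by (meson openin_subset openin_topspace subset_antisym)
qed

lemma closedin_zariski: "closedin (zariski I) Z \<longleftrightarrow> (\<exists>S\<subseteq>mpolys I. Z = zero_locus I S)"
proof -
  have "zero_locus I S \<subseteq> affine_space I" for S :: "('a, 'b) mpoly set"
    by (auto simp: zero_locus_def)
  moreover have "openin (zariski I) U \<longleftrightarrow> (\<exists>S\<subseteq>mpolys I. U = affine_space I - zero_locus I S)" for U
    unfolding zariski_def topology_inverse'[OF istopology_zariski] ..
  ultimately show ?thesis
    unfolding closedin_def topspace_zariski by (smt (verit) double_diff subset_refl)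
qed

section \<open>Affine curves and their degree\<close>

text \<open>The ground field need not be algebraically closed, so a closed irreducible subvariety of affine
  \<open>n\<close>-space over it (possibly without rational points) is given by its prime ideal in the polynomial
  ring; its dimension is the Krull dimension of the coordinate ring. Irreducibility is meant over the
  ground field, not over an algebraic closure.\<close>

definition irreducible_affine_curve :: "nat \<Rightarrow> (nat, 'a::field) mpoly set \<Rightarrow> bool" where
  "irreducible_affine_curve n C \<longleftrightarrow>
     primeideal C (mpoly_ring {..<n}) \<and> ring_krull_dim (mpoly_ring {..<n} Quot C) = 1"

definition mpolys_upto :: "'i set \<Rightarrow> nat \<Rightarrow> ('i, 'a::comm_ring_1) mpoly set" where
  "mpolys_upto I k = {p \<in> mpolys I. \<forall>m\<in>Poly_Mapping.keys p.
     (\<Sum>i\<in>Poly_Mapping.keys m. Poly_Mapping.lookup m i) \<le> k}"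

definition mpoly_scale :: "'a::field \<Rightarrow> ('i, 'a) mpoly \<Rightarrow> ('i, 'a) mpoly" where
  "mpoly_scale c p = Poly_Mapping.single 0 c * p"

lemma vector_space_mpoly: "vector_space mpoly_scale"
  by unfold_locales
     (simp_all add: mpoly_scale_def distrib_left distrib_right single_add mult_single
        flip: mult.assoc)

text \<open>Homogenisation with one extra variable maps the polynomials of degree at most \<open>k\<close> bijectively
  onto the forms of degree \<open>k\<close>, and those in the ideal \<open>C\<close> onto the forms of degree \<open>k\<close> in the ideal
  of the projective closure. Hence the following is the dimension of the degree \<open>k\<close> part of the
  homogeneous coordinate ring of the projective closure, and the degree below is the usual degree
  of a projective variety.\<close>

definition hilbert_function :: "nat \<Rightarrow> (nat, 'a::field) mpoly set \<Rightarrow> nat \<Rightarrow> nat" where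
  "hilbert_function n C k =
     vector_space.dim mpoly_scale (mpolys_upto {..<n} k :: (nat, 'a) mpoly set) -
     vector_space.dim mpoly_scale (C \<inter> mpolys_upto {..<n} k)"

definition has_degree :: "nat \<Rightarrow> (nat, 'a::field) mpoly set \<Rightarrow> nat \<Rightarrow> bool" where
  "has_degree n C d \<longleftrightarrow>
     (\<exists>h :: rat poly. (\<forall>\<^sub>F k in sequentially. poly h (of_nat k) = of_nat (hilbert_function n C k)) \<and>
        of_nat d = fact (Polynomial.degree h) * lead_coeff h)"

section \<open>Polynomial points of bounded degree\<close>

definition rational_points :: "nat \<Rightarrow> (nat, 'a::field) mpoly set \<Rightarrow> (nat \<Rightarrow> 'a) set" where
  "rational_points n C = zero_locus {..<n} C"

definition poly_points ::
    "nat \<Rightarrow> (nat, complex poly fract) mpoly set \<Rightarrow> nat \<Rightarrow> (nat \<Rightarrow> complex poly) set" where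
  "poly_points n C b =
     {a \<in> {..<n} \<rightarrow>\<^sub>E UNIV. (\<lambda>i\<in>{..<n}. Fract (a i) 1) \<in> rational_points n C \<and>
        (\<forall>i<n. Polynomial.degree (a i) < b)}"

text \<open>The affine space of dimension \<open>b n\<close> over the complex numbers has its coordinates indexed by
  \<open>{..<n} \<times> {..<b}\<close>: the coordinate \<open>(i, j)\<close> is the coefficient of \<open>t ^ j\<close> in the \<open>i\<close>-th polynomial.\<close>

definition coeff_vector :: "nat \<Rightarrow> nat \<Rightarrow> (nat \<Rightarrow> complex poly) \<Rightarrow> nat \<times> nat \<Rightarrow> complex" where
  "coeff_vector n b a = (\<lambda>(i, j)\<in>{..<n} \<times> {..<b}. Polynomial.coeff (a i) j)"

definition poly_points_space ::
    "nat \<Rightarrow> (nat, complex poly fract) mpoly set \<Rightarrow> nat \<Rightarrow> (nat \<times> nat \<Rightarrow> complex) topology" where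
  "poly_points_space n C b =
     subtopology (zariski ({..<n} \<times> {..<b})) (coeff_vector n b ` poly_points n C b)"

end

theory Submission
  imports Defs
    "HOL-Computational_Algebra.Fundamental_Theorem_Algebra"
    "HOL-Analysis.Continuum_Not_Denumerable"
begin

text \<open>Let \<open>k = \<lceil>b / d\<rceil>\<close> and let \<open>x\<close> be a linear form with constant coefficients over which the
  coordinate ring of \<open>C\<close> is finite. The point is to bound by \<open>2 b d ^ 3\<close> the number of polynomial
  points \<open>Q\<close> of degree less than \<open>b\<close> with \<open>x(Q)\<close> prescribed modulo \<open>(t - t0) ^ k\<close> and
  whose reduction at \<open>t0\<close> is a smooth point of the projection. This is the determinant method over a
  function field: at most \<open>d\<close> points lie over the value of \<open>x\<close> at \<open>t0\<close>. By Hensel's lemma the points reducing to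
  one of them are given by power series in \<open>\<tau> = t - t0\<close> and \<open>w\<close>, where
  \<open>x = x(Q0) + \<tau> ^ k w\<close>, in which \<open>\<tau> ^ a\<close> comes with at most the power \<open>a div k\<close> of \<open>w\<close>. Counting
  coefficients gives a polynomial of degree \<open>2 b d\<close>, nonzero on \<open>C\<close>, whose value at each such \<open>Q\<close> is
  divisible by a power of \<open>\<tau>\<close> exceeding its degree in \<open>t\<close>, and Bezout's bound applies.

  So the \<open>k\<close> coefficients of \<open>x(Q)\<close> modulo \<open>(t - t0) ^ k\<close> define a map from a dense open part of the
  relevant components of \<open>C(b)\<close> to affine \<open>k\<close>-space with fibres of size at most \<open>2 b d ^ 3\<close>. Hence the
  dimension is at most \<open>k\<close>, and since the components of dimension \<open>k\<close> all dominate affine space, a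
  general fibre meets each of them in a point lying on no other one.\<close>

section \<open>Ideals and polynomials\<close>

text \<open>The threshold \<open>k = \<lceil>b / d\<rceil>\<close> comes out of a parameter count.
  Let D be the degree of the auxiliary polynomial, B = b - 1, and ask for divisibility by the power
  of \<tau> with exponent N = k d D. This costs about k d^2 D^2 / 2 equations, against about k d^2
  D^2 - d B D^2 / 2 unknowns. The surplus d D^2 (k d - B) / 2 is positive exactly when b \<le> k d.
  The factor k d - B can be as small as 1, so D has to beat the lower-order terms; D = 2 b d does.
  The passage from fibres to dimension and components needs general fibres. These come from the
  uncountability of the ground field: specialising a transcendental element goes wrong for only
  countably many values, so countably many prime ideals can be specialised at once. The same device
  yields the Nullstellensatz over the complex numbers and, over K, a chain of primes from two
  independent functions. What is needed of the curve (basis of the function field, bound on zeros)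
  is read off its Hilbert function by comparing slopes.\<close>

lemma homogeneous_system:
  fixes a :: "'e \<Rightarrow> 'u \<Rightarrow> 'k::field"
  assumes "finite E" "finite U" "card E < card U"
  shows "\<exists>p. (\<exists>u\<in>U. p u \<noteq> 0) \<and> (\<forall>e\<in>E. (\<Sum>u\<in>U. a e u * p u) = 0)"
  using assms
proof (induction E arbitrary: U a rule: finite_induct)
  case empty
  then have "U \<noteq> {}" by auto
  then show ?case by (intro exI[of _ "\<lambda>_. 1"]) auto
next
  case (insert e E)
  show ?case
  proof (cases "\<forall>u\<in>U. a e u = 0")
    case True
    have "card E < card U" using insert by simp
    from insert.IH[OF insert.prems(1) this, of a] obtain p where
      "\<exists>u\<in>U. p u \<noteq> 0" "\<forall>e\<in>E. (\<Sum>u\<in>U. a e u * p u) = 0" by blast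
    then show ?thesis using True by (intro exI[of _ p]) auto
  next
    case False
    \<comment> \<open>Gaussian elimination: equation \<open>e\<close> is solved for the pivot
      unknown \<open>v\<close>, and \<open>a'\<close> are the coefficients of the remaining
      equations after substitution.\<close>
    then obtain v where v: "v \<in> U" "a e v \<noteq> 0" by auto
    let ?U = "U - {v}"
    define a' where "a' = (\<lambda>f u. a f u - a f v * a e u / a e v)"
    have "card E < card ?U" using insert v by simp
    from insert.IH[OF _ this, of a'] insert.prems obtain p where
      p: "\<exists>u\<in>?U. p u \<noteq> 0" "\<And>f. f \<in> E \<Longrightarrow> (\<Sum>u\<in>?U. a' f u * p u) = 0" by auto
    define s where "s = (\<Sum>u\<in>?U. a e u * p u)"
    define q where "q = (\<lambda>u. if u = v then - s / a e v else p u)"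
    have split: "(\<Sum>u\<in>U. a f u * q u) = a f v * (- s / a e v) + (\<Sum>u\<in>?U. a f u * p u)" for f
    proof -
      have "(\<Sum>u\<in>U. a f u * q u) = a f v * q v + (\<Sum>u\<in>?U. a f u * q u)"
        using insert.prems v by (intro sum.remove) auto
      also have "(\<Sum>u\<in>?U. a f u * q u) = (\<Sum>u\<in>?U. a f u * p u)"
        by (rule sum.cong) (auto simp: q_def)
      finally show ?thesis by (simp add: q_def)
    qed
    have "(\<Sum>u\<in>U. a f u * q u) = 0" if "f \<in> insert e E" for f
    proof (cases "f = e")
      case True
      then show ?thesis using v by (simp add: split s_def)
    next
      case False
      with that have "f \<in> E" by auto
      have "(\<Sum>u\<in>?U. a' f u * p u) = (\<Sum>u\<in>?U. a f u * p u - (a f v / a e v) * (a e u * p u))"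
        by (rule sum.cong) (simp_all add: a'_def algebra_simps)
      with p(2)[OF \<open>f \<in> E\<close>] have "(\<Sum>u\<in>?U. a f u * p u) - (a f v / a e v) * s = 0"
        by (simp only: sum_subtractf s_def sum_distrib_left)
      then show ?thesis by (simp add: split)
    qed
    moreover have "\<exists>u\<in>U. q u \<noteq> 0" using p(1) by (auto simp: q_def)
    ultimately show ?thesis by blast
  qed
qed

text \<open>Ideals live in a whole ring type, so that type-class arithmetic applies; ideals of
  \<open>mpoly_ring I\<close> are brought into this form by adding the variables outside
  \<open>I\<close>.\<close>

definition idl :: "'r::comm_ring_1 set \<Rightarrow> bool" where
  "idl J \<longleftrightarrow> 0 \<in> J \<and> (\<forall>a\<in>J. \<forall>b\<in>J. a + b \<in> J) \<and> (\<forall>r. \<forall>a\<in>J. r * a \<in> J)"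

definition prime_idl :: "'r::comm_ring_1 set \<Rightarrow> bool" where
  "prime_idl J \<longleftrightarrow> idl J \<and> 1 \<notin> J \<and> (\<forall>a b. a * b \<in> J \<longrightarrow> a \<in> J \<or> b \<in> J)"

lemma idl_0: "idl J \<Longrightarrow> 0 \<in> J"
  and idl_add: "idl J \<Longrightarrow> a \<in> J \<Longrightarrow> b \<in> J \<Longrightarrow> a + b \<in> J"
  and idl_mult: "idl J \<Longrightarrow> a \<in> J \<Longrightarrow> r * a \<in> J"
  by (simp_all add: idl_def)

lemma idl_mult_right: "idl J \<Longrightarrow> a \<in> J \<Longrightarrow> a * r \<in> J"
  by (subst mult.commute) (rule idl_mult)

lemma idl_uminus: "idl J \<Longrightarrow> a \<in> J \<Longrightarrow> - a \<in> J"
  using idl_mult[of J a "-1"] by simp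

lemma idl_diff: "idl J \<Longrightarrow> a \<in> J \<Longrightarrow> b \<in> J \<Longrightarrow> a - b \<in> J"
  using idl_add[of J a "-b"] idl_uminus[of J b] by simp

lemma idl_sum: "idl J \<Longrightarrow> (\<And>i. i \<in> A \<Longrightarrow> f i \<in> J) \<Longrightarrow> sum f A \<in> J"
  by (induction A rule: infinite_finite_induct) (auto simp: idl_0 idl_add)

lemma idl_cong: "idl J \<Longrightarrow> a - b \<in> J \<Longrightarrow> a \<in> J \<longleftrightarrow> b \<in> J"
  using idl_add[of J "a - b" b] idl_diff[of J a "a - b"] by auto

lemma idl_diff_trans: "idl J \<Longrightarrow> a - b \<in> J \<Longrightarrow> b - c \<in> J \<Longrightarrow> a - c \<in> J"
  using idl_add[of J "a - b" "b - c"] by simp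

lemma prime_idl_idl: "prime_idl J \<Longrightarrow> idl J"
  by (simp add: prime_idl_def)

lemma prime_idl_mult: "prime_idl J \<Longrightarrow> a * b \<in> J \<longleftrightarrow> a \<in> J \<or> b \<in> J"
  by (auto simp: prime_idl_def idl_mult idl_mult_right)

lemma prime_idl_power: "prime_idl J \<Longrightarrow> a ^ n \<in> J \<Longrightarrow> a \<in> J"
proof (induction n)
  case 0
  then show ?case by (simp add: prime_idl_def)
next
  case (Suc n)
  then show ?case by (auto simp: prime_idl_mult)
qed

lemma prime_idl_prod:
  "finite A \<Longrightarrow> prime_idl J \<Longrightarrow> (\<And>i. i \<in> A \<Longrightarrow> f i \<notin> J) \<Longrightarrow> prod f A \<notin> J"
proof (induction A rule: finite_induct)
  case empty
  then show ?case by (simp add: prime_idl_def)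
next
  case (insert i A)
  then show ?case by (simp add: prime_idl_mult)
qed

definition idl_plus :: "'r::comm_ring_1 set \<Rightarrow> 'r \<Rightarrow> 'r set" where
  "idl_plus J v = {a. \<exists>s. a - v * s \<in> J}"

lemma idl_plusI: "a - v * s \<in> J \<Longrightarrow> a \<in> idl_plus J v"
  unfolding idl_plus_def by (rule CollectI) (rule exI)

lemma idl_plusE: assumes "a \<in> idl_plus J v" obtains s where "a - v * s \<in> J"
  using assms unfolding idl_plus_def by auto

lemma idl_idl_plus: assumes "idl J" shows "idl (idl_plus J v)"
  unfolding idl_def
proof (intro conjI ballI allI)
  show "0 \<in> idl_plus J v"
    by (rule idl_plusI[where s = 0]) (simp add: idl_0 assms)
  fix a assume "a \<in> idl_plus J v"
  then obtain s where s: "a - v * s \<in> J" by (rule idl_plusE)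
  show "r * a \<in> idl_plus J v" for r
    using idl_mult[OF assms s, of r] by (intro idl_plusI[where s = "r * s"]) (simp add: algebra_simps)
  fix b assume "b \<in> idl_plus J v"
  then obtain s' where s': "b - v * s' \<in> J" by (rule idl_plusE)
  show "a + b \<in> idl_plus J v"
    using idl_add[OF assms s s'] by (intro idl_plusI[where s = "s + s'"]) (simp add: algebra_simps)
qed

lemma subset_idl_plus: "J \<subseteq> idl_plus J v"
proof
  fix a assume "a \<in> J"
  then show "a \<in> idl_plus J v" by (intro idl_plusI[where s = 0]) simp
qed

lemma mem_idl_plus: "idl J \<Longrightarrow> v \<in> idl_plus J v"
  by (rule idl_plusI[where s = 1]) (simp add: idl_0)

text \<open>Krull's argument. An ideal maximal among those containing \<open>J\<close> and missing
  \<open>S\<close> is prime: if a product lies in it but neither factor does, adding either factor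
  meets \<open>S\<close>, and the product of the two elements met lies both in \<open>S\<close> and
  in the ideal.\<close>

lemma prime_avoiding:
  fixes J S :: "'r::comm_ring_1 set"
  assumes J: "idl J" "J \<inter> S = {}" and S: "1 \<in> S" "\<And>a b. a \<in> S \<Longrightarrow> b \<in> S \<Longrightarrow> a * b \<in> S"
  obtains P where "prime_idl P" "J \<subseteq> P" "P \<inter> S = {}"
proof -
  let ?A = "{P. idl P \<and> J \<subseteq> P \<and> P \<inter> S = {}}"
  have "\<exists>M\<in>?A. \<forall>X\<in>?A. M \<subseteq> X \<longrightarrow> X = M"
  proof (rule subset_Zorn_nonempty)
    show "?A \<noteq> {}" using J by auto
    fix \<C> assume C: "\<C> \<noteq> {}" "subset.chain ?A \<C>"
    then have sub: "\<And>X. X \<in> \<C> \<Longrightarrow> idl X \<and> J \<subseteq> X \<and> X \<inter> S = {}"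
      by (auto simp: subset.chain_def)
    have "idl (\<Union>\<C>)"
      unfolding idl_def
    proof (intro conjI ballI allI)
      show "0 \<in> \<Union>\<C>" using C(1) sub idl_0 by blast
      fix a assume "a \<in> \<Union>\<C>"
      then obtain X where X: "X \<in> \<C>" "a \<in> X" by auto
      then have "r * a \<in> X" for r using sub idl_mult by blast
      then show "r * a \<in> \<Union>\<C>" for r using X by blast
      fix b assume "b \<in> \<Union>\<C>"
      then obtain Y where Y: "Y \<in> \<C>" "b \<in> Y" by auto
      from C(2) X Y have "X \<subseteq> Y \<or> Y \<subseteq> X" by (simp add: subset_chain_def)
      then obtain Z where Z: "Z \<in> \<C>" "a \<in> Z" "b \<in> Z" using X Y by blast
      then have "a + b \<in> Z" using sub idl_add by blast
      then show "a + b \<in> \<Union>\<C>" using Z by blast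
    qed
    then show "\<Union>\<C> \<in> ?A" using C(1) sub by blast
  qed
  then obtain P where P: "idl P" "J \<subseteq> P" "P \<inter> S = {}"
    and max: "\<And>X. idl X \<Longrightarrow> J \<subseteq> X \<Longrightarrow> X \<inter> S = {} \<Longrightarrow> P \<subseteq> X \<Longrightarrow> X = P" by auto
  have meet: "\<exists>s\<in>S. \<exists>t. s - a * t \<in> P" if "a \<notin> P" for a
  proof (rule ccontr)
    assume "\<not> ?thesis"
    then have "idl_plus P a \<inter> S = {}" by (auto elim!: idl_plusE)
    then have "idl_plus P a = P"
      using P(2) subset_idl_plus[of P a] by (intro max idl_idl_plus P(1)) auto
    then show False using that mem_idl_plus[OF P(1), of a] by simp
  qed
  have "prime_idl P"
    unfolding prime_idl_def
  proof (intro conjI allI impI)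
    show "idl P" "1 \<notin> P" using P S by auto
    fix a b assume ab: "a * b \<in> P"
    show "a \<in> P \<or> b \<in> P"
    proof (rule ccontr)
      assume "\<not> ?thesis"
      then obtain s t s' t' where st: "s \<in> S" "s - a * t \<in> P" "s' \<in> S" "s' - b * t' \<in> P"
        using meet[of a] meet[of b] by auto
      have "s * s' = s' * (s - a * t) + (a * t) * (s' - b * t') + (t * t') * (a * b)"
        by (simp add: algebra_simps)
      then have "s * s' \<in> P"
        using st ab P(1) by (simp add: idl_add idl_mult)
      then show False using S(2)[OF st(1,3)] P(3) by auto
    qed
  qed
  then show ?thesis using P(2,3) by (rule that)
qed

section \<open>Constants, monomials and degree bounds\<close>

definition kap :: "'k::comm_ring_1 \<Rightarrow> ('i, 'k) mpoly" where "kap = Poly_Mapping.single 0"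
definition mon :: "('i \<Rightarrow>\<^sub>0 nat) \<Rightarrow> ('i, 'k::comm_ring_1) mpoly" where "mon m = Poly_Mapping.single m 1"
definition var :: "'i \<Rightarrow> ('i, 'k::comm_ring_1) mpoly" where "var i = mon (Poly_Mapping.single i 1)"
definition mdeg :: "('i \<Rightarrow>\<^sub>0 nat) \<Rightarrow> nat" where
  "mdeg m = (\<Sum>i\<in>Poly_Mapping.keys m. Poly_Mapping.lookup m i)"

lemma kap_0 [simp]: "kap 0 = 0" and kap_1 [simp]: "kap 1 = 1"
  and kap_add: "kap (a + b) = kap a + kap b" and kap_mult: "kap (a * b) = kap a * kap b"
  and kap_uminus: "kap (- a) = - kap a" and kap_diff: "kap (a - b) = kap a - kap b"
  by (simp_all add: kap_def single_add mult_single single_uminus single_diff)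

lemma kap_sum: "kap (sum f A) = (\<Sum>a\<in>A. kap (f a))"
  by (induction A rule: infinite_finite_induct) (auto simp: kap_add)

lemma kap_power: "kap (a ^ n) = kap a ^ n"
  by (induction n) (auto simp: kap_mult)

lemma mon_0 [simp]: "mon 0 = 1" and mon_add: "mon (m + m') = mon m * mon m'"
  by (simp_all add: mon_def mult_single)

lemma single_eq_kap_mon: "Poly_Mapping.single m c = kap c * mon m"
  by (simp add: kap_def mon_def mult_single)

lemma mpoly_eq_sum:
  fixes p :: "('i, 'k::comm_ring_1) mpoly"
  assumes "finite A" "Poly_Mapping.keys p \<subseteq> A"
  shows "p = (\<Sum>m\<in>A. kap (Poly_Mapping.lookup p m) * mon m)"
proof -
  have "p = (\<Sum>m\<in>Poly_Mapping.keys p. Poly_Mapping.single m (Poly_Mapping.lookup p m))"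
    by (rule poly_mapping_eqI)
       (auto simp: lookup_sum lookup_single when_def in_keys_iff if_distrib cong: if_cong)
  also have "\<dots> = (\<Sum>m\<in>A. Poly_Mapping.single m (Poly_Mapping.lookup p m))"
    by (rule sum.mono_neutral_left) (use assms in \<open>auto simp: in_keys_iff\<close>)
  finally show ?thesis by (simp add: single_eq_kap_mon)
qed

lemma keys_add_nat: "Poly_Mapping.keys (m + m' :: 'i \<Rightarrow>\<^sub>0 nat) = Poly_Mapping.keys m \<union> Poly_Mapping.keys m'"
  by (auto simp: in_keys_iff lookup_add)

lemma mdeg_superset:
  assumes "finite A" "Poly_Mapping.keys m \<subseteq> A"
  shows "mdeg m = (\<Sum>i\<in>A. Poly_Mapping.lookup m i)"
  unfolding mdeg_def by (rule sum.mono_neutral_left) (use assms in \<open>auto simp: in_keys_iff\<close>)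

lemma mdeg_add: "mdeg (m + m') = mdeg m + mdeg m'"
proof -
  let ?A = "Poly_Mapping.keys m \<union> Poly_Mapping.keys m'"
  show ?thesis
    by (simp add: mdeg_superset[of ?A] keys_add_nat lookup_add sum.distrib)
qed

lemma mdeg_0 [simp]: "mdeg 0 = 0" and mdeg_single [simp]: "mdeg (Poly_Mapping.single i e) = e"
  by (auto simp: mdeg_def)

lemma monom_induct [case_names zero add]:
  fixes m :: "'i \<Rightarrow>\<^sub>0 nat"
  assumes "P 0" "\<And>m i. P m \<Longrightarrow> P (Poly_Mapping.single i 1 + m)"
  shows "P m"
proof (induction "mdeg m" arbitrary: m)
  case 0
  then have "m = 0"
    by (auto simp: mdeg_def in_keys_iff intro!: poly_mapping_eqI)
  then show ?case using assms by simp
next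
  case (Suc k)
  then have "Poly_Mapping.keys m \<noteq> {}" by (auto simp: mdeg_def)
  then obtain i where i: "i \<in> Poly_Mapping.keys m" by blast
  have eq: "m = Poly_Mapping.single i 1 + (m - Poly_Mapping.single i 1)"
    using i by (intro poly_mapping_eqI) (auto simp: lookup_add lookup_minus lookup_single when_def in_keys_iff)
  have "Suc k = 1 + mdeg (m - Poly_Mapping.single i 1)"
    using Suc(2) eq by (metis mdeg_add mdeg_single)
  then have "P (m - Poly_Mapping.single i 1)" using Suc(1) by simp
  then show ?case using assms(2) by (subst eq)
qed

lemma mpolys_upto_alt:
  "mpolys_upto I k = {p. \<forall>m\<in>Poly_Mapping.keys p. Poly_Mapping.keys m \<subseteq> I \<and> mdeg m \<le> k}"
  by (auto simp: mpolys_upto_def mpolys_def mdeg_def)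

lemma upto_0 [simp]: "0 \<in> mpolys_upto I k" by (simp add: mpolys_upto_alt)

lemma upto_add: "p \<in> mpolys_upto I k \<Longrightarrow> q \<in> mpolys_upto I k \<Longrightarrow> p + q \<in> mpolys_upto I k"
  using Poly_Mapping.keys_add[of p q] by (auto simp: mpolys_upto_alt)

lemma upto_sum: "(\<And>a. a \<in> A \<Longrightarrow> f a \<in> mpolys_upto I k) \<Longrightarrow> sum f A \<in> mpolys_upto I k"
  by (induction A rule: infinite_finite_induct) (auto simp: upto_add)

lemma upto_mult: "p \<in> mpolys_upto I k \<Longrightarrow> q \<in> mpolys_upto I l \<Longrightarrow> p * q \<in> mpolys_upto I (k + l)"
  using keys_mult[of p q] by (fastforce simp: mpolys_upto_alt keys_add_nat mdeg_add)

lemma upto_mono: "p \<in> mpolys_upto I k \<Longrightarrow> k \<le> l \<Longrightarrow> I \<subseteq> I' \<Longrightarrow> p \<in> mpolys_upto I' l"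
  by (fastforce simp: mpolys_upto_alt)

lemma kap_upto [simp]: "kap c \<in> mpolys_upto I k"
  by (auto simp: mpolys_upto_alt kap_def)

lemma one_upto [simp]: "1 \<in> mpolys_upto I k"
  by (auto simp: mpolys_upto_alt)

lemma mon_upto: "Poly_Mapping.keys m \<subseteq> I \<Longrightarrow> mdeg m \<le> k \<Longrightarrow> mon m \<in> mpolys_upto I k"
  by (auto simp: mpolys_upto_alt mon_def)

lemma var_upto: "i \<in> I \<Longrightarrow> 1 \<le> k \<Longrightarrow> var i \<in> mpolys_upto I k"
  unfolding var_def by (rule mon_upto) auto

lemma upto_uminus: "p \<in> mpolys_upto I k \<Longrightarrow> - p \<in> mpolys_upto I k"
  using upto_mult[of "kap (-1)" I 0 p k] by (simp del: kap_upto add: kap_upto[of "-1", simplified kap_uminus kap_1] kap_uminus)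

lemma upto_diff: "p \<in> mpolys_upto I k \<Longrightarrow> q \<in> mpolys_upto I k \<Longrightarrow> p - q \<in> mpolys_upto I k"
  using upto_add[of p I k "-q"] upto_uminus by auto

lemma upto_kap_mult: "q \<in> mpolys_upto I k \<Longrightarrow> kap c * q \<in> mpolys_upto I k"
  using upto_mult[of "kap c" I 0 q k] by simp

lemma upto_power: "p \<in> mpolys_upto I k \<Longrightarrow> p ^ e \<in> mpolys_upto I (k * e)"
  by (induction e) (auto dest: upto_mult)

definition mons :: "'i set \<Rightarrow> nat \<Rightarrow> ('i \<Rightarrow>\<^sub>0 nat) set" where
  "mons I k = {m. Poly_Mapping.keys m \<subseteq> I \<and> mdeg m \<le> k}"

lemma finite_mons: assumes "finite I" shows "finite (mons I k)"
proof (rule finite_imageD[where f = "\<lambda>m. restrict (Poly_Mapping.lookup m) I"])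
  have "(\<lambda>m. restrict (Poly_Mapping.lookup m) I) ` mons I k \<subseteq> I \<rightarrow>\<^sub>E {..k}"
  proof clarify
    fix m assume m: "m \<in> mons I k"
    have "Poly_Mapping.lookup m i \<le> k" if "i \<in> I" for i
    proof -
      have "Poly_Mapping.lookup m i \<le> (\<Sum>i\<in>I. Poly_Mapping.lookup m i)"
        using assms that by (intro member_le_sum) auto
      also have "\<dots> = mdeg m" using m assms by (subst mdeg_superset[of I]) (auto simp: mons_def)
      finally show ?thesis using m by (simp add: mons_def)
    qed
    then show "restrict (Poly_Mapping.lookup m) I \<in> I \<rightarrow>\<^sub>E {..k}" by auto
  qed
  then show "finite ((\<lambda>m. restrict (Poly_Mapping.lookup m) I) ` mons I k)"
    using assms by (meson finite_PiE finite_atMost finite_subset)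
  show "inj_on (\<lambda>m. restrict (Poly_Mapping.lookup m) I) (mons I k)"
  proof (rule inj_onI)
    fix m m' assume *: "m \<in> mons I k" "m' \<in> mons I k"
      "restrict (Poly_Mapping.lookup m) I = restrict (Poly_Mapping.lookup m') I"
    show "m = m'"
    proof (rule poly_mapping_eqI)
      fix i show "Poly_Mapping.lookup m i = Poly_Mapping.lookup m' i"
      proof (cases "i \<in> I")
        case True then show ?thesis using *(3) by (metis restrict_apply')
      next
        case False
        then have "i \<notin> Poly_Mapping.keys m" "i \<notin> Poly_Mapping.keys m'" using * by (auto simp: mons_def)
        then show ?thesis by (simp add: in_keys_iff)
      qed
    qed
  qed
qed

lemma upto_keys: "p \<in> mpolys_upto I k \<longleftrightarrow> Poly_Mapping.keys p \<subseteq> mons I k"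
  by (auto simp: mpolys_upto_alt mons_def)

lemma mpolys_imp_upto: assumes "p \<in> mpolys I" shows "\<exists>k. p \<in> mpolys_upto I k"
proof -
  have "mdeg m \<le> Max (mdeg ` Poly_Mapping.keys p)" if "m \<in> Poly_Mapping.keys p" for m
    using that by (intro Max_ge) auto
  then show ?thesis using assms unfolding mpolys_upto_alt mpolys_def by blast
qed

lemma upto_imp_mpolys: "p \<in> mpolys_upto I k \<Longrightarrow> p \<in> mpolys I"
  by (simp add: mpolys_upto_def)

text \<open>The ring endomorphism that sends the variables outside \<open>I\<close> to 0. Modulo an
  ideal containing these variables it is the identity, so such ideals behave like ideals of the
  polynomial ring in the variables from \<open>I\<close>.\<close>

definition restr :: "'i set \<Rightarrow> ('i, 'k::comm_ring_1) mpoly \<Rightarrow> ('i, 'k) mpoly" where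
  "restr I p = (\<Sum>m\<in>{m\<in>Poly_Mapping.keys p. Poly_Mapping.keys m \<subseteq> I}. Poly_Mapping.single m (Poly_Mapping.lookup p m))"

lemma lookup_restr:
  "Poly_Mapping.lookup (restr I p) m = (if Poly_Mapping.keys m \<subseteq> I then Poly_Mapping.lookup p m else 0)"
  by (auto simp: restr_def lookup_sum lookup_single when_def in_keys_iff)

lemma restr_in: "restr I p \<in> mpolys I"
  unfolding mpolys_def by (auto simp: in_keys_iff[of _ "restr I p"] lookup_restr split: if_splits)

lemma restr_id: "p \<in> mpolys I \<Longrightarrow> restr I p = p"
  by (rule poly_mapping_eqI) (auto simp: lookup_restr mpolys_def in_keys_iff)

lemma restr_0 [simp]: "restr I 0 = 0" by (simp add: restr_def)

lemma restr_add: "restr I (p + q) = restr I p + restr I q"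
  by (rule poly_mapping_eqI) (auto simp: lookup_restr lookup_add)

lemma restr_single: "restr I (Poly_Mapping.single m c) =
    (if Poly_Mapping.keys m \<subseteq> I then Poly_Mapping.single m c else 0)"
  by (rule poly_mapping_eqI) (auto simp: lookup_restr lookup_single when_def)

lemma restr_1 [simp]: "restr I 1 = 1"
  using restr_single[of I 0 1] by simp

lemma restr_mult: "restr I (p * q) = restr I p * restr I q"
proof (induction p rule: mpoly_induct)
  case (single m c)
  show ?case
    by (induction q rule: mpoly_induct)
       (auto simp: mult_single restr_single restr_add distrib_left keys_add_nat)
qed (simp_all add: restr_add distrib_right)

lemma restr_var: "i \<notin> I \<Longrightarrow> restr I (var i) = 0"
  by (simp add: var_def mon_def restr_single)

lemma diff_restr:
  assumes J: "idl J" "\<And>i. i \<notin> I \<Longrightarrow> var i \<in> J"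
  shows "p - restr I p \<in> J"
proof (induction p rule: mpoly_induct)
  case zero then show ?case using J by (simp add: idl_0)
next
  case (add p q)
  then show ?case using idl_add[OF J(1) add] by (simp add: restr_add algebra_simps)
next
  case (single m c)
  show ?case
  proof (cases "Poly_Mapping.keys m \<subseteq> I")
    case True then show ?thesis using J by (simp add: restr_single idl_0)
  next
    case False
    then obtain i where i: "i \<in> Poly_Mapping.keys m" "i \<notin> I" by blast
    have eq: "m = (m - Poly_Mapping.single i 1) + Poly_Mapping.single i 1"
      using i by (intro poly_mapping_eqI) (auto simp: lookup_add lookup_minus lookup_single when_def in_keys_iff)
    have "Poly_Mapping.single m c = (kap c * mon (m - Poly_Mapping.single i 1)) * var i"
      by (subst eq) (simp only: single_eq_kap_mon mon_add var_def mult.assoc)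
    then have "Poly_Mapping.single m c \<in> J" using i J by (metis idl_mult)
    then show ?thesis using False by (simp add: restr_single)
  qed
qed

lemma eval_restr: "eval_mpoly x (restr I p) = eval_mpoly (\<lambda>i. if i \<in> I then x i else 0) p"
proof (induction p rule: mpoly_induct)
  case (single m c)
  have "eval_monom (\<lambda>i. if i \<in> I then x i else 0) m = (if Poly_Mapping.keys m \<subseteq> I then eval_monom x m else 0)"
  proof (cases "Poly_Mapping.keys m \<subseteq> I")
    case True
    then show ?thesis by (auto simp: eval_monom_def intro!: prod.cong)
  next
    case False
    then obtain i where "i \<in> Poly_Mapping.keys m" "i \<notin> I" by blast
    then show ?thesis using False unfolding eval_monom_def
      by (subst prod_zero) (auto intro!: bexI[of _ i] simp: zero_power in_keys_iff)
  qed
  then show ?case by (simp add: restr_single eval_mpoly_single)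
qed (simp_all add: restr_add eval_mpoly_add)

lemma eval_kap [simp]: "eval_mpoly x (kap c) = c"
  by (simp add: kap_def eval_mpoly_single eval_monom_def)

lemma eval_mon [simp]: "eval_mpoly x (mon m) = eval_monom x m"
  by (simp add: mon_def eval_mpoly_single)

lemma eval_var [simp]: "eval_mpoly x (var i) = x i"
  by (simp add: var_def eval_monom_def)

lemma eval_uminus: "eval_mpoly x (- p) = - eval_mpoly x p"
  using eval_mpoly_add[of x p "-p"] by (simp add: eq_neg_iff_add_eq_0 add.commute)

lemma eval_diff: "eval_mpoly x (p - q) = eval_mpoly x p - eval_mpoly x q"
  using eval_mpoly_add[of x p "-q"] by (simp add: eval_uminus)

lemma eval_sum: "eval_mpoly x (sum f A) = (\<Sum>a\<in>A. eval_mpoly x (f a))"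
  by (induction A rule: infinite_finite_induct) (auto simp: eval_mpoly_add)

lemma eval_prod: "eval_mpoly x (prod f A) = (\<Prod>a\<in>A. eval_mpoly x (f a))"
  by (induction A rule: infinite_finite_induct) (auto simp: eval_mpoly_mult)

lemma eval_power: "eval_mpoly x (p ^ k) = eval_mpoly x p ^ k"
  by (induction k) (auto simp: eval_mpoly_mult)

definition indep_mod :: "('i, 'k::field) mpoly set \<Rightarrow> 'a set \<Rightarrow> ('a \<Rightarrow> ('i, 'k) mpoly) \<Rightarrow> bool" where
  "indep_mod J A f \<longleftrightarrow> (\<forall>l. (\<Sum>a\<in>A. kap (l a) * f a) \<in> J \<longrightarrow> (\<forall>a\<in>A. l a = 0))"

text \<open>The exchange argument modulo \<open>J\<close>: if there were more \<open>f a\<close>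
  than \<open>g b\<close>, the coefficient vectors would satisfy a nontrivial linear relation, and
  the same relation would hold between the \<open>f a\<close> modulo \<open>J\<close>. The later
  dimension counts modulo an ideal rest on it.\<close>

lemma indep_mod_card:
  fixes J :: "('i, 'k::field) mpoly set"
  assumes J: "idl J" and fin: "finite A" "finite B" and ind: "indep_mod J A f"
    and sp: "\<And>a. a \<in> A \<Longrightarrow> \<exists>c. f a - (\<Sum>b\<in>B. kap (c b) * g b) \<in> J"
  shows "card A \<le> card B"
proof (rule ccontr)
  assume "\<not> ?thesis"
  then have lt: "card B < card A" by simp
  from sp obtain c where c: "\<And>a. a \<in> A \<Longrightarrow> f a - (\<Sum>b\<in>B. kap (c a b) * g b) \<in> J" by metis
  from homogeneous_system[OF fin(2,1) lt, of "\<lambda>b a. c a b"] obtain p where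
    p: "\<exists>a\<in>A. p a \<noteq> 0" "\<And>b. b \<in> B \<Longrightarrow> (\<Sum>a\<in>A. c a b * p a) = 0" by auto
  have "(\<Sum>a\<in>A. kap (p a) * (f a - (\<Sum>b\<in>B. kap (c a b) * g b))) \<in> J"
    by (intro idl_sum idl_mult J c)
  moreover have "(\<Sum>a\<in>A. kap (p a) * (\<Sum>b\<in>B. kap (c a b) * g b)) = 0"
  proof -
    have "(\<Sum>a\<in>A. kap (p a) * (\<Sum>b\<in>B. kap (c a b) * g b)) =
       (\<Sum>b\<in>B. \<Sum>a\<in>A. kap (c a b * p a) * g b)"
      by (subst sum.swap) (simp add: sum_distrib_left kap_mult mult_ac)
    also have "\<dots> = (\<Sum>b\<in>B. kap (\<Sum>a\<in>A. c a b * p a) * g b)"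
      by (simp add: kap_sum sum_distrib_right)
    finally show ?thesis by (simp add: p(2))
  qed
  ultimately have "(\<Sum>a\<in>A. kap (p a) * f a) \<in> J"
    by (simp add: right_diff_distrib sum_subtractf)
  then have "\<forall>a\<in>A. p a = 0" using ind by (simp add: indep_mod_def)
  then show False using p(1) by blast
qed

lemma upto_eq_sum:
  assumes "finite I" "p \<in> mpolys_upto I k"
  shows "p = (\<Sum>m\<in>mons I k. kap (Poly_Mapping.lookup p m) * mon m)"
  using assms by (rule_tac mpoly_eq_sum) (simp_all add: finite_mons upto_keys)

section \<open>Specialisation over an uncountable field\<close>

lemma kap_prod: "kap (prod f A) = (\<Prod>a\<in>A. kap (f a))"
  by (induction A rule: infinite_finite_induct) (auto simp: kap_mult)

section \<open>Subrings containing the constants, and polynomials over them\<close>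

definition subr :: "('i, 'k::comm_ring_1) mpoly set \<Rightarrow> bool" where
  "subr B \<longleftrightarrow> range kap \<subseteq> B \<and> (\<forall>a\<in>B. \<forall>b\<in>B. a + b \<in> B \<and> a * b \<in> B)"

definition coeffs_in :: "'r::comm_ring_1 set \<Rightarrow> 'r poly \<Rightarrow> bool" where
  "coeffs_in B c \<longleftrightarrow> (\<forall>i. coeff c i \<in> B)"

lemma subr_kap: "subr B \<Longrightarrow> kap c \<in> B" and subr_add: "subr B \<Longrightarrow> a \<in> B \<Longrightarrow> b \<in> B \<Longrightarrow> a + b \<in> B"
  and subr_mult: "subr B \<Longrightarrow> a \<in> B \<Longrightarrow> b \<in> B \<Longrightarrow> a * b \<in> B"
  by (auto simp: subr_def)

lemma subr_0: "subr B \<Longrightarrow> 0 \<in> B" and subr_1: "subr B \<Longrightarrow> 1 \<in> B"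
  using subr_kap[of B 0] subr_kap[of B 1] by simp_all

lemma subr_uminus: "subr B \<Longrightarrow> a \<in> B \<Longrightarrow> - a \<in> B"
  using subr_mult[OF _ subr_kap[of B "-1"], of a] by (simp add: kap_uminus)

lemma subr_sum: "subr B \<Longrightarrow> (\<And>i. i \<in> A \<Longrightarrow> f i \<in> B) \<Longrightarrow> sum f A \<in> B"
  by (induction A rule: infinite_finite_induct) (auto simp: subr_0 subr_add)

lemma subr_prod: "subr B \<Longrightarrow> (\<And>i. i \<in> A \<Longrightarrow> f i \<in> B) \<Longrightarrow> prod f A \<in> B"
  by (induction A rule: infinite_finite_induct) (auto simp: subr_1 subr_mult)

lemma subr_range_kap: "subr (range kap)"
  unfolding subr_def by (auto simp flip: kap_add kap_mult)

lemma coeffs_in_add: "subr B \<Longrightarrow> coeffs_in B c \<Longrightarrow> coeffs_in B c' \<Longrightarrow> coeffs_in B (c + c')"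
  by (simp add: coeffs_in_def subr_add)

lemma coeffs_in_mult: "subr B \<Longrightarrow> coeffs_in B c \<Longrightarrow> coeffs_in B c' \<Longrightarrow> coeffs_in B (c * c')"
  by (simp add: coeffs_in_def coeff_mult subr_sum subr_mult)

lemma coeffs_in_pCons: "coeffs_in B (pCons a c) \<longleftrightarrow> a \<in> B \<and> coeffs_in B c"
  unfolding coeffs_in_def by (metis coeff_pCons_0 coeff_pCons_Suc not0_implies_Suc)

lemma coeffs_in_0: "0 \<in> B \<Longrightarrow> coeffs_in B 0"
  by (simp add: coeffs_in_def)

lemma coeffs_in_const: "subr B \<Longrightarrow> a \<in> B \<Longrightarrow> coeffs_in B [:a:]"
  by (simp add: coeffs_in_pCons coeffs_in_0 subr_0)

lemma coeffs_in_smult: "subr B \<Longrightarrow> a \<in> B \<Longrightarrow> coeffs_in B c \<Longrightarrow> coeffs_in B (smult a c)"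
  by (simp add: coeffs_in_def subr_mult)

lemma coeffs_in_sum: "subr B \<Longrightarrow> (\<And>i. i \<in> A \<Longrightarrow> coeffs_in B (f i)) \<Longrightarrow> coeffs_in B (sum f A)"
  by (induction A rule: infinite_finite_induct) (auto simp: coeffs_in_0 subr_0 coeffs_in_add)

lemma coeffs_in_prod: "subr B \<Longrightarrow> (\<And>i. i \<in> A \<Longrightarrow> coeffs_in B (f i)) \<Longrightarrow> coeffs_in B (prod f A)"
  by (induction A rule: infinite_finite_induct)
     (auto simp: coeffs_in_mult one_pCons coeffs_in_const subr_1)

lemma poly_in_idl: "idl J \<Longrightarrow> coeffs_in J c \<Longrightarrow> poly c v \<in> J"
  by (simp add: poly_altdef coeffs_in_def idl_sum idl_mult_right)

lemma kap_mult_mem_iff: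
  assumes "idl J" "(r::'k::field) \<noteq> 0" shows "kap r * a \<in> J \<longleftrightarrow> a \<in> J"
proof
  assume "kap r * a \<in> J"
  from idl_mult[OF assms(1) this, of "kap (inverse r)"] show "a \<in> J"
    using assms(2) by (simp flip: mult.assoc kap_mult)
qed (rule idl_mult[OF assms(1)])

lemma kap_mem_iff:
  assumes "idl J" "1 \<notin> J" shows "kap (r::'k::field) \<in> J \<longleftrightarrow> r = 0"
  using kap_mult_mem_iff[OF assms(1), of r 1] assms by (cases "r = 0") (auto simp: idl_0)

text \<open>If infinitely many \<open>r\<close> were bad with cofactors of bounded degree, these cofactors would be linearly
  dependent, and eliminating them gives a nontrivial relation for \<open>v\<close> over \<open>B\<close>.\<close>

theorem countable_bad_specialisations:
  fixes J J0 :: "('i, 'k::field) mpoly set"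
  assumes I: "finite I" and J: "idl J" "\<And>i. i \<notin> I \<Longrightarrow> var i \<in> J" and J0: "idl J0" and B: "subr B"
    and Inv: "\<And>c m. coeffs_in B c \<Longrightarrow> p ^ m * poly c v \<in> J \<Longrightarrow> coeffs_in J0 c"
  shows "countable {r. \<exists>b\<in>B - J0. \<exists>m. b * p ^ m \<in> idl_plus J (v - kap r)}"
proof -
  define bad where "bad = (\<lambda>m k. {r. \<exists>b\<in>B - J0. \<exists>s\<in>mpolys_upto I k. b * p ^ m - (v - kap r) * s \<in> J})"
  have fin: "finite (bad m k)" for m k
  proof (rule ccontr)
    assume "infinite (bad m k)"
    then obtain A where A: "A \<subseteq> bad m k" "finite A" "card A = Suc (card (mons I k))"
      by (meson infinite_arbitrarily_large)
    then have "\<forall>r\<in>A. \<exists>b s. b \<in> B - J0 \<and> s \<in> mpolys_upto I k \<and> b * p ^ m - (v - kap r) * s \<in> J"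
      unfolding bad_def by blast
    then obtain b s where bs: "\<And>r. r \<in> A \<Longrightarrow> b r \<in> B" "\<And>r. r \<in> A \<Longrightarrow> b r \<notin> J0"
      "\<And>r. r \<in> A \<Longrightarrow> s r \<in> mpolys_upto I k" "\<And>r. r \<in> A \<Longrightarrow> b r * p ^ m - (v - kap r) * s r \<in> J"
      by (metis DiffE)
    obtain l where l: "\<exists>r\<in>A. l r \<noteq> 0"
      "\<And>e. e \<in> mons I k \<Longrightarrow> (\<Sum>r\<in>A. Poly_Mapping.lookup (s r) e * l r) = 0"
      using homogeneous_system[of "mons I k" A "\<lambda>e r. Poly_Mapping.lookup (s r) e"] A I finite_mons[OF I]
      by auto
    have "(\<Sum>r\<in>A. kap (l r) * s r) = (\<Sum>r\<in>A. \<Sum>e\<in>mons I k. kap (Poly_Mapping.lookup (s r) e * l r) * mon e)"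
    proof (rule sum.cong[OF refl])
      fix r assume "r \<in> A"
      from upto_eq_sum[OF I bs(3)[OF this]]
      have "kap (l r) * s r = kap (l r) * (\<Sum>e\<in>mons I k. kap (Poly_Mapping.lookup (s r) e) * mon e)"
        by simp
      then show "kap (l r) * s r = (\<Sum>e\<in>mons I k. kap (Poly_Mapping.lookup (s r) e * l r) * mon e)"
        by (simp add: sum_distrib_left kap_mult mult_ac)
    qed
    also have "\<dots> = (\<Sum>e\<in>mons I k. kap (\<Sum>r\<in>A. Poly_Mapping.lookup (s r) e * l r) * mon e)"
      by (subst sum.swap) (simp add: kap_sum sum_distrib_right)
    finally have dep: "(\<Sum>r\<in>A. kap (l r) * s r) = 0" by (simp add: l(2))
    \<comment> \<open>Lagrange products over the bad values: \<open>poly (\<pi> r) v\<close>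
      completes \<open>v - kap r\<close> to the product over all of \<open>A\<close>, and
      \<open>\<pi> r\<close> vanishes at every other value in \<open>A\<close>.\<close>
    define \<pi> where "\<pi> = (\<lambda>r. \<Prod>w\<in>A - {r}. [:- kap w, 1::('i, 'k) mpoly:])"
    define c where "c = (\<Sum>r\<in>A. smult (kap (l r) * b r) (\<pi> r))"
    have cB: "coeffs_in B c"
      unfolding c_def \<pi>_def using B bs(1)
      by (intro coeffs_in_sum coeffs_in_smult coeffs_in_prod)
         (auto simp: subr_mult subr_kap coeffs_in_pCons subr_1 subr_0 subr_uminus coeffs_in_0)
    have split: "(v - kap r) * poly (\<pi> r) v = (\<Prod>w\<in>A. v - kap w)" if "r \<in> A" for r
      using prod.remove[OF A(2) that, of "\<lambda>w. v - kap w"] by (simp add: \<pi>_def poly_prod)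
    \<comment> \<open>Modulo \<open>J\<close> each \<open>b r * p ^ m\<close> may be replaced by
      \<open>(v - kap r) * s r\<close>. The full product then factors out next to the sum in
      \<open>dep\<close>, which is zero, so \<open>c\<close> is a relation for
      \<open>v\<close>.\<close>
    have "p ^ m * poly c v = (\<Sum>r\<in>A. (kap (l r) * poly (\<pi> r) v) * (b r * p ^ m - (v - kap r) * s r))
       + (\<Sum>r\<in>A. (kap (l r) * s r) * ((v - kap r) * poly (\<pi> r) v))"
      by (simp add: c_def poly_sum sum_distrib_left algebra_simps flip: sum.distrib)
    also have "(\<Sum>r\<in>A. (kap (l r) * s r) * ((v - kap r) * poly (\<pi> r) v)) =
        (\<Sum>r\<in>A. kap (l r) * s r) * (\<Prod>w\<in>A. v - kap w)"
      by (simp add: split sum_distrib_right)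
    finally have "p ^ m * poly c v = (\<Sum>r\<in>A. (kap (l r) * poly (\<pi> r) v) * (b r * p ^ m - (v - kap r) * s r))"
      by (simp add: dep)
    also have "\<dots> \<in> J" by (intro idl_sum idl_mult J bs)
    finally have cJ: "coeffs_in J0 c" by (rule Inv[OF cB])
    from l(1) obtain r0 where r0: "r0 \<in> A" "l r0 \<noteq> 0" by blast
    \<comment> \<open>At \<open>kap r0\<close> only the summand of \<open>r0\<close> survives, up to
      a nonzero constant factor, so the relation puts \<open>b r0\<close> into
      \<open>J0\<close>.\<close>
    have "poly c (kap r0) = (\<Sum>r\<in>A. kap (l r) * b r * poly (\<pi> r) (kap r0))"
      by (simp add: c_def poly_sum)
    also have "\<dots> = kap (l r0) * b r0 * poly (\<pi> r0) (kap r0)"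
    proof (subst sum.remove[OF A(2) r0(1)])
      have "poly (\<pi> r) (kap r0) = 0" if "r \<in> A - {r0}" for r
        using that A(2) r0 unfolding \<pi>_def poly_prod by (intro prod_zero) auto
      then show "kap (l r0) * b r0 * poly (\<pi> r0) (kap r0) +
        (\<Sum>r\<in>A - {r0}. kap (l r) * b r * poly (\<pi> r) (kap r0)) = kap (l r0) * b r0 * poly (\<pi> r0) (kap r0)"
        by simp
    qed
    also have "poly (\<pi> r0) (kap r0) = kap (\<Prod>w\<in>A - {r0}. r0 - w)"
      unfolding \<pi>_def poly_prod by (simp add: kap_prod kap_diff)
    finally have "kap (l r0 * (\<Prod>w\<in>A - {r0}. r0 - w)) * b r0 \<in> J0"
      using poly_in_idl[OF J0 cJ, of "kap r0"] by (simp add: kap_mult mult_ac)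
    moreover have "l r0 * (\<Prod>w\<in>A - {r0}. r0 - w) \<noteq> 0" using r0 A(2) by auto
    ultimately have "b r0 \<in> J0" using kap_mult_mem_iff[OF J0] by blast
    then show False using bs(2) r0 by blast
  qed
  have "{r. \<exists>b\<in>B - J0. \<exists>m. b * p ^ m \<in> idl_plus J (v - kap r)} \<subseteq> (\<Union>m. \<Union>k. bad m k)"
  proof clarify
    fix r b m assume b: "b \<in> B" "b \<notin> J0" "b * p ^ m \<in> idl_plus J (v - kap r)"
    then obtain s where s: "b * p ^ m - (v - kap r) * s \<in> J" by (auto elim: idl_plusE)
    have "(v - kap r) * (s - restr I s) \<in> J" by (intro idl_mult diff_restr J)
    from idl_add[OF J(1) s this] have "b * p ^ m - (v - kap r) * restr I s \<in> J"
      by (simp add: algebra_simps)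
    moreover obtain k where "restr I s \<in> mpolys_upto I k"
      using mpolys_imp_upto[OF restr_in] by blast
    ultimately have "r \<in> bad m k" using b by (auto simp: bad_def)
    then show "r \<in> (\<Union>m. \<Union>k. bad m k)" by blast
  qed
  moreover have "countable (\<Union>m. \<Union>k. bad m k)"
    using fin by (intro countable_UN) (auto simp: countable_finite)
  ultimately show ?thesis by (rule countable_subset)
qed

definition adjoin :: "'r::comm_ring_1 set \<Rightarrow> 'r \<Rightarrow> 'r set" where
  "adjoin B v = {poly c v | c. coeffs_in B c}"

text \<open>Transcendence of \<open>v\<close> over \<open>B\<close> in the quotient by
  \<open>J\<close>. A relation forces its coefficients into \<open>J\<close> rather than to be zero,
  because \<open>B\<close> is a subring of the polynomial ring and need not inject into the
  quotient.\<close>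

definition transc :: "'r::comm_ring_1 set \<Rightarrow> 'r \<Rightarrow> 'r set \<Rightarrow> bool" where
  "transc B v J \<longleftrightarrow> (\<forall>c. coeffs_in B c \<longrightarrow> poly c v \<in> J \<longrightarrow> coeffs_in J c)"

primrec gen :: "('i, 'k::comm_ring_1) mpoly list \<Rightarrow> ('i, 'k) mpoly set" where
  "gen [] = range kap"
| "gen (z # zs) = adjoin (gen zs) z"

text \<open>Independence is stated one element at a time, each over the subring generated by the
  rest of the list, because specialisation removes the elements in this order.\<close>

primrec alg_indep :: "('i, 'k::comm_ring_1) mpoly set \<Rightarrow> ('i, 'k) mpoly list \<Rightarrow> bool" where
  "alg_indep J [] \<longleftrightarrow> True"
| "alg_indep J (z # zs) \<longleftrightarrow> transc (gen zs) z J \<and> alg_indep J zs"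

lemma subr_adjoin: assumes "subr B" shows "subr (adjoin B v)"
proof -
  have "kap r \<in> adjoin B v" for r
    using assms unfolding adjoin_def by (auto intro!: exI[of _ "[:kap r:]"] coeffs_in_const simp: subr_kap)
  moreover have "poly c v + poly c' v = poly (c + c') v" "poly c v * poly c' v = poly (c * c') v" for c c'
    by simp_all
  ultimately show ?thesis
    using coeffs_in_add[OF assms] coeffs_in_mult[OF assms]
    unfolding subr_def adjoin_def by (smt (verit, best) image_subset_iff mem_Collect_eq)
qed

lemma subset_adjoin: assumes "subr B" shows "B \<subseteq> adjoin B v"
proof
  fix b assume "b \<in> B"
  then show "b \<in> adjoin B v"
    using assms unfolding adjoin_def by (auto intro!: exI[of _ "[:b:]"] coeffs_in_const)
qed

lemma mem_adjoin: assumes "subr B" shows "v \<in> adjoin B v"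
  using assms unfolding adjoin_def
  by (auto intro!: exI[of _ "[:0, 1:]"] simp: coeffs_in_pCons coeffs_in_0 subr_0 subr_1)

lemma subr_gen: "subr (gen zs)"
  by (induction zs) (auto simp: subr_range_kap subr_adjoin)

lemma set_subset_gen: "set zs \<subseteq> gen zs"
  by (induction zs) (use subset_adjoin mem_adjoin subr_gen in \<open>fastforce\<close>)+

lemma transc_mono: "transc B v J \<Longrightarrow> B' \<subseteq> B \<Longrightarrow> transc B' v J"
  unfolding transc_def coeffs_in_def by blast

lemma congruent_const_poly:
  fixes J :: "'n \<Rightarrow> ('i, 'k::comm_ring_1) mpoly set"
  assumes J: "\<And>n. idl (J n)" and c: "\<And>i. \<exists>r. \<forall>n. coeff c i - kap r \<in> J n"
    and v: "\<And>n. v - kap a \<in> J n"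
  shows "\<exists>r. \<forall>n. poly c v - kap r \<in> J n"
  using c
proof (induction c)
  case 0
  then show ?case by (intro exI[of _ 0]) (simp add: idl_0 J)
next
  case (pCons b c)
  from pCons.prems[of 0] obtain r where r: "\<And>n. b - kap r \<in> J n" by auto
  have "\<exists>r. \<forall>n. coeff c i - kap r \<in> J n" for i using pCons.prems[of "Suc i"] by simp
  from pCons.IH[OF this] obtain s where s: "\<And>n. poly c v - kap s \<in> J n" by auto
  have "poly (pCons b c) v - kap (r + a * s) =
      (b - kap r) + (v * (poly c v - kap s) + kap s * (v - kap a))" for n
    by (simp add: kap_add kap_mult algebra_simps)
  then show ?case
    using r s v J by (intro exI[of _ "r + a * s"] allI) (simp add: idl_add idl_mult del: poly_pCons)
qed

text \<open>Each ideal forbids only countably many values for the head of the list, so over an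
  uncountable field one value serves all the ideals \<open>J n\<close> at once. The invariant, that
  an element of \<open>gen zs\<close> outside \<open>J0 n\<close> is not brought into
  \<open>J n\<close> by powers of \<open>p n\<close>, survives the choice and finally keeps these
  powers outside the ideal by taking \<open>b = 1\<close>.\<close>

lemma simultaneous_specialisation:
  fixes J J0 :: "nat \<Rightarrow> ('i, 'k::field) mpoly set"
  assumes I: "finite I" and unc: "uncountable (UNIV :: 'k set)"
    and J0: "\<And>n. prime_idl (J0 n)" "\<And>n. alg_indep (J0 n) zs"
    and J: "\<And>n. idl (J n)" "\<And>n i. i \<notin> I \<Longrightarrow> var i \<in> J n"
    and Inv: "\<And>n b m. b \<in> gen zs \<Longrightarrow> b * p n ^ m \<in> J n \<Longrightarrow> b \<in> J0 n"
  shows "\<exists>J'. (\<forall>n. idl (J' n) \<and> J n \<subseteq> J' n \<and> (\<forall>m. p n ^ m \<notin> J' n)) \<and>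
    (\<forall>z\<in>gen zs. \<exists>r. \<forall>n. z - kap r \<in> J' n)"
  using J0(2) J Inv
proof (induction zs arbitrary: J)
  case Nil
  have "p n ^ m \<notin> J n" for n m
    using Nil.prems(4)[of 1 n m] J0(1)[of n] range_eqI[of 1 kap 1] by (auto simp: prime_idl_def)
  moreover have "\<exists>r. \<forall>n. z - kap r \<in> J n" if "z \<in> gen []" for z
  proof -
    from that obtain r where "z = kap r" by auto
    then show ?thesis using Nil.prems(2) by (intro exI[of _ r]) (simp add: idl_0)
  qed
  ultimately show ?case using Nil.prems(2) by (intro exI[of _ J]) auto
next
  case (Cons z zs)
  define bad where "bad = (\<lambda>n. {r. \<exists>b\<in>gen zs - J0 n. \<exists>m. b * p n ^ m \<in> idl_plus (J n) (z - kap r)})"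
  have "countable (bad n)" for n
    unfolding bad_def
  proof (rule countable_bad_specialisations[OF I Cons.prems(2,3)])
    show "idl (J0 n)" using J0(1) by (rule prime_idl_idl)
    show "subr (gen zs)" by (rule subr_gen)
    fix c m assume c: "coeffs_in (gen zs) c" "p n ^ m * poly c z \<in> J n"
    have "poly c z \<in> gen (z # zs)" using c by (auto simp: adjoin_def)
    then have "poly c z \<in> J0 n" using Cons.prems(4) c(2) by (metis mult.commute)
    then show "coeffs_in (J0 n) c" using Cons.prems(1)[of n] c(1) by (simp add: transc_def)
  qed
  then have "countable (\<Union>n. bad n)" by auto
  with unc obtain r where r: "\<And>n. r \<notin> bad n"
    by (metis UNIV_I UN_I countable_subset subsetI)
  define J1 where "J1 = (\<lambda>n. idl_plus (J n) (z - kap r))"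
  have "\<exists>J'. (\<forall>n. idl (J' n) \<and> J1 n \<subseteq> J' n \<and> (\<forall>m. p n ^ m \<notin> J' n)) \<and>
    (\<forall>z\<in>gen zs. \<exists>r. \<forall>n. z - kap r \<in> J' n)"
  proof (rule Cons.IH)
    show "alg_indep (J0 n) zs" for n using Cons.prems(1)[of n] by simp
    show "idl (J1 n)" for n unfolding J1_def by (rule idl_idl_plus[OF Cons.prems(2)])
    show "var i \<in> J1 n" if "i \<notin> I" for n i
      using Cons.prems(3)[OF that] subset_idl_plus unfolding J1_def by blast
    show "b \<in> J0 n" if "b \<in> gen zs" "b * p n ^ m \<in> J1 n" for n b m
      using r[of n] that unfolding bad_def J1_def by blast
  qed
  then obtain J' where J': "\<And>n. idl (J' n)" "\<And>n. J1 n \<subseteq> J' n" "\<And>n m. p n ^ m \<notin> J' n"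
    and cst: "\<And>z. z \<in> gen zs \<Longrightarrow> \<exists>r. \<forall>n. z - kap r \<in> J' n" by blast
  have zJ: "z - kap r \<in> J' n" for n
    using J'(2)[of n] mem_idl_plus[OF Cons.prems(2)[of n]] unfolding J1_def by blast
  have "J n \<subseteq> J' n" for n
    using J'(2)[of n] subset_idl_plus unfolding J1_def by blast
  moreover have "\<exists>r. \<forall>n. y - kap r \<in> J' n" if "y \<in> gen (z # zs)" for y
  proof -
    from that obtain c where c: "coeffs_in (gen zs) c" "y = poly c z" by (auto simp: adjoin_def)
    show ?thesis unfolding c(2)
      by (rule congruent_const_poly[OF J'(1) _ zJ]) (use c(1) cst in \<open>auto simp: coeffs_in_def\<close>)
  qed
  ultimately show ?case using J'(1,3) by (intro exI[of _ J']) auto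
qed

lemma eval_congruent_kap: "f - kap r \<in> J \<Longrightarrow> (\<And>f. f \<in> J \<Longrightarrow> eval_mpoly Q f = 0) \<Longrightarrow> eval_mpoly Q f = r"
  by (metis eval_diff eval_kap right_minus_eq)

text \<open>Over the complex numbers \<open>g\<close> splits into linear factors, and a prime ideal
  containing the product \<open>g(u)\<close> contains one of the factors.\<close>

lemma prime_contains_linear_factor:
  fixes P :: "('i, complex) mpoly set"
  assumes P: "prime_idl P" and "g \<noteq> 0" "poly (map_poly kap g) u \<in> P"
  shows "\<exists>r. u - kap r \<in> P"
  using assms(2,3)
proof (induction "degree g" arbitrary: g)
  case 0
  then obtain a where "g = [:a:]" "a \<noteq> 0" by (metis degree_eq_zeroE pCons_0_0)
  then have "kap a \<in> P" using 0(3) by (simp add: map_poly_pCons)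
  then show ?case using P \<open>a \<noteq> 0\<close> kap_mem_iff[of P a] by (auto simp: prime_idl_def)
next
  case (Suc k)
  then have "\<not> constant (poly g)" by (simp add: constant_degree)
  then obtain r where "poly g r = 0" using fundamental_theorem_of_algebra by blast
  then obtain h where h: "g = [:-r, 1:] * h" by (metis dvdE poly_eq_0_iff_dvd)
  with Suc(3) have "h \<noteq> 0" by auto
  then have deg: "k = degree h" using Suc(2) h degree_mult_eq[of "[:-r, 1:]" h] by simp
  have "map_poly kap g = [:- kap r, 1:] * map_poly kap h"
    unfolding h by (intro poly_eqI) (simp add: coeff_map_poly coeff_pCons kap_diff kap_mult kap_uminus kap_add split: nat.split)
  then have "poly (map_poly kap g) u = poly [:- kap r, 1:] u * poly (map_poly kap h) u"
    by (metis poly_mult)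
  moreover have "poly [:- kap r, 1:] u = u - kap r" by simp
  ultimately have "poly (map_poly kap g) u = (u - kap r) * poly (map_poly kap h) u" by metis
  then have "(u - kap r) * poly (map_poly kap h) u \<in> P" using Suc(4) by simp
  then show ?case using P Suc(1)[OF deg \<open>h \<noteq> 0\<close>] by (auto simp: prime_idl_mult)
qed

lemma uncountable_UNIV_complex: "uncountable (UNIV :: complex set)"
proof
  assume "countable (UNIV :: complex set)"
  then have "countable (range complex_of_real)" by (rule countable_subset[OF subset_UNIV])
  then show False
    using uncountable_UNIV_real by (auto dest: countable_image_inj_on simp: inj_on_def)
qed

text \<open>The coordinates are made constant one after another modulo a growing prime that avoids
  \<open>p\<close>. A transcendental coordinate has a value outside a countable bad set; an
  algebraic one satisfies an equation that splits over the complex numbers.\<close>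

theorem nullstellensatz_point:
  fixes J :: "('i, complex) mpoly set"
  assumes I: "finite I" and J: "idl J" "\<And>i. i \<notin> I \<Longrightarrow> var i \<in> J" and p: "\<And>m. p ^ m \<notin> J"
  shows "\<exists>Q. (\<forall>f\<in>J. eval_mpoly Q f = 0) \<and> eval_mpoly Q p \<noteq> 0"
proof -
  have ext: "\<exists>P. prime_idl P \<and> J' \<subseteq> P \<and> p \<notin> P" if J': "idl J'" "\<And>m. p ^ m \<notin> J'" for J'
  proof -
    have "J' \<inter> range (\<lambda>m. p ^ m) = {}" using J'(2) by auto
    moreover have "1 \<in> range (\<lambda>m. p ^ m)" by (auto intro: range_eqI[of _ _ 0])
    moreover have "a * b \<in> range (\<lambda>m. p ^ m)" if "a \<in> range (\<lambda>m. p ^ m)" "b \<in> range (\<lambda>m. p ^ m)" for a b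
      using that by (auto simp flip: power_add)
    ultimately obtain P where "prime_idl P" "J' \<subseteq> P" "P \<inter> range (\<lambda>m. p ^ m) = {}"
      using prime_avoiding[OF J'(1), of "range (\<lambda>m. p ^ m)"] by blast
    moreover from this(3) have "p \<notin> P" by (metis disjoint_iff power_one_right rangeI)
    ultimately show ?thesis by blast
  qed
  have "\<exists>P. prime_idl P \<and> J \<subseteq> P \<and> p \<notin> P \<and> (\<forall>i\<in>A. \<exists>r. var i - kap r \<in> P)" if "finite A" for A
    using that
  proof (induction A rule: finite_induct)
    case empty
    then show ?case using ext[OF J(1) p] by auto
  next
    case (insert i A)
    then obtain P where P: "prime_idl P" "J \<subseteq> P" "p \<notin> P" "\<forall>i\<in>A. \<exists>r. var i - kap r \<in> P" by blast
    have idlP: "idl P" using P(1) by (rule prime_idl_idl)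
    show ?case
    proof (cases "transc (range kap) (var i) P")
      case True
      define S where "S = {r. \<exists>b\<in>range kap - P. \<exists>m. b * p ^ m \<in> idl_plus P (var i - kap r)}"
      have "countable S" unfolding S_def
      proof (rule countable_bad_specialisations[OF I idlP _ idlP subr_range_kap])
        show "var i \<in> P" if "i \<notin> I" for i using J(2)[OF that] P(2) by blast
        fix c m assume "coeffs_in (range kap) c" "p ^ m * poly c (var i) \<in> P"
        then show "coeffs_in P c" using True P(1,3) prime_idl_power[OF P(1), of p m]
          by (auto simp: transc_def prime_idl_mult)
      qed
      then have "S \<noteq> UNIV" using uncountable_UNIV_complex by metis
      then obtain r where r: "r \<notin> S" by blast
      have "p ^ m \<notin> idl_plus P (var i - kap r)" for m
      proof
        assume "p ^ m \<in> idl_plus P (var i - kap r)"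
        then have "kap 1 * p ^ m \<in> idl_plus P (var i - kap r)" by simp
        moreover have "kap 1 \<in> range kap - P" using P(1) rangeI[of kap 1] by (simp add: prime_idl_def)
        ultimately show False using r unfolding S_def by blast
      qed
      from ext[OF idl_idl_plus[OF idlP] this] obtain P' where
        P': "prime_idl P'" "idl_plus P (var i - kap r) \<subseteq> P'" "p \<notin> P'" by blast
      have "P \<subseteq> P'" using P'(2) subset_idl_plus by (rule subset_trans[rotated])
      moreover have "var i - kap r \<in> P'" using P'(2) mem_idl_plus[OF idlP] by auto
      moreover have "\<forall>j\<in>insert i A. \<exists>r. var j - kap r \<in> P'"
        using P(4) \<open>P \<subseteq> P'\<close> \<open>var i - kap r \<in> P'\<close> by (metis insert_iff subsetD)
      ultimately show ?thesis using P' P(2) by (intro exI[of _ P']) simp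
    next
      case False
      then obtain c where c: "coeffs_in (range kap) c" "poly c (var i) \<in> P" "\<not> coeffs_in P c"
        by (auto simp: transc_def)
      have "\<exists>g. c = map_poly kap g" using c(1)
      proof (induction c)
        case 0 then show ?case by (intro exI[of _ 0]) simp
      next
        case (pCons a c)
        then obtain g r where "c = map_poly kap g" "a = kap r" by (auto simp: coeffs_in_pCons)
        then have "pCons a c = map_poly kap (pCons r g)" by (simp add: map_poly_pCons)
        then show ?case by blast
      qed
      then obtain g where g: "c = map_poly kap g" by blast
      have "g \<noteq> 0" using c(3) g idl_0[OF idlP] by (auto simp: coeffs_in_def)
      from prime_contains_linear_factor[OF P(1) this] c(2) g obtain r where "var i - kap r \<in> P" by auto
      then show ?thesis using P by (intro exI[of _ P]) auto
    qed
  qed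
  from this[OF I] obtain P where P: "prime_idl P" "J \<subseteq> P" "p \<notin> P" "\<forall>i\<in>I. \<exists>r. var i - kap r \<in> P"
    by blast
  have idlP: "idl P" using P(1) by (rule prime_idl_idl)
  have "\<exists>r. var i - kap r \<in> P" for i
  proof (cases "i \<in> I")
    case False
    then have "var i - kap 0 \<in> P" using P(2) J(2)[of i] by auto
    then show ?thesis by blast
  qed (use P(4) in blast)
  then obtain Q where Q: "\<And>i. var i - kap (Q i) \<in> P" by metis
  \<comment> \<open>With all coordinates constant modulo \<open>P\<close>, every polynomial is
    congruent to its value at \<open>Q\<close>, so every member of \<open>P\<close> vanishes at
    \<open>Q\<close>.\<close>
  have monc: "mon m - kap (eval_monom Q m) \<in> P" for m
  proof (induction m rule: monom_induct)
    case zero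
    then show ?case using idlP by (simp add: idl_0 eval_monom_def)
  next
    case (add m i)
    have "mon (Poly_Mapping.single i 1 + m) - kap (eval_monom Q (Poly_Mapping.single i 1 + m)) =
      var i * (mon m - kap (eval_monom Q m)) + kap (eval_monom Q m) * (var i - kap (Q i))"
      unfolding mon_add eval_monom_add kap_mult var_def by (simp add: eval_monom_def algebra_simps)
    then show ?case using add Q idlP by (simp add: idl_add idl_mult)
  qed
  have cong: "f - kap (eval_mpoly Q f) \<in> P" for f
  proof (induction f rule: mpoly_induct)
    case zero
    then show ?case using idlP by (simp add: idl_0)
  next
    case (single m c)
    then show ?case
      using idl_mult[OF idlP monc[of m], of "kap c"]
      by (simp add: single_eq_kap_mon eval_mpoly_mult right_diff_distrib kap_mult)
  next
    case (add f g)
    then show ?case using idl_add[OF idlP add] by (simp add: eval_mpoly_add kap_add algebra_simps)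
  qed
  have "eval_mpoly Q f = 0" if "f \<in> J" for f
    using cong[of f] that P(2) idl_diff[OF idlP, of f "f - kap (eval_mpoly Q f)"] kap_mem_iff[OF idlP]
      P(1) by (auto simp: prime_idl_def)
  moreover have "eval_mpoly Q p \<noteq> 0" using cong[of p] P(3) by auto
  ultimately show ?thesis by blast
qed

section \<open>Algebraic independence modulo a prime ideal\<close>

interpretation mp: vector_space mpoly_scale by (rule vector_space_mpoly)

lemma mpoly_scale_eq: "mpoly_scale c p = kap c * p"
  by (simp add: mpoly_scale_def kap_def)

lemma mult_mem_span:
  assumes "x \<in> mp.span S" "\<And>s. s \<in> S \<Longrightarrow> y * s \<in> mp.span T"
  shows "y * x \<in> mp.span T"
  using assms(1)
proof (induction rule: mp.span_induct_alt)
  case base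
  then show ?case by (simp add: mp.span_zero)
next
  case (step c s x)
  have "y * (mpoly_scale c s + x) = mpoly_scale c (y * s) + y * x"
    by (simp add: mpoly_scale_eq algebra_simps)
  then show ?case using step assms(2) by (simp add: mp.span_add mp.span_scale)
qed

lemma span_mod_idl:
  assumes J: "idl J" and "x \<in> mp.span S" "\<And>s. s \<in> S \<Longrightarrow> \<exists>y\<in>mp.span T. r * s - y \<in> J"
  shows "\<exists>y\<in>mp.span T. r * x - y \<in> J"
  using assms(2)
proof (induction rule: mp.span_induct_alt)
  case base
  then show ?case using J by (intro bexI[of _ 0]) (auto simp: mp.span_zero idl_0)
next
  case (step c s x)
  then obtain y1 y2 where y: "y1 \<in> mp.span T" "r * s - y1 \<in> J" "y2 \<in> mp.span T" "r * x - y2 \<in> J"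
    using assms(3) by blast
  have eq: "r * (mpoly_scale c s + x) - (mpoly_scale c y1 + y2) = kap c * (r * s - y1) + (r * x - y2)"
    by (simp add: mpoly_scale_eq algebra_simps)
  have "r * (mpoly_scale c s + x) - (mpoly_scale c y1 + y2) \<in> J"
    unfolding eq using y J by (intro idl_add idl_mult)
  moreover have "mpoly_scale c y1 + y2 \<in> mp.span T" using y by (simp add: mp.span_add mp.span_scale)
  ultimately show ?case by blast
qed

lemma indep_mod_card_span:
  assumes J: "idl J" and fin: "finite A" "finite G" and ind: "indep_mod J A f"
    and sp: "\<And>a. a \<in> A \<Longrightarrow> \<exists>y\<in>mp.span G. f a - y \<in> J"
  shows "card A \<le> card G"
proof (rule indep_mod_card[OF J fin ind, of "\<lambda>g. g"])
  fix a assume "a \<in> A"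
  then obtain y where "y \<in> mp.span G" "f a - y \<in> J" using sp by blast
  moreover then obtain u where "y = (\<Sum>v\<in>G. mpoly_scale (u v) v)"
    unfolding mp.span_finite[OF fin(2)] by blast
  ultimately show "\<exists>c. f a - (\<Sum>b\<in>G. kap (c b) * b) \<in> J"
    by (auto simp: mpoly_scale_eq)
qed

lemma indep_mod_mult:
  assumes "prime_idl J" "g \<notin> J" "indep_mod J A f"
  shows "indep_mod J A (\<lambda>a. g * f a)"
  unfolding indep_mod_def
proof (intro allI impI)
  fix l assume "(\<Sum>a\<in>A. kap (l a) * (g * f a)) \<in> J"
  then have "g * (\<Sum>a\<in>A. kap (l a) * f a) \<in> J" by (simp add: sum_distrib_left mult_ac)
  then have "(\<Sum>a\<in>A. kap (l a) * f a) \<in> J" using assms(1,2) by (simp add: prime_idl_mult)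
  then show "\<forall>a\<in>A. l a = 0" using assms(3) by (simp add: indep_mod_def)
qed

fun fam :: "('i, 'k::comm_ring_1) mpoly list \<Rightarrow> nat list \<Rightarrow> ('i, 'k) mpoly" where
  "fam (z # zs) (e # es) = z ^ e * fam zs es"
| "fam _ _ = 1"

definition Lst :: "nat \<Rightarrow> nat \<Rightarrow> nat list set" where
  "Lst s D = {es. length es = s \<and> set es \<subseteq> {..<D}}"

lemma finite_Lst [simp]: "finite (Lst s D)"
  using finite_lists_length_eq[of "{..<D}" s] by (simp add: Lst_def conj_commute)

lemma card_Lst: "card (Lst s D) = D ^ s"
  using card_lists_length_eq[of "{..<D}" s] by (simp add: Lst_def conj_commute)

lemma Lst_0 [simp]: "Lst 0 D = {[]}"
  by (auto simp: Lst_def)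

lemma Cons_Lst: "e # es \<in> Lst (Suc s) D \<longleftrightarrow> e < D \<and> es \<in> Lst s D"
  by (auto simp: Lst_def)

lemma Lst_Suc: "Lst (Suc s) D = (\<lambda>(e, es). e # es) ` ({..<D} \<times> Lst s D)"
proof (intro equalityI subsetI)
  fix es assume "es \<in> Lst (Suc s) D"
  then show "es \<in> (\<lambda>(e, es). e # es) ` ({..<D} \<times> Lst s D)"
    by (cases es) (auto simp: Lst_def)
qed (auto simp: Lst_def)

lemma sum_Lst_Suc: "(\<Sum>es\<in>Lst (Suc s) D. f es) = (\<Sum>e<D. \<Sum>es\<in>Lst s D. f (e # es))"
proof -
  have "(\<Sum>es\<in>Lst (Suc s) D. f es) = (\<Sum>(e, es)\<in>{..<D} \<times> Lst s D. f (e # es))"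
    unfolding Lst_Suc by (subst sum.reindex) (auto simp: inj_on_def intro!: sum.cong)
  then show ?thesis by (simp add: sum.cartesian_product)
qed

lemma fam_in_gen: "fam zs es \<in> gen zs"
proof (induction zs es rule: fam.induct)
  case (1 z zs e es)
  have "z ^ e \<in> gen (z # zs)" for e
  proof (induction e)
    case (Suc e)
    have "z \<in> gen (z # zs)" using set_subset_gen[of "z # zs"] by simp
    with Suc show ?case by (simp add: subr_mult subr_gen del: gen.simps)
  qed (simp add: subr_1 subr_gen del: gen.simps)
  moreover have "fam zs es \<in> gen (z # zs)" using 1 subset_adjoin[OF subr_gen] by auto
  ultimately show ?case by (simp del: gen.simps add: subr_mult subr_gen)
qed (auto simp: subr_1[OF subr_gen] subr_1[OF subr_adjoin[OF subr_gen]] subr_1[OF subr_range_kap])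

text \<open>Collecting the powers of the head \<open>z\<close> turns a linear relation between
  monomials into a polynomial in \<open>z\<close> over \<open>gen zs\<close>. Transcendence puts
  each coefficient into \<open>J\<close>, and these are relations between monomials in the
  tail.\<close>

lemma alg_indep_fam:
  fixes J :: "('i, 'k::field) mpoly set"
  assumes J: "idl J" "1 \<notin> J"
  shows "alg_indep J zs \<Longrightarrow> indep_mod J (Lst (length zs) D) (fam zs)"
proof (induction zs)
  case Nil
  then show ?case using J by (auto simp: indep_mod_def kap_mem_iff)
next
  case (Cons z zs)
  show ?case unfolding indep_mod_def
  proof (intro allI impI)
    fix l assume l: "(\<Sum>a\<in>Lst (length (z # zs)) D. kap (l a) * fam (z # zs) a) \<in> J"
    define h where "h = (\<lambda>e. \<Sum>es\<in>Lst (length zs) D. kap (l (e # es)) * fam zs es)"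
    define c where "c = (\<Sum>e<D. monom (h e) e)"
    have cf: "coeff c e = (if e < D then h e else 0)" for e
      by (simp add: c_def coeff_sum if_distrib cong: if_cong)
    have "(\<Sum>a\<in>Lst (length (z # zs)) D. kap (l a) * fam (z # zs) a) = poly c z"
      by (simp add: sum_Lst_Suc c_def h_def poly_sum poly_monom sum_distrib_right sum_distrib_left mult_ac)
    moreover have "h e \<in> gen zs" for e
      unfolding h_def by (intro subr_sum subr_mult subr_gen fam_in_gen subr_kap)
    then have "coeffs_in (gen zs) c"
      by (auto simp: coeffs_in_def cf subr_0 subr_gen)
    ultimately have "coeffs_in J c" using l Cons.prems by (simp add: transc_def)
    then have "h e \<in> J" if "e < D" for e using that cf[of e] by (auto simp: coeffs_in_def dest: spec[of _ e])
    moreover have "indep_mod J (Lst (length zs) D) (fam zs)" using Cons by simp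
    ultimately have "\<forall>es\<in>Lst (length zs) D. l (e # es) = 0" if "e < D" for e
      using that unfolding h_def indep_mod_def by (elim allE[of _ "\<lambda>es. l (e # es)"]) simp
    then show "\<forall>a\<in>Lst (length (z # zs)) D. l a = 0" by (auto simp: Lst_Suc)
  qed
qed

text \<open>A filtration of \<open>gen zs\<close> by the degree in each generator. It exhausts
  \<open>gen zs\<close>, its indices add under multiplication, and its pieces are spanned by at most
  \<open>(t + 1) ^ length zs\<close> elements, which makes counting possible.\<close>

definition wspan :: "('i, 'k::field) mpoly list \<Rightarrow> nat \<Rightarrow> ('i, 'k) mpoly set" where
  "wspan zs t = mp.span (fam zs ` Lst (length zs) (Suc t))"

lemma wspan_mono: "t \<le> t' \<Longrightarrow> wspan zs t \<subseteq> wspan zs t'"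
  unfolding wspan_def by (intro mp.span_mono image_mono) (auto simp: Lst_def)

lemma wspan_Cons:
  assumes "x \<in> wspan zs t" "t \<le> t'" "e \<le> t'"
  shows "z ^ e * x \<in> wspan (z # zs) t'"
proof -
  have "x \<in> wspan zs t'" using assms wspan_mono by blast
  then show ?thesis unfolding wspan_def
  proof (rule mult_mem_span)
    fix s assume "s \<in> fam zs ` Lst (length zs) (Suc t')"
    then obtain es where es: "es \<in> Lst (length zs) (Suc t')" "s = fam zs es" by blast
    have "fam (z # zs) (e # es) \<in> fam (z # zs) ` Lst (length (z # zs)) (Suc t')"
      using es assms by (intro imageI) (simp add: Cons_Lst)
    then show "z ^ e * s \<in> mp.span (fam (z # zs) ` Lst (length (z # zs)) (Suc t'))"
      using es(2) by (auto intro: mp.span_base)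
  qed
qed

lemma gen_wspan: "b \<in> gen zs \<Longrightarrow> \<exists>t. b \<in> wspan zs t"
proof (induction zs arbitrary: b)
  case Nil
  then obtain r where "b = mpoly_scale r 1" by (auto simp: mpoly_scale_eq)
  moreover have "mpoly_scale r 1 \<in> wspan [] 0"
    unfolding wspan_def by (intro mp.span_scale mp.span_base) simp
  ultimately show ?case by blast
next
  case (Cons z zs)
  then obtain c where c: "coeffs_in (gen zs) c" "b = poly c z" by (auto simp: adjoin_def)
  then have "\<exists>t. coeff c i \<in> wspan zs t" for i using Cons.IH by (simp add: coeffs_in_def)
  then obtain t where t: "\<And>i. coeff c i \<in> wspan zs (t i)" by metis
  define T where "T = degree c + (\<Sum>i\<le>degree c. t i)"
  have "b = (\<Sum>i\<le>degree c. z ^ i * coeff c i)"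
    by (simp add: c(2) poly_altdef mult.commute)
  also have "\<dots> \<in> wspan (z # zs) T"
  proof -
    have "z ^ i * coeff c i \<in> wspan (z # zs) T" if "i \<le> degree c" for i
    proof (rule wspan_Cons[OF t])
      show "t i \<le> T" using member_le_sum[of i "{..degree c}" t] that by (simp add: T_def)
      show "i \<le> T" using that by (simp add: T_def)
    qed
    then show ?thesis unfolding wspan_def by (intro mp.span_sum) auto
  qed
  finally show ?case by blast
qed

lemma gen_wspan_finite: assumes "finite F" "F \<subseteq> gen zs" shows "\<exists>t. F \<subseteq> wspan zs t"
  using assms
proof (induction F rule: finite_induct)
  case (insert b F)
  then obtain t t' where "F \<subseteq> wspan zs t" "b \<in> wspan zs t'" using gen_wspan[of b zs] by auto
  then show ?case using wspan_mono[of t "max t t'" zs] wspan_mono[of t' "max t t'" zs]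
    by (intro exI[of _ "max t t'"]) auto
qed simp

lemma fam_mult:
  "length es = length zs \<Longrightarrow> length es' = length zs \<Longrightarrow>
    fam zs es * fam zs es' = fam zs (map2 (+) es es')"
proof (induction zs arbitrary: es es')
  case (Cons z zs)
  then obtain e f e' f' where "es = e # f" "es' = e' # f'"
    by (metis length_Suc_conv)
  then show ?case using Cons.prems Cons.IH[of f f'] by (simp add: power_add mult_ac flip: Cons.IH)
qed simp

lemma map2_Lst:
  "es \<in> Lst s (Suc t) \<Longrightarrow> es' \<in> Lst s (Suc t') \<Longrightarrow> map2 (+) es es' \<in> Lst s (Suc (t + t'))"
proof (induction s arbitrary: es es')
  case (Suc s)
  then show ?case by (cases es; cases es') (auto simp: Cons_Lst, auto simp: Lst_def)
qed auto

lemma wspan_mult: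
  assumes "x \<in> wspan zs t" "y \<in> wspan zs t'"
  shows "x * y \<in> wspan zs (t + t')"
proof -
  have "fam zs es * y \<in> wspan zs (t + t')" if "es \<in> Lst (length zs) (Suc t)" for es
    using assms(2) unfolding wspan_def
  proof (rule mult_mem_span)
    fix s assume "s \<in> fam zs ` Lst (length zs) (Suc t')"
    then obtain es' where es': "es' \<in> Lst (length zs) (Suc t')" "s = fam zs es'" by blast
    then have "fam zs es * s = fam zs (map2 (+) es es')"
      using that by (simp add: Lst_def fam_mult)
    then show "fam zs es * s \<in> mp.span (fam zs ` Lst (length zs) (Suc (t + t')))"
      using map2_Lst[OF that es'(1)] by (auto intro: mp.span_base)
  qed
  then have "y * s \<in> wspan zs (t + t')" if "s \<in> fam zs ` Lst (length zs) (Suc t)" for s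
    using that by (metis imageE mult.commute)
  then have "y * x \<in> wspan zs (t + t')"
    using assms(1) unfolding wspan_def by (intro mult_mem_span[of x]) simp_all
  then show ?thesis by (simp add: mult.commute)
qed

lemma not_transc_relation:
  assumes J: "idl J" and B: "subr B" and nt: "\<not> transc B v J"
  obtains a e c where "a \<in> B" "a \<notin> J" "\<And>l. c l \<in> B" "a * v ^ e + (\<Sum>l<e. c l * v ^ l) \<in> J"
proof -
  from nt obtain c where c: "coeffs_in B c" "poly c v \<in> J" "\<not> coeffs_in J c"
    by (auto simp: transc_def)
  define S where "S = {i. coeff c i \<notin> J}"
  have S: "S \<noteq> {}" "S \<subseteq> {..degree c}" "finite S"
  proof -
    show "S \<noteq> {}" using c(3) by (auto simp: S_def coeffs_in_def)
    show "S \<subseteq> {..degree c}"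
    proof
      fix i assume "i \<in> S"
      then have "coeff c i \<noteq> 0" using J by (auto simp: S_def idl_0)
      then show "i \<in> {..degree c}" by (simp add: le_degree)
    qed
    then show "finite S" by (rule finite_subset) simp
  qed
  define e where "e = Max S"
  have eS: "e \<in> S" unfolding e_def using S by (intro Max_in)
  then have le: "e \<le> degree c" using S(2) by auto
  have big: "coeff c i \<in> J" if "i > e" for i
  proof (rule ccontr)
    assume "coeff c i \<notin> J"
    then have "i \<le> e" unfolding e_def by (intro Max_ge S(3)) (simp add: S_def)
    then show False using that by simp
  qed
  have "{..degree c} = {..<e} \<union> {e} \<union> {e<..degree c}" using le by auto
  then have "poly c v = (\<Sum>i\<in>{..<e} \<union> {e} \<union> {e<..degree c}. coeff c i * v ^ i)"
    by (simp only: poly_altdef)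
  also have "\<dots> = (\<Sum>i<e. coeff c i * v ^ i) + coeff c e * v ^ e + (\<Sum>i\<in>{e<..degree c}. coeff c i * v ^ i)"
    by (subst sum.union_disjoint, simp, simp, fastforce, subst sum.union_disjoint) auto
  finally have "coeff c e * v ^ e + (\<Sum>i<e. coeff c i * v ^ i) =
      poly c v - (\<Sum>i\<in>{e<..degree c}. coeff c i * v ^ i)" by (simp add: algebra_simps)
  also have "\<dots> \<in> J" using c(2) big J by (intro idl_diff idl_sum idl_mult_right) auto
  finally show ?thesis
    using that[of "coeff c e" "coeff c" e] c(1) eS by (auto simp: S_def coeffs_in_def)
qed

text \<open>Counting argument: modulo \<open>J\<close> the monomials in \<open>fs\<close> with exponents below \<open>D\<close> number \<open>D ^ length fs\<close> and,
  after multiplication by a power of one denominator, lie in a space of dimension \<open>O(D ^ length zs)\<close>.\<close>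

theorem alg_indep_length_le:
  fixes J :: "('i, 'k::field) mpoly set"
  assumes I: "finite I" and J: "prime_idl J"
    and alg: "\<And>i. i \<in> I \<Longrightarrow> \<not> transc (gen zs) (var i) J"
    and fs: "alg_indep J fs" "set fs \<subseteq> mpolys I"
  shows "length fs \<le> length zs"
proof -
  have idlJ: "idl J" and oneJ: "1 \<notin> J" using J by (auto simp: prime_idl_def)
  let ?B = "gen zs"
  have B: "subr ?B" by (rule subr_gen)
  define R where "R = (\<lambda>i a e c. a \<in> ?B \<and> a \<notin> J \<and> (\<forall>l. c l \<in> ?B) \<and>
      a * var i ^ e + (\<Sum>l<e. c l * var i ^ l) \<in> J)"
  have "\<exists>a e c. R i a e c" if i: "i \<in> I" for i
  proof -
    obtain a e c where "a \<in> ?B" "a \<notin> J" "\<And>l. c l \<in> ?B" "a * var i ^ e + (\<Sum>l<e. c l * var i ^ l) \<in> J"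
      by (rule not_transc_relation[OF idlJ B alg[OF i]]) blast
    then have "R i a e c" unfolding R_def by simp
    then show ?thesis by blast
  qed
  then obtain a e c where R: "\<And>i. i \<in> I \<Longrightarrow> R i (a i) (e i) (c i)" by metis
  then have rel: "\<And>i. i \<in> I \<Longrightarrow> a i \<in> ?B" "\<And>i. i \<in> I \<Longrightarrow> a i \<notin> J"
    "\<And>i l. i \<in> I \<Longrightarrow> c i l \<in> ?B" "\<And>i. i \<in> I \<Longrightarrow> a i * var i ^ e i + (\<Sum>l<e i. c i l * var i ^ l) \<in> J"
    unfolding R_def by blast+
  \<comment> \<open>\<open>g\<close> is a common denominator for the variables, and \<open>E\<close>
    exceeds the degrees of their relations. After inverting \<open>g\<close>, the finitely many
    monomials in \<open>\<Gamma>\<close> generate the quotient as a module over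
    \<open>gen zs\<close>.\<close>
  define g where "g = prod a I"
  define E where "E = Suc (sum e I)"
  have gB: "g \<in> ?B" unfolding g_def using rel(1) B by (intro subr_prod)
  have gJ: "g \<notin> J" unfolding g_def by (rule prime_idl_prod[OF I J rel(2)])
  define \<Gamma> where "\<Gamma> = {m. Poly_Mapping.keys m \<subseteq> I \<and> (\<forall>i\<in>I. Poly_Mapping.lookup m i < E)}"
  have fin\<Gamma>: "finite \<Gamma>"
  proof (rule finite_subset[OF _ finite_mons[OF I, of "card I * E"]])
    show "\<Gamma> \<subseteq> mons I (card I * E)"
    proof
      fix m assume m: "m \<in> \<Gamma>"
      then have "mdeg m = (\<Sum>i\<in>I. Poly_Mapping.lookup m i)"
        using I by (intro mdeg_superset) (auto simp: \<Gamma>_def)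
      also have "\<dots> \<le> (\<Sum>i\<in>I. E)" using m by (intro sum_mono) (auto simp: \<Gamma>_def less_imp_le)
      finally show "m \<in> mons I (card I * E)" using m by (auto simp: mons_def \<Gamma>_def)
    qed
  qed
  define MS where "MS = {x. \<exists>c. (\<forall>m. c m \<in> ?B) \<and> x - (\<Sum>m\<in>\<Gamma>. c m * mon m) \<in> J}"
  have MS_add: "x + y \<in> MS" if "x \<in> MS" "y \<in> MS" for x y
  proof -
    from that obtain c d where "\<forall>m. c m \<in> ?B" "x - (\<Sum>m\<in>\<Gamma>. c m * mon m) \<in> J"
      "\<forall>m. d m \<in> ?B" "y - (\<Sum>m\<in>\<Gamma>. d m * mon m) \<in> J" by (auto simp: MS_def)
    then have "\<forall>m. c m + d m \<in> ?B" "(x + y) - (\<Sum>m\<in>\<Gamma>. (c m + d m) * mon m) \<in> J"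
      using idl_add[OF idlJ, of "x - (\<Sum>m\<in>\<Gamma>. c m * mon m)" "y - (\<Sum>m\<in>\<Gamma>. d m * mon m)"]
      by (auto simp: subr_add[OF B] distrib_right sum.distrib algebra_simps)
    then show ?thesis unfolding MS_def by (intro CollectI exI[of _ "\<lambda>m. c m + d m"] conjI)
  qed
  have MS_J: "x \<in> MS" if "x \<in> J" for x
    unfolding MS_def using that by (intro CollectI exI[of _ "\<lambda>_. 0"]) (simp add: subr_0[OF B])
  have MS_mon: "b * mon m \<in> MS" if "b \<in> ?B" "m \<in> \<Gamma>" for b m
    unfolding MS_def
  proof (intro CollectI exI[of _ "\<lambda>m'. if m' = m then b else 0"] conjI allI)
    show "(if m' = m then b else 0) \<in> ?B" for m' using that by (simp add: subr_0[OF B])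
    have "(\<Sum>m'\<in>\<Gamma>. (if m' = m then b else 0) * mon m') = b * mon m"
      using that(2) fin\<Gamma> by (simp add: if_distrib[of "\<lambda>x. x * _"] cong: if_cong)
    then show "b * mon m - (\<Sum>m'\<in>\<Gamma>. (if m' = m then b else 0) * mon m') \<in> J"
      by (simp add: idl_0[OF idlJ])
  qed
  have MS_sum: "(\<And>x. x \<in> A \<Longrightarrow> h x \<in> MS) \<Longrightarrow> sum h A \<in> MS" for A and h :: "nat \<Rightarrow> ('i, 'k) mpoly"
    by (induction A rule: infinite_finite_induct) (auto intro: MS_add MS_J idl_0[OF idlJ])
  \<comment> \<open>A power reaching \<open>E\<close> is lowered by the relation of its variable:
    the factor \<open>g\<close> contains the leading coefficient \<open>a i\<close>, and the
    remaining part \<open>h\<close> of \<open>g\<close> goes into the new coefficients.\<close>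
  have power_E: "mon m0 * (g * var i ^ E) \<in> MS"
    if i: "i \<in> I" and m0: "m0 \<in> \<Gamma>" "Poly_Mapping.lookup m0 i = 0" for i m0
  proof -
    define h where "h = prod a (I - {i})"
    have hB: "h \<in> ?B" unfolding h_def using rel(1) B by (intro subr_prod) auto
    have gh: "g = a i * h" unfolding g_def h_def using I i by (simp add: prod.remove)
    have ei: "e i < E" unfolding E_def using member_le_sum[of i I e] I i by simp
    define k where "k = E - e i"
    have k: "E = k + e i" "0 < k" using ei by (auto simp: k_def)
    let ?r = "a i * var i ^ e i + (\<Sum>l<e i. c i l * var i ^ l)"
    have shift: "(mon m0 :: ('i, 'k) mpoly) * var i ^ l = mon (m0 + Poly_Mapping.single i l)" for l
    proof (induction l)
      case (Suc l)
      have "(mon m0 :: ('i, 'k) mpoly) * var i ^ Suc l = mon (m0 + Poly_Mapping.single i l) * var i"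
        by (simp only: power_Suc2 Suc mult.assoc[symmetric])
      also have "\<dots> = mon (m0 + (Poly_Mapping.single i l + Poly_Mapping.single i 1))"
        by (simp only: var_def mon_add mult.assoc)
      finally show ?case by (simp flip: single_add)
    qed simp
    have in\<Gamma>: "m0 + Poly_Mapping.single i l \<in> \<Gamma>" if "l < E" for l
      using m0 that i by (auto simp: \<Gamma>_def keys_add_nat lookup_add lookup_single when_def split: if_splits)
    have "mon m0 * (g * var i ^ E) = mon m0 * h * var i ^ k * ?r +
        (\<Sum>l<e i. (- (h * c i l)) * (mon m0 * var i ^ (k + l)))"
      by (simp add: gh k(1) power_add distrib_left sum_distrib_left sum_negf mult_ac)
    moreover have "mon m0 * h * var i ^ k * ?r \<in> MS" by (intro MS_J idl_mult idlJ rel(4) i)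
    moreover have "(\<Sum>l<e i. (- (h * c i l)) * (mon m0 * var i ^ (k + l))) \<in> MS"
      unfolding shift using k rel(3)[OF i] hB
      by (intro MS_sum MS_mon in\<Gamma> subr_uminus subr_mult B) auto
    ultimately show ?thesis using MS_add by simp
  qed
  have step: "\<exists>c. (\<forall>m. c m \<in> ?B) \<and> g * (var i * mon m) - (\<Sum>m'\<in>\<Gamma>. c m' * mon m') \<in> J"
    if i: "i \<in> I" and m: "m \<in> \<Gamma>" for i m
  proof -
    have "g * (var i * mon m) \<in> MS"
    proof (cases "Suc (Poly_Mapping.lookup m i) < E")
      case True
      then have "Poly_Mapping.single i 1 + m \<in> \<Gamma>"
        using m i by (auto simp: \<Gamma>_def keys_add_nat lookup_add lookup_single when_def split: if_splits)
      from MS_mon[OF gB this] show ?thesis by (simp add: mon_add var_def)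
    next
      case False
      then have l: "Suc (Poly_Mapping.lookup m i) = E"
        using m i by (auto simp: \<Gamma>_def not_less intro: antisym)
      define m0 where "m0 = m - Poly_Mapping.single i (Poly_Mapping.lookup m i)"
      have m0: "m0 \<in> \<Gamma>" "Poly_Mapping.lookup m0 i = 0"
        using m unfolding \<Gamma>_def m0_def
        by (auto simp: lookup_minus lookup_single in_keys_iff when_def le_less_trans[OF diff_le_self] split: if_splits)
      have mm: "m = m0 + Poly_Mapping.single i (Poly_Mapping.lookup m i)"
        unfolding m0_def by (rule poly_mapping_eqI) (auto simp: lookup_add lookup_minus lookup_single when_def)
      have vp: "(mon (Poly_Mapping.single i l) :: ('i, 'k) mpoly) = var i ^ l" for l
      proof (induction l)
        case (Suc l)
        have "(mon (Poly_Mapping.single i (Suc l)) :: ('i, 'k) mpoly) = mon (Poly_Mapping.single i 1 + Poly_Mapping.single i l)"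
          by (simp flip: single_add)
        then show ?case using Suc by (simp only: mon_add var_def[symmetric]) simp
      qed simp
      have "(mon m :: ('i, 'k) mpoly) = mon m0 * var i ^ Poly_Mapping.lookup m i"
        by (subst mm) (simp only: mon_add vp)
      then have "g * (var i * mon m) = mon m0 * (g * var i ^ E)"
        by (simp add: mult_ac flip: l)
      then show ?thesis using power_E[OF i m0] by simp
    qed
    then show ?thesis by (simp add: MS_def)
  qed
  define SR where "SR = (\<lambda>i m c. (\<forall>m'. c m' \<in> ?B) \<and> g * (var i * mon m) - (\<Sum>m'\<in>\<Gamma>. c m' * mon m') \<in> J)"
  have "\<exists>c. SR i m c" if "i \<in> I" "m \<in> \<Gamma>" for i m
    unfolding SR_def by (rule step[OF that])
  then obtain s where "\<And>i m. i \<in> I \<Longrightarrow> m \<in> \<Gamma> \<Longrightarrow> SR i m (s i m)" by metis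
  then have s: "\<And>i m m'. i \<in> I \<Longrightarrow> m \<in> \<Gamma> \<Longrightarrow> s i m m' \<in> ?B"
    "\<And>i m. i \<in> I \<Longrightarrow> m \<in> \<Gamma> \<Longrightarrow> g * (var i * mon m) - (\<Sum>m'\<in>\<Gamma>. s i m m' * mon m') \<in> J"
    unfolding SR_def by blast+
  define F where "F = insert g ((\<lambda>(i, m, m'). s i m m') ` (I \<times> \<Gamma> \<times> \<Gamma>))"
  have "finite F" "F \<subseteq> ?B" using I fin\<Gamma> gB s(1) by (auto simp: F_def)
  then obtain t where t: "F \<subseteq> wspan zs t" using gen_wspan_finite by blast
  define G where "G = (\<lambda>N. (\<lambda>(es, m). fam zs es * mon m) ` (Lst (length zs) (Suc N) \<times> \<Gamma>))"
  have in_G: "w * mon m \<in> mp.span (G N)" if "w \<in> wspan zs N" "m \<in> \<Gamma>" for w m N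
  proof -
    have "mon m * w \<in> mp.span (G N)"
      using that(1) unfolding wspan_def
    proof (rule mult_mem_span)
      fix y assume "y \<in> fam zs ` Lst (length zs) (Suc N)"
      then obtain es where "es \<in> Lst (length zs) (Suc N)" "y = fam zs es" by blast
      then have "mon m * y \<in> G N" using that(2) unfolding G_def
        by (intro image_eqI[of _ _ "(es, m)"]) (auto simp: mult.commute)
      then show "mon m * y \<in> mp.span (G N)" by (rule mp.span_base)
    qed
    then show ?thesis by (simp add: mult.commute)
  qed
  have gpow: "g ^ D \<in> wspan zs (D * t)" for D
  proof (induction D)
    case 0
    have "fam zs (replicate (length zs) 0) = 1" by (induction zs) auto
    moreover have "replicate (length zs) 0 \<in> Lst (length zs) (Suc 0)" by (auto simp: Lst_def)
    ultimately have "1 \<in> fam zs ` Lst (length zs) (Suc 0)" by (metis imageI)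
    then show ?case by (simp add: wspan_def mp.span_base)
  next
    case (Suc D)
    have "g \<in> wspan zs t" using t by (simp add: F_def)
    from wspan_mult[OF this Suc] show ?case by (simp add: algebra_simps)
  qed
  \<comment> \<open>Every variable multiplied in costs one factor \<open>g\<close> and raises the
    degree of the coefficients in \<open>zs\<close> by at most \<open>t\<close>; hence
    \<open>D\<close> factors and degree \<open>D * t\<close> suffice up to degree
    \<open>D\<close>.\<close>
  have main: "\<exists>x\<in>mp.span (G (D * t)). g ^ D * mon m - x \<in> J"
    if "Poly_Mapping.keys m \<subseteq> I" "mdeg m \<le> D" for m D
    using that
  proof (induction m arbitrary: D rule: monom_induct)
    case zero
    have "0 \<in> \<Gamma>" by (simp add: \<Gamma>_def E_def)
    from in_G[OF gpow this] show ?case by (intro bexI[of _ "g ^ D"]) (auto simp: idl_0[OF idlJ])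
  next
    case (add m i)
    then have i: "i \<in> I" and D: "0 < D" "mdeg m \<le> D - 1" and km: "Poly_Mapping.keys m \<subseteq> I"
      by (auto simp: keys_add_nat mdeg_add)
    define D' where "D' = D - 1"
    have DD: "D = Suc D'" using D by (simp add: D'_def)
    from add.IH[OF km D(2)] obtain x where x: "x \<in> mp.span (G (D' * t))" "g ^ D' * mon m - x \<in> J"
      by (auto simp: D'_def)
    have "\<exists>y\<in>mp.span (G (D * t)). (g * var i) * x - y \<in> J"
    proof (rule span_mod_idl[OF idlJ x(1)])
      fix z assume "z \<in> G (D' * t)"
      then obtain es m where z: "es \<in> Lst (length zs) (Suc (D' * t))" "m \<in> \<Gamma>" "z = fam zs es * mon m"
        by (auto simp: G_def)
      define y where "y = (\<Sum>m'\<in>\<Gamma>. (fam zs es * s i m m') * mon m')"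
      have "g * var i * z - y = fam zs es * (g * (var i * mon m) - (\<Sum>m'\<in>\<Gamma>. s i m m' * mon m'))"
        by (simp add: z(3) y_def sum_distrib_left algebra_simps)
      also have "\<dots> \<in> J" by (intro idl_mult idlJ s(2) i z(2))
      finally have "g * var i * z - y \<in> J" .
      moreover have "y \<in> mp.span (G (D * t))"
        unfolding y_def
      proof (intro mp.span_sum in_G)
        fix m' assume m': "m' \<in> \<Gamma>"
        have "fam zs es \<in> wspan zs (D' * t)"
          unfolding wspan_def using z(1) by (intro mp.span_base imageI)
        moreover have "s i m m' \<in> wspan zs t" using t i z(2) m' by (force simp: F_def)
        ultimately show "fam zs es * s i m m' \<in> wspan zs (D * t)"
          using wspan_mult[of _ zs "D' * t" _ t] by (simp add: DD add.commute)
      qed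
      ultimately show "\<exists>y\<in>mp.span (G (D * t)). g * var i * z - y \<in> J" by blast
    qed
    then obtain y where y: "y \<in> mp.span (G (D * t))" "(g * var i) * x - y \<in> J" by blast
    have "g ^ D * mon (Poly_Mapping.single i 1 + m) - y =
        g * var i * (g ^ D' * mon m - x) + ((g * var i) * x - y)"
      by (simp add: mon_add var_def DD algebra_simps)
    also have "\<dots> \<in> J" using x(2) y(2) idlJ by (intro idl_add idl_mult)
    finally show ?case using y(1) by blast
  qed
  have main': "\<exists>x\<in>mp.span (G (D * t)). g ^ D * f - x \<in> J" if "f \<in> mpolys_upto I D" for f D
  proof (rule span_mod_idl[OF idlJ])
    show "f \<in> mp.span (mon ` mons I D)"
      by (subst upto_eq_sum[OF I that], unfold mpoly_scale_eq[symmetric],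
          intro mp.span_sum mp.span_scale mp.span_base imageI)
    show "\<exists>y\<in>mp.span (G (D * t)). g ^ D * z - y \<in> J" if "z \<in> mon ` mons I D" for z
      using that main by (auto simp: mons_def)
  qed
  define n where "n = length fs"
  define q where "q = length zs"
  have "\<exists>k. \<forall>f\<in>set fs. f \<in> mpolys_upto I k"
    using fs(2)
  proof (induction fs)
    case (Cons f fs)
    then obtain k k' where "\<forall>f\<in>set fs. f \<in> mpolys_upto I k" "f \<in> mpolys_upto I k'"
      using mpolys_imp_upto[of f I] by auto
    then show ?case by (intro exI[of _ "max k k'"]) (auto intro: upto_mono)
  qed simp
  then obtain k where k: "\<And>f. f \<in> set fs \<Longrightarrow> f \<in> mpolys_upto I k" by blast
  have fam_upto: "fam gs es \<in> mpolys_upto I (k * D * length gs)"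
    if "set gs \<subseteq> mpolys_upto I k" "es \<in> Lst (length gs) D" for gs es D
    using that
  proof (induction gs arbitrary: es)
    case (Cons f gs)
    then obtain e es' where es: "es = e # es'" "e < D" "es' \<in> Lst (length gs) D"
      by (auto simp: Lst_Suc)
    have "f ^ e \<in> mpolys_upto I (k * D)"
      using upto_power[of f I k e] Cons(2) es(2) by (auto intro: upto_mono)
    from upto_mult[OF this Cons.IH[OF _ es(3)]] Cons(2) show ?case
      by (simp add: es(1) algebra_simps)
  qed simp
  have bound: "D ^ n \<le> Suc (k * D * n * t) ^ q * card \<Gamma>" for D
  proof -
    let ?N = "k * D * n"
    have "card (Lst n D) \<le> card (G (?N * t))"
    proof (rule indep_mod_card_span[OF idlJ])
      show "finite (G (?N * t))" unfolding G_def using fin\<Gamma> by simp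
      show "indep_mod J (Lst n D) (\<lambda>es. g ^ ?N * fam fs es)"
        unfolding n_def using prime_idl_power[OF J] gJ
        by (intro indep_mod_mult J alg_indep_fam idlJ oneJ fs(1)) blast
      show "\<exists>y\<in>mp.span (G (?N * t)). g ^ ?N * fam fs es - y \<in> J" if "es \<in> Lst n D" for es
        using main' fam_upto[of fs es D] k that by (auto simp: n_def)
    qed simp
    also have "\<dots> \<le> card (Lst q (Suc (?N * t)) \<times> \<Gamma>)"
      unfolding G_def q_def using fin\<Gamma> by (intro card_image_le) simp
    finally show ?thesis by (simp add: card_Lst card_cartesian_product)
  qed
  show ?thesis
  proof (rule ccontr)
    assume "\<not> ?thesis"
    then have qn: "Suc q \<le> n" by (simp add: n_def q_def)
    \<comment> \<open>\<open>M\<close> bounds the right-hand side of \<open>bound\<close> apart from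
      a factor \<open>D ^ q\<close>. With \<open>q < n\<close> this gives \<open>D \<le> M\<close>,
      which \<open>D = Suc M\<close> violates.\<close>
    define M where "M = Suc (k * n * t) ^ q * card \<Gamma>"
    define D where "D = Suc M"
    have "Suc (k * D * n * t) \<le> D * Suc (k * n * t)" by (simp add: D_def algebra_simps)
    then have "Suc (k * D * n * t) ^ q \<le> (D * Suc (k * n * t)) ^ q" by (rule power_mono) simp
    then have "Suc (k * D * n * t) ^ q * card \<Gamma> \<le> (D * Suc (k * n * t)) ^ q * card \<Gamma>"
      by (rule mult_le_mono1)
    also have "\<dots> = D ^ q * M" by (simp only: M_def power_mult_distrib mult.assoc)
    finally have "D ^ n \<le> D ^ q * M" using bound[of D] by (rule le_trans[rotated])
    moreover have "D ^ Suc q \<le> D ^ n" using qn by (intro power_increasing) (auto simp: D_def)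
    ultimately have "D ^ q * D \<le> D ^ q * M" by (metis le_trans power_Suc2)
    moreover have "0 < D ^ q" by (simp add: D_def)
    ultimately show False by (simp add: D_def)
  qed
qed

text \<open>Going through the list from its end, an entry is kept if it is transcendental over those
  kept so far; a discarded one stays algebraic as the subring grows. Equality of lengths means that
  nothing was discarded, which is how \<open>xs\<close> itself is later seen to be
  independent.\<close>

lemma greedy_alg_indep:
  assumes J: "idl J" "1 \<notin> J"
  shows "\<exists>zs. alg_indep J zs \<and> set zs \<subseteq> set xs \<and> length zs \<le> length xs \<and>
    (length zs = length xs \<longrightarrow> zs = xs) \<and> (\<forall>x\<in>set xs. \<not> transc (gen zs) x J)"
proof (induction xs)
  case (Cons x xs)
  then obtain zs where zs: "alg_indep J zs" "set zs \<subseteq> set xs" "length zs \<le> length xs"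
    "length zs = length xs \<longrightarrow> zs = xs" "\<forall>x\<in>set xs. \<not> transc (gen zs) x J" by blast
  show ?case
  proof (cases "transc (gen zs) x J")
    case True
    have "\<not> transc (gen (x # zs)) x J"
    proof
      assume tr: "transc (gen (x # zs)) x J"
      have "x \<in> gen (x # zs)" using set_subset_gen[of "x # zs"] by simp
      then have "coeffs_in (gen (x # zs)) [:- x, 1:]"
        using subr_gen[of "x # zs"] by (simp only: coeffs_in_pCons subr_uminus subr_1 coeffs_in_0 subr_0)
      moreover have "poly [:- x, 1:] x \<in> J" using J by (simp add: idl_0)
      ultimately have "coeffs_in J [:- x, 1:]" using tr by (simp only: transc_def)
      then show False using J by (simp add: coeffs_in_pCons)
    qed
    moreover have "\<not> transc (gen (x # zs)) y J" if "y \<in> set xs" for y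
      using zs(5) that transc_mono[of "gen (x # zs)" y J "gen zs"] subset_adjoin[OF subr_gen, of zs x] by auto
    ultimately show ?thesis using zs True by (intro exI[of _ "x # zs"]) (auto simp del: gen.simps)
  next
    case False
    then show ?thesis using zs by (intro exI[of _ zs]) auto
  qed
qed simp

text \<open>From each strict inclusion take an element of \<open>J j\<close> outside
  \<open>J (Suc j)\<close>. The invariant \<open>gen fs \<inter> J j \<subseteq> J m\<close> makes
  it transcendental over the previous ones: the constant term of a relation lies in
  \<open>J j\<close>, hence in \<open>J m\<close>, and the relation can then be divided by the
  element because \<open>J (Suc j)\<close> is prime.\<close>

lemma chain_alg_indep:
  fixes J :: "nat \<Rightarrow> ('i, 'k::field) mpoly set"
  assumes J: "\<And>j. j \<le> m \<Longrightarrow> prime_idl (J j)" "\<And>j i. j \<le> m \<Longrightarrow> i \<notin> I \<Longrightarrow> var i \<in> J j"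
    and dec: "\<And>j. j < m \<Longrightarrow> J (Suc j) \<subset> J j"
  shows "\<exists>fs. length fs = m \<and> set fs \<subseteq> mpolys I \<and> alg_indep (J m) fs"
proof -
  have mono: "J j \<subseteq> J i" if "i \<le> j" "j \<le> m" for i j
    using that
  proof (induction j)
    case (Suc j)
    show ?case
    proof (cases "i = Suc j")
      case False
      then have "J j \<subseteq> J i" using Suc by auto
      then show ?thesis using dec[of j] Suc.prems by auto
    qed simp
  qed simp
  have "\<exists>fs. length fs = j \<and> set fs \<subseteq> mpolys I \<and> alg_indep (J m) fs \<and> gen fs \<inter> J j \<subseteq> J m" if "j \<le> m" for j
    using that
  proof (induction j)
    case 0
    have "gen [] \<inter> J 0 \<subseteq> J m"
      using J(1)[of 0] J(1)[of m] by (auto simp: prime_idl_def kap_mem_iff idl_0)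
    then show ?case by (intro exI[of _ "[]"]) auto
  next
    case (Suc j)
    then obtain fs where fs: "length fs = j" "set fs \<subseteq> mpolys I" "alg_indep (J m) fs" "gen fs \<inter> J j \<subseteq> J m" by auto
    obtain f0 where f0: "f0 \<in> J j" "f0 \<notin> J (Suc j)" using dec[of j] Suc by auto
    define f where "f = restr I f0"
    have idlj: "idl (J j)" "idl (J (Suc j))" "idl (J m)" and pr: "prime_idl (J (Suc j))"
      using J(1) Suc.prems by (auto simp: prime_idl_idl)
    have "f0 - f \<in> J j" "f0 - f \<in> J (Suc j)"
      unfolding f_def using Suc.prems J(2) idlj by (auto intro!: diff_restr)
    then have f: "f \<in> J j" "f \<notin> J (Suc j)" "f \<in> mpolys I"
      using f0 idl_cong idlj by (auto simp: f_def restr_in)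
    have key: "coeffs_in (gen fs) c \<Longrightarrow> poly c f \<in> J (Suc j) \<Longrightarrow> coeffs_in (J m) c" for c
    proof (induction c)
      case 0
      then show ?case using idlj by (simp add: coeffs_in_0 idl_0)
    next
      case (pCons a c)
      have "poly (pCons a c) f \<in> J j" using subsetD[OF mono[of j "Suc j"] pCons.prems(2)] Suc.prems by simp
      moreover have "f * poly c f \<in> J j" using f(1) idlj by (intro idl_mult_right)
      ultimately have "a \<in> J j" using idl_diff[OF idlj(1), of "poly (pCons a c) f" "f * poly c f"] by simp
      then have a: "a \<in> J m" using pCons.prems(1) fs(4) by (auto simp: coeffs_in_pCons)
      then have "a \<in> J (Suc j)" using subsetD[OF mono[of "Suc j" m]] Suc.prems by simp
      then have "f * poly c f \<in> J (Suc j)"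
        using idl_diff[OF idlj(2) pCons.prems(2), of a] by simp
      then have "poly c f \<in> J (Suc j)" using pr f(2) by (simp add: prime_idl_mult)
      then show ?case using pCons a by (simp add: coeffs_in_pCons)
    qed
    have "transc (gen fs) f (J m)"
      unfolding transc_def using key subsetD[OF mono[of "Suc j" m]] Suc.prems by simp
    moreover have "gen (f # fs) \<inter> J (Suc j) \<subseteq> J m"
      using key poly_in_idl[OF idlj(3)] by (auto simp: adjoin_def)
    ultimately show ?case using fs f(3) by (intro exI[of _ "f # fs"]) auto
  qed
  from this[of m] show ?thesis by auto
qed

section \<open>Finite fibres\<close>

definition pts :: "('i, 'k::comm_ring_1) mpoly set \<Rightarrow> ('i \<Rightarrow> 'k) set" where
  "pts J = {Q. \<forall>f\<in>J. eval_mpoly Q f = 0}"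

lemma ptsD: "Q \<in> pts J \<Longrightarrow> f \<in> J \<Longrightarrow> eval_mpoly Q f = 0"
  by (simp add: pts_def)

text \<open>This plays the role of a general fibre shared by dominant maps: \<open>xs\<close> is
  specialised simultaneously for all the primes, and the Nullstellensatz supplies a point for each.
  The inequations \<open>p n\<close> may differ from prime to prime, which later separates
  components.\<close>

theorem common_fibre:
  fixes J :: "nat \<Rightarrow> ('i, complex) mpoly set"
  assumes I: "finite I" and J: "\<And>n. prime_idl (J n)" "\<And>n i. i \<notin> I \<Longrightarrow> var i \<in> J n"
    and p: "\<And>n. p n \<notin> J n" and xs: "\<And>n. alg_indep (J n) xs"
  shows "\<exists>v Q. \<forall>n. Q n \<in> pts (J n) \<and> eval_mpoly (Q n) (p n) \<noteq> 0 \<and> map (eval_mpoly (Q n)) xs = v"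
proof -
  have idlJ: "idl (J n)" for n using J(1) by (rule prime_idl_idl)
  have "\<exists>J'. (\<forall>n. idl (J' n) \<and> J n \<subseteq> J' n \<and> (\<forall>m. p n ^ m \<notin> J' n)) \<and>
    (\<forall>z\<in>gen xs. \<exists>r. \<forall>n. z - kap r \<in> J' n)"
  proof (rule simultaneous_specialisation[OF I uncountable_UNIV_complex J(1) xs idlJ J(2)])
    show "b \<in> J n" if "b \<in> gen xs" "b * p n ^ m \<in> J n" for n b m
      using that p[of n] prime_idl_power[OF J(1)] by (auto simp: prime_idl_mult[OF J(1)])
  qed
  then obtain J' where J': "\<And>n. idl (J' n)" "\<And>n. J n \<subseteq> J' n" "\<And>n m. p n ^ m \<notin> J' n"
    and const: "\<And>z. z \<in> gen xs \<Longrightarrow> \<exists>r. \<forall>n. z - kap r \<in> J' n" by blast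
  have "\<exists>Q. (\<forall>f\<in>J' n. eval_mpoly Q f = 0) \<and> eval_mpoly Q (p n) \<noteq> 0" for n
    by (rule nullstellensatz_point[OF I J'(1) _ J'(3)]) (use J(2) J'(2) in blast)
  then obtain Q where Q: "\<And>n f. f \<in> J' n \<Longrightarrow> eval_mpoly (Q n) f = 0" "\<And>n. eval_mpoly (Q n) (p n) \<noteq> 0"
    by metis
  have same: "map (eval_mpoly (Q n)) xs = map (eval_mpoly (Q 0)) xs" for n
  proof (rule map_cong[OF refl])
    fix z assume "z \<in> set xs"
    then obtain r where "\<forall>n. z - kap r \<in> J' n" using const set_subset_gen by blast
    then show "eval_mpoly (Q n) z = eval_mpoly (Q 0) z"
      using eval_congruent_kap[OF _ Q(1)] by metis
  qed
  have "Q n \<in> pts (J n)" for n using Q(1) J'(2) by (auto simp: pts_def)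
  with same Q(2) show ?thesis by blast
qed

lemma finite_poly_roots_eq:
  fixes a :: "'k::idom"
  assumes "a \<noteq> 0"
  shows "finite {x. a * x ^ e + (\<Sum>l<e. c l * x ^ l) = 0}"
proof -
  define g where "g = monom a e + (\<Sum>l<e. monom (c l) l)"
  have "coeff g e = a" by (simp add: g_def coeff_sum)
  then have "g \<noteq> 0" using assms by auto
  moreover have "poly g x = a * x ^ e + (\<Sum>l<e. c l * x ^ l)" for x
    by (simp add: g_def poly_sum poly_monom)
  ultimately show ?thesis using poly_roots_finite[of g] by simp
qed

text \<open>Let \<open>zs\<close> be a maximal independent part of \<open>xs\<close>. If some
  variable were transcendental over \<open>gen zs\<close>, it could take infinitely many values
  while \<open>zs\<close> stays fixed. As \<open>xs\<close> is algebraic over \<open>zs\<close>, it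
  takes only finitely many values there, and one fibre of \<open>xs\<close> would be infinite. So
  every variable is algebraic over \<open>zs\<close>, and \<open>zs\<close> is at least as long as
  \<open>fs\<close>.\<close>

theorem alg_indep_of_finite_fibres:
  fixes J :: "('i, complex) mpoly set"
  assumes I: "finite I" and J: "prime_idl J" "\<And>i. i \<notin> I \<Longrightarrow> var i \<in> J" and p: "p \<notin> J"
    and fs: "alg_indep J fs" "set fs \<subseteq> mpolys I"
    and fin: "\<And>v. finite {Q \<in> pts J. eval_mpoly Q p \<noteq> 0 \<and> map (eval_mpoly Q) xs = v}"
  shows "length fs \<le> length xs \<and> (length fs = length xs \<longrightarrow> alg_indep J xs)"
proof -
  have idlJ: "idl J" and oneJ: "1 \<notin> J" using J(1) by (auto simp: prime_idl_def)
  obtain zs where zs: "alg_indep J zs" "length zs \<le> length xs"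
    "length zs = length xs \<longrightarrow> zs = xs" "\<And>x. x \<in> set xs \<Longrightarrow> \<not> transc (gen zs) x J"
    using greedy_alg_indep[OF idlJ oneJ, of xs] by blast
  have B: "subr (gen zs)" by (rule subr_gen)
  have "\<not> transc (gen zs) (var i) J" for i
  proof
    define u :: "('i, complex) mpoly" where "u = var i"
    assume "transc (gen zs) (var i) J"
    then have tr: "transc (gen zs) u J" by (simp add: u_def)
    define R where "R = (\<lambda>x a e c. a \<in> gen zs \<and> a \<notin> J \<and> (\<forall>l. c l \<in> gen zs) \<and>
      a * x ^ e + (\<Sum>l<e. c l * x ^ l) \<in> J)"
    have "\<exists>a e c. R x a e c" if x: "x \<in> set xs" for x
    proof -
      obtain a e c where "a \<in> gen zs" "a \<notin> J" "\<And>l. c l \<in> gen zs" "a * x ^ e + (\<Sum>l<e. c l * x ^ l) \<in> J"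
        by (rule not_transc_relation[OF idlJ B zs(4)[OF x]]) blast
      then have "R x a e c" unfolding R_def by simp
      then show ?thesis by blast
    qed
    then obtain a e c where R: "\<And>x. x \<in> set xs \<Longrightarrow> R x (a x) (e x) (c x)" by metis
    then have rel: "\<And>x. x \<in> set xs \<Longrightarrow> a x \<in> gen zs" "\<And>x. x \<in> set xs \<Longrightarrow> a x \<notin> J"
      "\<And>x l. x \<in> set xs \<Longrightarrow> c x l \<in> gen zs"
      "\<And>x. x \<in> set xs \<Longrightarrow> a x * x ^ e x + (\<Sum>l<e x. c x l * x ^ l) \<in> J"
      unfolding R_def by blast+
    \<comment> \<open>The leading coefficients of the relations are included, so that at points
      where \<open>p'\<close> is nonzero none of the relations degenerates.\<close>
    define p' where "p' = p * prod a (set xs)"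
    have p': "p' \<notin> J"
      unfolding p'_def using p prime_idl_prod[of "set xs" J a, OF _ J(1) rel(2)] by (simp add: prime_idl_mult[OF J(1)])
    define S where "S = {r. \<exists>b\<in>gen zs - J. \<exists>m. b * p' ^ m \<in> idl_plus J (u - kap r)}"
    have "countable S"
      unfolding S_def
    proof (rule countable_bad_specialisations[OF I idlJ J(2) idlJ B])
      fix c m assume "coeffs_in (gen zs) c" "p' ^ m * poly c u \<in> J"
      then show "coeffs_in J c"
        using tr p' prime_idl_power[OF J(1), of p' m] by (auto simp: transc_def prime_idl_mult[OF J(1)])
    qed
    then have "infinite (- S)"
      using uncountable_UNIV_complex countable_finite[of "- S"] countable_Un[of S "- S"] by auto
    then obtain r :: "nat \<Rightarrow> complex" where r: "inj r" "range r \<subseteq> - S"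
      using infinite_countable_subset by blast
    define J1 where "J1 = (\<lambda>n. idl_plus J (u - kap (r n)))"
    have "\<exists>J'. (\<forall>n. idl (J' n) \<and> J1 n \<subseteq> J' n \<and> (\<forall>m. p' ^ m \<notin> J' n)) \<and>
      (\<forall>z\<in>gen zs. \<exists>r. \<forall>n. z - kap r \<in> J' n)"
    proof (rule simultaneous_specialisation[OF I uncountable_UNIV_complex, where ?J0.0 = "\<lambda>_. J"])
      show "idl (J1 n)" for n unfolding J1_def by (rule idl_idl_plus[OF idlJ])
      show "var i \<in> J1 n" if "i \<notin> I" for n i
        unfolding J1_def using J(2)[OF that] subset_idl_plus by blast
      show "b \<in> J" if b: "b \<in> gen zs" "b * p' ^ m \<in> J1 n" for n b m
      proof (rule ccontr)
        assume "b \<notin> J"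
        then have "r n \<in> S" using b unfolding S_def J1_def by blast
        then show False using r(2) by blast
      qed
    qed (use J(1) zs(1) in auto)
    then obtain J' where J': "\<And>n. idl (J' n)" "\<And>n. J1 n \<subseteq> J' n" "\<And>n m. p' ^ m \<notin> J' n"
      and const: "\<And>z. z \<in> gen zs \<Longrightarrow> \<exists>r. \<forall>n. z - kap r \<in> J' n" by blast
    have JJ': "J \<subseteq> J' n" for n
      using J'(2)[of n] subset_idl_plus[of J] unfolding J1_def by blast
    have uJ': "u - kap (r n) \<in> J' n" for n
      using J'(2)[of n] mem_idl_plus[OF idlJ] unfolding J1_def by blast
    have "\<exists>Q. (\<forall>f\<in>J' n. eval_mpoly Q f = 0) \<and> eval_mpoly Q p' \<noteq> 0" for n
      using J' J(2) JJ' by (intro nullstellensatz_point[OF I]) blast+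
    then obtain Q where Q: "\<And>n f. f \<in> J' n \<Longrightarrow> eval_mpoly (Q n) f = 0" "\<And>n. eval_mpoly (Q n) p' \<noteq> 0"
      by metis
    have Qu: "eval_mpoly (Q n) u = r n" for n
      using eval_congruent_kap[OF uJ' Q(1)] .
    have const': "eval_mpoly (Q n) z = eval_mpoly (Q 0) z" if "z \<in> gen zs" for z n
    proof -
      from const[OF that] obtain s where "\<forall>n. z - kap s \<in> J' n" by blast
      then show ?thesis using eval_congruent_kap[OF _ Q(1)] by metis
    qed
    define F where "F = (\<lambda>x. {y. eval_mpoly (Q 0) (a x) * y ^ e x + (\<Sum>l<e x. eval_mpoly (Q 0) (c x l) * y ^ l) = 0})"
    have finF: "finite (F x)" if "x \<in> set xs" for x
      unfolding F_def
    proof (rule finite_poly_roots_eq)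
      show "eval_mpoly (Q 0) (a x) \<noteq> 0"
        using Q(2)[of 0] that by (auto simp: p'_def eval_mpoly_mult eval_prod)
    qed
    have inF: "eval_mpoly (Q n) x \<in> F x" if "x \<in> set xs" for x n
    proof -
      have "eval_mpoly (Q n) (a x * x ^ e x + (\<Sum>l<e x. c x l * x ^ l)) = 0"
        using Q(1) rel(4)[OF that] JJ' by blast
      moreover have "eval_mpoly (Q n) (a x) = eval_mpoly (Q 0) (a x)"
        "\<And>l. eval_mpoly (Q n) (c x l) = eval_mpoly (Q 0) (c x l)"
        using rel(1,3)[OF that] by (intro const'; simp)+
      ultimately show ?thesis unfolding F_def
        by (simp only: eval_mpoly_add eval_mpoly_mult eval_power eval_sum mem_Collect_eq)
    qed
    define vs where "vs = {l. set l \<subseteq> (\<Union>x\<in>set xs. F x) \<and> length l = length xs}"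
    have "finite vs" unfolding vs_def using finF by (intro finite_lists_length_eq) auto
    have "map (eval_mpoly (Q n)) xs \<in> vs" for n
      using inF by (auto simp: vs_def)
    then have "finite ((\<lambda>n. map (eval_mpoly (Q n)) xs) ` UNIV)"
      using \<open>finite vs\<close> by (meson finite_subset image_subsetI)
    then obtain n0 where "infinite {n \<in> UNIV. map (eval_mpoly (Q n)) xs = map (eval_mpoly (Q n0)) xs}"
      using pigeonhole_infinite[OF infinite_UNIV_nat] by blast
    then obtain v where v: "infinite {n. map (eval_mpoly (Q n)) xs = v}"
      by (simp only: UNIV_I simp_thms)
    have "Q ` {n. map (eval_mpoly (Q n)) xs = v} \<subseteq>
      {Q \<in> pts J. eval_mpoly Q p \<noteq> 0 \<and> map (eval_mpoly Q) xs = v}"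
    proof clarify
      fix n
      have "Q n \<in> pts J" using Q(1) JJ' unfolding pts_def by blast
      moreover have "eval_mpoly (Q n) p \<noteq> 0" using Q(2)[of n] by (auto simp: p'_def eval_mpoly_mult)
      ultimately show "Q n \<in> pts J \<and> eval_mpoly (Q n) p \<noteq> 0 \<and> map (eval_mpoly (Q n)) xs = map (eval_mpoly (Q n)) xs"
        by simp
    qed
    then have "finite (Q ` {n. map (eval_mpoly (Q n)) xs = v})" using fin finite_subset by blast
    moreover have "inj_on Q A" for A
      using r(1) Qu by (metis injD inj_onI)
    ultimately show False using v finite_imageD by blast
  qed
  then have "length fs \<le> length zs" using alg_indep_length_le[OF I J(1) _ fs] by blast
  then show ?thesis using zs by auto
qed

text \<open>A point of \<open>affine_space I\<close> is \<open>undefined\<close> outside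
  \<open>I\<close>, whereas the zeros of an ideal that contains the variables outside
  \<open>I\<close> are 0 there. \<open>ext0\<close> passes from the first convention to the second,
  and \<open>restrict\<close> passes back.\<close>

definition ext0 :: "'i set \<Rightarrow> ('i \<Rightarrow> 'k) \<Rightarrow> 'i \<Rightarrow> 'k::comm_ring_1" where
  "ext0 I Q = (\<lambda>i. if i \<in> I then Q i else 0)"

definition van :: "'i set \<Rightarrow> ('i \<Rightarrow> 'k) set \<Rightarrow> ('i, 'k::comm_ring_1) mpoly set" where
  "van I Z = {f. \<forall>Q\<in>Z. eval_mpoly (ext0 I Q) f = 0}"

lemma eval_ext0: "eval_mpoly (ext0 I Q) f = eval_mpoly Q (restr I f)"
  by (simp add: eval_restr ext0_def)

lemma eval_ext0_mpolys: "f \<in> mpolys I \<Longrightarrow> eval_mpoly (ext0 I Q) f = eval_mpoly Q f"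
  by (simp add: eval_ext0 restr_id)

lemma ext0_restrict [simp]: "ext0 I (restrict Q I) = ext0 I Q"
  by (auto simp: ext0_def)

lemma eval_restrict: "f \<in> mpolys I \<Longrightarrow> eval_mpoly (restrict Q I) f = eval_mpoly Q f"
  by (metis eval_ext0_mpolys ext0_restrict)

lemma var_van: "i \<notin> I \<Longrightarrow> var i \<in> van I Z"
  by (simp add: van_def ext0_def)

lemma idl_van: "idl (van I Z)"
  by (auto simp: idl_def van_def eval_mpoly_add eval_mpoly_mult)

lemma van_antimono: "Z \<subseteq> Z' \<Longrightarrow> van I Z' \<subseteq> van I Z"
  by (auto simp: van_def)

lemma pts_van_restrict:
  assumes "closedin (zariski I) Z" "Q \<in> pts (van I Z)"
  shows "restrict Q I \<in> Z"
proof -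
  obtain S where S: "S \<subseteq> mpolys I" "Z = zero_locus I S" using assms(1) closedin_zariski by blast
  have "eval_mpoly (restrict Q I) f = 0" if "f \<in> S" for f
  proof -
    have fI: "f \<in> mpolys I" using that S(1) by blast
    then have "f \<in> van I Z" using that S(2) by (auto simp: van_def zero_locus_def eval_ext0_mpolys)
    then show ?thesis using fI assms(2) by (simp add: eval_restrict pts_def)
  qed
  then show ?thesis by (auto simp: S(2) zero_locus_def)
qed

lemma pts_van_zero: "Q \<in> pts (van I Z) \<Longrightarrow> ext0 I Q = Q"
  using ptsD[OF _ var_van, of Q I Z] by (auto simp: ext0_def fun_eq_iff)

lemma van_subsetD:
  assumes "closedin (zariski I) Z" "Z' \<subseteq> affine_space I" "van I Z \<subseteq> van I Z'"
  shows "Z' \<subseteq> Z"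
proof
  fix Q assume Q: "Q \<in> Z'"
  then have "ext0 I Q \<in> pts (van I Z)" using assms(3) by (auto simp: pts_def van_def)
  from pts_van_restrict[OF assms(1) this] have "restrict (ext0 I Q) I \<in> Z" .
  moreover have "restrict (ext0 I Q) I = Q"
    using Q assms(2) by (auto simp: ext0_def PiE_def extensional_def restrict_def fun_eq_iff)
  ultimately show "Q \<in> Z" by simp
qed

lemma closedin_zariski_zeros:
  fixes f :: "('i, 'k::idom) mpoly"
  shows "closedin (zariski I) {Q \<in> affine_space I. eval_mpoly (ext0 I Q) f = 0}"
  unfolding closedin_zariski
  by (rule exI[of _ "{restr I f}"]) (auto simp: restr_in zero_locus_def eval_ext0)

lemma prime_van:
  fixes Z :: "('i \<Rightarrow> 'k::idom) set"
  assumes "irreducible_in (zariski I) Z"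
  shows "prime_idl (van I Z)"
proof -
  have sub: "Z \<subseteq> affine_space I" and ne: "Z \<noteq> {}"
    and irr: "\<And>A B. closedin (zariski I) A \<Longrightarrow> closedin (zariski I) B \<Longrightarrow> Z \<subseteq> A \<union> B \<Longrightarrow> Z \<subseteq> A \<or> Z \<subseteq> B"
    using assms by (auto simp: irreducible_in_def topspace_zariski)
  let ?V = "\<lambda>f. {Q \<in> affine_space I. eval_mpoly (ext0 I Q) f = 0}"
  have V: "f \<in> van I Z \<longleftrightarrow> Z \<subseteq> ?V f" for f using sub by (auto simp: van_def)
  show ?thesis
    unfolding prime_idl_def
  proof (intro conjI allI impI idl_van)
    show "1 \<notin> van I Z" using ne by (auto simp: van_def)
    fix f g assume "f * g \<in> van I Z"
    then have "Z \<subseteq> ?V f \<union> ?V g" using sub by (auto simp: V eval_mpoly_mult)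
    then show "f \<in> van I Z \<or> g \<in> van I Z" unfolding V by (intro irr closedin_zariski_zeros)
  qed
qed

lemma irreducible_in_subtopology:
  assumes "irreducible_in (subtopology T X) Z" shows "irreducible_in T Z"
  unfolding irreducible_in_def
proof (intro conjI allI impI)
  show sub: "Z \<subseteq> topspace T" "Z \<noteq> {}" using assms by (auto simp: irreducible_in_def)
  fix A B assume AB: "closedin T A \<and> closedin T B \<and> Z \<subseteq> A \<union> B"
  have "closedin (subtopology T X) (A \<inter> X)" "closedin (subtopology T X) (B \<inter> X)"
    using AB by (auto simp: closedin_subtopology)
  moreover have "Z \<subseteq> X" using assms by (auto simp: irreducible_in_def)
  ultimately have "Z \<subseteq> A \<inter> X \<or> Z \<subseteq> B \<inter> X"
    using assms AB unfolding irreducible_in_def by (metis Int_subset_iff inf_sup_distrib2)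
  then show "Z \<subseteq> A \<or> Z \<subseteq> B" by auto
qed

lemma finite_closedin_zariski:
  assumes I: "finite I" and "finite F" "F \<subseteq> affine_space I"
  shows "closedin (zariski I :: ('i \<Rightarrow> 'k::idom) topology) F"
  using assms(2,3)
proof (induction F rule: finite_induct)
  case (insert q F)
  have "{q} = zero_locus I ((\<lambda>i. var i - kap (q i)) ` I)"
    using insert.prems by (auto simp: zero_locus_def eval_diff PiE_def extensional_def fun_eq_iff) metis
  moreover have "(\<lambda>i. var i - kap (q i) :: ('i, 'k) mpoly) ` I \<subseteq> mpolys I"
    by (auto intro!: upto_imp_mpolys[of _ I 1] upto_diff var_upto kap_upto)
  ultimately have "closedin (zariski I) {q}" unfolding closedin_zariski by blast
  moreover have "closedin (zariski I) F" using insert by auto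
  ultimately show ?case using closedin_Un by (metis insert_is_Un)
qed simp

text \<open>Points are closed, so a finite irreducible set is a single point and has no nonempty
  proper subset. This keeps positive-dimensional sets out of the finite locus where
  \<open>\<Theta>\<close> will vanish.\<close>

lemma irreducible_infinite:
  assumes I: "finite I" and Z: "irreducible_in (zariski I :: ('i \<Rightarrow> 'k::idom) topology) Z" and Y: "Y \<noteq> {}" "Y \<subset> Z"
  shows "infinite Z"
proof
  assume fin: "finite Z"
  have sub: "Z \<subseteq> affine_space I" using Z by (simp add: irreducible_in_def topspace_zariski)
  obtain q where q: "q \<in> Y" using Y by blast
  have "closedin (zariski I) {q}" "closedin (zariski I) (Z - {q})"
    using fin sub q Y by (auto intro!: finite_closedin_zariski[OF I])
  moreover have "Z \<subseteq> {q} \<union> (Z - {q})" by auto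
  ultimately have "Z \<subseteq> {q} \<or> Z \<subseteq> Z - {q}" using Z unfolding irreducible_in_def by metis
  then show False using q Y by auto
qed

lemma finite_pts_fibre:
  fixes Z :: "('i \<Rightarrow> complex) set"
  assumes cl: "closedin (zariski I) Z" "Z \<subseteq> X" and p: "p \<in> mpolys I" and xs: "set xs \<subseteq> mpolys I"
    and fin: "finite {Q \<in> X. eval_mpoly Q p \<noteq> 0 \<and> map (eval_mpoly Q) xs = v}"
  shows "finite {Q \<in> pts (van I Z). eval_mpoly Q p \<noteq> 0 \<and> map (eval_mpoly Q) xs = v}"
proof (rule finite_imageD[where f = "\<lambda>Q. restrict Q I"])
  have "map (eval_mpoly (restrict Q I)) xs = map (eval_mpoly Q) xs" for Q :: "'i \<Rightarrow> complex"
    using xs by (auto simp: eval_restrict)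
  then have "(\<lambda>Q. restrict Q I) ` {Q \<in> pts (van I Z). eval_mpoly Q p \<noteq> 0 \<and> map (eval_mpoly Q) xs = v}
     \<subseteq> {Q \<in> X. eval_mpoly Q p \<noteq> 0 \<and> map (eval_mpoly Q) xs = v}"
    using pts_van_restrict[OF cl(1)] cl(2) eval_restrict[OF p] by auto
  then show "finite ((\<lambda>Q. restrict Q I) ` {Q \<in> pts (van I Z). eval_mpoly Q p \<noteq> 0 \<and> map (eval_mpoly Q) xs = v})"
    using fin by (rule finite_subset)
  show "inj_on (\<lambda>Q. restrict Q I) {Q \<in> pts (van I Z). eval_mpoly Q p \<noteq> 0 \<and> map (eval_mpoly Q) xs = v}"
    by (rule inj_onI) (metis (no_types, lifting) ext0_restrict mem_Collect_eq pts_van_zero)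
qed

text \<open>Vanishing ideals turn the chain into a descending chain of primes, and thus into
  \<open>m\<close> functions independent on \<open>Z m\<close>; finite fibres of \<open>xs\<close>
  bound their number. In the extreme case \<open>xs\<close> is independent on \<open>Z m\<close>,
  that is, \<open>Z m\<close> dominates affine space.\<close>

theorem chain_length_le_of_finite_fibres:
  fixes X :: "('i \<Rightarrow> complex) set"
  assumes I: "finite I"
    and Z: "\<And>j. j \<le> m \<Longrightarrow> closedin (zariski I) (Z j) \<and> irreducible_in (zariski I) (Z j)"
      "\<And>j. j < m \<Longrightarrow> Z j \<subset> Z (Suc j)" "Z m \<subseteq> X"
    and p: "p \<in> mpolys I" "Q0 \<in> Z m" "eval_mpoly Q0 p \<noteq> 0" and xs: "set xs \<subseteq> mpolys I"
    and fin: "\<And>v. finite {Q \<in> X. eval_mpoly Q p \<noteq> 0 \<and> map (eval_mpoly Q) xs = v}"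
  shows "m \<le> length xs \<and> (m = length xs \<longrightarrow> alg_indep (van I (Z m)) xs)"
proof -
  have sub: "Z j \<subseteq> affine_space I" if "j \<le> m" for j
    using Z(1)[OF that] by (simp add: irreducible_in_def topspace_zariski)
  have dec: "van I (Z (Suc j)) \<subset> van I (Z j)" if "j < m" for j
  proof
    show "van I (Z (Suc j)) \<subseteq> van I (Z j)" using Z(2)[OF that] by (intro van_antimono) auto
    show "van I (Z (Suc j)) \<noteq> van I (Z j)"
      using van_subsetD[of I "Z j" "Z (Suc j)"] Z(1)[of j] Z(2)[OF that] sub[of "Suc j"] that by auto
  qed
  have pr: "prime_idl (van I (Z j))" if "j \<le> m" for j
    using Z(1)[OF that] by (intro prime_van) simp
  obtain fs where fs: "length fs = m" "set fs \<subseteq> mpolys I" "alg_indep (van I (Z m)) fs"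
    using chain_alg_indep[of m "\<lambda>j. van I (Z j)" I, OF pr var_van dec] by auto
  have "p \<notin> van I (Z m)" using p by (auto simp: van_def eval_ext0_mpolys)
  from alg_indep_of_finite_fibres[OF I pr[OF le_refl] var_van this fs(3,2) finite_pts_fibre[OF _ Z(3) p(1) xs fin]]
  show ?thesis using Z(1)[of m] fs(1) by simp
qed

text \<open>The function \<open>q Z\<close> vanishes on all other members of \<open>\<Z>\<close> but
  not on \<open>Z\<close>. In a common fibre of \<open>xs\<close> each member has a point where its
  own \<open>q Z\<close> is nonzero; these points are pairwise distinct, so the size of one fibre
  bounds the number of members.\<close>

theorem card_components_le_of_fibres:
  fixes X :: "('i \<Rightarrow> complex) set"
  assumes I: "finite I" and \<Z>: "finite \<Z>"
    and Z: "\<And>Z. Z \<in> \<Z> \<Longrightarrow> closedin (zariski I) Z \<and> irreducible_in (zariski I) Z \<and> Z \<subseteq> X"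
      "\<And>Z Z'. Z \<in> \<Z> \<Longrightarrow> Z' \<in> \<Z> \<Longrightarrow> Z \<subseteq> Z' \<Longrightarrow> Z = Z'"
      "\<And>Z. Z \<in> \<Z> \<Longrightarrow> alg_indep (van I Z) xs"
    and p: "p \<in> mpolys I" "\<And>Z. Z \<in> \<Z> \<Longrightarrow> \<exists>Q\<in>Z. eval_mpoly Q p \<noteq> 0" and xs: "set xs \<subseteq> mpolys I"
    and fin: "\<And>v. finite {Q \<in> X. eval_mpoly Q p \<noteq> 0 \<and> map (eval_mpoly Q) xs = v}"
      "\<And>v. card {Q \<in> X. eval_mpoly Q p \<noteq> 0 \<and> map (eval_mpoly Q) xs = v} \<le> M"
  shows "card \<Z> \<le> M"
proof (cases "\<Z> = {}")
  case False
  then obtain Z0 where Z0: "Z0 \<in> \<Z>" by blast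
  obtain f where f: "bij_betw f {0..<card \<Z>} \<Z>" using ex_bij_betw_nat_finite[OF \<Z>] by blast
  \<comment> \<open>\<open>common_fibre\<close> takes ideals indexed by all natural numbers, so the
    enumeration of \<open>\<Z>\<close> is continued by an arbitrary member.\<close>
  define g where "g = (\<lambda>n. if n < card \<Z> then f n else Z0)"
  have g: "g n \<in> \<Z>" for n using f Z0 by (auto simp: g_def bij_betw_def)
  have pr: "prime_idl (van I Z)" if "Z \<in> \<Z>" for Z using Z(1)[OF that] by (intro prime_van) simp
  have "\<exists>h. h \<in> van I Z' \<and> h \<notin> van I Z" if ZZ: "Z \<in> \<Z>" "Z' \<in> \<Z>" "Z \<noteq> Z'" for Z Z'
  proof -
    have "Z \<subseteq> affine_space I" using Z(1)[OF ZZ(1)] by (simp add: irreducible_in_def topspace_zariski)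
    then have "\<not> van I Z' \<subseteq> van I Z" using van_subsetD[of I Z' Z] Z(1)[OF ZZ(2)] Z(2)[OF ZZ(1,2)] ZZ(3) by auto
    then show ?thesis by blast
  qed
  then obtain h where h: "\<And>Z Z'. Z \<in> \<Z> \<Longrightarrow> Z' \<in> \<Z> \<Longrightarrow> Z \<noteq> Z' \<Longrightarrow> h Z Z' \<in> van I Z'"
    "\<And>Z Z'. Z \<in> \<Z> \<Longrightarrow> Z' \<in> \<Z> \<Longrightarrow> Z \<noteq> Z' \<Longrightarrow> h Z Z' \<notin> van I Z" by metis
  define q where "q = (\<lambda>Z. p * (\<Prod>Z'\<in>\<Z> - {Z}. h Z Z'))"
  have "q Z \<notin> van I Z" if ZZ: "Z \<in> \<Z>" for Z
  proof -
    have "p \<notin> van I Z" using p ZZ by (auto simp: van_def eval_ext0_mpolys)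
    moreover have "(\<Prod>Z'\<in>\<Z> - {Z}. h Z Z') \<notin> van I Z"
      using h(2)[OF ZZ] \<Z> by (intro prime_idl_prod pr ZZ) auto
    ultimately show ?thesis by (simp add: q_def prime_idl_mult[OF pr[OF ZZ]])
  qed
  then have "\<exists>v Q. \<forall>n. Q n \<in> pts (van I (g n)) \<and> eval_mpoly (Q n) (q (g n)) \<noteq> 0 \<and> map (eval_mpoly (Q n)) xs = v"
    using g by (intro common_fibre[OF I]) (auto simp: pr var_van Z(3))
  then obtain v Q where Q: "\<And>n. Q n \<in> pts (van I (g n))" "\<And>n. eval_mpoly (Q n) (q (g n)) \<noteq> 0"
    "\<And>n. map (eval_mpoly (Q n)) xs = v" by blast
  let ?F = "{Q \<in> X. eval_mpoly Q p \<noteq> 0 \<and> map (eval_mpoly Q) xs = v}"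
  have inj: "inj_on (\<lambda>n. restrict (Q n) I) {0..<card \<Z>}"
  proof (rule inj_onI, rule ccontr)
    fix m n assume mn: "m \<in> {0..<card \<Z>}" "n \<in> {0..<card \<Z>}" "restrict (Q m) I = restrict (Q n) I" "m \<noteq> n"
    then have ne: "g m \<noteq> g n" using f by (auto simp: g_def bij_betw_def inj_on_def)
    have "Q m = Q n" using mn(3) pts_van_zero[OF Q(1)] by (metis ext0_restrict)
    moreover have "eval_mpoly (Q n) (h (g m) (g n)) = 0" using Q(1)[of n] h(1)[OF g g ne] by (simp add: ptsD)
    ultimately have "eval_mpoly (Q m) (q (g m)) = 0"
      using \<Z> g[of n] ne by (auto simp: q_def eval_mpoly_mult eval_prod)
    then show False using Q(2) by blast
  qed
  have "restrict (Q n) I \<in> ?F" for n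
  proof -
    have "restrict (Q n) I \<in> g n" using Z(1)[OF g] Q(1) by (intro pts_van_restrict) auto
    then have "restrict (Q n) I \<in> X" using Z(1)[OF g] by blast
    moreover have "eval_mpoly (restrict (Q n) I) p \<noteq> 0"
      using Q(2)[of n] by (auto simp: eval_restrict[OF p(1)] q_def eval_mpoly_mult)
    moreover have "map (eval_mpoly (restrict (Q n) I)) xs = map (eval_mpoly (Q n)) xs"
      using xs by (auto simp: eval_restrict)
    ultimately show ?thesis using Q(3) by simp
  qed
  then have "card {0..<card \<Z>} \<le> card ?F" using inj fin(1) by (intro card_inj_on_le) auto
  also have "\<dots> \<le> M" by (rule fin(2))
  finally show ?thesis by simp
qed simp

section \<open>Hensel's lemma\<close>

definition rhom :: "('a::comm_ring_1 \<Rightarrow> 'b::comm_ring_1) \<Rightarrow> bool" where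
  "rhom h \<longleftrightarrow> h 0 = 0 \<and> h 1 = 1 \<and> (\<forall>a b. h (a + b) = h a + h b) \<and> (\<forall>a b. h (a * b) = h a * h b)"

lemma rhom_0: "rhom h \<Longrightarrow> h 0 = 0" and rhom_1: "rhom h \<Longrightarrow> h 1 = 1"
  and rhom_add: "rhom h \<Longrightarrow> h (a + b) = h a + h b" and rhom_mult: "rhom h \<Longrightarrow> h (a * b) = h a * h b"
  by (simp_all add: rhom_def)

lemma rhom_diff: assumes "rhom h" shows "h (a - b) = h a - h b"
  using rhom_add[OF assms, of "a - b" b] by simp

lemma rhom_power: "rhom h \<Longrightarrow> h (a ^ n) = h a ^ n"
  by (induction n) (auto simp: rhom_1 rhom_mult)

lemma rhom_sum: "rhom h \<Longrightarrow> h (sum f A) = (\<Sum>a\<in>A. h (f a))"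
  by (induction A rule: infinite_finite_induct) (auto simp: rhom_0 rhom_add)

lemma rhom_prod: "rhom h \<Longrightarrow> h (prod f A) = (\<Prod>a\<in>A. h (f a))"
  by (induction A rule: infinite_finite_induct) (auto simp: rhom_1 rhom_mult)

lemma rhom_of_nat: "rhom h \<Longrightarrow> h (of_nat n) = of_nat n"
  by (induction n) (auto simp: rhom_0 rhom_1 rhom_add)

lemma rhom_dvd: "rhom h \<Longrightarrow> a dvd b \<Longrightarrow> h a dvd h b"
  by (auto simp: dvd_def rhom_mult)

lemma rhom_eval_monom: "rhom h \<Longrightarrow> h (eval_monom Y m) = eval_monom (\<lambda>i. h (Y i)) m"
  by (simp add: eval_monom_def rhom_prod rhom_power)

text \<open>Iterating this construction evaluates polynomials whose coefficients are again
  polynomials, as they occur for the tower of \<open>t\<close>, \<open>x\<close> and a further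
  coordinate.\<close>

definition hev :: "('a::comm_ring_1 \<Rightarrow> 'b::comm_ring_1) \<Rightarrow> 'b \<Rightarrow> 'a poly \<Rightarrow> 'b" where
  "hev h v p = poly (map_poly h p) v"

lemma hev_0 [simp]: "hev h v 0 = 0"
  by (simp add: hev_def)

lemma hev_pCons: "rhom h \<Longrightarrow> hev h v (pCons a p) = h a + v * hev h v p"
  by (simp add: hev_def map_poly_pCons rhom_0)

lemma hev_add: assumes "rhom h" shows "hev h v (p + q) = hev h v p + hev h v q"
proof -
  have "map_poly h (p + q) = map_poly h p + map_poly h q"
    using assms by (intro poly_eqI) (simp add: coeff_map_poly rhom_0 rhom_add)
  then show ?thesis by (simp add: hev_def)
qed

lemma hev_smult: assumes "rhom h" shows "hev h v (smult a p) = h a * hev h v p"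
  using assms by (induction p) (simp_all add: hev_pCons rhom_mult algebra_simps)

lemma rhom_hev: assumes h: "rhom h" shows "rhom (hev h v)"
proof -
  have "hev h v (p * q) = hev h v p * hev h v q" for p q
    by (induction p) (simp_all add: h hev_pCons hev_add hev_smult rhom_0 algebra_simps)
  moreover have "hev h v 1 = 1" using h by (simp add: one_pCons hev_pCons rhom_1)
  ultimately show ?thesis using hev_add[OF h] by (simp add: rhom_def)
qed

lemma hev_const: "rhom h \<Longrightarrow> hev h v [:a:] = h a"
  by (simp add: hev_pCons)

lemma rhom_hev_comp: "rhom g \<Longrightarrow> rhom h \<Longrightarrow> g (hev h v p) = hev (\<lambda>a. g (h a)) (g v) p"
  by (induction p) (simp_all add: rhom_0 rhom_add rhom_mult hev_pCons, subst hev_pCons, auto simp: rhom_def)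

lemma pderiv_map_poly:
  fixes h :: "'a::idom \<Rightarrow> 'b::idom"
  assumes "rhom h" shows "pderiv (map_poly h p) = map_poly h (pderiv p)"
proof (rule poly_eqI)
  fix n
  have "h (of_nat (Suc n) * coeff p (Suc n)) = of_nat (Suc n) * h (coeff p (Suc n))"
    by (simp only: rhom_mult[OF assms] rhom_of_nat[OF assms])
  then show "coeff (pderiv (map_poly h p)) n = coeff (map_poly h (pderiv p)) n"
    using assms by (simp only: coeff_pderiv coeff_map_poly rhom_0)
qed

lemma poly_taylor2:
  fixes F :: "'r::idom poly"
  shows "\<exists>r. poly F (y + h) = poly F y + h * poly (pderiv F) y + h ^ 2 * r"
proof (induction F)
  case (pCons a F)
  then obtain r where r: "poly F (y + h) = poly F y + h * poly (pderiv F) y + h ^ 2 * r" by blast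
  have "poly (pCons a F) (y + h) = a + (y + h) * (poly F y + h * poly (pderiv F) y + h ^ 2 * r)"
    by (simp only: poly_pCons r)
  also have "\<dots> = poly (pCons a F) y + h * poly (pderiv (pCons a F)) y
      + h ^ 2 * (poly (pderiv F) y + y * r + h * r)"
    by (simp add: pderiv_pCons algebra_simps power2_eq_square)
  finally have "poly (pCons a F) (y + h) = poly (pCons a F) y + h * poly (pderiv (pCons a F)) y
      + h ^ 2 * (poly (pderiv F) y + y * r + h * r)" .
  then show ?case by blast
qed simp

lemma dvd_poly_diff: fixes F :: "'r::comm_ring_1 poly" assumes "t dvd y - z" shows "t dvd poly F y - poly F z"
proof (induction F)
  case (pCons a F)
  have "poly (pCons a F) y - poly (pCons a F) z = (y - z) * poly F y + z * (poly F y - poly F z)"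
    by (simp add: algebra_simps)
  then show ?case using assms pCons by (metis dvd_add dvd_mult dvd_mult2)
qed simp

text \<open>The correction \<open>c * F(y)\<close> uses one fixed inverse \<open>c\<close> of the
  derivative modulo \<open>t\<close>. No division occurs, and the iterates stay in any set
  \<open>S\<close> closed under subtraction, multiplication and \<open>F\<close>; here
  \<open>S\<close> will carry the weight condition. A root modulo \<open>t ^ m\<close> is enough,
  which keeps everything polynomial.\<close>

lemma hensel_exists:
  fixes F :: "'r::idom poly"
  assumes F0: "t dvd poly F y0" "t dvd poly (pderiv F) y0 * c - 1"
    and S: "\<And>a b. a \<in> S \<Longrightarrow> b \<in> S \<Longrightarrow> a - b \<in> S \<and> a * b \<in> S" "y0 \<in> S" "c \<in> S"
      "\<And>y. y \<in> S \<Longrightarrow> poly F y \<in> S"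
  shows "\<exists>y\<in>S. t ^ m dvd poly F y \<and> t dvd y - y0"
proof (induction m)
  case 0
  show ?case using S by (intro bexI[of _ y0]) auto
next
  case (Suc m)
  show ?case
  proof (cases "m = 0")
    case True
    then show ?thesis using S F0 by (intro bexI[of _ y0]) auto
  next
    case False
    from Suc obtain y where y: "y \<in> S" "t ^ m dvd poly F y" "t dvd y - y0" by blast
    define y' where "y' = y - c * poly F y"
    obtain r where r: "poly F (y + - (c * poly F y)) =
        poly F y + - (c * poly F y) * poly (pderiv F) y + (- (c * poly F y)) ^ 2 * r"
      using poly_taylor2 by blast
    have "t dvd poly (pderiv F) y - poly (pderiv F) y0" by (rule dvd_poly_diff[OF y(3)])
    then have "t dvd (poly (pderiv F) y - poly (pderiv F) y0) * c + (poly (pderiv F) y0 * c - 1)"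
      using F0(2) by (intro dvd_add dvd_mult2)
    then have *: "t dvd poly (pderiv F) y * c - 1" by (simp add: algebra_simps)
    have eq: "poly F y' = - (poly F y * (poly (pderiv F) y * c - 1)) + poly F y * (poly F y * (c ^ 2 * r))"
      using r by (simp add: y'_def algebra_simps power2_eq_square)
    have t: "t dvd poly F y" using y(2) False by (meson dvd_power dvd_trans not_gr_zero)
    have "t ^ Suc m dvd poly F y'"
      unfolding eq power_Suc2 using y(2) * t by (intro dvd_add dvd_minus_iff[THEN iffD2] mult_dvd_mono) auto
    moreover have "t dvd y' - y0" using dvd_diff[OF y(3), of "c * poly F y"] t by (simp add: y'_def algebra_simps)
    moreover have "y' \<in> S" using S y(1) by (simp add: y'_def)
    ultimately show ?thesis by blast
  qed
qed

text \<open>An element invertible modulo \<open>t\<close> is invertible modulo \<open>t ^ m\<close>: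
  the power \<open>(1 - g * c) ^ m\<close> is divisible by \<open>t ^ m\<close> and has the form
  \<open>1 - g * e\<close>.\<close>

lemma dvd_cancel_unit_mod:
  fixes t :: "'r::comm_ring_1"
  assumes "t dvd g * c - 1" "t ^ m dvd h * g" shows "t ^ m dvd h"
proof -
  have "\<exists>e. (1 - g * c) ^ m = 1 - g * e"
  proof (induction m)
    case (Suc m)
    then obtain e where "(1 - g * c) ^ m = 1 - g * e" by blast
    then have "(1 - g * c) ^ Suc m = (1 - g * c) * (1 - g * e)" by simp
    also have "\<dots> = 1 - g * (e + c - c * g * e)" by (simp add: algebra_simps)
    finally have "(1 - g * c) ^ Suc m = 1 - g * (e + c - c * g * e)" .
    then show ?case by blast
  qed (auto intro: exI[of _ 0])
  then obtain e where e: "(1 - g * c) ^ m = 1 - g * e" by blast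
  have "t dvd 1 - g * c" using assms(1) by (metis dvd_minus_iff minus_diff_eq)
  then have "t ^ m dvd (1 - g * c) ^ m" by (rule dvd_power_same)
  then have "t ^ m dvd h * (1 - g * c) ^ m + (h * g) * e" using assms(2) by (intro dvd_add dvd_mult[of _ "(1 - g * c) ^ m"] dvd_mult2[of _ "h * g"])
  moreover have "h * (1 - g * c) ^ m + (h * g) * e = h"
    by (simp only: e) (simp add: algebra_simps)
  ultimately show ?thesis by simp
qed

text \<open>By Taylor expansion \<open>F(y) + (z - y) * u = 0\<close>, where \<open>u\<close> agrees
  with the derivative at \<open>y\<close> modulo \<open>t\<close> and so can be cancelled.\<close>

lemma hensel_unique:
  fixes F :: "'r::idom poly"
  assumes "t ^ m dvd poly F y" "poly F z = 0" "t dvd z - y" "t dvd poly (pderiv F) y * c - 1"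
  shows "t ^ m dvd z - y"
proof -
  obtain r where r: "poly F (y + (z - y)) = poly F y + (z - y) * poly (pderiv F) y + (z - y) ^ 2 * r"
    using poly_taylor2 by blast
  then have "(z - y) * (poly (pderiv F) y + (z - y) * r) = - poly F y"
    using assms(2) by (simp add: algebra_simps power2_eq_square)
  then have "t ^ m dvd (z - y) * (poly (pderiv F) y + (z - y) * r)" using assms(1) by simp
  moreover have "t dvd (poly (pderiv F) y * c - 1) + (z - y) * (r * c)"
    using assms by (intro dvd_add dvd_mult2)
  then have "t dvd (poly (pderiv F) y + (z - y) * r) * c - 1" by (simp add: algebra_simps)
  ultimately show ?thesis using dvd_cancel_unit_mod by blast
qed

lemma dvd_diff_mult:
  fixes N :: "'r::comm_ring_1"
  assumes "N dvd a - b" "N dvd c - d" shows "N dvd a * c - b * d"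
proof -
  have "a * c - b * d = (a - b) * c + b * (c - d)" by (simp add: algebra_simps)
  then show ?thesis using assms by (metis dvd_add dvd_mult dvd_mult2)
qed

lemma dvd_diff_power: fixes N :: "'r::comm_ring_1" shows "N dvd a - b \<Longrightarrow> N dvd a ^ e - b ^ e"
  by (induction e) (auto intro: dvd_diff_mult)

lemma dvd_diff_eval_monom:
  fixes N :: "'r::comm_ring_1"
  assumes "\<And>i. i \<in> Poly_Mapping.keys m \<Longrightarrow> N dvd Y i - Z i"
  shows "N dvd eval_monom Y m - eval_monom Z m"
proof -
  have "N dvd (\<Prod>i\<in>A. Y i ^ Poly_Mapping.lookup m i) - (\<Prod>i\<in>A. Z i ^ Poly_Mapping.lookup m i)"
    if "finite A" "A \<subseteq> Poly_Mapping.keys m" for A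
    using that
  proof (induction A rule: finite_induct)
    case (insert i A)
    then show ?case using assms by (auto intro!: dvd_diff_mult dvd_diff_power)
  qed simp
  then show ?thesis by (simp add: eval_monom_def)
qed

lemma degree_eval_monom:
  fixes Y :: "'i \<Rightarrow> 'a::idom poly"
  assumes "\<And>i. i \<in> Poly_Mapping.keys m \<Longrightarrow> degree (Y i) \<le> b"
  shows "degree (eval_monom Y m) \<le> b * mdeg m"
proof -
  have "degree (\<Prod>i\<in>A. Y i ^ Poly_Mapping.lookup m i) \<le> b * (\<Sum>i\<in>A. Poly_Mapping.lookup m i)"
    if "finite A" "A \<subseteq> Poly_Mapping.keys m" for A
    using that
  proof (induction A rule: finite_induct)
    case (insert i A)
    have "degree (Y i ^ Poly_Mapping.lookup m i) \<le> b * Poly_Mapping.lookup m i"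
      using insert.prems assms[of i] degree_power_le[of "Y i" "Poly_Mapping.lookup m i"]
      by (meson insertI1 le_trans mult_le_mono1 subsetD)
    then show ?case
      using insert degree_mult_le[of "Y i ^ Poly_Mapping.lookup m i" "\<Prod>i\<in>A. Y i ^ Poly_Mapping.lookup m i"]
      by (simp add: algebra_simps)
  qed simp
  then show ?thesis by (simp add: eval_monom_def mdeg_def)
qed

section \<open>Fibres of the jet map\<close>

text \<open>What is used of a curve \<open>C\<close> of degree \<open>d\<close> with set \<open>S\<close> of polynomial points: \<open>xc\<close> is the form \<open>x\<close>
  above, the monomials \<open>w\<close> are a basis of the function field over \<open>K(x)\<close>, with multiplication table
  \<open>s / q\<close>, the polynomial \<open>f i\<close> over \<open>\<complex>[t][x]\<close> annihilates the \<open>i\<close>-th coordinate, \<open>\<Theta>\<close> vanishes where the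
  projection may fail to be smooth, and the last assumption is Bezout's bound.\<close>

locale curve_points =
  fixes n d :: nat and lam :: "nat \<Rightarrow> complex" and w :: "nat \<Rightarrow> (nat \<Rightarrow>\<^sub>0 nat)"
    and f :: "nat \<Rightarrow> complex poly poly poly" and q :: "complex poly poly"
    and s :: "nat \<Rightarrow> nat \<Rightarrow> nat \<Rightarrow> complex poly poly" and S :: "(nat \<Rightarrow> complex poly) set"
    and xc :: "(nat \<Rightarrow> complex poly) \<Rightarrow> complex poly"
    and fx :: "nat \<Rightarrow> complex poly \<Rightarrow> complex poly poly"
    and \<Theta> :: "(nat \<Rightarrow> complex poly) \<Rightarrow> complex poly"
  assumes d: "1 \<le> d"
    and w: "\<And>j. j < d \<Longrightarrow> Poly_Mapping.keys (w j) \<subseteq> {..<n} \<and> mdeg (w j) \<le> j" "w 0 = 0"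
    and S: "S \<subseteq> {..<n} \<rightarrow>\<^sub>E UNIV"
    and xc_def: "\<And>Q. xc Q = (\<Sum>i<n. smult (lam i) (Q i))"
    and fx_def: "\<And>i X. fx i X = map_poly (\<lambda>a. poly a X) (f i)"
    and \<Theta>_def: "\<And>Q. \<Theta> Q = poly q (xc Q) * (\<Prod>i<n. poly (pderiv (fx i (xc Q))) (Q i))"
    and root: "\<And>Q i. Q \<in> S \<Longrightarrow> i < n \<Longrightarrow> poly (fx i (xc Q)) (Q i) = 0"
    and table: "\<And>Q i l. Q \<in> S \<Longrightarrow> i < n \<Longrightarrow> l < d \<Longrightarrow>
      poly q (xc Q) * Q i * eval_monom Q (w l) = (\<Sum>m<d. poly (s i l m) (xc Q) * eval_monom Q (w m))"
    and zeros: "\<And>D p. d \<le> D \<Longrightarrow> (\<exists>j<d. \<exists>i. i + j \<le> D \<and> p i j \<noteq> 0) \<Longrightarrow>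
      finite {Q \<in> S. (\<Sum>j<d. \<Sum>i\<le>D - j. p i j * xc Q ^ i * eval_monom Q (w j)) = 0} \<and>
      card {Q \<in> S. (\<Sum>j<d. \<Sum>i\<le>D - j. p i j * xc Q ^ i * eval_monom Q (w j)) = 0} \<le> d * D"
begin

definition residue :: "complex \<Rightarrow> (nat \<Rightarrow> complex poly) \<Rightarrow> nat \<Rightarrow> complex" where
  "residue t0 Q = (\<lambda>i\<in>{..<n}. poly (Q i) t0)"

text \<open>Functions on \<open>S\<close> that lie in the span of the basis monomials once powers of
  \<open>q\<close> are allowed as denominators. Products of linear factors in the coordinates are
  shown to be of this kind by the multiplication table.\<close>

definition reducible :: "((nat \<Rightarrow> complex poly) \<Rightarrow> complex poly) \<Rightarrow> bool" where
  "reducible g \<longleftrightarrow> (\<exists>N r. \<forall>Q\<in>S. poly q (xc Q) ^ N * g Q = (\<Sum>l<d. poly (r l) (xc Q) * eval_monom Q (w l)))"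

lemma reducible_one: "reducible (\<lambda>_. 1)"
proof -
  have "poly q (xc Q) ^ 0 * 1 = (\<Sum>l<d. poly (if l = 0 then 1 else 0) (xc Q) * eval_monom Q (w l))" for Q
  proof -
    have "(\<Sum>l<d. poly (if l = 0 then 1 else 0) (xc Q) * eval_monom Q (w l)) =
        (\<Sum>l<d. if l = 0 then eval_monom Q (w l) else 0)" by (rule sum.cong) auto
    also have "\<dots> = 1" using d w(2) by (simp add: eval_monom_def)
    finally show ?thesis by simp
  qed
  then show ?thesis unfolding reducible_def
    by (intro exI[of _ 0] exI[of _ "\<lambda>l. if l = 0 then 1 else 0"] ballI)
qed

lemma reducible_linear_mult:
  assumes g: "reducible g" and i: "i < n"
  shows "reducible (\<lambda>Q. (Q i - [:c:]) * g Q)"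
proof -
  obtain N r where r: "\<And>Q. Q \<in> S \<Longrightarrow>
      poly q (xc Q) ^ N * g Q = (\<Sum>l<d. poly (r l) (xc Q) * eval_monom Q (w l))"
    using g unfolding reducible_def by blast
  define r' where "r' = (\<lambda>m. (\<Sum>l<d. r l * s i l m) - [:[:c:]:] * q * r m)"
  have "poly q (xc Q) ^ Suc N * ((Q i - [:c:]) * g Q) = (\<Sum>m<d. poly (r' m) (xc Q) * eval_monom Q (w m))"
    if Q: "Q \<in> S" for Q
  proof -
    have "poly q (xc Q) ^ Suc N * ((Q i - [:c:]) * g Q) =
        (poly q (xc Q) * Q i) * (poly q (xc Q) ^ N * g Q) - [:c:] * poly q (xc Q) * (poly q (xc Q) ^ N * g Q)"
      by (simp add: algebra_simps)
    also have "(poly q (xc Q) * Q i) * (poly q (xc Q) ^ N * g Q) =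
        (\<Sum>l<d. poly (r l) (xc Q) * (poly q (xc Q) * Q i * eval_monom Q (w l)))"
      unfolding r[OF Q] sum_distrib_left by (simp add: mult_ac)
    also have "\<dots> = (\<Sum>l<d. poly (r l) (xc Q) * (\<Sum>m<d. poly (s i l m) (xc Q) * eval_monom Q (w m)))"
      using table[OF Q i] by simp
    also have "\<dots> = (\<Sum>m<d. (\<Sum>l<d. poly (r l) (xc Q) * poly (s i l m) (xc Q)) * eval_monom Q (w m))"
      unfolding sum_distrib_left sum_distrib_right by (subst sum.swap) (simp add: mult_ac)
    also have "[:c:] * poly q (xc Q) * (poly q (xc Q) ^ N * g Q) =
        (\<Sum>m<d. [:c:] * poly q (xc Q) * poly (r m) (xc Q) * eval_monom Q (w m))"
      unfolding r[OF Q] sum_distrib_left by (simp add: mult_ac)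
    finally show ?thesis
      by (simp add: r'_def poly_sum sum_subtractf left_diff_distrib)
  qed
  then show ?thesis unfolding reducible_def by blast
qed

lemma reducible_prod:
  assumes "finite A" "\<And>a. a \<in> A \<Longrightarrow> i a < n"
  shows "reducible (\<lambda>Q. \<Prod>a\<in>A. Q (i a) - [:c a:])"
  using assms
proof (induction A rule: finite_induct)
  case (insert a A)
  then show ?case using reducible_linear_mult[of _ "i a" "c a"] by simp
qed (simp add: reducible_one)

lemma rhom_eval_at: "rhom (\<lambda>p. poly p (t0 :: 'a::comm_ring_1))"
  by (simp add: rhom_def)

lemma poly_poly_eq: "poly (poly a X) t0 = hev (\<lambda>p. poly p t0) (poly X t0) (a :: complex poly poly)"
  by (induction a) (simp_all add: hev_pCons rhom_eval_at)

text \<open>At \<open>t0\<close> and \<open>x0\<close> a reducible function is determined by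
  \<open>d\<close> complex coefficients, since \<open>q\<close> does not vanish there. For
  \<open>d + 1\<close> residues choose functions \<open>e\<close>, each nonzero at exactly one of
  them. Their coefficient vectors are dependent, and evaluating the dependence at the residues one
  by one makes all its coefficients zero.\<close>

lemma card_residue_le:
  assumes T: "T \<subseteq> S" "\<And>Q. Q \<in> T \<Longrightarrow> poly (xc Q) t0 = x0" "\<And>Q. Q \<in> T \<Longrightarrow> poly (poly q (xc Q)) t0 \<noteq> 0"
  shows "finite (residue t0 ` T) \<and> card (residue t0 ` T) \<le> d"
proof (rule ccontr)
  assume "\<not> ?thesis"
  then obtain R where R: "R \<subseteq> residue t0 ` T" "finite R" "card R = Suc d"
    by (metis infinite_arbitrarily_large not_less_eq_eq obtain_subset_with_card_n)
  then have "\<forall>\<eta>\<in>R. \<exists>Q. Q \<in> T \<and> residue t0 Q = \<eta>" by blast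
  then obtain P where P: "\<And>\<eta>. \<eta> \<in> R \<Longrightarrow> P \<eta> \<in> T" "\<And>\<eta>. \<eta> \<in> R \<Longrightarrow> residue t0 (P \<eta>) = \<eta>" by metis
  have "\<exists>i. i < n \<and> \<eta> i \<noteq> \<eta>' i" if "\<eta> \<in> R" "\<eta>' \<in> R" "\<eta> \<noteq> \<eta>'" for \<eta> \<eta>'
  proof (rule ccontr)
    assume "\<not> ?thesis"
    then have "residue t0 (P \<eta>) = residue t0 (P \<eta>')"
      using P(2)[OF that(1)] P(2)[OF that(2)] unfolding residue_def by (metis (mono_tags, lifting) lessThan_iff restrict_apply' restrict_ext)
    then show False using P(2) that by metis
  qed
  then obtain ix where ix: "\<And>\<eta> \<eta>'. \<eta> \<in> R \<Longrightarrow> \<eta>' \<in> R \<Longrightarrow> \<eta> \<noteq> \<eta>' \<Longrightarrow> ix \<eta> \<eta>' < n \<and> \<eta> (ix \<eta> \<eta>') \<noteq> \<eta>' (ix \<eta> \<eta>')"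
    by metis
  define e where "e = (\<lambda>\<eta> (Q :: nat \<Rightarrow> complex poly). \<Prod>\<eta>'\<in>R - {\<eta>}. Q (ix \<eta> \<eta>') - [:\<eta>' (ix \<eta> \<eta>'):])"
  have e_eval: "poly (e \<eta> (P \<eta>')) t0 = (\<Prod>\<eta>''\<in>R - {\<eta>}. \<eta>' (ix \<eta> \<eta>'') - \<eta>'' (ix \<eta> \<eta>''))"
    if "\<eta> \<in> R" "\<eta>' \<in> R" for \<eta> \<eta>'
    unfolding e_def poly_prod
  proof (rule prod.cong[OF refl])
    fix \<eta>'' assume a: "\<eta>'' \<in> R - {\<eta>}"
    then have "ix \<eta> \<eta>'' < n" using ix that by blast
    then have "poly (P \<eta>' (ix \<eta> \<eta>'')) t0 = \<eta>' (ix \<eta> \<eta>'')"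
      using P(2)[OF that(2)] unfolding residue_def by (metis lessThan_iff restrict_apply')
    then show "poly (P \<eta>' (ix \<eta> \<eta>'') - [:\<eta>'' (ix \<eta> \<eta>''):]) t0 = \<eta>' (ix \<eta> \<eta>'') - \<eta>'' (ix \<eta> \<eta>'')" by simp
  qed
  have "reducible (e \<eta>)" if "\<eta> \<in> R" for \<eta>
    unfolding e_def using that ix R(2) by (intro reducible_prod) auto
  then obtain N r where r: "\<And>\<eta> Q. \<eta> \<in> R \<Longrightarrow> Q \<in> S \<Longrightarrow>
      poly q (xc Q) ^ N \<eta> * e \<eta> Q = (\<Sum>l<d. poly (r \<eta> l) (xc Q) * eval_monom Q (w l))"
    unfolding reducible_def by metis
  define h where "h = hev (\<lambda>p. poly p t0) x0"
  have h: "poly (poly a (xc Q)) t0 = h a" if "Q \<in> T" for a Q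
    unfolding h_def using T(2)[OF that] by (simp add: poly_poly_eq)
  have "card {..<d} < card R" using R(3) by simp
  from homogeneous_system[OF _ R(2) this, of "\<lambda>l \<eta>. h (r \<eta> l)"] obtain c where
    c: "\<exists>\<eta>\<in>R. c \<eta> \<noteq> 0" "\<And>l. l < d \<Longrightarrow> (\<Sum>\<eta>\<in>R. h (r \<eta> l) * c \<eta>) = 0" by auto
  have cz: "c \<eta>' = 0" if \<eta>': "\<eta>' \<in> R" for \<eta>'
  proof -
    have PT: "P \<eta>' \<in> T" and PS: "P \<eta>' \<in> S" using P(1)[OF \<eta>'] T(1) by auto
    have "(\<Sum>\<eta>\<in>R. c \<eta> * (h q ^ N \<eta> * poly (e \<eta> (P \<eta>')) t0)) =
        (\<Sum>\<eta>\<in>R. c \<eta> * poly (poly q (xc (P \<eta>')) ^ N \<eta> * e \<eta> (P \<eta>')) t0)"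
      by (simp add: poly_power h[OF PT])
    also have "\<dots> = (\<Sum>\<eta>\<in>R. c \<eta> * (\<Sum>l<d. h (r \<eta> l) * poly (eval_monom (P \<eta>') (w l)) t0))"
      by (rule sum.cong) (simp_all add: r[OF _ PS] poly_sum h[OF PT])
    also have "\<dots> = (\<Sum>l<d. (\<Sum>\<eta>\<in>R. h (r \<eta> l) * c \<eta>) * poly (eval_monom (P \<eta>') (w l)) t0)"
      unfolding sum_distrib_left sum_distrib_right by (subst sum.swap) (simp add: mult_ac)
    finally have "(\<Sum>\<eta>\<in>R. c \<eta> * (h q ^ N \<eta> * poly (e \<eta> (P \<eta>')) t0)) = 0" by (simp add: c(2))
    moreover have "poly (e \<eta> (P \<eta>')) t0 = 0" if "\<eta> \<in> R - {\<eta>'}" for \<eta>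
      using that \<eta>' R(2) by (subst e_eval) (auto intro!: prod_zero)
    then have "(\<Sum>\<eta>\<in>R - {\<eta>'}. c \<eta> * (h q ^ N \<eta> * poly (e \<eta> (P \<eta>')) t0)) = 0" by simp
    ultimately have "c \<eta>' * (h q ^ N \<eta>' * poly (e \<eta>' (P \<eta>')) t0) = 0"
      by (simp add: sum.remove[OF R(2) \<eta>'])
    moreover have "h q \<noteq> 0" using T(3)[OF PT] h[OF PT] by simp
    moreover have "poly (e \<eta>' (P \<eta>')) t0 \<noteq> 0"
      using ix[OF \<eta>'] R(2) by (subst e_eval[OF \<eta>' \<eta>']) auto
    ultimately show ?thesis by simp
  qed
  then show False using c(1) by blast
qed

end

section \<open>The count of unknowns against equations\<close>

lemma sum_div_count:
  fixes k L :: nat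
  assumes "0 < k"
  shows "2 * (\<Sum>a<L * k. a div k + 1) = k * L * (L + 1)"
proof -
  have "(\<Sum>a<L * k. a div k + 1) = (\<Sum>m<L. \<Sum>a\<in>{m * k..<m * k + k}. a div k + 1)"
    by (rule sum.nat_group[symmetric])
  also have "\<dots> = (\<Sum>m<L. k * (m + 1))"
  proof (rule sum.cong[OF refl])
    fix m
    have "(\<Sum>a\<in>{m * k..<m * k + k}. a div k + 1) = (\<Sum>a\<in>{m * k..<m * k + k}. m + 1)"
    proof (rule sum.cong[OF refl])
      fix a assume "a \<in> {m * k..<m * k + k}"
      then have "a div k = m" using assms by (intro div_nat_eqI) (auto simp: mult.commute)
      then show "a div k + 1 = m + 1" by simp
    qed
    then show "(\<Sum>a\<in>{m * k..<m * k + k}. a div k + 1) = k * (m + 1)" by simp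
  qed
  finally have "(\<Sum>a<L * k. a div k + 1) = (\<Sum>m<L. k * (m + 1))" .
  moreover have "2 * (\<Sum>m<L. k * (m + 1)) = k * L * (L + 1)"
    by (induction L) (auto simp: algebra_simps)
  ultimately show ?thesis by simp
qed

lemma sum_weights_count:
  fixes N B D d :: nat
  assumes "B * D \<le> N" "d \<le> D"
  shows "2 * N * d * (D + 1) \<le> 2 * (\<Sum>j<d. \<Sum>i\<le>D - j. N - B * (i + j)) + N * d * (d - 1) + d * B * D * (D + 1)"
proof -
  have inner: "int (2 * (\<Sum>i\<le>D - j. N - B * (i + j))) \<ge> 2 * int N * (int D + 1 - int j) - int B * int D * (int D + 1)"
    if "j < d" for j
  proof -
    have jD: "j \<le> D" using that assms by simp
    define m where "m = D - j"
    have D: "int D = int m + int j" using jD by (simp add: m_def)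
    have "int (\<Sum>i\<le>m. N - B * (i + j)) = (\<Sum>i\<le>m. int N - int B * (int i + int j))"
    proof (simp only: of_nat_sum, rule sum.cong[OF refl])
      fix i assume "i \<in> {..m}"
      then have "B * (i + j) \<le> B * D" using D by (intro mult_le_mono2) simp
      then have "B * (i + j) \<le> N" using assms(1) by (rule le_trans)
      then show "int (N - B * (i + j)) = int N - int B * (int i + int j)"
        by (simp add: of_nat_diff del: mult_le_cancel1)
    qed
    also have "2 * (\<Sum>i\<le>m. int N - int B * (int i + int j)) = 2 * int N * (int m + 1) - int B * ((int m + 1) * (int m + 2 * int j))"
      by (induction m) (auto simp: algebra_simps)
    finally have "int (2 * (\<Sum>i\<le>m. N - B * (i + j))) = 2 * int N * (int m + 1) - int B * ((int m + 1) * (int m + 2 * int j))"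
      by simp
    \<comment> \<open>The right-hand side exceeds the left-hand side by
      \<open>j * (j - 1)\<close>.\<close>
    moreover have "(int m + 1) * (int m + 2 * int j) \<le> int D * (int D + 1)"
    proof -
      have "0 \<le> int j * (int j - 1)" by (cases j) auto
      then show ?thesis by (simp add: D algebra_simps)
    qed
    then have "int B * ((int m + 1) * (int m + 2 * int j)) \<le> int B * (int D * (int D + 1))"
      by (intro mult_left_mono) auto
    ultimately show ?thesis by (simp add: D m_def[symmetric] algebra_simps)
  qed
  have "(\<Sum>j<d. 2 * int N * (int D + 1 - int j) - int B * int D * (int D + 1)) \<le>
      (\<Sum>j<d. int (2 * (\<Sum>i\<le>D - j. N - B * (i + j))))"
    by (intro sum_mono inner) auto
  also have "\<dots> = int (2 * (\<Sum>j<d. \<Sum>i\<le>D - j. N - B * (i + j)))"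
    by (simp add: sum_distrib_left)
  also have "(\<Sum>j<d. 2 * int N * (int D + 1 - int j) - int B * int D * (int D + 1)) =
      2 * int N * int d * (int D + 1) - int N * int d * (int d - 1) - int d * (int B * int D * (int D + 1))"
    by (induction d) (auto simp: algebra_simps)
  finally have "int (2 * N * d * (D + 1)) \<le>
      int (2 * (\<Sum>j<d. \<Sum>i\<le>D - j. N - B * (i + j))) + int N * int d * (int d - 1) + int (d * B * D * (D + 1))"
    by (simp add: algebra_simps)
  also have "int N * int d * (int d - 1) = int (N * d * (d - 1))" by (cases d) (auto simp: algebra_simps)
  finally show ?thesis by (simp only: of_nat_add[symmetric] of_nat_le_iff)
qed

text \<open>The left-hand side counts the pairs \<open>(a, r)\<close> with
  \<open>a < k * (d * D)\<close> and \<open>k * r \<le> a\<close>. The hypothesis \<open>num\<close>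
  is the wanted inequality after doubling, inserting the lower bound for the unknowns and dividing
  by \<open>d * D\<close>.\<close>

lemma count_unknowns_gt_equations:
  fixes k d D B :: nat
  assumes k: "0 < k" and d: "1 \<le> d" "d \<le> D" and BD: "B * D \<le> k * (d * D)"
    and num: "k * (d * D + 1) + k * d * (d - 1) + B * (D + 1) < 2 * k * d * (D + 1)"
  shows "(\<Sum>a<k * (d * D). a div k + 1) < (\<Sum>j<d. \<Sum>i\<le>D - j. k * (d * D) - B * (i + j))"
proof -
  define N where "N = k * (d * D)"
  define A where "A = (\<Sum>j<d. \<Sum>i\<le>D - j. N - B * (i + j))"
  have "2 * N * d * (D + 1) \<le> 2 * A + N * d * (d - 1) + d * B * D * (D + 1)"
    unfolding A_def by (rule sum_weights_count) (use BD d in \<open>auto simp: N_def\<close>)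
  moreover have "(d * D) * (k * (d * D + 1) + k * d * (d - 1) + B * (D + 1)) < (d * D) * (2 * k * d * (D + 1))"
    using num d by simp
  then have "k * (d * D) * (d * D + 1) + N * d * (d - 1) + d * B * D * (D + 1) < 2 * N * d * (D + 1)"
    by (simp add: N_def algebra_simps)
  moreover have "2 * (\<Sum>a<k * (d * D). a div k + 1) = k * (d * D) * (d * D + 1)"
    using sum_div_count[OF k, of "d * D"] by (simp add: mult.commute mult.left_commute)
  ultimately show ?thesis unfolding A_def N_def by linarith
qed

text \<open>In \<open>num\<close> the terms with \<open>D\<close> leave
  \<open>D * (k * d - b + 1)\<close> on the right, where the second factor can be 1; the other terms
  leave less than \<open>k * d ^ 2\<close> on the left. With \<open>D = 2 * b * d\<close> the point
  is \<open>2 * b * (k * d - b + 1) \<ge> k * d\<close>. For \<open>k = 1\<close> this is concavity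
  in \<open>b\<close> between 1 and \<open>d\<close>; for \<open>k \<ge> 2\<close> it holds because
  \<open>k * d \<le> 2 * (k - 1) * d < 2 * b\<close>.\<close>

lemma numeric_choice:
  fixes b d k :: nat
  assumes b: "1 \<le> b" and d: "1 \<le> d" and k: "b \<le> k * d" "(k - 1) * d < b"
  defines "D \<equiv> 2 * b * d"
  shows "0 < k" "d \<le> D" "(b - 1) * D < k * (d * D)"
    "k * (d * D + 1) + k * d * (d - 1) + (b - 1) * (D + 1) < 2 * k * d * (D + 1)"
proof -
  show k0: "0 < k" using b k by (cases k) auto
  show "d \<le> D" using b d by (simp add: D_def)
  have Dpos: "0 < D" using b d by (simp add: D_def)
  have lt: "b - 1 < k * d" using b k by simp
  then have "(b - 1) * D < k * d * D" using Dpos by (rule mult_less_mono1)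
  then show "(b - 1) * D < k * (d * D)" by (simp add: mult.assoc)
  define K where "K = int k" define b' where "b' = int b" define d' where "d' = int d"
  have b1: "b' \<ge> 1" "d' \<ge> 1" "K \<ge> 1" "b' \<le> K * d'" using b d k0 k(1) by (auto simp: K_def b'_def d'_def simp flip: of_nat_mult)
  have key: "2 * b' * (K * d' - b' + 1) \<ge> K * d'"
  proof (cases "k = 1")
    case True
    then have "K = 1" by (simp add: K_def)
    have "(b' - 1) * (d' - b') \<ge> 0" using b1 \<open>K = 1\<close> by (intro mult_nonneg_nonneg) auto
    then have "b' * (d' - b' + 1) \<ge> d'" by (simp add: algebra_simps)
    moreover have "b' * (d' - b' + 1) \<ge> 0" using b1 \<open>K = 1\<close> by (intro mult_nonneg_nonneg) auto
    ultimately show ?thesis using \<open>K = 1\<close> by (simp add: algebra_simps)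
  next
    case False
    then obtain k' where k': "k = Suc (Suc k')" using k0 by (metis One_nat_def gr0_implies_Suc not0_implies_Suc)
    have "int ((k - 1) * d) < b'" using k(2) by (simp only: b'_def of_nat_less_iff)
    then have "(K - 1) * d' < b'" by (simp add: k' K_def d'_def algebra_simps)
    moreover have "K * d' \<le> 2 * ((K - 1) * d')"
    proof -
      have "0 \<le> (K - 2) * d'" using b1 by (intro mult_nonneg_nonneg) (auto simp: K_def k')
      then show ?thesis by (simp add: algebra_simps)
    qed
    ultimately have "K * d' \<le> 2 * b'" by linarith
    also have "\<dots> \<le> 2 * b' * (K * d' - b' + 1)" using b1 by simp
    finally show ?thesis .
  qed
  have "d' * (K * d') \<le> d' * (2 * b' * (K * d' - b' + 1))" using key b1 by (intro mult_left_mono) auto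
  then have 1: "K * d' * d' \<le> (2 * b' * d') * (K * d' - b' + 1)" by (simp add: algebra_simps)
  have 2: "K + b' - 1 < 3 * (K * d')"
  proof -
    have "K * 1 \<le> K * d'" using b1 by (intro mult_left_mono) auto
    then show ?thesis using b1 by linarith
  qed
  define DD where "DD = 2 * b' * d'"
  have "K * (d' * DD + 1) + K * d' * (d' - 1) + (b' - 1) * (DD + 1) < 2 * K * d' * (DD + 1)"
    using 1 2 unfolding DD_def[symmetric] by (simp add: algebra_simps)
  moreover have "int (k * (d * D + 1) + k * d * (d - 1) + (b - 1) * (D + 1)) =
      K * (d' * DD + 1) + K * d' * (d' - 1) + (b' - 1) * (DD + 1)"
    using b d unfolding K_def b'_def d'_def DD_def D_def
    by (simp only: of_nat_add of_nat_mult of_nat_diff of_nat_1 of_nat_numeral)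
  moreover have "int (2 * k * d * (D + 1)) = 2 * K * d' * (DD + 1)"
    by (simp add: K_def b'_def d'_def DD_def D_def algebra_simps)
  ultimately show "k * (d * D + 1) + k * d * (d - 1) + (b - 1) * (D + 1) < 2 * k * d * (D + 1)"
    by (metis of_nat_less_iff)
qed

text \<open>With \<tau> as the outer and \<open>w\<close> as the inner variable, this is the ring of
  polynomials in \<tau> and \<open>\<tau> ^ k * w\<close>. It limits the number of coefficients that
  must vanish for divisibility by a power of \<tau>.\<close>

definition weighted :: "nat \<Rightarrow> 'a::comm_ring_1 poly poly set" where
  "weighted k = {g. \<forall>a r. coeff (coeff g a) r \<noteq> 0 \<longrightarrow> k * r \<le> a}"

lemma weighted_add: "g \<in> weighted k \<Longrightarrow> h \<in> weighted k \<Longrightarrow> g + h \<in> weighted k"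
  unfolding weighted_def by (auto, metis add.right_neutral)

lemma weighted_uminus: "g \<in> weighted k \<Longrightarrow> - g \<in> weighted k"
  by (simp add: weighted_def)

lemma weighted_diff: "g \<in> weighted k \<Longrightarrow> h \<in> weighted k \<Longrightarrow> g - h \<in> weighted k"
  using weighted_add[of g k "- h"] weighted_uminus[of h k] by simp

lemma weighted_mult:
  assumes g: "g \<in> weighted k" and h: "h \<in> weighted k" shows "g * h \<in> weighted k"
  unfolding weighted_def
proof (intro CollectI allI impI)
  fix a r assume nz: "coeff (coeff (g * h) a) r \<noteq> 0"
  have "coeff (coeff (g * h) a) r = (\<Sum>i\<le>a. \<Sum>l\<le>r. coeff (coeff g i) l * coeff (coeff h (a - i)) (r - l))"
    by (simp add: coeff_mult coeff_sum)
  then obtain i l where il: "i \<le> a" "l \<le> r" "coeff (coeff g i) l * coeff (coeff h (a - i)) (r - l) \<noteq> 0"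
    using nz by (auto elim!: sum.not_neutral_contains_not_neutral)
  then have "coeff (coeff g i) l \<noteq> 0" "coeff (coeff h (a - i)) (r - l) \<noteq> 0" by auto
  then have "k * l \<le> i" "k * (r - l) \<le> a - i" using g h unfolding weighted_def by blast+
  then have "k * l + k * (r - l) \<le> a" using il(1) by simp
  then show "k * r \<le> a" using il(2) by (simp flip: add_mult_distrib2)
qed

lemma weighted_const: "[:[:c:]:] \<in> weighted k"
  unfolding weighted_def by (auto simp: coeff_pCons split: nat.splits)

lemma weighted_linear: "[:[:c:], 1:] \<in> weighted k"
  unfolding weighted_def by (auto simp: coeff_pCons split: nat.splits)

lemma weighted_monom: "monom [:0, 1:] k \<in> weighted k"
  unfolding weighted_def by (auto simp: coeff_pCons split: nat.splits if_splits)

lemma weighted_1: "1 \<in> weighted k"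
  using weighted_const[of 1 k] by (simp add: one_pCons)

lemma weighted_0: "0 \<in> weighted k"
  by (simp add: weighted_def)

lemma weighted_power: "g \<in> weighted k \<Longrightarrow> g ^ e \<in> weighted k"
  by (induction e) (auto simp: weighted_1 weighted_mult)

lemma weighted_sum: "(\<And>i. i \<in> A \<Longrightarrow> F i \<in> weighted k) \<Longrightarrow> sum F A \<in> weighted k"
  by (induction A rule: infinite_finite_induct) (auto simp: weighted_0 weighted_add)

lemma weighted_eval_monom:
  assumes "\<And>i. i \<in> Poly_Mapping.keys m \<Longrightarrow> Y i \<in> weighted k"
  shows "eval_monom Y m \<in> weighted k"
proof -
  have "(\<Prod>i\<in>A. Y i ^ Poly_Mapping.lookup m i) \<in> weighted k" if "A \<subseteq> Poly_Mapping.keys m" for A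
    using that by (induction A rule: infinite_finite_induct) (auto simp: weighted_1 assms weighted_power weighted_mult)
  then show ?thesis by (simp add: eval_monom_def)
qed

lemma weighted_hev:
  assumes "rhom h" "\<And>a. h a \<in> weighted k" "v \<in> weighted k" shows "hev h v p \<in> weighted k"
  by (induction p) (simp_all add: hev_pCons assms weighted_0 weighted_add weighted_mult)

lemma weighted_dvd:
  assumes "g \<in> weighted k" "\<And>a r. a \<le> H \<Longrightarrow> k * r \<le> a \<Longrightarrow> coeff (coeff g a) r = 0"
  shows "[:0, 1:] ^ Suc H dvd g"
proof -
  have "coeff g a = 0" if "a < Suc H" for a
  proof (rule poly_eqI)
    fix r show "coeff (coeff g a) r = coeff 0 r"
      using assms(1) assms(2)[of a r] that unfolding weighted_def by (cases "k * r \<le> a") auto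
  qed
  then have "monom 1 (Suc H) dvd g" using monom_1_dvd_iff' by blast
  then show ?thesis by (simp add: monom_altdef)
qed

context curve_points
begin

text \<open>Up to multiples of a high power of \<tau>, all points of the class are values of one
  family \<open>Y\<close> with parameter \<open>w\<close>. A nonzero auxiliary polynomial is made to
  vanish to order \<open>Suc H\<close> on the whole family. At a point its value has degree at most
  \<open>H\<close> in \<open>t\<close>, hence is zero, and \<open>zeros\<close> bounds the number of
  points.\<close>

lemma card_class_le:
  fixes T :: "(nat \<Rightarrow> complex poly) set" and t0 :: complex
  assumes k: "0 < k" and D: "d \<le> D" "(b - 1) * D < k * (d * D)"
    and num: "k * (d * D + 1) + k * d * (d - 1) + (b - 1) * (D + 1) < 2 * k * d * (D + 1)"
    and T: "T \<subseteq> S" "Q0 \<in> S" "\<And>Q i. Q \<in> T \<Longrightarrow> i < n \<Longrightarrow> degree (Q i) \<le> b - 1"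
    and jet: "\<And>Q. Q \<in> T \<Longrightarrow> [:-t0, 1:] ^ k dvd xc Q - xc Q0"
    and res: "\<And>Q. Q \<in> T \<Longrightarrow> residue t0 Q = residue t0 Q0"
    and \<Theta>0: "poly (\<Theta> Q0) t0 \<noteq> 0"
  shows "finite T \<and> card T \<le> d * D"
proof -
  define B where "B = b - 1"
  \<comment> \<open>\<open>Suc H\<close> is the order of vanishing asked for. It exceeds
    \<open>(b - 1) * D\<close>, so every coefficient of the auxiliary polynomial is allowed at least
    one power of \<open>t\<close>.\<close>
  define H where "H = k * (d * D) - 1"
  have H: "Suc H = k * (d * D)" 
    unfolding H_def by (rule Suc_diff_1) (rule le_less_trans[OF le0 D(2)])
  \<comment> \<open>In \<open>complex poly poly\<close> the outer variable is \<open>\<tau> = t - t0\<close> and the inner one is the parameter \<open>w\<close>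
    of the points with \<open>xc Q = xc Q0 + \<tau> ^ k * w\<close>.\<close>
  define lift :: "complex poly \<Rightarrow> complex poly poly" where "lift = hev (\<lambda>c. [:[:c:]:]) [:[:t0:], 1:]"
  have rc: "rhom (\<lambda>c::complex. [:[:c:]:])" by (auto simp: rhom_def one_pCons)
  have rl: "rhom lift" unfolding lift_def by (rule rhom_hev[OF rc])
  define X where "X = lift (xc Q0) + monom [:0, 1:] k"
  define fl where "fl = hev lift X"
  have rfl: "rhom fl" unfolding fl_def by (rule rhom_hev[OF rl])
  define F where "F = (\<lambda>i. map_poly fl (f i))"
  have poly_F: "poly (F i) y = hev fl y (f i)" for i y by (simp add: F_def hev_def)
  have poly_F': "poly (pderiv (F i)) y = hev fl y (pderiv (f i))" for i y
    by (simp add: F_def hev_def pderiv_map_poly[OF rfl])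
  have re: "rhom (\<lambda>a. poly a (Z :: 'c::comm_ring_1))" for Z by (simp add: rhom_def)
  have poly_fx: "poly (fx i Z) y = hev (\<lambda>a. poly a Z) y (f i)" for i Z y by (simp add: fx_def hev_def)
  have poly_fx': "poly (pderiv (fx i Z)) y = hev (\<lambda>a. poly a Z) y (pderiv (f i))" for i Z y
    by (simp add: fx_def hev_def pderiv_map_poly[OF re])
  \<comment> \<open>Reduction modulo \<tau>. Since \<open>k > 0\<close>, the parameter disappears
    from \<open>X\<close>, and the reduced equations are those of \<open>Q0\<close> at
    \<open>t0\<close>.\<close>
  define \<pi> where "\<pi> = (\<lambda>g :: complex poly poly. poly g 0)"
  have r\<pi>: "rhom \<pi>" unfolding \<pi>_def by (rule re)
  have \<pi>_lift: "\<pi> (lift p) = [:poly p t0:]" for p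
    by (induction p) (simp_all add: rhom_0[OF rl] rhom_0[OF r\<pi>], simp add: lift_def hev_pCons[OF rc] \<pi>_def)
  have "[:poly (xc Q0) t0:] = \<pi> X"
    using k by (simp add: X_def rhom_add[OF r\<pi>] \<pi>_lift) (simp add: \<pi>_def poly_monom)
  then have \<pi>X: "\<pi> X = [:poly (xc Q0) t0:]" ..
  have \<pi>_fl: "\<pi> (fl a) = [:poly (poly a (xc Q0)) t0:]" for a
    by (induction a)
       (simp_all add: fl_def rhom_0[OF r\<pi>] hev_pCons[OF rl] rhom_add[OF r\<pi>] rhom_mult[OF r\<pi>] \<pi>_lift \<pi>X mult.commute)
  have \<pi>_G': "\<pi> (hev fl y G) = [:poly (hev (\<lambda>a. poly a (xc Q0)) Y G) t0:]" if y: "\<pi> y = [:poly Y t0:]" for G Y y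
  proof (induction G)
    case 0
    then show ?case by (simp add: rhom_0[OF r\<pi>])
  next
    case (pCons a G)
    with y show ?case
      by (simp add: hev_pCons[OF rfl] hev_pCons[OF re] rhom_add[OF r\<pi>] rhom_mult[OF r\<pi>] \<pi>_fl mult.commute)
  qed
  have \<pi>_G: "\<pi> (hev fl [:[:poly Y t0:]:] G) = [:poly (hev (\<lambda>a. poly a (xc Q0)) Y G) t0:]" for G Y
    by (rule \<pi>_G') (simp add: \<pi>_def)
  define \<tau> :: "complex poly poly" where "\<tau> = [:0, 1:]"
  have \<tau>_dvd: "\<tau> dvd g \<longleftrightarrow> \<pi> g = 0" for g unfolding \<tau>_def \<pi>_def
    using poly_eq_0_iff_dvd[of g 0] by simp
  define y0 where "y0 = (\<lambda>i. [:[:poly (Q0 i) t0:]:])"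
  define \<theta> where "\<theta> = (\<lambda>i. poly (poly (pderiv (fx i (xc Q0))) (Q0 i)) t0)"
  have \<theta>: "\<theta> i \<noteq> 0" if "i < n" for i
    using \<Theta>0 that unfolding \<theta>_def \<Theta>_def by (auto simp: poly_prod)
  \<comment> \<open>As \<open>\<Theta> Q0\<close> does not vanish at \<open>t0\<close>, the
    derivatives are nonzero constants modulo \<tau>; their inverses are what Hensel's lemma
    needs.\<close>
  define c where "c = (\<lambda>i. [:[:1 / \<theta> i:]:] :: complex poly poly)"
  have F0: "\<tau> dvd poly (F i) (y0 i)" if "i < n" for i
    unfolding \<tau>_dvd poly_F y0_def \<pi>_G poly_fx[symmetric] using root[OF T(2) that] by simp
  have F0': "\<tau> dvd poly (pderiv (F i)) (y0 i) * c i - 1" if "i < n" for i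
  proof -
    have "\<pi> (poly (pderiv (F i)) (y0 i)) = [:\<theta> i:]"
      unfolding poly_F' y0_def \<pi>_G poly_fx'[symmetric] \<theta>_def ..
    moreover have "\<pi> (c i) = [:1 / \<theta> i:]" by (simp add: c_def \<pi>_def)
    ultimately show ?thesis
      using \<theta>[OF that] by (simp add: \<tau>_dvd rhom_diff[OF r\<pi>] rhom_mult[OF r\<pi>] rhom_1[OF r\<pi>])
  qed
  have lift_w: "lift p \<in> weighted k" for p
    unfolding lift_def by (intro weighted_hev rc weighted_const weighted_linear)
  have X_w: "X \<in> weighted k" unfolding X_def by (intro weighted_add lift_w weighted_monom)
  have fl_w: "fl a \<in> weighted k" for a unfolding fl_def by (intro weighted_hev rl lift_w X_w)
  have "\<exists>y\<in>weighted k. \<tau> ^ Suc H dvd poly (F i) y \<and> \<tau> dvd y - y0 i" if "i < n" for i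
  proof (rule hensel_exists[OF F0[OF that] F0'[OF that]])
    show "poly (F i) y \<in> weighted k" if "y \<in> weighted k" for y
      unfolding poly_F using that by (intro weighted_hev rfl fl_w)
  qed (auto simp: weighted_diff weighted_mult y0_def c_def weighted_const)
  then obtain Y where Y: "\<And>i. i < n \<Longrightarrow> Y i \<in> weighted k" "\<And>i. i < n \<Longrightarrow> \<tau> ^ Suc H dvd poly (F i) (Y i)"
    "\<And>i. i < n \<Longrightarrow> \<tau> dvd Y i - y0 i" by metis
  define el where "el = (\<lambda>(j, i, e). lift (monom 1 e) * X ^ i * eval_monom Y (w j))"
  \<comment> \<open>The unknowns are the coefficients of \<open>t ^ e * x ^ i * w j\<close>, as long as its degree in \<open>t\<close> stays at most
    \<open>H\<close>; the equations are the coefficients of \<open>\<tau> ^ a * w ^ r\<close> with \<open>a \<le> H\<close> and, by weights, \<open>k * r \<le> a\<close>.\<close>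
  define U where "U = (SIGMA j:{..<d}. SIGMA i:{..D - j}. {..<Suc H - B * (i + j)})"
  define E where "E = (SIGMA a:{..<Suc H}. {..a div k})"
  have finU: "finite U" unfolding U_def by (intro finite_SigmaI) auto
  have el_w: "el u \<in> weighted k" if uU: "u \<in> U" for u
  proof -
    obtain j i e where u: "u = (j, i, e)" "j < d" using uU by (auto simp: U_def)
    have "eval_monom Y (w j) \<in> weighted k"
      using w(1)[OF u(2)] Y(1) by (intro weighted_eval_monom) auto
    then show ?thesis by (simp add: el_def u(1) weighted_mult lift_w weighted_power X_w)
  qed
  have "card E = (\<Sum>a<k * (d * D). a div k + 1)"
    unfolding E_def H by (subst card_SigmaI) auto
  also have "\<dots> < (\<Sum>j<d. \<Sum>i\<le>D - j. k * (d * D) - B * (i + j))"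
    by (rule count_unknowns_gt_equations) (use k d D num in \<open>auto simp: B_def\<close>)
  also have "\<dots> = card U"
    unfolding U_def H by (subst card_SigmaI, simp, simp, rule sum.cong[OF refl], subst card_SigmaI) auto
  finally have "card E < card U" .
  moreover have "finite E" unfolding E_def by (intro finite_SigmaI) auto
  ultimately obtain p where p: "\<exists>u\<in>U. p u \<noteq> 0"
    "\<And>a r. (a, r) \<in> E \<Longrightarrow> (\<Sum>u\<in>U. coeff (coeff (el u) a) r * p u) = 0"
    using homogeneous_system[of E U "\<lambda>e u. coeff (coeff (el u) (fst e)) (snd e)"] finU by fastforce
  define G where "G = (\<Sum>u\<in>U. [:[:p u:]:] * el u)"
  have G_dvd: "\<tau> ^ Suc H dvd G"
    unfolding \<tau>_def
  proof (rule weighted_dvd)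
    show "G \<in> weighted k" unfolding G_def by (intro weighted_sum weighted_mult weighted_const el_w)
    fix a r assume "a \<le> H" "k * r \<le> a"
    then have "(a, r) \<in> E" using k by (auto simp: E_def less_eq_div_iff_mult_less_eq mult.commute)
    then show "coeff (coeff G a) r = 0" using p(2) by (simp add: G_def coeff_sum mult.commute)
  qed
  define pp where "pp = (\<lambda>i j. \<Sum>e<Suc H - B * (i + j). monom (p (j, i, e)) e)"
  define PQ where "PQ = (\<lambda>Q. \<Sum>j<d. \<Sum>i\<le>D - j. pp i j * xc Q ^ i * eval_monom Q (w j))"
  have PQ_eq: "PQ Q = (\<Sum>(j, i, e)\<in>U. [:p (j, i, e):] * (monom 1 e * xc Q ^ i * eval_monom Q (w j)))" for Q
  proof -
    have "PQ Q = (\<Sum>j<d. \<Sum>i\<le>D - j. \<Sum>e<Suc H - B * (i + j). [:p (j, i, e):] * (monom 1 e * xc Q ^ i * eval_monom Q (w j)))"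
    proof -
      have "[:a:] * (monom 1 e * x * y) = monom a e * x * y" for a :: complex and e x y
      proof -
        have "[:a:] * (monom 1 e * x * y) = ([:a:] * monom 1 e) * x * y" by (simp only: mult.assoc)
        then show ?thesis by (simp add: smult_monom)
      qed
      then show ?thesis unfolding PQ_def pp_def by (simp only: sum_distrib_right)
    qed
    also have "\<dots> = (\<Sum>(j, i, e)\<in>U. [:p (j, i, e):] * (monom 1 e * xc Q ^ i * eval_monom Q (w j)))"
      unfolding U_def by (subst sum.Sigma[symmetric], simp, simp, rule sum.cong[OF refl], subst sum.Sigma[symmetric]) auto
    finally show ?thesis .
  qed
  have zero: "PQ Q = 0" if Q: "Q \<in> T" for Q
  proof -
    have QS: "Q \<in> S" using Q T(1) by blast
    obtain \<zeta> where "xc Q - xc Q0 = [:-t0, 1:] ^ k * \<zeta>" using jet[OF Q] by (auto simp: dvd_def)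
    then have \<zeta>: "xc Q = xc Q0 + [:-t0, 1:] ^ k * \<zeta>" by (simp add: algebra_simps)
    \<comment> \<open>The specialisation \<tau> = t - t0 and w = \<zeta>, which turns
      \<open>X\<close> into \<open>xc Q\<close> and the equations \<open>F i\<close> into those of
      \<open>Q\<close>.\<close>
    define ev where "ev = hev (\<lambda>r. pcompose r \<zeta>) [:-t0, 1:]"
    have rp: "rhom (\<lambda>r. pcompose r \<zeta>)" by (auto simp: rhom_def pcompose_add pcompose_mult pcompose_1)
    have rev: "rhom ev" unfolding ev_def by (rule rhom_hev[OF rp])
    have ev_c: "ev [:[:c:]:] = [:c:]" for c by (simp add: ev_def hev_const[OF rp])
    have ev_lift: "ev (lift p) = p" for p
    proof (induction p)
      case (pCons a p)
      have "ev [:[:t0:], 1:] = [:0, 1:]" by (simp add: ev_def hev_pCons[OF rp] pcompose_1)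
      then have "ev (lift (pCons a p)) = [:a:] + [:0, 1:] * ev (lift p)"
        by (simp only: lift_def hev_pCons[OF rc] rhom_add[OF rev] rhom_mult[OF rev] ev_c)
      then show ?case using pCons by simp
    qed (simp add: rhom_0[OF rl] rhom_0[OF rev])
    have ev_\<tau>: "ev \<tau> = [:-t0, 1:]" by (simp add: \<tau>_def ev_def hev_pCons[OF rp] pcompose_1)
    have "ev (monom [:0, 1:] k) = [:-t0, 1:] ^ k * \<zeta>"
      by (simp add: ev_def hev_def map_poly_monom poly_monom pcompose_pCons mult.commute)
    then have evX: "ev X = xc Q" by (simp add: X_def rhom_add[OF rev] ev_lift \<zeta>)
    have ev_fl: "ev (fl a) = poly a (xc Q)" for a
      by (induction a)
         (simp_all add: fl_def rhom_0[OF rev] hev_pCons[OF rl] rhom_add[OF rev] rhom_mult[OF rev] ev_lift evX)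
    have ev_G: "ev (hev fl y G) = hev (\<lambda>a. poly a (xc Q)) (ev y) G" for y G
      by (induction G)
         (simp_all add: rhom_0[OF rev] hev_pCons[OF rfl] hev_pCons[OF re] rhom_add[OF rev] rhom_mult[OF rev] ev_fl)
    \<comment> \<open>\<open>Q i\<close> is an exact root and \<open>ev (Y i)\<close> an approximate
      one with the same residue at \<open>t0\<close>, so uniqueness in Hensel's lemma identifies
      them to the required order.\<close>
    have evY: "[:-t0, 1:] ^ Suc H dvd Q i - ev (Y i)" if i: "i < n" for i
    proof (rule hensel_unique[where F = "fx i (xc Q)" and c = "ev (c i)"])
      show "[:-t0, 1:] ^ Suc H dvd poly (fx i (xc Q)) (ev (Y i))"
        using rhom_dvd[OF rev Y(2)[OF i]] by (simp only: rhom_power[OF rev] ev_\<tau> poly_F ev_G poly_fx)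
      show "poly (fx i (xc Q)) (Q i) = 0" by (rule root[OF QS i])
      have "poly (Q i) t0 = poly (Q0 i) t0"
        using fun_cong[OF res[OF Q], of i] i by (simp add: residue_def)
      then have a: "[:-t0, 1:] dvd Q i - [:poly (Q0 i) t0:]" by (simp add: poly_eq_0_iff_dvd[symmetric])
      have "[:-t0, 1:] dvd ev (Y i) - [:poly (Q0 i) t0:]"
        using rhom_dvd[OF rev Y(3)[OF i]] by (simp only: ev_\<tau> rhom_diff[OF rev] y0_def ev_c)
      from dvd_diff[OF a this] show "[:-t0, 1:] dvd Q i - ev (Y i)" by (simp only: diff_diff_eq2 diff_add_cancel)
      have "\<tau> dvd poly (pderiv (F i)) (Y i) - poly (pderiv (F i)) (y0 i)" by (rule dvd_poly_diff[OF Y(3)[OF i]])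
      then have "\<tau> dvd (poly (pderiv (F i)) (Y i) - poly (pderiv (F i)) (y0 i)) * c i + (poly (pderiv (F i)) (y0 i) * c i - 1)"
        using F0'[OF i] by (intro dvd_add dvd_mult2)
      then have "\<tau> dvd poly (pderiv (F i)) (Y i) * c i - 1" by (simp add: algebra_simps)
      from rhom_dvd[OF rev this] show "[:-t0, 1:] dvd poly (pderiv (fx i (xc Q))) (ev (Y i)) * ev (c i) - 1"
        by (simp only: ev_\<tau> rhom_diff[OF rev] rhom_mult[OF rev] rhom_1[OF rev] poly_F' ev_G poly_fx')
    qed
    have "[:-t0, 1:] ^ Suc H dvd ev G" using rhom_dvd[OF rev G_dvd] by (simp only: rhom_power[OF rev] ev_\<tau>)
    moreover have "ev G = (\<Sum>(j, i, e)\<in>U. [:p (j, i, e):] * (monom 1 e * xc Q ^ i * eval_monom (\<lambda>i. ev (Y i)) (w j)))"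
      unfolding G_def rhom_sum[OF rev]
      by (rule sum.cong[OF refl], clarify)
         (simp only: el_def prod.case rhom_mult[OF rev] ev_c ev_lift rhom_power[OF rev] evX rhom_eval_monom[OF rev])
    moreover have "[:-t0, 1:] ^ Suc H dvd PQ Q - (\<Sum>(j, i, e)\<in>U. [:p (j, i, e):] * (monom 1 e * xc Q ^ i * eval_monom (\<lambda>i. ev (Y i)) (w j)))"
      unfolding PQ_eq sum_subtractf[symmetric]
    proof (rule dvd_sum)
      fix u assume "u \<in> U"
      then obtain j i e where u: "u = (j, i, e)" "j < d" by (auto simp: U_def)
      have "[:-t0, 1:] ^ Suc H dvd eval_monom Q (w j) - eval_monom (\<lambda>i. ev (Y i)) (w j)"
        using w(1)[OF u(2)] by (intro dvd_diff_eval_monom evY) auto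
      then have "[:-t0, 1:] ^ Suc H dvd [:p (j, i, e):] * (monom 1 e * xc Q ^ i) * (eval_monom Q (w j) - eval_monom (\<lambda>i. ev (Y i)) (w j))"
        by (rule dvd_mult)
      then show "[:-t0, 1:] ^ Suc H dvd
         (case u of (j, i, e) \<Rightarrow> [:p (j, i, e):] * (monom 1 e * xc Q ^ i * eval_monom Q (w j))) -
         (case u of (j, i, e) \<Rightarrow> [:p (j, i, e):] * (monom 1 e * xc Q ^ i * eval_monom (\<lambda>i. ev (Y i)) (w j)))"
        unfolding u(1) prod.case by (simp only: right_diff_distrib mult.assoc)
    qed
    ultimately have dv: "[:-t0, 1:] ^ Suc H dvd PQ Q" by (metis dvd_add diff_add_cancel)
    have "degree (PQ Q) \<le> H"
      unfolding PQ_eq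
    proof (rule degree_sum_le[OF finU])
      fix u assume "u \<in> U"
      then obtain j i e where u: "u = (j, i, e)" "j < d" "i + j \<le> D" "e < Suc H - B * (i + j)"
        using D(1) by (auto simp: U_def)
      have dx: "degree (xc Q) \<le> B"
        unfolding xc_def B_def using T(3)[OF Q] by (intro degree_sum_le) (auto intro: le_trans[OF degree_smult_le])
      have "degree (monom (1::complex) e * xc Q ^ i * eval_monom Q (w j)) \<le>
          degree (monom (1::complex) e) + degree (xc Q ^ i) + degree (eval_monom Q (w j))"
        by (meson add_le_mono1 degree_mult_le le_trans)
      also have "\<dots> \<le> e + B * i + B * mdeg (w j)"
      proof (intro add_mono)
        show "degree (xc Q ^ i) \<le> B * i" using dx degree_power_le[of "xc Q" i] by (meson le_trans mult_le_mono1)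
        show "degree (eval_monom Q (w j)) \<le> B * mdeg (w j)"
          using w(1)[OF u(2)] T(3)[OF Q] by (intro degree_eval_monom) (auto simp: B_def)
      qed (simp add: degree_monom_le)
      also have "\<dots> \<le> e + B * (i + j)"
        using w(1)[OF u(2)] by (simp add: distrib_left)
      also have "\<dots> \<le> H" using u(4) by simp
      finally show "degree (case u of (j, i, e) \<Rightarrow> [:p (j, i, e):] * (monom 1 e * xc Q ^ i * eval_monom Q (w j))) \<le> H"
        unfolding u(1) prod.case by (intro le_trans[OF degree_mult_le]) simp
    qed
    moreover have "degree ([:-t0, 1:] ^ Suc H) = Suc H"
      by (subst degree_power_eq) auto
    ultimately show ?thesis
      using dvd_imp_degree_le[OF dv] by (metis Suc_n_not_le_n le_trans)
  qed
  have "\<exists>j<d. \<exists>i. i + j \<le> D \<and> pp i j \<noteq> 0"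
  proof -
    from p(1) obtain j i e where u: "j < d" "i \<le> D - j" "e < Suc H - B * (i + j)" "p (j, i, e) \<noteq> 0"
      by (auto simp: U_def)
    have "coeff (pp i j) e = p (j, i, e)" using u(3) by (simp add: pp_def coeff_sum)
    then have "pp i j \<noteq> 0" using u(4) by auto
    then show ?thesis using u(1,2) D(1) by (intro exI[of _ j] conjI exI[of _ i]) auto
  qed
  from zeros[OF D(1) this] have Z: "finite {Q \<in> S. PQ Q = 0}" "card {Q \<in> S. PQ Q = 0} \<le> d * D"
    unfolding PQ_def by auto
  have "T \<subseteq> {Q \<in> S. PQ Q = 0}" using zero T(1) by auto
  then show ?thesis using Z by (meson card_mono finite_subset le_trans)
qed

text \<open>At most \<open>d\<close> residues at \<open>t0\<close> occur, each with at most
  \<open>d * D\<close> points; with \<open>D = 2 * b * d\<close> this makes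
  \<open>2 * b * d ^ 3\<close>. The remainder modulo a positive power of \<open>[:-t0, 1:]\<close>
  fixes \<open>xc\<close> at \<open>t0\<close>, as the count of residues requires.\<close>

theorem card_fibre_le:
  assumes b: "1 \<le> b" and k: "b \<le> k * d" "(k - 1) * d < b"
  shows "finite {Q \<in> S. (\<forall>i<n. degree (Q i) < b) \<and> poly (\<Theta> Q) t0 \<noteq> 0 \<and> xc Q mod [:-t0, 1:] ^ k = v} \<and>
    card {Q \<in> S. (\<forall>i<n. degree (Q i) < b) \<and> poly (\<Theta> Q) t0 \<noteq> 0 \<and> xc Q mod [:-t0, 1:] ^ k = v} \<le> 2 * b * d ^ 3"
    (is "finite ?T \<and> card ?T \<le> _")
proof -
  define D where "D = 2 * b * d"
  note nc = numeric_choice[OF b d k, folded D_def]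
  have "card (residue t0 ` ?T) \<le> d \<and> finite (residue t0 ` ?T)"
  proof (cases "?T = {}")
    case False
    then obtain Q0 where Q0: "Q0 \<in> ?T" by blast
    have "finite (residue t0 ` ?T) \<and> card (residue t0 ` ?T) \<le> d"
    proof (rule card_residue_le)
      show "poly (xc Q) t0 = poly v t0" if "Q \<in> ?T" for Q
      proof -
        have "xc Q = [:-t0, 1:] ^ k * (xc Q div [:-t0, 1:] ^ k) + v"
          using that by (metis (mono_tags, lifting) mem_Collect_eq mult_div_mod_eq)
        then have "poly (xc Q) t0 = poly ([:-t0, 1:] ^ k * (xc Q div [:-t0, 1:] ^ k) + v) t0" by simp
        then show ?thesis using nc(1) by (simp add: poly_power)
      qed
      show "poly (poly q (xc Q)) t0 \<noteq> 0" if "Q \<in> ?T" for Q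
        using that by (auto simp: \<Theta>_def)
    qed auto
    then show ?thesis by simp
  next
    case True
    then show ?thesis by (simp only: image_empty card.empty finite.emptyI) simp
  qed
  moreover have cl: "finite {Q \<in> ?T. residue t0 Q = r} \<and> card {Q \<in> ?T. residue t0 Q = r} \<le> d * D" for r
  proof (cases "{Q \<in> ?T. residue t0 Q = r} = {}")
    case False
    then obtain Q0 where Q0: "Q0 \<in> ?T" "residue t0 Q0 = r" by blast
    show ?thesis
    proof (rule card_class_le[OF nc(1,2,3,4)])
      show "degree (Q i) \<le> b - 1" if "Q \<in> {Q \<in> ?T. residue t0 Q = r}" "i < n" for Q i
        using that by fastforce
      show "[:-t0, 1:] ^ k dvd xc Q - xc Q0" if "Q \<in> {Q \<in> ?T. residue t0 Q = r}" for Q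
        using that Q0 by (auto intro: mod_eq_dvd_iff[THEN iffD1])
    qed (use Q0 in auto)
  next
    case True
    then show ?thesis by (simp only: card.empty finite.emptyI) simp
  qed
  moreover have un: "?T = (\<Union>r\<in>residue t0 ` ?T. {Q \<in> ?T. residue t0 Q = r})" by auto
  ultimately have "finite ?T" by (metis (no_types, lifting) finite_UN_I)
  moreover have "card ?T \<le> d * (d * D)"
  proof -
    have "card ?T \<le> (\<Sum>r\<in>residue t0 ` ?T. card {Q \<in> ?T. residue t0 Q = r})"
      by (subst un) (rule card_UN_le, use \<open>finite ?T\<close> in blast)
    also have "\<dots> \<le> (\<Sum>r\<in>residue t0 ` ?T. d * D)" using cl by (intro sum_mono) blast
    also have "\<dots> \<le> d * (d * D)"
      using \<open>card (residue t0 ` ?T) \<le> d \<and> finite (residue t0 ` ?T)\<close> by simp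
    finally show ?thesis .
  qed
  then have "card ?T \<le> 2 * b * d ^ 3" by (simp add: D_def power3_eq_cube mult_ac)
  ultimately show ?thesis by blast
qed

end

section \<open>Rings of dimension one\<close>

text \<open>Adding the variables outside \<open>I\<close> to an ideal of \<open>mpoly_ring I\<close> turns it into an ideal of the type of
  all polynomials, with the same quotient.\<close>

definition full_idl :: "'i set \<Rightarrow> ('i, 'k::comm_ring_1) mpoly set \<Rightarrow> ('i, 'k) mpoly set" where
  "full_idl I C = {p. restr I p \<in> C}"

lemma mpoly_ring_simps [simp]:
  "carrier (mpoly_ring I) = mpolys I" "mult (mpoly_ring I) = (*)" "one (mpoly_ring I) = 1"
  "zero (mpoly_ring I) = 0" "add (mpoly_ring I) = (+)"
  by (simp_all add: mpoly_ring_def)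

lemma prime_full_idl:
  fixes C :: "('i, 'k::comm_ring_1) mpoly set"
  assumes "primeideal C (mpoly_ring I)"
  shows "prime_idl (full_idl I C)"
proof -
  interpret primeideal C "mpoly_ring I" by fact
  have "1 \<notin> C" using one_imp_carrier I_notcarr by auto
  moreover have "restr I a * restr I b \<in> C \<Longrightarrow> restr I a \<in> C \<or> restr I b \<in> C" for a b
    using I_prime[of "restr I a" "restr I b"] by (simp add: restr_in)
  moreover have "0 \<in> C" using additive_subgroup.zero_closed[OF additive_subgroup_axioms] by simp
  moreover have "a \<in> C \<Longrightarrow> b \<in> C \<Longrightarrow> a + b \<in> C" for a b 
    using additive_subgroup.a_closed[OF additive_subgroup_axioms, of a b] by simp
  moreover have "a \<in> C \<Longrightarrow> restr I r * a \<in> C" for a r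
    using I_l_closed[of a "restr I r"] by (simp add: restr_in)
  ultimately show ?thesis
    unfolding prime_idl_def idl_def full_idl_def by (auto simp: restr_add restr_mult)
qed

lemma var_full_idl: assumes "0 \<in> C" "i \<notin> I" shows "var i \<in> full_idl I C"
  using assms by (simp add: full_idl_def restr_var)

lemma primeideal_of_prime_idl:
  assumes P: "prime_idl P"
  shows "primeideal (P \<inter> mpolys I) (mpoly_ring I)"
proof (rule primeidealI2)
  have idlP: "idl P" and oneP: "1 \<notin> P" using P by (auto simp: prime_idl_def)
  interpret R: cring "mpoly_ring I" by (rule cring_mpoly_ring)
  show "additive_subgroup (P \<inter> mpolys I) (mpoly_ring I)"
    unfolding additive_subgroup_def
  proof (rule R.add.subgroupI)
    show "P \<inter> mpolys I \<subseteq> carrier (mpoly_ring I)" by simp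
    show "P \<inter> mpolys I \<noteq> {}" using idl_0[OF idlP] by auto
    fix a assume a: "a \<in> P \<inter> mpolys I"
    have "\<ominus>\<^bsub>mpoly_ring I\<^esub> a = - a"
      using a mpolys_uminus[of a I] by (intro R.minus_equality) auto
    then show "\<ominus>\<^bsub>mpoly_ring I\<^esub> a \<in> P \<inter> mpolys I" using a by (simp add: idl_uminus[OF idlP] mpolys_uminus)
    fix b assume "b \<in> P \<inter> mpolys I"
    then show "a \<oplus>\<^bsub>mpoly_ring I\<^esub> b \<in> P \<inter> mpolys I" using a by (simp add: idl_add[OF idlP] mpolys_add)
  qed
  show "cring (mpoly_ring I)" by (rule cring_mpoly_ring)
  show "carrier (mpoly_ring I) \<noteq> P \<inter> mpolys I"
    using oneP by (metis Int_iff mpolys_1 mpoly_ring_simps(1))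
qed (use P in \<open>auto simp: mpolys_mult prime_idl_mult\<close>)

text \<open>One half of the correspondence between primes containing \<open>C\<close> and primes of
  the quotient; the second claim lets strictness of inclusions be tested on representatives.\<close>

lemma quotient_prime:
  assumes R: "cring R" and C: "ideal C R" and J: "primeideal J R" "C \<subseteq> J"
  shows "primeideal ((+>\<^bsub>R\<^esub>) C ` J) (R Quot C)"
    and "a \<in> carrier R \<Longrightarrow> C +>\<^bsub>R\<^esub> a \<in> (+>\<^bsub>R\<^esub>) C ` J \<longleftrightarrow> a \<in> J"
proof -
  interpret R: cring R by fact
  interpret C: ideal C R by fact
  interpret J: primeideal J R by fact
  have idl: "ideal ((+>\<^bsub>R\<^esub>) C ` J) (R Quot C)"
    by (rule R.ring_ideal_imp_quot_ideal[OF C J.is_ideal])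
  have un: "\<Union>((+>\<^bsub>R\<^esub>) C ` J) = J" using R.ideal_incl_iff[OF C J.is_ideal] J(2) by blast
  have sub: "(+>\<^bsub>R\<^esub>) C ` J \<subseteq> carrier (R Quot C)" using idl by (rule ideal.Icarr[THEN subsetI])
  have mem: "C +>\<^bsub>R\<^esub> a \<in> (+>\<^bsub>R\<^esub>) C ` J \<longleftrightarrow> a \<in> J" if "a \<in> carrier R" for a
    using R.canonical_proj_vimage_mem_iff[OF C sub that] un by simp
  then show "a \<in> carrier R \<Longrightarrow> C +>\<^bsub>R\<^esub> a \<in> (+>\<^bsub>R\<^esub>) C ` J \<longleftrightarrow> a \<in> J" .
  show "primeideal ((+>\<^bsub>R\<^esub>) C ` J) (R Quot C)"
  proof (rule primeidealI[OF idl C.quotient_is_cring[OF R]])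
    have one: "\<one>\<^bsub>R\<^esub> \<notin> J" using J.one_imp_carrier J.I_notcarr by auto
    show "carrier (R Quot C) \<noteq> (+>\<^bsub>R\<^esub>) C ` J"
    proof
      assume "carrier (R Quot C) = (+>\<^bsub>R\<^esub>) C ` J"
      moreover have "C +>\<^bsub>R\<^esub> \<one>\<^bsub>R\<^esub> \<in> carrier (R Quot C)"
        by (simp add: FactRing_def R.a_rcosetsI C.a_subset)
      ultimately show False using mem[of "\<one>\<^bsub>R\<^esub>"] one by simp
    qed
    fix A B assume AB: "A \<in> carrier (R Quot C)" "B \<in> carrier (R Quot C)" "A \<otimes>\<^bsub>R Quot C\<^esub> B \<in> (+>\<^bsub>R\<^esub>) C ` J"
    then obtain a b where a: "a \<in> carrier R" "A = C +>\<^bsub>R\<^esub> a" and b: "b \<in> carrier R" "B = C +>\<^bsub>R\<^esub> b"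
      unfolding FactRing_def by (auto simp: A_RCOSETS_def')
    have "A \<otimes>\<^bsub>R Quot C\<^esub> B = C +>\<^bsub>R\<^esub> (a \<otimes>\<^bsub>R\<^esub> b)"
      using a b by (simp add: FactRing_def C.rcoset_mult_add)
    then have "a \<otimes>\<^bsub>R\<^esub> b \<in> J" using AB(3) mem[of "a \<otimes>\<^bsub>R\<^esub> b"] a b by simp
    then show "A \<in> (+>\<^bsub>R\<^esub>) C ` J \<or> B \<in> (+>\<^bsub>R\<^esub>) C ` J"
      using J.I_prime[OF a(1) b(1)] mem a b by simp
  qed
qed

lemma chain_dim_ge:
  assumes "\<And>i. i \<le> k \<Longrightarrow> Z i \<in> \<F>" "\<And>i. i < k \<Longrightarrow> Z i \<subset> Z (Suc i)"
  shows "enat k \<le> chain_dim \<F>"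
  unfolding chain_dim_def by (rule Sup_upper) (use assms in blast)

text \<open>A supremum of at least \<open>k\<close> is not bounded by \<open>k - 1\<close>, so some
  chain has length at least \<open>k\<close> and can be truncated. For \<open>k = 0\<close> this
  would fail on an empty family, whose dimension is 0 as well.\<close>

lemma chain_dim_obtain:
  assumes "enat k \<le> chain_dim \<F>" "0 < k"
  obtains Z where "\<And>i. i \<le> k \<Longrightarrow> Z i \<in> \<F>" "\<And>i. i < k \<Longrightarrow> Z i \<subset> Z (Suc i)"
proof -
  obtain k' where k: "k = Suc k'" using assms(2) by (cases k) auto
  let ?S = "{enat k | k. \<exists>Z. (\<forall>i\<le>k. Z i \<in> \<F>) \<and> (\<forall>i<k. Z i \<subset> Z (Suc i))}"
  have "\<not> (\<forall>x\<in>?S. x \<le> enat k')"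
  proof
    assume "\<forall>x\<in>?S. x \<le> enat k'"
    then have "Sup ?S \<le> enat k'" by (intro Sup_least) blast
    then have "enat k \<le> enat k'" using assms(1) unfolding chain_dim_def by (rule order_trans[rotated])
    then show False using k by simp
  qed
  then obtain m Z where "enat m > enat k'" and Z: "\<forall>i\<le>m. Z i \<in> \<F>" "\<forall>i<m. Z i \<subset> Z (Suc i)"
    by (auto simp: not_le)
  then have "k \<le> m" using k by simp
  then show ?thesis using that[of Z] Z by simp
qed

lemma no_prime_chain_of_krull_dim_1:
  fixes C :: "('i, 'k::comm_ring_1) mpoly set"
  assumes C: "primeideal C (mpoly_ring I)" and dim: "ring_krull_dim (mpoly_ring I Quot C) = 1"
    and PQ: "prime_idl P" "prime_idl Q" "full_idl I C \<subset> P" "P \<subset> Q"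
  shows False
proof -
  interpret C: primeideal C "mpoly_ring I" by fact
  let ?R = "mpoly_ring I"
  have var: "var i \<in> J" if "full_idl I C \<subseteq> J" "i \<notin> I" for i J
    using var_full_idl[of C i I] additive_subgroup.zero_closed[OF C.additive_subgroup_axioms] that by auto
  have CF: "C \<subseteq> full_idl I C \<inter> mpolys I"
  proof
    fix a assume "a \<in> C"
    then show "a \<in> full_idl I C \<inter> mpolys I" using C.Icarr[of a] by (simp add: full_idl_def restr_id)
  qed
  have prF: "prime_idl (full_idl I C)" by (rule prime_full_idl[OF C])
  have prim: "primeideal ((+>\<^bsub>?R\<^esub>) C ` (J \<inter> mpolys I)) (?R Quot C)"
    and mem: "\<And>a. a \<in> mpolys I \<Longrightarrow> C +>\<^bsub>?R\<^esub> a \<in> (+>\<^bsub>?R\<^esub>) C ` (J \<inter> mpolys I) \<longleftrightarrow> a \<in> J"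
    if "prime_idl J" "full_idl I C \<subseteq> J" for J
    using quotient_prime[OF C.is_cring C.is_ideal primeideal_of_prime_idl[OF that(1)]] CF that(2) by auto
  have strict: "(+>\<^bsub>?R\<^esub>) C ` (J \<inter> mpolys I) \<subset> (+>\<^bsub>?R\<^esub>) C ` (J' \<inter> mpolys I)"
    if JJ: "prime_idl J" "full_idl I C \<subseteq> J" "prime_idl J'" "J \<subset> J'" for J J'
  proof
    show "(+>\<^bsub>?R\<^esub>) C ` (J \<inter> mpolys I) \<subseteq> (+>\<^bsub>?R\<^esub>) C ` (J' \<inter> mpolys I)" using that(4) by auto
    obtain a where a: "a \<in> J'" "a \<notin> J" using JJ(4) by blast
    have "a - restr I a \<in> J" "a - restr I a \<in> J'"
      using that var by (auto intro!: diff_restr simp: prime_idl_idl)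
    then have "restr I a \<in> J'" "restr I a \<notin> J"
      using a idl_cong[OF prime_idl_idl[OF that(1)], of a "restr I a"] idl_cong[OF prime_idl_idl[OF that(3)], of a "restr I a"]
      by simp_all
    then show "(+>\<^bsub>?R\<^esub>) C ` (J \<inter> mpolys I) \<noteq> (+>\<^bsub>?R\<^esub>) C ` (J' \<inter> mpolys I)"
    proof -
      have "full_idl I C \<subseteq> J'" using that by blast
      then have "C +>\<^bsub>?R\<^esub> restr I a \<in> (+>\<^bsub>?R\<^esub>) C ` (J' \<inter> mpolys I)"
        using mem[OF that(3) _ restr_in] \<open>restr I a \<in> J'\<close> by metis
      moreover have "C +>\<^bsub>?R\<^esub> restr I a \<notin> (+>\<^bsub>?R\<^esub>) C ` (J \<inter> mpolys I)"
        using mem[OF that(1,2) restr_in] \<open>restr I a \<notin> J\<close> by metis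
      ultimately show ?thesis by metis
    qed
  qed
  define Z where "Z = (\<lambda>i::nat. (+>\<^bsub>?R\<^esub>) C ` ((if i = 0 then full_idl I C else if i = 1 then P else Q) \<inter> mpolys I))"
  have Z0: "Z 0 \<subset> Z 1" and Z1: "Z 1 \<subset> Z 2"
    using strict[OF prF subset_refl PQ(1,3)] strict[OF PQ(1) _ PQ(2,4)] PQ(3) by (simp_all add: Z_def psubset_imp_subset)
  have "enat 2 \<le> ring_krull_dim (?R Quot C)"
    unfolding ring_krull_dim_def
  proof (rule chain_dim_ge)
    show "Z i \<in> {Q. primeideal Q (?R Quot C)}" if "i \<le> 2" for i
      using prim[of "full_idl I C"] prim[of P] prim[of Q] prF PQ unfolding Z_def by auto
    show "Z i \<subset> Z (Suc i)" if "i < 2" for i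
    proof -
      have "i = 0 \<or> i = 1" using that by auto
      then show ?thesis using Z0 Z1 by (auto simp: numeral_2_eq_2)
    qed
  qed
  then show False using dim by (simp add: one_enat_def)
qed

text \<open>A chain of two primes in the quotient provides an element of the larger one outside the
  smaller one: it is nonzero and not invertible. It will keep the Hilbert function from becoming
  constant.\<close>

lemma non_unit_of_krull_dim_1:
  fixes C :: "('i, 'k::comm_ring_1) mpoly set"
  assumes C: "primeideal C (mpoly_ring I)" and dim: "ring_krull_dim (mpoly_ring I Quot C) = 1"
  shows "\<exists>a. a \<notin> full_idl I C \<and> (\<forall>s. 1 - a * s \<notin> full_idl I C)"
proof -
  interpret C: primeideal C "mpoly_ring I" by fact
  let ?R = "mpoly_ring I"
  have "enat 1 \<le> chain_dim {Q. primeideal Q (?R Quot C)}"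
    using dim by (simp add: ring_krull_dim_def one_enat_def)
  then obtain Z where Z: "\<And>i. i \<le> 1 \<Longrightarrow> Z i \<in> {Q. primeideal Q (?R Quot C)}" "\<And>i. i < 1 \<Longrightarrow> Z i \<subset> Z (Suc i)"
    by (rule chain_dim_obtain) auto
  interpret Z0: primeideal "Z 0" "?R Quot C" using Z(1)[of 0] by simp
  interpret Z1: primeideal "Z 1" "?R Quot C" using Z(1)[of 1] by simp
  obtain A where A: "A \<in> Z 1" "A \<notin> Z 0" using Z(2)[of 0] by auto
  have "A \<in> carrier (?R Quot C)" using A(1) Z1.Icarr by simp
  then obtain a where a: "a \<in> mpolys I" "A = C +>\<^bsub>?R\<^esub> a"
    unfolding FactRing_def by (auto simp: A_RCOSETS_def')
  have "a \<notin> C"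
  proof
    assume "a \<in> C"
    then have "A = C" using a(2) C.a_coset_join2[of a C] C.a_rcos_const[of a] by simp
    then have "A = \<zero>\<^bsub>?R Quot C\<^esub>" by (simp add: FactRing_def)
    then show False using A(2) additive_subgroup.zero_closed[OF Z0.additive_subgroup_axioms] by simp
  qed
  then have "a \<notin> full_idl I C" using a(1) by (simp add: full_idl_def restr_id)
  moreover have "1 - a * s \<notin> full_idl I C" for s
  proof
    assume "1 - a * s \<in> full_idl I C"
    moreover have "restr I (1 - a * s) = 1 - a * restr I s"
      using restr_add[of I "1 - a * s" "a * s"] by (simp add: restr_mult restr_id[OF a(1)] algebra_simps)
    ultimately have c: "1 - a * restr I s \<in> C" by (simp add: full_idl_def)
    have as: "a * restr I s \<in> mpolys I" using a(1) restr_in by (rule mpolys_mult)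
    have "C +>\<^bsub>?R\<^esub> 1 = C +>\<^bsub>?R\<^esub> (a * restr I s)"
    proof (rule C.a_repr_independence'[symmetric])
      show "1 \<in> C +>\<^bsub>?R\<^esub> (a * restr I s)"
        unfolding a_r_coset_def' using c by (auto intro!: bexI[of _ "1 - a * restr I s"])
    qed (use as in auto)
    also have "\<dots> = A \<otimes>\<^bsub>?R Quot C\<^esub> (C +>\<^bsub>?R\<^esub> restr I s)"
      using a restr_in[of I s] C.rcoset_mult_add[of a "restr I s"] by (simp add: FactRing_def)
    also have "\<dots> \<in> Z 1"
      using A(1) restr_in[of I s] by (intro Z1.I_r_closed) (auto simp: FactRing_def intro!: C.a_rcosetsI C.a_subset)
    finally have "\<one>\<^bsub>?R Quot C\<^esub> \<in> Z 1" by (simp add: FactRing_def)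
    then show False using Z1.one_imp_carrier Z1.I_notcarr by auto
  qed
  ultimately show ?thesis by blast
qed

lemma ex_not_mem_countable: "countable A \<Longrightarrow> uncountable (UNIV :: 'a set) \<Longrightarrow> \<exists>r::'a. r \<notin> A"
  by (metis UNIV_eq_I)

text \<open>Otherwise \<open>y\<close> and then \<open>x\<close> could be specialised. A prime
  \<open>P\<close> contains \<open>y - kap r\<close> and meets \<open>gen [x]\<close> only in the
  ideal of the curve, so that \<open>x\<close> stays transcendental; a prime \<open>Q\<close> above
  \<open>P\<close> contains \<open>x - kap r'\<close>. Both inclusions are strict, and the chain is
  too long for dimension one.\<close>

lemma not_alg_indep_pair:
  fixes C :: "('i, 'k::field) mpoly set"
  assumes I: "finite I" and unc: "uncountable (UNIV :: 'k set)"
    and C: "primeideal C (mpoly_ring I)" and dim: "ring_krull_dim (mpoly_ring I Quot C) = 1"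
  shows "\<not> alg_indep (full_idl I C) [y, x]"
proof
  let ?C = "full_idl I C"
  interpret C: primeideal C "mpoly_ring I" by fact
  have pr: "prime_idl ?C" by (rule prime_full_idl[OF C])
  have idlC: "idl ?C" and one: "1 \<notin> ?C" using pr by (auto simp: prime_idl_def)
  have var: "var i \<in> ?C" if "i \<notin> I" for i using var_full_idl[of C i I] additive_subgroup.zero_closed[OF C.additive_subgroup_axioms] that by simp
  assume "alg_indep ?C [y, x]"
  then have tr: "transc (gen [x]) y ?C" "transc (range kap) x ?C" by simp_all
  have "countable {r. \<exists>b\<in>gen [x] - ?C. \<exists>m. b * 1 ^ m \<in> idl_plus ?C (y - kap r)}"
    using tr(1) by (intro countable_bad_specialisations[OF I idlC var idlC subr_gen]) (auto simp: transc_def)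
  from ex_not_mem_countable[OF this unc] obtain r where r: "r \<notin> {r. \<exists>b\<in>gen [x] - ?C. \<exists>m. b * 1 ^ m \<in> idl_plus ?C (y - kap r)}" ..
  have one_gen: "1 \<in> gen [x] - ?C" using one subr_1[OF subr_gen, of "[x]"] by simp
  obtain P where P: "prime_idl P" "idl_plus ?C (y - kap r) \<subseteq> P" "P \<inter> (gen [x] - ?C) = {}"
  proof (rule prime_avoiding[OF idl_idl_plus[OF idlC, of "y - kap r"] _ one_gen])
    show "idl_plus ?C (y - kap r) \<inter> (gen [x] - ?C) = {}" using r by auto
    show "a * b \<in> gen [x] - ?C" if "a \<in> gen [x] - ?C" "b \<in> gen [x] - ?C" for a b
      using that pr by (auto simp: subr_mult[OF subr_gen] prime_idl_mult simp del: gen.simps)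
  qed
  have linear: "v - kap r \<notin> J" if "transc B v J" "subr B" "1 \<notin> J" for v r B and J :: "('i, 'k) mpoly set"
  proof
    assume "v - kap r \<in> J"
    then have "poly [:- kap r, 1:] v \<in> J" by simp
    moreover have "coeffs_in B [:- kap r, 1:]"
      using that(2) by (simp add: coeffs_in_pCons coeffs_in_0 subr_0 subr_1 subr_uminus subr_kap)
    ultimately have "coeffs_in J [:- kap r, 1:]" using that(1) unfolding transc_def by blast
    then show False using that(3) by (simp add: coeffs_in_pCons)
  qed
  have CP: "?C \<subset> P"
    using P(2) subset_idl_plus[of ?C "y - kap r"] mem_idl_plus[OF idlC, of "y - kap r"]
      linear[OF tr(1) subr_gen one, of r] by blast
  have idlP: "idl P" and oneP: "1 \<notin> P" using P(1) by (auto simp: prime_idl_def)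
  have trP: "transc (range kap) x P"
    unfolding transc_def
  proof (intro allI impI)
    fix c assume c: "coeffs_in (range kap) c" "poly c x \<in> P"
    then have "poly c x \<in> gen [x]" by (auto simp: adjoin_def)
    then have "poly c x \<in> ?C" using c(2) P(3) by blast
    then have "coeffs_in ?C c" using tr(2) c(1) by (simp add: transc_def)
    then show "coeffs_in P c" using CP by (auto simp: coeffs_in_def)
  qed
  have varP: "var i \<in> P" if "i \<notin> I" for i using var[OF that] CP by blast
  have "countable {r. \<exists>b\<in>range kap - P. \<exists>m. b * 1 ^ m \<in> idl_plus P (x - kap r)}"
    using trP by (intro countable_bad_specialisations[OF I idlP varP idlP subr_range_kap]) (auto simp: transc_def)
  from ex_not_mem_countable[OF this unc] obtain r' where r': "r' \<notin> {r. \<exists>b\<in>range kap - P. \<exists>m. b * 1 ^ m \<in> idl_plus P (x - kap r)}" ..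
  have "kap 1 \<in> range kap - P" using oneP rangeI[of kap 1] by simp
  then have one': "1 \<notin> idl_plus P (x - kap r')" using r' by auto
  obtain Q where Q: "prime_idl Q" "idl_plus P (x - kap r') \<subseteq> Q" "Q \<inter> {1} = {}"
    by (rule prime_avoiding[OF idl_idl_plus[OF idlP, of "x - kap r'"], of "{1}"]) (use one' in auto)
  have "P \<subset> Q"
    using Q(2) subset_idl_plus[of P "x - kap r'"] mem_idl_plus[OF idlP, of "x - kap r'"]
      linear[OF trP subr_range_kap oneP, of r'] by blast
  with no_prime_chain_of_krull_dim_1[OF C dim P(1) Q(1) CP] show False .
qed

section \<open>Noether normalisation and the Hilbert function\<close>

lemma rhom_kap: "rhom kap"
  by (simp add: rhom_def kap_add kap_mult)

lemma hev_eq_sum: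
  assumes h: "rhom h" and "degree p \<le> M"
  shows "hev h v p = (\<Sum>i\<le>M. h (coeff p i) * v ^ i)"
proof -
  have m: "hev h v (monom a i) = h a * v ^ i" for a i
    using h by (simp add: hev_def map_poly_monom rhom_0 poly_monom)
  have "hev h v p = hev h v (\<Sum>i\<le>M. monom (coeff p i) i)"
    using poly_as_sum_of_monoms'[OF assms(2)] by simp
  then show ?thesis by (simp add: rhom_sum[OF rhom_hev[OF h]] m)
qed

lemma coeffs_in_range:
  assumes h: "rhom h" and "coeffs_in (range h) c"
  shows "\<exists>g. c = map_poly h g"
  using assms(2)
proof (induction c)
  case 0
  then show ?case by (intro exI[of _ 0]) simp
next
  case (pCons a c)
  then obtain g r where "c = map_poly h g" "a = h r" by (auto simp: coeffs_in_pCons)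
  then have "pCons a c = map_poly h (pCons r g)" using h by (simp add: map_poly_pCons rhom_0)
  then show ?case by blast
qed

lemma adjoin_range_kap: "adjoin (range kap) x = range (hev kap x)"
proof (intro equalityI subsetI)
  fix y assume "y \<in> adjoin (range kap) x"
  then obtain c where "coeffs_in (range kap) c" "y = poly c x" by (auto simp: adjoin_def)
  then show "y \<in> range (hev kap x)" using coeffs_in_range[OF rhom_kap] by (auto simp: hev_def)
next
  fix y assume "y \<in> range (hev kap x)"
  then show "y \<in> adjoin (range kap) x"
    by (auto simp: adjoin_def hev_def coeffs_in_def coeff_map_poly)
qed

lemma not_transc_hev:
  assumes h: "rhom h" and J: "idl J" and nt: "\<not> transc (range h) v J"
  shows "\<exists>g. g \<noteq> 0 \<and> hev h v g \<in> J"
proof -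
  obtain c where c: "coeffs_in (range h) c" "poly c v \<in> J" "\<not> coeffs_in J c"
    using nt by (auto simp: transc_def)
  obtain g where g: "c = map_poly h g" using coeffs_in_range[OF h c(1)] by blast
  then have "g \<noteq> 0" using c(3) J by (auto simp: coeffs_in_0 idl_0)
  then show ?thesis using c(2) g by (auto simp: hev_def)
qed

lemma algebraic_relation:
  fixes J :: "('i, 'k::field) mpoly set"
  assumes J: "idl J" and dep: "\<not> alg_indep J [v, x]"
  shows "\<exists>H :: 'k poly poly. H \<noteq> 0 \<and> hev (hev kap x) v H \<in> J"
proof (cases "transc (range kap) x J")
  case False
  then obtain g where "g \<noteq> 0" "hev kap x g \<in> J" using not_transc_hev[OF rhom_kap J] by blast
  then show ?thesis by (intro exI[of _ "[:g:]"]) (simp add: hev_const rhom_hev rhom_kap)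
next
  case True
  then have "\<not> transc (range (hev kap x)) v J" using dep by (simp add: adjoin_range_kap)
  then show ?thesis by (rule not_transc_hev[OF rhom_hev[OF rhom_kap] J])
qed

text \<open>That \<open>mpolys_upto I (Suc D)\<close> is contained in this set for large
  \<open>D\<close> expresses finiteness over the polynomials in \<open>x\<close> with control of
  degrees. Geometrically, the linear form \<open>x\<close> has no zero at infinity on the projective
  closure.\<close>

definition pushed :: "('i, 'k::field) mpoly set \<Rightarrow> 'i set \<Rightarrow> ('i, 'k) mpoly \<Rightarrow> nat \<Rightarrow> ('i, 'k) mpoly set" where
  "pushed J I x D = {p. \<exists>p1\<in>mpolys_upto I D. \<exists>p2\<in>mpolys_upto I D. p - (x * p1 + p2) \<in> J}"

lemma pushedI: "p1 \<in> mpolys_upto I D \<Longrightarrow> p2 \<in> mpolys_upto I D \<Longrightarrow> p - (x * p1 + p2) \<in> J \<Longrightarrow> p \<in> pushed J I x D"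
  unfolding pushed_def by blast

lemma pushedE:
  assumes "p \<in> pushed J I x D"
  obtains p1 p2 where "p1 \<in> mpolys_upto I D" "p2 \<in> mpolys_upto I D" "p - (x * p1 + p2) \<in> J"
  using assms unfolding pushed_def by blast

lemma pushed_add:
  assumes J: "idl J" and p: "p \<in> pushed J I x D" and q: "q \<in> pushed J I x D"
  shows "p + q \<in> pushed J I x D"
proof -
  obtain p1 p2 where p': "p1 \<in> mpolys_upto I D" "p2 \<in> mpolys_upto I D" "p - (x * p1 + p2) \<in> J"
    using p by (rule pushedE)
  obtain q1 q2 where q': "q1 \<in> mpolys_upto I D" "q2 \<in> mpolys_upto I D" "q - (x * q1 + q2) \<in> J"
    using q by (rule pushedE)
  have eq: "p + q - (x * (p1 + q1) + (p2 + q2)) = (p - (x * p1 + p2)) + (q - (x * q1 + q2))"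
    by (simp add: algebra_simps)
  show ?thesis
    by (rule pushedI[of "p1 + q1" _ _ "p2 + q2"], unfold eq) (use p' q' J in \<open>auto intro: upto_add idl_add\<close>)
qed

lemma pushed_mult:
  assumes J: "idl J" and p: "p \<in> pushed J I x D" and w: "w \<in> mpolys_upto I e"
  shows "w * p \<in> pushed J I x (e + D)"
proof -
  obtain p1 p2 where p': "p1 \<in> mpolys_upto I D" "p2 \<in> mpolys_upto I D" "p - (x * p1 + p2) \<in> J"
    using p by (rule pushedE)
  have eq: "w * p - (x * (w * p1) + w * p2) = w * (p - (x * p1 + p2))" by (simp add: algebra_simps)
  show ?thesis
    by (rule pushedI[of "w * p1" _ _ "w * p2"], unfold eq) (use p' w J in \<open>auto intro: upto_mult idl_mult\<close>)
qed

lemma pushed_kap: "idl J \<Longrightarrow> p \<in> pushed J I x D \<Longrightarrow> kap r * p \<in> pushed J I x D"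
  using pushed_mult[of J p I x D "kap r" 0] by simp

lemma pushed_J: "p \<in> J \<Longrightarrow> p \<in> pushed J I x D"
  by (rule pushedI[of 0 _ _ 0]) simp_all

lemma pushed_upto: "idl J \<Longrightarrow> p \<in> mpolys_upto I D \<Longrightarrow> p \<in> pushed J I x D"
  by (rule pushedI[of 0 _ _ p]) (simp_all add: idl_0)

lemma pushed_mult_x: "idl J \<Longrightarrow> p \<in> mpolys_upto I D \<Longrightarrow> x * p \<in> pushed J I x D"
  by (rule pushedI[of p _ _ 0]) (simp_all add: idl_0)

lemma pushed_sum: "idl J \<Longrightarrow> (\<And>a. a \<in> A \<Longrightarrow> h a \<in> pushed J I x D) \<Longrightarrow> sum h A \<in> pushed J I x D"
  by (induction A rule: infinite_finite_induct) (auto intro: pushed_add pushed_J idl_0)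

text \<open>Up to multiples of \<open>x' = x + kap c * v\<close>, the leading form of a relation
  between \<open>x\<close> and \<open>v\<close> is its value at \<open>(- c, 1)\<close>, called
  \<open>poly top c\<close>, times \<open>v ^ m\<close>. Only finitely many \<open>c\<close> make
  this value vanish, so the infinite set \<open>Sc\<close> contains a good one.\<close>

lemma exists_monic_shift:
  fixes J :: "(nat, 'k::field) mpoly set"
  assumes J: "idl J" "1 \<notin> J" and dep: "\<not> alg_indep J [v, x]" and Sc: "infinite (Sc :: 'k set)"
    and x: "x \<in> mpolys_upto I 1" and v: "v \<in> mpolys_upto I 1"
  shows "\<exists>c\<in>Sc. \<exists>m\<ge>1. \<exists>p1\<in>mpolys_upto I (m - 1). \<exists>p2\<in>mpolys_upto I (m - 1).
    v ^ m - ((x + kap c * v) * p1 + p2) \<in> J"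
proof -
  obtain H :: "'k poly poly" where H: "H \<noteq> 0" "hev (hev kap x) v H \<in> J"
    using algebraic_relation[OF J(1) dep] by blast
  define M where "M = degree H + (\<Sum>j\<le>degree H. degree (coeff H j))"
  have degM: "degree (coeff H j) \<le> M" for j
  proof (cases "j \<le> degree H")
    case True
    then show ?thesis using member_le_sum[of j "{..degree H}" "\<lambda>j. degree (coeff H j)"] by (simp add: M_def)
  qed (simp add: coeff_eq_0)
  define g where "g = (\<lambda>i j. coeff (coeff H j) i)"
  have Hsum: "hev (hev kap x) v H = (\<Sum>j\<le>M. \<Sum>i\<le>M. kap (g i j) * x ^ i * v ^ j)"
    using degM
    by (simp add: hev_eq_sum[OF rhom_hev[OF rhom_kap], of H M] hev_eq_sum[OF rhom_kap, of _ M] M_def g_def sum_distrib_right)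
  have gM: "i \<le> M \<and> j \<le> M" if "g i j \<noteq> 0" for i j
  proof -
    have "coeff H j \<noteq> 0" "i \<le> degree (coeff H j)" using that by (auto simp: g_def le_degree)
    then show ?thesis using degM[of j] le_degree[of H j] by (simp add: M_def)
  qed
  define A where "A = {(i, j). g i j \<noteq> 0}"
  have "A \<subseteq> {..M} \<times> {..M}" using gM by (auto simp: A_def)
  then have finA: "finite A" by (rule finite_subset) simp
  have "A \<noteq> {}" using H(1) by (auto simp: A_def g_def poly_eq_iff)
  define m where "m = Max ((\<lambda>(i, j). i + j) ` A)"
  have m_le: "i + j \<le> m" if "g i j \<noteq> 0" for i j
    unfolding m_def using finA that by (intro Max_ge) (auto simp: A_def intro: rev_image_eqI[of "(i, j)"])
  have "m \<in> (\<lambda>(i, j). i + j) ` A" unfolding m_def using finA \<open>A \<noteq> {}\<close> by (intro Max_in) auto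
  then obtain i0 j0 where ij0: "g i0 j0 \<noteq> 0" "i0 + j0 = m" by (auto simp: A_def)
  define top where "top = (\<Sum>i\<le>m. monom (g i (m - i) * (- 1) ^ i) i)"
  have "coeff top i0 = g i0 (m - i0) * (- 1) ^ i0"
    unfolding top_def using ij0(2) by (simp add: coeff_sum)
  moreover have "m - i0 = j0" using ij0(2) by simp
  ultimately have "top \<noteq> 0" using ij0(1) by auto
  then have "\<not> Sc \<subseteq> {c. poly top c = 0}"
    using Sc poly_roots_finite finite_subset by blast
  then obtain c where c: "c \<in> Sc" "poly top c \<noteq> 0" by blast
  define x' where "x' = x + kap c * v"
  define V :: "nat \<Rightarrow> (nat, 'k) mpoly set" where "V = mpolys_upto I"
  define L where "L = pushed J I x'"
  note L_add = pushed_add[OF J(1), of _ I x', folded L_def]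
    and L_kap = pushed_kap[OF J(1), of _ I x', folded L_def]
    and L_J = pushed_J[of _ J I x', folded L_def]
    and L_V = pushed_upto[OF J(1), of _ I _ x', folded L_def V_def]
    and L_x = pushed_mult_x[OF J(1), of _ I _ x', folded L_def V_def]
    and L_sum = pushed_sum[OF J(1), of _ _ I x', folded L_def]
  have pw: "x ^ i * v ^ j - kap ((- c) ^ i) * v ^ m \<in> L (m - 1)" if ij: "i + j = m" for i j
  proof (cases i)
    case 0
    then show ?thesis using ij by (simp add: L_J idl_0 J)
  next
    case (Suc i')
    have m1: "m - 1 = i' + j" using ij Suc by simp
    have xv: "x - kap (- c) * v = x'" by (simp add: x'_def kap_uminus)
    have cv: "kap (- c) * v \<in> mpolys_upto I 1" using v by (rule upto_kap_mult)
    have "x ^ Suc i' - (kap (- c) * v) ^ Suc i' = x' * (\<Sum>p<Suc i'. x ^ p * (kap (- c) * v) ^ (i' - p))"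
      unfolding xv[symmetric] by (rule diff_power_eq_sum)
    then have "x ^ i * v ^ j - kap ((- c) ^ i) * v ^ m =
        x' * ((\<Sum>p<Suc i'. x ^ p * (kap (- c) * v) ^ (i' - p)) * v ^ j)"
    proof -
      assume a: "x ^ Suc i' - (kap (- c) * v) ^ Suc i' = x' * (\<Sum>p<Suc i'. x ^ p * (kap (- c) * v) ^ (i' - p))"
      have "x ^ i * v ^ j - kap ((- c) ^ i) * v ^ m = (x ^ i - (kap (- c) * v) ^ i) * v ^ j"
        by (simp only: ij[symmetric] power_add power_mult_distrib kap_power left_diff_distrib mult.assoc)
      then show ?thesis by (simp only: Suc a mult.assoc)
    qed
    moreover have "x ^ p * (kap (- c) * v) ^ (i' - p) \<in> V i'" if "p < Suc i'" for p
      unfolding V_def using upto_mult[OF upto_power[OF x, of p] upto_power[OF cv, of "i' - p"]] that by simp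
    then have "(\<Sum>p<Suc i'. x ^ p * (kap (- c) * v) ^ (i' - p)) \<in> mpolys_upto I i'"
      unfolding V_def by (intro upto_sum) simp
    from upto_mult[OF this upto_power[OF v, of j]]
    have "(\<Sum>p<Suc i'. x ^ p * (kap (- c) * v) ^ (i' - p)) * v ^ j \<in> V (m - 1)"
      unfolding V_def m1 by (simp only: mult_1)
    ultimately show ?thesis using L_x by simp
  qed
  have inner: "(\<Sum>i\<le>M. kap (g i j) * x ^ i * v ^ j) - (if j \<le> m then kap (g (m - j) j * (- c) ^ (m - j)) * v ^ m else 0) \<in> L (m - 1)" for j
  proof -
    have 1: "kap (g i j) * x ^ i * v ^ j - (if i + j = m then kap (g i j * (- c) ^ i) * v ^ m else 0) \<in> L (m - 1)" for i
    proof (cases "i + j = m")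
      case True
      then show ?thesis using L_kap[OF pw[OF True], of "g i j"] by (simp add: kap_mult algebra_simps)
    next
      case False
      show ?thesis
      proof (cases "g i j = 0")
        case True
        then show ?thesis using False by (simp add: L_J idl_0 J)
      next
        case nz: False
        then have "i + j \<le> m - 1" using m_le[OF nz] False by simp
        moreover have "x ^ i * v ^ j \<in> V (i + j)"
          unfolding V_def using upto_mult[OF upto_power[OF x, of i] upto_power[OF v, of j]] by simp
        ultimately have "kap (g i j) * (x ^ i * v ^ j) \<in> V (m - 1)"
          unfolding V_def by (intro upto_kap_mult) (auto intro: upto_mono)
        then show ?thesis using False L_V by (simp add: mult.assoc)
      qed
    qed
    have "(\<Sum>i\<le>M. if i + j = m then kap (g i j * (- c) ^ i) * v ^ m else 0) =
        (if j \<le> m then kap (g (m - j) j * (- c) ^ (m - j)) * v ^ m else 0)"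
    proof (cases "j \<le> m")
      case True
      have "(\<Sum>i\<le>M. if i + j = m then kap (g i j * (- c) ^ i) * v ^ m else 0) =
          (\<Sum>i\<le>M. if i = m - j then kap (g i j * (- c) ^ i) * v ^ m else 0)"
        using True by (intro sum.cong) auto
      then show ?thesis using True gM[of "m - j" j] by (cases "g (m - j) j = 0") simp_all
    qed auto
    then have "(\<Sum>i\<le>M. kap (g i j) * x ^ i * v ^ j) - (if j \<le> m then kap (g (m - j) j * (- c) ^ (m - j)) * v ^ m else 0) =
        (\<Sum>i\<le>M. kap (g i j) * x ^ i * v ^ j - (if i + j = m then kap (g i j * (- c) ^ i) * v ^ m else 0))"
      by (simp add: sum_subtractf)
    also have "\<dots> \<in> L (m - 1)" using 1 by (intro L_sum)
    finally show ?thesis .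
  qed
  have "(\<Sum>j\<le>M. if j \<le> m then kap (g (m - j) j * (- c) ^ (m - j)) * v ^ m else 0) = kap (poly top c) * v ^ m"
  proof -
    have "(\<Sum>j\<le>M. if j \<le> m then kap (g (m - j) j * (- c) ^ (m - j)) * v ^ m else 0) =
        (\<Sum>j\<le>m. kap (g (m - j) j * (- c) ^ (m - j)) * v ^ m)"
    proof -
      have "(\<Sum>j\<le>M. if j \<le> m then kap (g (m - j) j * (- c) ^ (m - j)) * v ^ m else 0) =
          (\<Sum>j\<in>{..M} \<inter> {..m}. kap (g (m - j) j * (- c) ^ (m - j)) * v ^ m)"
        by (subst sum.inter_restrict) simp_all
      also have "\<dots> = (\<Sum>j\<le>m. kap (g (m - j) j * (- c) ^ (m - j)) * v ^ m)"
      proof (rule sum.mono_neutral_left)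
        show "\<forall>j\<in>{..m} - {..M} \<inter> {..m}. kap (g (m - j) j * (- c) ^ (m - j)) * v ^ m = 0"
        proof
          fix j assume "j \<in> {..m} - {..M} \<inter> {..m}"
          then have "g (m - j) j = 0" using gM[of "m - j" j] by auto
          then show "kap (g (m - j) j * (- c) ^ (m - j)) * v ^ m = 0" by simp
        qed
      qed auto
      finally show ?thesis .
    qed
    also have "\<dots> = kap (\<Sum>j\<le>m. g (m - j) j * (- c) ^ (m - j)) * v ^ m"
      by (simp add: kap_sum sum_distrib_right)
    also have "(\<Sum>j\<le>m. g (m - j) j * (- c) ^ (m - j)) = (\<Sum>i\<le>m. g i (m - i) * (- c) ^ i)"
      by (rule sum.reindex_bij_witness[of _ "\<lambda>i. m - i" "\<lambda>i. m - i"]) auto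
    also have "\<dots> = poly top c"
      unfolding top_def poly_sum by (rule sum.cong) (simp_all add: poly_monom power_minus[of c] mult_ac)
    finally show ?thesis .
  qed
  then have "hev (hev kap x) v H - kap (poly top c) * v ^ m =
      (\<Sum>j\<le>M. (\<Sum>i\<le>M. kap (g i j) * x ^ i * v ^ j) - (if j \<le> m then kap (g (m - j) j * (- c) ^ (m - j)) * v ^ m else 0))"
    by (simp add: Hsum sum_subtractf)
  also have "\<dots> \<in> L (m - 1)" using inner by (intro L_sum)
  finally have d: "hev (hev kap x) v H - kap (poly top c) * v ^ m \<in> L (m - 1)" .
  have "kap (- 1) * (hev (hev kap x) v H - kap (poly top c) * v ^ m) + hev (hev kap x) v H \<in> L (m - 1)"
    by (intro L_add L_kap d L_J H(2))
  then have "kap (poly top c) * v ^ m \<in> L (m - 1)" by (simp add: kap_uminus)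
  from L_kap[OF this, of "inverse (poly top c)"] have vm: "v ^ m \<in> L (m - 1)"
    using c(2) by (simp flip: mult.assoc kap_mult)
  \<comment> \<open>A relation of degree 0 would be a nonzero constant lying in
    \<open>J\<close>.\<close>
  have "m \<noteq> 0"
  proof
    assume m0: "m = 0"
    then have z: "g i j = 0" if "i \<noteq> 0 \<or> j \<noteq> 0" for i j using m_le[of i j] that by auto
    have "hev (hev kap x) v H = kap (g 0 0)"
    proof -
      have "coeff H j = (if j = 0 then [:g 0 0:] else 0)" for j
        using z by (intro poly_eqI) (auto simp: g_def coeff_pCons split: nat.split)
      then have "H = [:[:g 0 0:]:]" by (intro poly_eqI) (auto simp: coeff_pCons split: nat.split)
      then show ?thesis by (metis hev_const rhom_hev rhom_kap)
    qed
    then have "g 0 0 = 0" using H(2) kap_mem_iff[OF J] by simp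
    then show False using ij0 z by (cases "i0 = 0 \<and> j0 = 0") auto
  qed
  then show ?thesis using vm c(1) unfolding L_def x'_def pushed_def
    by (intro bexI[of _ c] exI[of _ m]) auto
qed

text \<open>The coefficients are taken from \<open>Sc\<close>, later the complex constants in K, so
  that \<open>x\<close> of a point with coordinates of degree below \<open>b\<close> again has
  degree below \<open>b\<close>. Variables are added one at a time, each with a coefficient from
  \<open>exists_monic_shift\<close>.\<close>

theorem noether_line:
  fixes J :: "(nat, 'k::field) mpoly set"
  assumes J: "idl J" "1 \<notin> J" and dep: "\<And>x y. \<not> alg_indep J [y, x]" and Sc: "infinite (Sc :: 'k set)"
  shows "\<exists>lam. (\<forall>j<n. lam j \<in> Sc) \<and> (\<exists>N. \<forall>D\<ge>N. mpolys_upto {..<n} (Suc D) \<subseteq>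
    pushed J {..<n} (\<Sum>j<n. kap (lam j) * var j) D)"
proof (induction n)
  case 0
  have "mpolys_upto {} (Suc D) \<subseteq> pushed J {} 0 D" for D
  proof
    fix p :: "(nat, 'k) mpoly" assume "p \<in> mpolys_upto {} (Suc D)"
    then have "p \<in> mpolys_upto {} D" by (auto simp: mpolys_upto_alt)
    then show "p \<in> pushed J {} 0 D" by (rule pushed_upto[OF J(1)])
  qed
  then show ?case by simp
next
  case (Suc n)
  then obtain lam N where lam: "\<And>j. j < n \<Longrightarrow> lam j \<in> Sc"
    and N: "\<And>D. N \<le> D \<Longrightarrow> mpolys_upto {..<n} (Suc D) \<subseteq> pushed J {..<n} (\<Sum>j<n. kap (lam j) * var j) D"
    by blast
  define x where "x = (\<Sum>j<n. kap (lam j) * var j :: (nat, 'k) mpoly)"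
  let ?I = "{..<Suc n}"
  have xI: "x \<in> mpolys_upto ?I 1" unfolding x_def by (intro upto_sum upto_kap_mult var_upto) auto
  have vI: "var n \<in> mpolys_upto ?I 1" by (rule var_upto) auto
  obtain c m p1 p2 where c: "c \<in> Sc" and m: "1 \<le> m"
    and vm: "p1 \<in> mpolys_upto ?I (m - 1)" "p2 \<in> mpolys_upto ?I (m - 1)"
      "var n ^ m - ((x + kap c * var n) * p1 + p2) \<in> J"
    using exists_monic_shift[OF J dep Sc xI vI] by blast
  define x' where "x' = x + kap c * var n"
  have vm': "var n ^ m \<in> pushed J ?I x' (m - 1)"
    using vm unfolding x'_def by (rule pushedI)
  \<comment> \<open>Induction on the degree \<open>r\<close> in the old variables. For
    \<open>r \<le> N\<close> the power of the new variable is at least \<open>m\<close>, and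
    \<open>vm'\<close> applies. Otherwise the old inclusion splits \<open>p\<close>, and
    \<open>x = x' - kap c * var n\<close> trades one degree in the old variables for one in the new
    variable.\<close>
  have main: "p * var n ^ j \<in> pushed J ?I x' D"
    if "r + j = Suc D" "N + m \<le> D" "p \<in> mpolys_upto {..<n} r" for r j D p
    using that
  proof (induction r arbitrary: j p)
    case 0
    have "p \<in> mpolys_upto ?I 0" using 0 by (auto intro: upto_mono)
    then have "p * var n ^ (j - m) \<in> mpolys_upto ?I (0 + 1 * (j - m))"
      by (intro upto_mult upto_power vI)
    from pushed_mult[OF J(1) vm' this] have "p * var n ^ (j - m) * var n ^ m \<in> pushed J ?I x' (0 + 1 * (j - m) + (m - 1))" .
    moreover have "0 + 1 * (j - m) + (m - 1) = D" "j - m + m = j" using 0 m by auto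
    ultimately show ?case by (simp add: mult.assoc flip: power_add)
  next
    case (Suc r)
    show ?case
    proof (cases "Suc r \<le> N")
      case True
      have "p \<in> mpolys_upto ?I (Suc r)" using Suc.prems by (auto intro: upto_mono)
      then have "p * var n ^ (j - m) \<in> mpolys_upto ?I (Suc r + 1 * (j - m))"
        by (intro upto_mult upto_power vI)
      from pushed_mult[OF J(1) vm' this]
      have "p * var n ^ (j - m) * var n ^ m \<in> pushed J ?I x' (Suc r + 1 * (j - m) + (m - 1))" .
      moreover have "Suc r + 1 * (j - m) + (m - 1) = D" "j - m + m = j" using Suc.prems m True by auto
      ultimately show ?thesis by (simp add: mult.assoc flip: power_add)
    next
      case False
      then have "p \<in> pushed J {..<n} x r" using N[of r] Suc.prems unfolding x_def by auto
      then obtain q1 q2 where q: "q1 \<in> mpolys_upto {..<n} r" "q2 \<in> mpolys_upto {..<n} r" "p - (x * q1 + q2) \<in> J"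
        by (rule pushedE)
      have D: "r + j = D" using Suc.prems by simp
      have up: "q * var n ^ j \<in> mpolys_upto ?I D" if "q \<in> mpolys_upto {..<n} r" for q
      proof -
        have "q \<in> mpolys_upto ?I r" using that by (auto intro: upto_mono)
        from upto_mult[OF this upto_power[OF vI, of j]] show ?thesis using D by simp
      qed
      have eq: "p * var n ^ j = (p - (x * q1 + q2)) * var n ^ j + (x' * (q1 * var n ^ j) +
          (kap (- c) * (q1 * var n ^ Suc j) + q2 * var n ^ j))"
        by (simp add: x'_def algebra_simps kap_uminus)
      show ?thesis unfolding eq
      proof (intro pushed_add[OF J(1)] pushed_kap[OF J(1)])
        show "(p - (x * q1 + q2)) * var n ^ j \<in> pushed J ?I x' D"
          using q(3) by (intro pushed_J idl_mult_right J)
        show "x' * (q1 * var n ^ j) \<in> pushed J ?I x' D" using up[OF q(1)] by (rule pushed_mult_x[OF J(1)])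
        show "q2 * var n ^ j \<in> pushed J ?I x' D" using up[OF q(2)] by (rule pushed_upto[OF J(1)])
        show "q1 * var n ^ Suc j \<in> pushed J ?I x' D" using Suc.IH[OF _ _ q(1), of "Suc j"] Suc.prems by simp
      qed
    qed
  qed
  have mon_case: "mon \<mu> \<in> pushed J ?I x' D" if \<mu>: "\<mu> \<in> mons ?I (Suc D)" and D: "N + m \<le> D" for \<mu> D
  proof (cases "mdeg \<mu> \<le> D")
    case True
    then show ?thesis using \<mu> by (intro pushed_upto J mon_upto) (auto simp: mons_def)
  next
    case False
    then have dm: "mdeg \<mu> = Suc D" using \<mu> by (simp add: mons_def)
    define j where "j = Poly_Mapping.lookup \<mu> n"
    define \<mu>' where "\<mu>' = \<mu> - Poly_Mapping.single n j"
    have eq: "\<mu> = \<mu>' + Poly_Mapping.single n j"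
      unfolding \<mu>'_def j_def by (rule poly_mapping_eqI) (auto simp: lookup_add lookup_minus lookup_single when_def)
    have "Poly_Mapping.lookup \<mu>' n = 0" by (simp add: \<mu>'_def j_def lookup_minus)
    then have "n \<notin> Poly_Mapping.keys \<mu>'" by (simp add: in_keys_iff)
    moreover have "Poly_Mapping.keys \<mu>' \<subseteq> Poly_Mapping.keys \<mu>"
      by (auto simp: \<mu>'_def in_keys_iff lookup_minus)
    ultimately have "Poly_Mapping.keys \<mu>' \<subseteq> {..<n}" using \<mu> by (fastforce simp: mons_def less_Suc_eq)
    then have p: "(mon \<mu>' :: (nat, 'k) mpoly) \<in> mpolys_upto {..<n} (mdeg \<mu>')" by (rule mon_upto) simp
    have "mdeg \<mu>' + j = Suc D" using dm by (subst (asm) eq) (simp add: mdeg_add)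
    from main[OF this D p] have "(mon \<mu>' :: (nat, 'k) mpoly) * var n ^ j \<in> pushed J ?I x' D" .
    moreover have vp: "(mon (Poly_Mapping.single n l) :: (nat, 'k) mpoly) = var n ^ l" for l
    proof (induction l)
      case (Suc l)
      have "(mon (Poly_Mapping.single n (Suc l)) :: (nat, 'k) mpoly) = mon (Poly_Mapping.single n 1 + Poly_Mapping.single n l)"
        by (simp flip: single_add)
      then show ?case using Suc by (simp only: mon_add var_def[symmetric]) simp
    qed simp
    ultimately show ?thesis by (subst eq) (simp only: mon_add vp)
  qed
  have "mpolys_upto ?I (Suc D) \<subseteq> pushed J ?I x' D" if D: "N + m \<le> D" for D
  proof
    fix p :: "(nat, 'k) mpoly" assume "p \<in> mpolys_upto ?I (Suc D)"
    from upto_eq_sum[OF _ this] have "p = (\<Sum>\<mu>\<in>mons ?I (Suc D). kap (Poly_Mapping.lookup p \<mu>) * mon \<mu>)" by simp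
    also have "\<dots> \<in> pushed J ?I x' D" by (intro pushed_sum pushed_kap J mon_case D)
    finally show "p \<in> pushed J ?I x' D" .
  qed
  moreover have "(\<Sum>j<Suc n. kap ((lam(n := c)) j) * var j) = x'"
    by (simp add: x'_def x_def)
  ultimately show ?case
    using lam c by (intro exI[of _ "lam(n := c)"] conjI exI[of _ "N + m"]) (auto simp: less_Suc_eq)
qed

lemma pushed_span:
  fixes J :: "('i, 'k::field) mpoly set"
  assumes I: "finite I" and J: "idl J" and N: "\<And>D. N \<le> D \<Longrightarrow> mpolys_upto I (Suc D) \<subseteq> pushed J I x D"
    and D: "N \<le> D" "p \<in> mpolys_upto I D"
  shows "\<exists>y\<in>mp.span ((\<lambda>(i, m). x ^ i * mon m) ` ({..D} \<times> mons I N)). p - y \<in> J"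
  using D
proof (induction D arbitrary: p rule: dec_induct)
  case base
  let ?S = "(\<lambda>(i, m). x ^ i * mon m) ` ({..N} \<times> mons I N)"
  have "mon m \<in> ?S" if "m \<in> mons I N" for m
    by (rule image_eqI[of _ _ "(0, m)"]) (use that in auto)
  then have "p \<in> mp.span ?S"
    by (subst upto_eq_sum[OF I base], unfold mpoly_scale_eq[symmetric], intro mp.span_sum mp.span_scale mp.span_base)
  then show ?case using J by (intro bexI[of _ p]) (simp_all add: idl_0)
next
  case (step D)
  let ?S = "\<lambda>D. (\<lambda>(i, m). x ^ i * mon m) ` ({..D} \<times> mons I N)"
  have "p \<in> pushed J I x D" using N[OF step(1)] step(4) by blast
  then obtain p1 p2 where p: "p1 \<in> mpolys_upto I D" "p2 \<in> mpolys_upto I D" "p - (x * p1 + p2) \<in> J"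
    by (rule pushedE)
  obtain y1 y2 where y: "y1 \<in> mp.span (?S D)" "p1 - y1 \<in> J" "y2 \<in> mp.span (?S D)" "p2 - y2 \<in> J"
    using step(3)[OF p(1)] step(3)[OF p(2)] by blast
  have "x * y1 \<in> mp.span (?S (Suc D))"
  proof (rule mult_mem_span[OF y(1)])
    fix s assume "s \<in> ?S D"
    then obtain i m where s: "i \<le> D" "m \<in> mons I N" "s = x ^ i * mon m" by auto
    then have "x * s \<in> ?S (Suc D)" by (intro image_eqI[of _ _ "(Suc i, m)"]) auto
    then show "x * s \<in> mp.span (?S (Suc D))" by (rule mp.span_base)
  qed
  moreover have "y2 \<in> mp.span (?S (Suc D))"
    using y(3) mp.span_mono[of "?S D" "?S (Suc D)"] by fastforce
  ultimately have "x * y1 + y2 \<in> mp.span (?S (Suc D))" by (rule mp.span_add)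
  moreover have "p - (x * y1 + y2) \<in> J"
  proof -
    have eq: "p - (x * y1 + y2) = (p - (x * p1 + p2)) + (x * (p1 - y1) + (p2 - y2))" by (simp add: algebra_simps)
    show ?thesis unfolding eq using p(3) y(2,4) J by (intro idl_add idl_mult)
  qed
  ultimately show ?case by blast
qed

section \<open>Hilbert functions and bases modulo the ideal\<close>

lemma subspace_upto: "mp.subspace (mpolys_upto I k)"
  by (auto simp: mp.subspace_def mpoly_scale_eq intro: upto_add upto_kap_mult)

lemma upto_span:
  fixes I :: "'i set"
  assumes "finite I" shows "(mpolys_upto I k :: ('i, 'k::field) mpoly set) = mp.span (mon ` mons I k)" (is "?V = ?S")
proof
  show "?V \<subseteq> ?S"
  proof
    fix p :: "('i, 'k) mpoly" assume "p \<in> ?V"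
    from upto_eq_sum[OF assms this] show "p \<in> ?S"
      by (elim ssubst, unfold mpoly_scale_eq[symmetric], intro mp.span_sum mp.span_scale mp.span_base imageI)
  qed
  show "?S \<subseteq> ?V"
    by (intro mp.span_minimal subspace_upto) (auto intro: mon_upto simp: mons_def)
qed

text \<open>A basis of the part of \<open>C\<close> in degree at most \<open>k\<close> is extended
  to one of all polynomials of degree at most \<open>k\<close>; the added vectors represent a basis
  of the quotient.\<close>

theorem hilbert_basis:
  fixes C :: "(nat, 'k::field) mpoly set"
  assumes J: "idl (full_idl {..<n} C)"
  obtains Bs where "finite Bs" "Bs \<subseteq> mpolys_upto {..<n} k" "card Bs = hilbert_function n C k"
    "indep_mod (full_idl {..<n} C) Bs (\<lambda>b. b)"
    "\<And>p. p \<in> mpolys_upto {..<n} k \<Longrightarrow> \<exists>y\<in>mp.span Bs. p - y \<in> full_idl {..<n} C"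
proof -
  let ?J = "full_idl {..<n} C"
  let ?V = "mpolys_upto {..<n} k :: (nat, 'k) mpoly set"
  have CV: "C \<inter> ?V = ?J \<inter> ?V"
    by (auto simp: full_idl_def restr_id upto_imp_mpolys)
  define W where "W = C \<inter> ?V"
  have sW: "mp.subspace W"
    unfolding W_def CV using J
    by (auto simp: mp.subspace_def mpoly_scale_eq idl_0 intro: idl_add idl_mult upto_add upto_kap_mult)
  have Vspan: "?V = mp.span (mon ` mons {..<n} k)" by (rule upto_span) simp
  obtain BW where BW: "BW \<subseteq> W" "mp.independent BW" "W \<subseteq> mp.span BW" "card BW = mp.dim W"
    using mp.basis_exists by blast
  have "BW \<subseteq> ?V" using BW(1) by (auto simp: W_def)
  then obtain BV where BV: "BW \<subseteq> BV" "BV \<subseteq> ?V" "mp.independent BV" "?V \<subseteq> mp.span BV"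
    using mp.maximal_independent_subset_extend[OF _ BW(2)] by metis
  have finV: "finite BV"
    using mp.independent_span_bound[OF finite_imageI[OF finite_mons[OF finite_lessThan]] BV(3)] BV(2) Vspan
    by auto
  define Bs where "Bs = BV - BW"
  have "mp.dim ?V = card BV" by (rule mp.dim_unique[OF BV(2,4,3) refl])
  then have "hilbert_function n C k = card BV - card BW"
    unfolding hilbert_function_def using BW(4) by (simp add: W_def)
  then have card: "card Bs = hilbert_function n C k"
    using BV(1) finV by (simp add: Bs_def card_Diff_subset finite_subset)
  have finW: "finite BW" using BV(1) finV by (rule finite_subset)
  have "indep_mod ?J Bs (\<lambda>b. b)"
    unfolding indep_mod_def
  proof (intro allI impI)
    fix l assume l: "(\<Sum>a\<in>Bs. kap (l a) * a) \<in> ?J"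
    have "(\<Sum>a\<in>Bs. kap (l a) * a) \<in> ?V" using BV(2) by (intro upto_sum upto_kap_mult) (auto simp: Bs_def)
    then have "(\<Sum>a\<in>Bs. kap (l a) * a) \<in> mp.span BW" using l CV BW(3) by (auto simp: W_def)
    then obtain u where u: "(\<Sum>a\<in>Bs. kap (l a) * a) = (\<Sum>a\<in>BW. mpoly_scale (u a) a)"
      unfolding mp.span_finite[OF finW] by blast
    define w where "w = (\<lambda>a. if a \<in> BW then - u a else l a)"
    have "(\<Sum>a\<in>BV. mpoly_scale (w a) a) = (\<Sum>a\<in>Bs. mpoly_scale (w a) a) + (\<Sum>a\<in>BW. mpoly_scale (w a) a)"
      unfolding Bs_def using BV(1) finV by (rule sum.subset_diff)
    also have "(\<Sum>a\<in>Bs. mpoly_scale (w a) a) = (\<Sum>a\<in>Bs. kap (l a) * a)"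
      by (rule sum.cong) (auto simp: w_def Bs_def mpoly_scale_eq)
    also have "(\<Sum>a\<in>BW. mpoly_scale (w a) a) = - (\<Sum>a\<in>BW. mpoly_scale (u a) a)"
      unfolding sum_negf[symmetric] by (rule sum.cong) (auto simp: w_def mpoly_scale_eq kap_uminus)
    finally have "(\<Sum>a\<in>BV. mpoly_scale (w a) a) = 0" using u by simp
    then have "w a = 0" if "a \<in> BV" for a
      using mp.independentD[OF BV(3) finV subset_refl _ that] by blast
    then show "\<forall>a\<in>Bs. l a = 0" unfolding Bs_def w_def by (metis DiffE)
  qed
  moreover have "\<exists>y\<in>mp.span Bs. p - y \<in> ?J" if p: "p \<in> ?V" for p
  proof -
    obtain u where u: "p = (\<Sum>a\<in>BV. mpoly_scale (u a) a)"
      using p BV(4) unfolding mp.span_finite[OF finV] by blast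
    have "p = (\<Sum>a\<in>Bs. mpoly_scale (u a) a) + (\<Sum>a\<in>BW. mpoly_scale (u a) a)"
      unfolding u Bs_def using BV(1) finV by (rule sum.subset_diff)
    moreover have "(\<Sum>a\<in>BW. mpoly_scale (u a) a) \<in> W"
      using BW(1) sW by (intro mp.subspace_sum mp.subspace_scale) auto
    then have "(\<Sum>a\<in>BW. mpoly_scale (u a) a) \<in> ?J" using CV by (auto simp: W_def)
    moreover have "(\<Sum>a\<in>Bs. mpoly_scale (u a) a) \<in> mp.span Bs"
      by (intro mp.span_sum mp.span_scale mp.span_base)
    ultimately show ?thesis by (intro bexI[of _ "\<Sum>a\<in>Bs. mpoly_scale (u a) a"]) simp_all
  qed
  ultimately show ?thesis using that[of Bs] card finV BV(2) by (auto simp: Bs_def)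
qed

lemma indep_mod_le_hilbert:
  fixes C :: "(nat, 'k::field) mpoly set"
  assumes J: "idl (full_idl {..<n} C)" and A: "finite A" "\<And>a. a \<in> A \<Longrightarrow> f a \<in> mpolys_upto {..<n} k"
    and ind: "indep_mod (full_idl {..<n} C) A f"
  shows "card A \<le> hilbert_function n C k"
proof -
  obtain Bs where Bs: "finite Bs" "card Bs = hilbert_function n C k"
    "\<And>p. p \<in> mpolys_upto {..<n} k \<Longrightarrow> \<exists>y\<in>mp.span Bs. p - y \<in> full_idl {..<n} C"
    by (rule hilbert_basis[OF J, of k]) blast
  show ?thesis using indep_mod_card_span[OF J A(1) Bs(1) ind] A(2) Bs(2,3) by simp
qed

text \<open>Multiplication by \<open>g\<close> outside the prime ideal preserves independence, so
  denominators may be cleared before spanning sets are counted.\<close>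

lemma hilbert_le_span:
  fixes C :: "(nat, 'k::field) mpoly set"
  assumes J: "prime_idl (full_idl {..<n} C)" and g: "g \<notin> full_idl {..<n} C" and G: "finite G"
    and sp: "\<And>p. p \<in> mpolys_upto {..<n} k \<Longrightarrow> \<exists>y\<in>mp.span G. g * p - y \<in> full_idl {..<n} C"
  shows "hilbert_function n C k \<le> card G"
proof -
  have idlJ: "idl (full_idl {..<n} C)" using J by (rule prime_idl_idl)
  obtain Bs where Bs: "finite Bs" "Bs \<subseteq> mpolys_upto {..<n} k" "card Bs = hilbert_function n C k"
    "indep_mod (full_idl {..<n} C) Bs (\<lambda>b. b)"
    by (rule hilbert_basis[OF idlJ, of k]) blast
  have "card Bs \<le> card G"
    using sp Bs(2) by (intro indep_mod_card_span[OF idlJ Bs(1) G indep_mod_mult[OF J g Bs(4)]]) auto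
  then show ?thesis using Bs(3) by simp
qed

section \<open>The function field of a curve\<close>

lemma of_rat_poly: "of_rat (poly p v) = poly (map_poly (of_rat :: rat \<Rightarrow> real) p) (of_rat v)"
  by (induction p) (simp_all add: map_poly_pCons of_rat_add of_rat_mult)

text \<open>\<open>has_degree\<close> leaves the degree of the Hilbert polynomial open. Values that
  are eventually nonnegative and linearly bounded force it to be at most 1, by the sign of the
  leading coefficient.\<close>

lemma rat_poly_linear_growth:
  fixes p :: "rat poly" and h :: "nat \<Rightarrow> nat"
  assumes ev: "\<forall>\<^sub>F k in sequentially. poly p (of_nat k) = of_nat (h k)"
    and bd: "\<forall>\<^sub>F k in sequentially. h k \<le> (k + 1) * K"
  shows "degree p \<le> 1"
proof (rule ccontr)
  assume "\<not> ?thesis"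
  then have deg: "2 \<le> degree p" by simp
  define P where "P = map_poly (of_rat :: rat \<Rightarrow> real) p"
  have degP: "degree P = degree p" unfolding P_def by (rule degree_map_poly) simp
  have P: "poly P (real k) = of_rat (poly p (of_nat k))" for k
    by (simp add: P_def of_rat_poly)
  have ev': "\<forall>\<^sub>F k in sequentially. poly P (real k) = real (h k) \<and> real (h k) \<le> (real k + 1) * real K"
    using ev bd
  proof eventually_elim
    case (elim k)
    have "real (h k) \<le> real ((k + 1) * K)" using elim(2) by (simp only: of_nat_le_iff)
    then have "real (h k) \<le> (real k + 1) * real K" by (simp add: algebra_simps)
    moreover have "poly P (real k) = real (h k)" unfolding P elim(1) by simp
    ultimately show ?case by blast
  qed
  have contra: False if q0: "0 < lead_coeff q" and q: "\<forall>\<^sub>F k in sequentially. poly q (real k) \<le> 0" for q :: "real poly"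
  proof -
    obtain x0 where "\<forall>x\<ge>x0. lead_coeff q \<le> poly q x" using poly_pinfty_gt_lc[OF q0] by blast
    moreover have "\<forall>\<^sub>F k in sequentially. x0 \<le> real k"
      using filterlim_real_sequentially by (simp add: filterlim_at_top)
    ultimately have "\<forall>\<^sub>F k in sequentially. lead_coeff q \<le> poly q (real k)"
      by (auto elim: eventually_mono)
    then have "\<forall>\<^sub>F k in sequentially. False"
      using q by eventually_elim (use q0 in linarith)
    then show False by simp
  qed
  have "P \<noteq> 0" using deg degP by auto
  then have lc: "lead_coeff P \<noteq> 0" by simp
  show False
  proof (cases "0 < lead_coeff P")
    case True
    define r where "r = [:real K, real K:]"
    let ?q = "P - r"
    have dq: "degree r < degree P" using deg degP by (simp add: r_def degree_pCons_eq_if)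
    then have "degree (P + - r) = degree P" by (intro degree_add_eq_left) simp
    then have "lead_coeff ?q = lead_coeff P" using dq by (simp add: coeff_eq_0)
    then have "0 < lead_coeff ?q" using True by simp
    moreover have "\<forall>\<^sub>F k in sequentially. poly ?q (real k) \<le> 0"
      using ev' by eventually_elim (simp add: r_def algebra_simps)
    ultimately show False by (rule contra)
  next
    case False
    then have "lead_coeff P < 0" using lc by linarith
    then have "0 < lead_coeff (- P)" by simp
    moreover have "\<forall>\<^sub>F k in sequentially. poly (- P) (real k) \<le> 0"
      using ev' by eventually_elim simp
    ultimately show False by (rule contra)
  qed
qed

text \<open>The curve together with a linear form \<open>x\<close> over which it is finite.
  Characteristic 0 serves the separability of minimal polynomials.\<close>

locale curve_coord =
  fixes n :: nat and C :: "(nat, 'k::field) mpoly set" and d :: nat and lam :: "nat \<Rightarrow> 'k" and N :: nat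
    and J :: "(nat, 'k) mpoly set" and x :: "(nat, 'k) mpoly" and aev :: "'k poly \<Rightarrow> (nat, 'k) mpoly"
  assumes prime: "primeideal C (mpoly_ring {..<n})" and dim: "ring_krull_dim (mpoly_ring {..<n} Quot C) = 1"
    and deg: "has_degree n C d" and char0: "\<And>m. 0 < m \<Longrightarrow> of_nat m \<noteq> (0 :: 'k)"
    and J_def: "J = full_idl {..<n} C" and x_def: "x = (\<Sum>j<n. kap (lam j) * var j)"
    and aev_def: "aev = hev kap x"
    and N: "\<And>D. N \<le> D \<Longrightarrow> mpolys_upto {..<n} (Suc D) \<subseteq> pushed J {..<n} x D"
begin

abbreviation V :: "nat \<Rightarrow> (nat, 'k) mpoly set" where "V \<equiv> mpolys_upto {..<n}"

lemma prJ: "prime_idl J" unfolding J_def by (rule prime_full_idl[OF prime])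
lemma idlJ: "idl J" using prJ by (rule prime_idl_idl)
lemma oneJ: "1 \<notin> J" using prJ by (simp add: prime_idl_def)

lemma raev: "rhom aev" unfolding aev_def by (rule rhom_hev[OF rhom_kap])

lemma x_upto: "x \<in> V 1"
  unfolding x_def by (intro upto_sum upto_kap_mult var_upto) auto

lemma aev_eq_sum: "degree a \<le> M \<Longrightarrow> aev a = (\<Sum>i\<le>M. kap (coeff a i) * x ^ i)"
  unfolding aev_def by (rule hev_eq_sum[OF rhom_kap])

lemma aev_const: "aev [:c:] = kap c"
  unfolding aev_def by (rule hev_const[OF rhom_kap])

lemma aev_monom: "aev (monom c i) = kap c * x ^ i"
  by (simp add: aev_def hev_def map_poly_monom poly_monom)

definition grid :: "nat \<Rightarrow> (nat, 'k) mpoly set" where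
  "grid D = (\<lambda>(i, m). x ^ i * mon m) ` ({..D} \<times> mons {..<n} N)"

lemma upto_grid: "N \<le> D \<Longrightarrow> p \<in> V D \<Longrightarrow> \<exists>y\<in>mp.span (grid D). p - y \<in> J"
  unfolding grid_def by (rule pushed_span[OF _ idlJ N]) auto

lemma hilbert_le: assumes "N \<le> D" shows "hilbert_function n C D \<le> (D + 1) * card (mons {..<n} N)"
proof -
  have fin: "finite (grid D)" unfolding grid_def by (simp add: finite_mons)
  have "hilbert_function n C D \<le> card (grid D)"
    by (rule hilbert_le_span[of n C 1, folded J_def]) (use prJ oneJ fin upto_grid[OF assms] in auto)
  also have "\<dots> \<le> card ({..D} \<times> mons {..<n} N)" unfolding grid_def by (rule card_image_le) (simp add: finite_mons)
  finally show ?thesis by (simp add: card_cartesian_product)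
qed

text \<open>Let \<open>a\<close> be nonzero and not invertible modulo \<open>J\<close>. Then 1
  together with \<open>a\<close> times a basis in degree \<open>D\<close> is independent, because a
  relation would either invert \<open>a\<close> or contradict the basis. So each value of the
  Hilbert function is exceeded later on.\<close>

lemma hilbert_not_constant: "\<not> (\<forall>\<^sub>F k in sequentially. hilbert_function n C k = M)"
proof
  assume "\<forall>\<^sub>F k in sequentially. hilbert_function n C k = M"
  then obtain D where D: "\<And>k. D \<le> k \<Longrightarrow> hilbert_function n C k = M" by (auto simp: eventually_sequentially)
  obtain a where a: "a \<notin> J" "\<And>s. 1 - a * s \<notin> J"
    using non_unit_of_krull_dim_1[OF prime dim] unfolding J_def by blast
  define a' where "a' = restr {..<n} a"
  have aa': "a - a' \<in> J" unfolding a'_def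
  proof (rule diff_restr[OF idlJ])
    interpret C: primeideal C "mpoly_ring {..<n}" by (rule prime)
    show "var i \<in> J" if "i \<notin> {..<n}" for i
      unfolding J_def using var_full_idl[OF _ that] additive_subgroup.zero_closed[OF C.additive_subgroup_axioms] by simp
  qed
  have a'J: "a' \<notin> J" using a(1) idl_cong[OF idlJ aa'] by simp
  obtain e where e: "a' \<in> V e" using mpolys_imp_upto[OF restr_in] unfolding a'_def by blast
  obtain Bs where Bs: "finite Bs" "Bs \<subseteq> V D" "card Bs = hilbert_function n C D" "indep_mod J Bs (\<lambda>b. b)"
    by (rule hilbert_basis[of n C D, folded J_def, OF idlJ]) blast
  define f where "f = case_option 1 (\<lambda>b. a' * b)"
  have "indep_mod J (insert None (Some ` Bs)) f"
    unfolding indep_mod_def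
  proof (intro allI impI)
    fix l assume "(\<Sum>z\<in>insert None (Some ` Bs). kap (l z) * f z) \<in> J"
    moreover have "(\<Sum>z\<in>insert None (Some ` Bs). kap (l z) * f z) = kap (l None) + a' * (\<Sum>b\<in>Bs. kap (l (Some b)) * b)"
      using Bs(1) by (simp add: f_def sum.reindex sum_distrib_left mult_ac)
    ultimately have *: "kap (l None) + a' * (\<Sum>b\<in>Bs. kap (l (Some b)) * b) \<in> J" by simp
    have "l None = 0"
    proof (rule ccontr)
      assume nz: "l None \<noteq> 0"
      define S where "S = (\<Sum>b\<in>Bs. kap (l (Some b)) * b)"
      have eq: "1 - a * (- kap (inverse (l None)) * S) =
          kap (inverse (l None)) * (kap (l None) + a' * S) + (kap (inverse (l None)) * S) * (a - a')"
        using nz by (simp add: algebra_simps flip: kap_mult mult.assoc)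
      have "1 - a * (- kap (inverse (l None)) * S) \<in> J"
        unfolding eq by (rule idl_add[OF idlJ idl_mult[OF idlJ *[folded S_def]] idl_mult[OF idlJ aa']])
      then show False using a(2) by blast
    qed
    then have "(\<Sum>b\<in>Bs. kap (l (Some b)) * b) \<in> J" using * a'J by (simp add: prime_idl_mult[OF prJ])
    then have "\<forall>b\<in>Bs. l (Some b) = 0"
      using Bs(4) unfolding indep_mod_def by (elim allE[of _ "\<lambda>b. l (Some b)"]) simp
    then show "\<forall>z\<in>insert None (Some ` Bs). l z = 0" using \<open>l None = 0\<close> by auto
  qed
  moreover have "f z \<in> V (e + D)" if "z \<in> insert None (Some ` Bs)" for z
    using that Bs(2) e by (auto simp: f_def intro!: upto_mult)
  ultimately have "card (insert None (Some ` Bs)) \<le> hilbert_function n C (e + D)"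
    using Bs(1) by (intro indep_mod_le_hilbert[of n C, folded J_def, OF idlJ]) auto
  moreover have "card (insert None (Some ` Bs)) = Suc (card Bs)"
    using Bs(1) by (subst card_insert_disjoint) (auto simp: card_image)
  ultimately show False using D[of "e + D"] D[of D] Bs(3) by simp
qed

lemma hilbert_linear: "1 \<le> d \<and> (\<exists>\<beta>. \<forall>\<^sub>F k in sequentially. int (hilbert_function n C k) = int d * int k + \<beta>)"
proof -
  obtain h :: "rat poly" where h: "\<forall>\<^sub>F k in sequentially. poly h (of_nat k) = of_nat (hilbert_function n C k)"
    "of_nat d = fact (degree h) * lead_coeff h" using deg unfolding has_degree_def by blast
  have "\<forall>\<^sub>F k in sequentially. hilbert_function n C k \<le> (k + 1) * card (mons {..<n} N)"
    using eventually_ge_at_top[of N] by eventually_elim (rule hilbert_le)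
  then have d1: "degree h \<le> 1" by (rule rat_poly_linear_growth[OF h(1)])
  have "degree h \<noteq> 0"
  proof
    assume "degree h = 0"
    then obtain c where c: "h = [:c:]" by (rule degree_eq_zeroE)
    obtain k0 where "\<And>k. k0 \<le> k \<Longrightarrow> c = of_nat (hilbert_function n C k)"
      using h(1) by (auto simp: c eventually_sequentially)
    then have "\<And>k. k0 \<le> k \<Longrightarrow> hilbert_function n C k = hilbert_function n C k0" by (metis le_refl of_nat_eq_iff)
    then show False using hilbert_not_constant unfolding eventually_sequentially by blast
  qed
  then have dh: "degree h = 1" using d1 by simp
  have lead: "coeff h 1 = of_nat d" using h(2) dh by simp
  have ph: "poly h v = coeff h 0 + of_nat d * v" for v
    using dh lead by (simp add: poly_altdef)
  obtain k0 where k0: "\<And>k. k0 \<le> k \<Longrightarrow> poly h (of_nat k) = of_nat (hilbert_function n C k)"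
    using h(1) by (auto simp: eventually_sequentially)
  define \<beta> where "\<beta> = int (hilbert_function n C k0) - int d * int k0"
  have "int (hilbert_function n C k) = int d * int k + \<beta>" if "k0 \<le> k" for k
  proof -
    have "(of_int (int (hilbert_function n C k)) :: rat) = of_int (int d * int k + \<beta>)"
      using k0[OF that] k0[OF le_refl] by (simp add: ph \<beta>_def algebra_simps)
    then show ?thesis by (simp only: of_int_eq_iff)
  qed
  then have "\<forall>\<^sub>F k in sequentially. int (hilbert_function n C k) = int d * int k + \<beta>"
    unfolding eventually_sequentially by blast
  moreover have "d \<noteq> 0"
  proof
    assume "d = 0"
    then have "coeff h 1 = 0" using lead by simp
    then show False using dh by (metis leading_coeff_0_iff zero_neq_one degree_0)
  qed
  ultimately show ?thesis by auto
qed

lemma le_of_hilbert_upper: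
  assumes "\<And>D. D0 \<le> D \<Longrightarrow> hilbert_function n C D \<le> s * (D + A)" shows "d \<le> s"
proof (rule ccontr)
  assume "\<not> ?thesis"
  then have sd: "int s + 1 \<le> int d" by simp
  obtain \<beta> k0 where k0: "\<And>k. k0 \<le> k \<Longrightarrow> int (hilbert_function n C k) = int d * int k + \<beta>"
    using hilbert_linear by (auto simp: eventually_sequentially)
  define D where "D = D0 + k0 + s * A + nat \<bar>\<beta>\<bar> + 1"
  have "int d * int D + \<beta> \<le> int (s * (D + A))"
  proof -
    have "D0 \<le> D" "k0 \<le> D" by (simp_all add: D_def)
    then show ?thesis using assms[of D] k0[of D] by (metis of_nat_le_iff)
  qed
  also have "\<dots> = int s * int D + int (s * A)" by (simp add: algebra_simps)
  finally have "(int s + 1) * int D + \<beta> \<le> int s * int D + int (s * A)"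
    using mult_right_mono[OF sd, of "int D"] by simp
  then have "int D + \<beta> \<le> int (s * A)" by (simp add: algebra_simps)
  then show False by (simp add: D_def)
qed

lemma le_of_hilbert_lower:
  assumes "\<And>D. D0 \<le> D \<Longrightarrow> s * (D - A) \<le> hilbert_function n C D" shows "s \<le> d"
proof (rule ccontr)
  assume "\<not> ?thesis"
  then have sd: "int d + 1 \<le> int s" by simp
  obtain \<beta> k0 where k0: "\<And>k. k0 \<le> k \<Longrightarrow> int (hilbert_function n C k) = int d * int k + \<beta>"
    using hilbert_linear by (auto simp: eventually_sequentially)
  define E where "E = D0 + k0 + d * A + nat \<bar>\<beta>\<bar> + 1"
  have "int (s * E) \<le> int d * int (E + A) + \<beta>"
  proof -
    have "D0 \<le> E + A" "k0 \<le> E + A" by (simp_all add: E_def)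
    then show ?thesis using assms[of "E + A"] k0[of "E + A"] by (metis add_diff_cancel_right' of_nat_le_iff)
  qed
  moreover have "(int d + 1) * int E \<le> int (s * E)"
    using mult_right_mono[OF sd, of "int E"] by simp
  ultimately have "int E \<le> int (d * A) + \<beta>" by (simp add: algebra_simps)
  then show False by (simp add: E_def)
qed

text \<open>If \<open>x\<close> were algebraic, its powers would span a finite-dimensional space
  modulo \<open>J\<close>, and so would all polynomials, being combinations of \<open>x ^ i\<close>
  times finitely many monomials. The Hilbert function would be bounded, although it grows with slope
  \<open>d \<ge> 1\<close>.\<close>

lemma x_transcendental: assumes "aev a \<in> J" shows "a = 0"
proof (rule ccontr)
  assume a0: "a \<noteq> 0"
  define e where "e = degree a"
  define S where "S = (\<lambda>l. x ^ l) ` {..<e}"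
  define lc where "lc = lead_coeff a"
  have lc: "lc \<noteq> 0" using a0 by (simp add: lc_def)
  have xe: "\<exists>y\<in>mp.span S. x ^ e - y \<in> J"
  proof -
    define y where "y = (\<Sum>l<e. mpoly_scale (- (inverse lc * coeff a l)) (x ^ l))"
    have "{..e} = insert e {..<e}" by auto
    then have "aev a = kap lc * x ^ e + (\<Sum>l<e. kap (coeff a l) * x ^ l)"
      using aev_eq_sum[of a e] by (simp add: e_def lc_def)
    then have "kap (inverse lc) * aev a = kap (inverse lc * lc) * x ^ e + (\<Sum>l<e. kap (inverse lc * coeff a l) * x ^ l)"
      by (simp only: distrib_left sum_distrib_left kap_mult mult.assoc)
    also have "(\<Sum>l<e. kap (inverse lc * coeff a l) * x ^ l) = - y"
      unfolding y_def sum_negf[symmetric] mpoly_scale_eq kap_uminus by simp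
    also have "kap (inverse lc * lc) = 1" using lc by simp
    finally have "kap (inverse lc) * aev a = x ^ e - y" by simp
    moreover have "kap (inverse lc) * aev a \<in> J" by (intro idl_mult idlJ assms)
    moreover have "y \<in> mp.span S" unfolding y_def S_def by (intro mp.span_sum mp.span_scale mp.span_base) auto
    ultimately show ?thesis by auto
  qed
  have xi: "\<exists>y\<in>mp.span S. x ^ i - y \<in> J" for i
  proof (induction i)
    case 0
    show ?case
    proof (cases "e = 0")
      case False
      then have "x ^ 0 \<in> S" unfolding S_def by blast
      then show ?thesis using idl_0[OF idlJ] by (intro bexI[of _ "x ^ 0"] mp.span_base) auto
    qed (use xe in simp)
  next
    case (Suc i)
    then obtain y where y: "y \<in> mp.span S" "x ^ i - y \<in> J" by blast
    have "\<exists>z\<in>mp.span S. x * y - z \<in> J"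
    proof (rule span_mod_idl[OF idlJ y(1)])
      fix s assume "s \<in> S"
      then obtain l where l: "l < e" "s = x ^ l" by (auto simp: S_def)
      show "\<exists>z\<in>mp.span S. x * s - z \<in> J"
      proof (cases "Suc l = e")
        case True
        then show ?thesis using xe l by auto
      next
        case False
        then have "x ^ Suc l \<in> S" using l unfolding S_def by (intro imageI) simp
        then show ?thesis using idl_0[OF idlJ] l by (intro bexI[of _ "x ^ Suc l"] mp.span_base) auto
      qed
    qed
    then obtain z where z: "z \<in> mp.span S" "x * y - z \<in> J" by blast
    have "x ^ Suc i - z = x * (x ^ i - y) + (x * y - z)" by (simp add: algebra_simps)
    also have "\<dots> \<in> J" using y z by (intro idl_add idl_mult idlJ)
    finally show ?case using z(1) by blast
  qed
  define G where "G = (\<lambda>(l, m). x ^ l * mon m) ` ({..<e} \<times> mons {..<n} N)"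
  have finG: "finite G" unfolding G_def by (simp add: finite_mons)
  have bound: "hilbert_function n C D \<le> card G" if "N \<le> D" for D
  proof -
    have "\<exists>y\<in>mp.span G. 1 * p - y \<in> J" if p: "p \<in> V D" for p
    proof -
      obtain y where y: "y \<in> mp.span (grid D)" "p - y \<in> J" using upto_grid[OF \<open>N \<le> D\<close> p] by blast
      have "\<exists>z\<in>mp.span G. 1 * y - z \<in> J"
      proof (rule span_mod_idl[OF idlJ y(1)])
        fix s assume "s \<in> grid D"
        then obtain i m where s: "m \<in> mons {..<n} N" "s = x ^ i * mon m" by (auto simp: grid_def)
        obtain u where u: "u \<in> mp.span S" "x ^ i - u \<in> J" using xi by blast
        have "mon m * u \<in> mp.span G"
        proof (rule mult_mem_span[OF u(1)])
          fix t assume "t \<in> S"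
          then obtain l where "l < e" "t = x ^ l" by (auto simp: S_def)
          then have "mon m * t \<in> G" unfolding G_def using s(1)
            by (intro image_eqI[of _ _ "(l, m)"]) (auto simp: mult.commute)
          then show "mon m * t \<in> mp.span G" by (rule mp.span_base)
        qed
        moreover have "1 * s - mon m * u = mon m * (x ^ i - u)" by (simp add: s(2) algebra_simps)
        then have "1 * s - mon m * u \<in> J" using idl_mult[OF idlJ u(2)] by simp
        ultimately show "\<exists>z\<in>mp.span G. 1 * s - z \<in> J" by blast
      qed
      then obtain z where "z \<in> mp.span G" "1 * y - z \<in> J" by blast
      then show ?thesis using idl_diff_trans[OF idlJ y(2), of z] by auto
    qed
    then show ?thesis
      using hilbert_le_span[of n C 1 G D, folded J_def, OF prJ oneJ finG] by simp
  qed
  have "1 \<le> d" using hilbert_linear by blast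
  obtain \<beta> k0 where k0: "\<And>k. k0 \<le> k \<Longrightarrow> int (hilbert_function n C k) = int d * int k + \<beta>"
    using hilbert_linear by (auto simp: eventually_sequentially)
  define D where "D = N + k0 + card G + nat \<bar>\<beta>\<bar> + 1"
  have "int d * int D + \<beta> \<le> int (card G)"
  proof -
    have "N \<le> D" "k0 \<le> D" by (simp_all add: D_def)
    then show ?thesis using bound[of D] k0[of D] by (metis of_nat_le_iff)
  qed
  moreover have "1 * int D \<le> int d * int D" using \<open>1 \<le> d\<close> by (intro mult_right_mono) auto
  ultimately show False by (simp add: D_def)
qed

end

section \<open>Linear algebra over the field of rational functions in x\<close>

context curve_coord
begin

definition lin_indep :: "nat \<Rightarrow> (nat \<Rightarrow> (nat, 'k) mpoly) \<Rightarrow> bool" where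
  "lin_indep s w \<longleftrightarrow> (\<forall>a. (\<Sum>j<s. aev (a j) * w j) \<in> J \<longrightarrow> (\<forall>j<s. a j = 0))"

text \<open>The span is meant over the field of rational functions in \<open>x\<close>; fractions
  are avoided by a common nonzero denominator \<open>a\<close>.\<close>

definition in_span :: "nat \<Rightarrow> (nat \<Rightarrow> (nat, 'k) mpoly) \<Rightarrow> (nat, 'k) mpoly \<Rightarrow> bool" where
  "in_span s w v \<longleftrightarrow> (\<exists>a b. a \<noteq> 0 \<and> aev a * v - (\<Sum>j<s. aev (b j) * w j) \<in> J)"

lemma in_spanI: "a \<noteq> 0 \<Longrightarrow> aev a * v - (\<Sum>j<s. aev (b j) * w j) \<in> J \<Longrightarrow> in_span s w v"
  unfolding in_span_def by blast

lemma in_spanE: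
  assumes "in_span s w v"
  obtains a b where "a \<noteq> 0" "aev a * v - (\<Sum>j<s. aev (b j) * w j) \<in> J"
  using assms unfolding in_span_def by blast

lemma aev_nonzero: "a \<noteq> 0 \<Longrightarrow> aev a \<notin> J"
  using x_transcendental by blast

lemma lin_indep_extend:
  assumes ind: "lin_indep s w" and v: "\<not> in_span s w v"
  shows "lin_indep (Suc s) (w(s := v))"
  unfolding lin_indep_def
proof (intro allI impI)
  fix a j assume a: "(\<Sum>j<Suc s. aev (a j) * (w(s := v)) j) \<in> J" and j: "j < Suc s"
  have eq: "(\<Sum>j<Suc s. aev (a j) * (w(s := v)) j) = aev (a s) * v - (\<Sum>j<s. aev (- a j) * w j)"
    using rhom_diff[OF raev, of 0] by (simp add: rhom_0[OF raev] sum_negf)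
  have as: "a s = 0"
  proof (rule ccontr)
    assume "a s \<noteq> 0"
    then have "in_span s w v" using a unfolding eq by (rule in_spanI)
    then show False using v by simp
  qed
  then have "(\<Sum>j<s. aev (a j) * w j) \<in> J" using a by (simp add: rhom_0[OF raev])
  then show "a j = 0" using ind as j unfolding lin_indep_def by (cases "j = s") auto
qed

lemma in_span_J: assumes "v \<in> J" shows "in_span s w v"
  by (rule in_spanI[where a = 1 and b = "\<lambda>_. 0"]) (use assms in \<open>simp_all add: rhom_0[OF raev] rhom_1[OF raev]\<close>)

lemma in_span_add:
  assumes "in_span s w u" "in_span s w v" shows "in_span s w (u + v)"
proof -
  obtain a b where u: "a \<noteq> 0" "aev a * u - (\<Sum>j<s. aev (b j) * w j) \<in> J" using assms(1) by (rule in_spanE)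
  obtain a' b' where v: "a' \<noteq> 0" "aev a' * v - (\<Sum>j<s. aev (b' j) * w j) \<in> J" using assms(2) by (rule in_spanE)
  show ?thesis
  proof (rule in_spanI[where a = "a * a'" and b = "\<lambda>j. a' * b j + a * b' j"])
    have eq: "aev (a * a') * (u + v) - (\<Sum>j<s. aev (a' * b j + a * b' j) * w j) =
        aev a' * (aev a * u - (\<Sum>j<s. aev (b j) * w j)) + aev a * (aev a' * v - (\<Sum>j<s. aev (b' j) * w j))"
      by (simp add: rhom_mult[OF raev] rhom_add[OF raev] sum.distrib sum_distrib_left algebra_simps)
    show "aev (a * a') * (u + v) - (\<Sum>j<s. aev (a' * b j + a * b' j) * w j) \<in> J"
      unfolding eq by (rule idl_add[OF idlJ idl_mult[OF idlJ u(2)] idl_mult[OF idlJ v(2)]])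
  qed (use u v in simp)
qed

lemma in_span_mult:
  assumes "in_span s w v" shows "in_span s w (aev c * v)"
proof -
  obtain a b where v: "a \<noteq> 0" "aev a * v - (\<Sum>j<s. aev (b j) * w j) \<in> J" using assms by (rule in_spanE)
  show ?thesis
  proof (rule in_spanI[where a = a and b = "\<lambda>j. c * b j"])
    have eq: "aev a * (aev c * v) - (\<Sum>j<s. aev (c * b j) * w j) = aev c * (aev a * v - (\<Sum>j<s. aev (b j) * w j))"
      by (simp add: rhom_mult[OF raev] sum_distrib_left algebra_simps)
    show "aev a * (aev c * v) - (\<Sum>j<s. aev (c * b j) * w j) \<in> J"
      unfolding eq by (rule idl_mult[OF idlJ v(2)])
  qed (rule v(1))
qed

lemma in_span_sum: "(\<And>i. i \<in> A \<Longrightarrow> in_span s w (h i)) \<Longrightarrow> in_span s w (sum h A)"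
  by (induction A rule: infinite_finite_induct) (auto intro: in_span_add in_span_J idl_0[OF idlJ])

lemma in_span_divide:
  assumes c: "c \<noteq> 0" and u: "in_span s w u" and d: "aev c * v - u \<in> J"
  shows "in_span s w v"
proof -
  obtain a b where v: "a \<noteq> 0" "aev a * u - (\<Sum>j<s. aev (b j) * w j) \<in> J" using u by (rule in_spanE)
  show ?thesis
  proof (rule in_spanI[where a = "a * c" and b = b])
    have eq: "aev (a * c) * v - (\<Sum>j<s. aev (b j) * w j) = aev a * (aev c * v - u) + (aev a * u - (\<Sum>j<s. aev (b j) * w j))"
      by (simp add: rhom_mult[OF raev] algebra_simps)
    show "aev (a * c) * v - (\<Sum>j<s. aev (b j) * w j) \<in> J"
      unfolding eq by (rule idl_add[OF idlJ idl_mult[OF idlJ d] v(2)])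
  qed (use c v in simp)
qed

lemma in_span_multiples:
  assumes "\<And>j. j < s \<Longrightarrow> in_span s w (z * w j)" and v: "in_span s w v"
  shows "in_span s w (z * v)"
proof -
  obtain a b where v: "a \<noteq> 0" "aev a * v - (\<Sum>j<s. aev (b j) * w j) \<in> J" using v by (rule in_spanE)
  show ?thesis
  proof (rule in_span_divide[OF v(1)])
    show "in_span s w (\<Sum>j<s. aev (b j) * (z * w j))" using assms(1) by (intro in_span_sum in_span_mult) auto
    have eq: "aev a * (z * v) - (\<Sum>j<s. aev (b j) * (z * w j)) = z * (aev a * v - (\<Sum>j<s. aev (b j) * w j))"
      by (simp add: sum_distrib_left algebra_simps)
    show "aev a * (z * v) - (\<Sum>j<s. aev (b j) * (z * w j)) \<in> J"
      unfolding eq by (rule idl_mult[OF idlJ v(2)])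
  qed
qed

text \<open>The products \<open>x ^ i * w j\<close> with \<open>i \<le> D - e\<close> are linearly
  independent over the constants and of degree at most \<open>D\<close>; comparing slopes with the
  Hilbert function gives the bound. With the converse estimate, the function field has degree
  \<open>d\<close> over the rational functions in \<open>x\<close>.\<close>

lemma lin_indep_le:
  assumes ind: "lin_indep s w" and w: "\<And>j. j < s \<Longrightarrow> w j \<in> V e"
  shows "s \<le> d"
proof (rule le_of_hilbert_lower)
  fix D assume D: "e \<le> D"
  let ?f = "\<lambda>(j, i). x ^ i * w j"
  have "card ({..<s} \<times> {..D - e}) \<le> hilbert_function n C D"
  proof (rule indep_mod_le_hilbert[of n C _ ?f, folded J_def, OF idlJ])
    show "?f z \<in> V D" if "z \<in> {..<s} \<times> {..D - e}" for z
    proof -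
      obtain j i where z: "z = (j, i)" "j < s" "i \<le> D - e" using \<open>z \<in> _\<close> by auto
      have "x ^ i * w j \<in> V (1 * i + e)" using upto_mult[OF upto_power[OF x_upto, of i] w[OF z(2)]] by simp
      then show ?thesis using z D by (auto intro: upto_mono)
    qed
    show "indep_mod J ({..<s} \<times> {..D - e}) ?f"
      unfolding indep_mod_def
    proof (intro allI impI)
      fix l assume l: "(\<Sum>z\<in>{..<s} \<times> {..D - e}. kap (l z) * ?f z) \<in> J"
      define a where "a = (\<lambda>j. \<Sum>i\<le>D - e. monom (l (j, i)) i)"
      have "(\<Sum>z\<in>{..<s} \<times> {..D - e}. kap (l z) * ?f z) = (\<Sum>j<s. \<Sum>i\<le>D - e. kap (l (j, i)) * (x ^ i * w j))"
        by (simp add: sum.cartesian_product case_prod_unfold)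
      also have "\<dots> = (\<Sum>j<s. aev (a j) * w j)"
        by (simp add: a_def rhom_sum[OF raev] aev_monom sum_distrib_right mult.assoc)
      finally have "\<forall>j<s. a j = 0" using l ind unfolding lin_indep_def by simp
      moreover have "coeff (a j) i = l (j, i)" if "i \<le> D - e" for j i
        using that by (simp add: a_def coeff_sum)
      ultimately show "\<forall>z\<in>{..<s} \<times> {..D - e}. l z = 0" by (metis SigmaE atMost_iff coeff_0 lessThan_iff)
    qed
  qed simp
  then show "s * (D - e) \<le> hilbert_function n C D" by (simp add: card_cartesian_product)
qed

text \<open>After multiplication by a common denominator \<open>g\<close>, everything of degree at
  most \<open>D\<close> is a combination of products \<open>x ^ i * w j\<close> with
  \<open>i \<le> D + A\<close>, where \<open>A\<close> does not depend on \<open>D\<close>. So the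
  Hilbert function has slope at most \<open>s\<close>.\<close>

lemma in_span_all_imp_le:
  assumes all: "\<And>m. m \<in> mons {..<n} N \<Longrightarrow> in_span s w (mon m)"
  shows "d \<le> s"
proof -
  define rel where "rel = (\<lambda>m a b. a \<noteq> 0 \<and> aev a * mon m - (\<Sum>j<s. aev (b j) * w j) \<in> J)"
  have "\<exists>a b. rel m a b" if "m \<in> mons {..<n} N" for m
    using all[OF that] unfolding in_span_def rel_def .
  then obtain a b where "\<And>m. m \<in> mons {..<n} N \<Longrightarrow> rel m (a m) (b m)" by metis
  then have ab: "\<And>m. m \<in> mons {..<n} N \<Longrightarrow> a m \<noteq> 0"
    "\<And>m. m \<in> mons {..<n} N \<Longrightarrow> aev (a m) * mon m - (\<Sum>j<s. aev (b m j) * w j) \<in> J"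
    unfolding rel_def by blast+
  define M where "M = mons {..<n} N"
  have finM: "finite M" unfolding M_def by (simp add: finite_mons)
  define g where "g = prod a M"
  have g0: "g \<noteq> 0" unfolding g_def using finM ab(1) by (simp add: M_def)
  have "\<exists>b'. aev g * mon m - (\<Sum>j<s. aev (b' j) * w j) \<in> J" if "m \<in> M" for m
  proof -
    define h where "h = prod a (M - {m})"
    have gh: "g = h * a m" unfolding g_def h_def using finM that by (simp add: prod.remove mult.commute)
    have eq: "aev g * mon m - (\<Sum>j<s. aev (h * b m j) * w j) = aev h * (aev (a m) * mon m - (\<Sum>j<s. aev (b m j) * w j))"
      by (simp add: gh rhom_mult[OF raev] sum_distrib_left algebra_simps)
    have "aev g * mon m - (\<Sum>j<s. aev (h * b m j) * w j) \<in> J"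
      unfolding eq using ab(2) that by (intro idl_mult idlJ) (simp add: M_def)
    then show ?thesis by (intro exI[of _ "\<lambda>j. h * b m j"])
  qed
  then obtain b' where b': "\<And>m. m \<in> M \<Longrightarrow> aev g * mon m - (\<Sum>j<s. aev (b' m j) * w j) \<in> J" by metis
  define A where "A = (\<Sum>m\<in>M. \<Sum>j<s. degree (b' m j))"
  have degA: "degree (b' m j) \<le> A" if "m \<in> M" "j < s" for m j
  proof -
    have "degree (b' m j) \<le> (\<Sum>j<s. degree (b' m j))" using that(2) by (intro member_le_sum) auto
    also have "\<dots> \<le> A" unfolding A_def using that(1) finM by (intro member_le_sum[of m M "\<lambda>m. \<Sum>j<s. degree (b' m j)"]) auto
    finally show ?thesis .
  qed
  show ?thesis
  proof (rule le_of_hilbert_upper)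
    fix D assume D: "N \<le> D"
    define G where "G = (\<lambda>(j, i). x ^ i * w j) ` ({..<s} \<times> {..D + A})"
    have "hilbert_function n C D \<le> card G"
    proof (rule hilbert_le_span[of n C "aev g", folded J_def, OF prJ aev_nonzero[OF g0]])
      show "finite G" unfolding G_def by simp
      fix p assume "p \<in> V D"
      then obtain y where y: "y \<in> mp.span (grid D)" "p - y \<in> J" using upto_grid[OF D] by blast
      have "\<exists>z\<in>mp.span G. aev g * y - z \<in> J"
      proof (rule span_mod_idl[OF idlJ y(1)])
        fix t assume "t \<in> grid D"
        then obtain i m where t: "i \<le> D" "m \<in> M" "t = x ^ i * mon m" by (auto simp: grid_def M_def)
        define z where "z = (\<Sum>j<s. x ^ i * (aev (b' m j) * w j))"
        have "aev g * t - z = x ^ i * (aev g * mon m - (\<Sum>j<s. aev (b' m j) * w j))"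
          by (simp add: t(3) z_def sum_distrib_left algebra_simps)
        then have "aev g * t - z \<in> J" using idl_mult[OF idlJ b'[OF t(2)]] by simp
        moreover have "z \<in> mp.span G"
          unfolding z_def
        proof (rule mp.span_sum)
          fix j assume j: "j \<in> {..<s}"
          have "x ^ i * (aev (b' m j) * w j) = (\<Sum>l\<le>A. mpoly_scale (coeff (b' m j) l) (x ^ (i + l) * w j))"
            using aev_eq_sum[OF degA[OF t(2)]] j
            by (simp add: mpoly_scale_eq sum_distrib_left sum_distrib_right power_add mult_ac)
          also have "\<dots> \<in> mp.span G"
          proof (intro mp.span_sum mp.span_scale mp.span_base)
            fix l assume "l \<in> {..A}"
            then show "x ^ (i + l) * w j \<in> G" unfolding G_def using j t(1)
              by (intro image_eqI[of _ _ "(j, i + l)"]) auto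
          qed
          finally show "x ^ i * (aev (b' m j) * w j) \<in> mp.span G" .
        qed
        ultimately show "\<exists>z\<in>mp.span G. aev g * t - z \<in> J" by blast
      qed
      then obtain z where z: "z \<in> mp.span G" "aev g * y - z \<in> J" by blast
      have "aev g * p - z = aev g * (p - y) + (aev g * y - z)" by (simp add: algebra_simps)
      also have "\<dots> \<in> J" by (rule idl_add[OF idlJ idl_mult[OF idlJ y(2)] z(2)])
      finally show "\<exists>z\<in>mp.span G. aev g * p - z \<in> J" using z(1) by blast
    qed
    also have "\<dots> \<le> card ({..<s} \<times> {..D + A})" unfolding G_def by (rule card_image_le) simp
    finally show "hilbert_function n C D \<le> s * (D + (A + 1))" by (simp add: card_cartesian_product)
  qed
qed

text \<open>If all monomials of degree at most \<open>s\<close> lay in the span of the first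
  \<open>s\<close> chosen ones, that span would be stable under multiplication by variables, since
  \<open>m j\<close> with \<open>j < s\<close> has degree below \<open>s\<close>. It would contain
  all monomials, forcing \<open>d \<le> s\<close>. This is the source of
  \<open>mdeg (w j) \<le> j\<close>, on which the count of unknowns depends.\<close>

theorem exists_monomial_basis:
  "1 \<le> s \<Longrightarrow> s \<le> d \<Longrightarrow> \<exists>m. m 0 = 0 \<and> (\<forall>j<s. Poly_Mapping.keys (m j) \<subseteq> {..<n} \<and> mdeg (m j) \<le> j) \<and>
    lin_indep s (\<lambda>j. mon (m j))"
proof (induction s rule: nat_induct_at_least)
  case base
  have "lin_indep 1 (\<lambda>j. mon 0)"
    unfolding lin_indep_def using x_transcendental by simp
  then show ?case by (intro exI[of _ "\<lambda>_. 0"]) simp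
next
  case (Suc s)
  then obtain m where m: "m 0 = 0" "\<And>j. j < s \<Longrightarrow> Poly_Mapping.keys (m j) \<subseteq> {..<n} \<and> mdeg (m j) \<le> j"
    "lin_indep s (\<lambda>j. mon (m j))" by auto
  have "\<exists>\<mu>\<in>mons {..<n} s. \<not> in_span s (\<lambda>j. mon (m j)) (mon \<mu>)"
  proof (rule ccontr)
    assume "\<not> ?thesis"
    then have all: "\<And>\<mu>. \<mu> \<in> mons {..<n} s \<Longrightarrow> in_span s (\<lambda>j. mon (m j)) (mon \<mu>)" by blast
    have "in_span s (\<lambda>j. mon (m j)) (mon \<mu>)" if "Poly_Mapping.keys \<mu> \<subseteq> {..<n}" for \<mu>
      using that
    proof (induction \<mu> rule: monom_induct)
      case zero
      show ?case by (rule all) (simp add: mons_def)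
    next
      case (add \<mu> i)
      have "in_span s (\<lambda>j. mon (m j)) (var i * mon \<mu>)"
      proof (rule in_span_multiples)
        show "in_span s (\<lambda>j. mon (m j)) (mon \<mu>)" using add by (simp add: keys_add_nat)
        fix j assume j: "j < s"
        have "in_span s (\<lambda>j. mon (m j)) (mon (Poly_Mapping.single i 1 + m j))"
          using m(2)[OF j] add(2) j by (intro all) (auto simp: mons_def keys_add_nat mdeg_add)
        then show "in_span s (\<lambda>j. mon (m j)) (var i * mon (m j))" by (simp only: mon_add var_def)
      qed
      then show ?case by (simp only: mon_add var_def)
    qed
    then have "d \<le> s" by (intro in_span_all_imp_le) (auto simp: mons_def)
    then show False using Suc by simp
  qed
  then obtain \<mu> where \<mu>: "\<mu> \<in> mons {..<n} s" "\<not> in_span s (\<lambda>j. mon (m j)) (mon \<mu>)" by blast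
  have "lin_indep (Suc s) ((\<lambda>j. mon (m j))(s := mon \<mu>))" by (rule lin_indep_extend[OF m(3) \<mu>(2)])
  also have "(\<lambda>j. mon (m j))(s := mon \<mu>) = (\<lambda>j. mon ((m(s := \<mu>)) j))" by auto
  finally have "lin_indep (Suc s) (\<lambda>j. mon ((m(s := \<mu>)) j))" .
  moreover have "(m(s := \<mu>)) 0 = 0" using m(1) Suc(1) by auto
  ultimately show ?case
    using m(2) \<mu>(1) by (intro exI[of _ "m(s := \<mu>)"]) (auto simp: mons_def less_Suc_eq)
qed

lemma in_span_full:
  assumes ind: "lin_indep d w" and w: "\<And>j. j < d \<Longrightarrow> w j \<in> V e" and v: "v \<in> V e'"
  shows "in_span d w v"
proof (rule ccontr)
  assume "\<not> ?thesis"
  then have "lin_indep (Suc d) (w(d := v))" by (rule lin_indep_extend[OF ind])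
  moreover have "(w(d := v)) j \<in> V (max e e')" if "j < Suc d" for j
    using w[of j] v that by (cases "j = d") (auto intro: upto_mono)
  ultimately have "Suc d \<le> d" by (rule lin_indep_le)
  then show False by simp
qed

text \<open>Take \<open>s\<close> such that the first \<open>s\<close> powers of \<open>v\<close>
  are independent and the first \<open>Suc s\<close> are not. The derivative of the relation
  involves only independent powers, and its top coefficient \<open>of_nat s * a s\<close> is nonzero
  in characteristic 0.\<close>

lemma minimal_polynomial:
  assumes v: "v \<in> V e"
  shows "\<exists>g. hev aev v g \<in> J \<and> hev aev v (pderiv g) \<notin> J"
proof -
  define P where "P = (\<lambda>s. lin_indep s (\<lambda>j. v ^ j))"
  have P1: "P 1" unfolding P_def lin_indep_def using x_transcendental by simp
  have Pd: "\<not> P (Suc d)"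
  proof
    assume "P (Suc d)"
    moreover have "v ^ j \<in> V (e * d)" if "j < Suc d" for j
      using upto_power[OF v, of j] that by (auto intro: upto_mono)
    ultimately have "Suc d \<le> d" unfolding P_def by (rule lin_indep_le)
    then show False by simp
  qed
  have "\<exists>s\<ge>1. P s \<and> \<not> P (Suc s)"
  proof (rule ccontr)
    assume no: "\<not> ?thesis"
    have "P s" if "1 \<le> s" for s
      using that
    proof (induction s rule: nat_induct_at_least)
      case base
      show ?case by (rule P1)
    next
      case (Suc s)
      then show ?case using no by blast
    qed
    then show False using Pd by simp
  qed
  then obtain s where s: "1 \<le> s" "P s" "\<not> P (Suc s)" by blast
  then obtain a j0 where a: "(\<Sum>j<Suc s. aev (a j) * v ^ j) \<in> J" "j0 < Suc s" "a j0 \<noteq> 0"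
    unfolding P_def lin_indep_def by blast
  have as: "a s \<noteq> 0"
  proof
    assume z: "a s = 0"
    then have "(\<Sum>j<s. aev (a j) * v ^ j) \<in> J" using a(1) by (simp add: rhom_0[OF raev])
    then show False using s(2) a(2,3) z unfolding P_def lin_indep_def by (auto simp: less_Suc_eq)
  qed
  define g where "g = (\<Sum>j\<le>s. monom (a j) j)"
  have cg: "coeff g i = (if i \<le> s then a i else 0)" for i by (simp add: g_def coeff_sum)
  have "degree g \<le> s" by (rule degree_le) (simp add: cg)
  then have "hev aev v g = (\<Sum>j\<le>s. aev (a j) * v ^ j)"
    by (subst hev_eq_sum[OF raev]) (auto simp: cg)
  then have "hev aev v g \<in> J" using a(1) by (simp add: lessThan_Suc_atMost)
  moreover have "hev aev v (pderiv g) \<notin> J"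
  proof
    assume *: "hev aev v (pderiv g) \<in> J"
    have "degree (pderiv g) \<le> s - 1" by (rule degree_le) (auto simp: coeff_pderiv cg)
    then have "hev aev v (pderiv g) = (\<Sum>j\<le>s - 1. aev (coeff (pderiv g) j) * v ^ j)"
      by (rule hev_eq_sum[OF raev])
    also have "{..s - 1} = {..<s}" using s(1) by auto
    finally have "\<forall>j<s. coeff (pderiv g) j = 0" using * s(2) unfolding P_def lin_indep_def by simp
    then have "coeff (pderiv g) (s - 1) = 0" using s(1) by simp
    then have "of_nat s * a s = 0" using s(1) by (simp add: coeff_pderiv cg)
    moreover have "(of_nat s :: 'k poly) \<noteq> 0" using char0[of s] s(1) by (simp add: of_nat_poly)
    ultimately show False using as by simp
  qed
  ultimately show ?thesis by blast
qed

lemma J_upto_C: "f \<in> J \<Longrightarrow> f \<in> V k \<Longrightarrow> f \<in> C"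
  by (auto simp: J_def full_idl_def restr_id upto_imp_mpolys)

text \<open>Multiples of \<open>P\<close> of degree at most \<open>D\<close> together with functions separating \<open>e\<close> zeros of \<open>P\<close> are independent
  modulo \<open>J\<close>, so \<open>h(D - m) + e \<le> h(D)\<close> for the Hilbert function \<open>h\<close>, which grows like \<open>d D\<close>.\<close>

theorem card_zeros_le:
  assumes P: "P \<in> V m" "P \<notin> J"
  shows "finite {Q \<in> rational_points n C. eval_mpoly Q P = 0} \<and> card {Q \<in> rational_points n C. eval_mpoly Q P = 0} \<le> d * m"
proof (rule finite_if_finite_subsets_card_bdd)
  fix F assume F: "F \<subseteq> {Q \<in> rational_points n C. eval_mpoly Q P = 0}" "finite F"
  define e where "e = card F"
  have aff: "Q \<in> affine_space {..<n}" if "Q \<in> F" for Q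
    using F that by (auto simp: rational_points_def zero_locus_def)
  have evC: "eval_mpoly Q f = 0" if "Q \<in> F" "f \<in> J" "f \<in> V k" for Q f k
    using F J_upto_C[OF that(2,3)] that(1) by (auto simp: rational_points_def zero_locus_def)
  have "\<exists>i<n. Q i \<noteq> Q' i" if "Q \<in> F" "Q' \<in> F" "Q \<noteq> Q'" for Q Q'
  proof (rule ccontr)
    assume "\<not> ?thesis"
    then have "Q = Q'" using aff[OF that(1)] aff[OF that(2)] by (intro PiE_ext) auto
    then show False using that by simp
  qed
  then obtain ix where ix: "\<And>Q Q'. Q \<in> F \<Longrightarrow> Q' \<in> F \<Longrightarrow> Q \<noteq> Q' \<Longrightarrow> ix Q Q' < n \<and> Q (ix Q Q') \<noteq> Q' (ix Q Q')"
    by metis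
  \<comment> \<open>Separating functions: at points of \<open>F\<close>, \<open>E Q\<close> vanishes
    everywhere except at \<open>Q\<close>.\<close>
  define E where "E = (\<lambda>Q. \<Prod>Q'\<in>F - {Q}. var (ix Q Q') - kap (Q' (ix Q Q')) :: (nat, 'k) mpoly)"
  have E_upto: "E Q \<in> V e" if Q: "Q \<in> F" for Q
  proof -
    have "(\<Prod>Q'\<in>A. var (ix Q Q') - kap (Q' (ix Q Q'))) \<in> V (card A)" if "finite A" "A \<subseteq> F - {Q}" for A
      using that
    proof (induction A rule: finite_induct)
      case (insert Q' A)
      have "var (ix Q Q') - kap (Q' (ix Q Q')) \<in> V 1"
        using ix[of Q Q'] insert.prems Q by (intro upto_diff var_upto kap_upto) auto
      from upto_mult[OF this insert.IH] insert show ?case by simp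
    qed simp
    from this[of "F - {Q}"] have "E Q \<in> V (card (F - {Q}))" using F(2) by (simp add: E_def)
    then show ?thesis using card_mono[of F "F - {Q}"] F(2) by (auto simp: e_def intro: upto_mono)
  qed
  have E_eval: "eval_mpoly Q' (E Q) = (\<Prod>R\<in>F - {Q}. Q' (ix Q R) - R (ix Q R))" for Q Q'
    by (simp add: E_def eval_prod eval_diff)
  have shift: "hilbert_function n C D + e \<le> hilbert_function n C (m + D)" if De: "e \<le> D" for D
  proof -
    obtain Bs where Bs: "finite Bs" "Bs \<subseteq> V D" "card Bs = hilbert_function n C D" "indep_mod J Bs (\<lambda>b. b)"
      by (rule hilbert_basis[of n C D, folded J_def, OF idlJ]) blast
    let ?f = "case_sum (\<lambda>b. P * b) E"
    have "card (Bs <+> F) \<le> hilbert_function n C (m + D)"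
    proof (rule indep_mod_le_hilbert[of n C _ ?f, folded J_def, OF idlJ])
      show "finite (Bs <+> F)" using Bs(1) F(2) by simp
      show mem: "?f z \<in> V (m + D)" if "z \<in> Bs <+> F" for z
      proof -
        have "P * b \<in> V (m + D)" if "b \<in> Bs" for b
          using upto_mult[OF P(1), of b D] Bs(2) that by (auto intro: upto_mono)
        moreover have "E Q \<in> V (m + D)" if "Q \<in> F" for Q
          using E_upto[OF that] De by (auto intro: upto_mono)
        ultimately show ?thesis using that by auto
      qed
      show "indep_mod J (Bs <+> F) ?f"
        unfolding indep_mod_def
      proof (intro allI impI)
        fix l assume l: "(\<Sum>z\<in>Bs <+> F. kap (l z) * ?f z) \<in> J"
        have eq: "(\<Sum>z\<in>Bs <+> F. kap (l z) * ?f z) =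
            P * (\<Sum>b\<in>Bs. kap (l (Inl b)) * b) + (\<Sum>Q\<in>F. kap (l (Inr Q)) * E Q)"
          using Bs(1) F(2) by (simp add: sum.Plus sum_distrib_left mult_ac)
        have up: "(\<Sum>z\<in>Bs <+> F. kap (l z) * ?f z) \<in> V (m + D)"
          using mem by (intro upto_sum upto_kap_mult)
        have lF: "l (Inr Q) = 0" if Q: "Q \<in> F" for Q
        proof -
          have "eval_mpoly Q (P * (\<Sum>b\<in>Bs. kap (l (Inl b)) * b) + (\<Sum>R\<in>F. kap (l (Inr R)) * E R)) = 0"
            using evC[OF Q l up] by (simp only: eq)
          moreover have "eval_mpoly Q P = 0" using F(1) Q by blast
          ultimately have "(\<Sum>R\<in>F. l (Inr R) * eval_mpoly Q (E R)) = 0"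
            by (simp add: eval_mpoly_add eval_mpoly_mult eval_sum)
          moreover have "eval_mpoly Q (E R) = 0" if "R \<in> F - {Q}" for R
            using that Q F(2) unfolding E_eval by (intro prod_zero) auto
          then have "(\<Sum>R\<in>F - {Q}. l (Inr R) * eval_mpoly Q (E R)) = 0" by simp
          ultimately have "l (Inr Q) * eval_mpoly Q (E Q) = 0" by (simp add: sum.remove[OF F(2) Q])
          moreover have "eval_mpoly Q (E Q) \<noteq> 0" unfolding E_eval using ix[OF Q] F(2) by auto
          ultimately show ?thesis by simp
        qed
        then have "P * (\<Sum>b\<in>Bs. kap (l (Inl b)) * b) \<in> J" using l unfolding eq by simp
        then have "(\<Sum>b\<in>Bs. kap (l (Inl b)) * b) \<in> J" using P(2) by (simp add: prime_idl_mult[OF prJ])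
        then have "\<forall>b\<in>Bs. l (Inl b) = 0"
          using Bs(4) unfolding indep_mod_def by (elim allE[of _ "\<lambda>b. l (Inl b)"]) simp
        then show "\<forall>z\<in>Bs <+> F. l z = 0" using lF by auto
      qed
    qed
    then show ?thesis using Bs(1,3) F(2) by (simp add: card_Plus e_def)
  qed
  \<comment> \<open>For large arguments the Hilbert function is linear, and its constant term
    cancels in the difference.\<close>
  obtain \<beta> k0 where k0: "\<And>k. k0 \<le> k \<Longrightarrow> int (hilbert_function n C k) = int d * int k + \<beta>"
    using hilbert_linear by (auto simp: eventually_sequentially)
  have "int (hilbert_function n C (e + k0)) + int e \<le> int (hilbert_function n C (m + (e + k0)))"
    using shift[of "e + k0"] by linarith
  then have "int e \<le> int d * int m" using k0[of "e + k0"] k0[of "m + (e + k0)"] by (simp add: algebra_simps)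
  then show "card F \<le> d * m" by (simp add: e_def flip: of_nat_mult)
qed

end

section \<open>Polynomial points of a curve\<close>

definition toK :: "complex poly \<Rightarrow> complex poly fract" where "toK p = Fract p 1"

lemma rhom_toK: "rhom toK"
  by (auto simp: rhom_def toK_def Zero_fract_def One_fract_def)

lemma toK_eq_iff [simp]: "toK a = toK b \<longleftrightarrow> a = b"
  by (simp add: toK_def eq_fract)

lemma toK_eq_0_iff [simp]: "toK a = 0 \<longleftrightarrow> a = 0"
  using toK_eq_iff[of a 0] by (simp add: rhom_0[OF rhom_toK])

lemma of_nat_fract_nonzero: "0 < m \<Longrightarrow> of_nat m \<noteq> (0 :: complex poly fract)"
  using rhom_of_nat[OF rhom_toK, of m] toK_eq_0_iff[of "of_nat m"] by simp

lemma inj_cst: "inj (\<lambda>c. toK [:c:])"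
  by (rule injI) simp

lemma uncountable_fract: "uncountable (UNIV :: complex poly fract set)"
proof
  assume "countable (UNIV :: complex poly fract set)"
  then have "countable (range (\<lambda>c. toK [:c:]))" by (rule countable_subset[OF subset_UNIV])
  then have "countable (UNIV :: complex set)" by (rule countable_image_inj_on) (rule inj_cst)
  then show False using uncountable_UNIV_complex by simp
qed

lemma infinite_cst: "infinite (range (\<lambda>c. toK [:c:]))"
  using inj_cst infinite_UNIV_char_0 finite_imageD by blast

lemma common_denominator:
  assumes "finite A"
  shows "\<exists>D. D \<noteq> 0 \<and> (\<forall>k\<in>A. toK D * k \<in> range toK)"
  using assms
proof (induction A rule: finite_induct)
  case (insert k A)
  then obtain D where D: "D \<noteq> 0" "\<forall>k\<in>A. toK D * k \<in> range toK" by blast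
  obtain a b where k: "k = Fract a b" "b \<noteq> 0" by (cases k)
  have kb: "toK b * k = toK a" using k by (simp add: toK_def eq_fract)
  have "toK (D * b) * k' \<in> range toK" if k': "k' \<in> insert k A" for k'
  proof (cases "k' = k")
    case True
    have "toK (D * b) * k = toK (D * a)" by (simp add: rhom_mult[OF rhom_toK] mult.assoc kb)
    then show ?thesis using True by simp
  next
    case False
    then obtain p where "toK D * k' = toK p" using D k' by blast
    then have "toK (D * b) * k' = toK (b * p)" by (simp add: rhom_mult[OF rhom_toK] mult_ac)
    then show ?thesis by simp
  qed
  then show ?case using D(1) k(2) by (intro exI[of _ "D * b"]) auto
qed (auto intro: exI[of _ 1])

lemma common_denominator_poly:
  assumes "finite A"
  shows "\<exists>D. D \<noteq> 0 \<and> (\<forall>a\<in>A. smult (toK D) a \<in> range (map_poly toK))"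
proof -
  have "finite (\<Union>a\<in>A. range (coeff a))"
  proof (intro finite_UN_I assms)
    fix a :: "complex poly fract poly"
    have "range (coeff a) \<subseteq> insert 0 (coeff a ` {..degree a})"
      by (auto simp: image_iff) (metis atMost_iff le_degree)
    then show "finite (range (coeff a))" by (rule finite_subset) simp
  qed
  from common_denominator[OF this] obtain D where
    D: "D \<noteq> 0" "\<And>k. k \<in> (\<Union>a\<in>A. range (coeff a)) \<Longrightarrow> toK D * k \<in> range toK" by blast
  have "smult (toK D) a \<in> range (map_poly toK)" if "a \<in> A" for a
  proof -
    have "toK D * coeff a i \<in> range toK" for i using that by (intro D(2)) blast
    then have "coeffs_in (range toK) (smult (toK D) a)" by (simp add: coeffs_in_def)
    from coeffs_in_range[OF rhom_toK this] show ?thesis by auto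
  qed
  then show ?thesis using D(1) by blast
qed

lemma rhom_map_poly: assumes h: "rhom h" shows "rhom (map_poly h)"
proof -
  have "map_poly h (p * q) = map_poly h p * map_poly h q" for p q
    by (rule poly_eqI) (simp add: coeff_map_poly rhom_0[OF h] coeff_mult rhom_sum[OF h] rhom_mult[OF h])
  moreover have "map_poly h (p + q) = map_poly h p + map_poly h q" for p q
    by (rule poly_eqI) (simp add: coeff_map_poly rhom_0[OF h] rhom_add[OF h])
  moreover have "map_poly h 1 = 1" by (simp add: one_pCons map_poly_pCons rhom_0[OF h] rhom_1[OF h])
  ultimately show ?thesis by (simp add: rhom_def)
qed

lemma hev_map_poly: "rhom h \<Longrightarrow> rhom g \<Longrightarrow> hev h v (map_poly g f) = hev (\<lambda>a. h (g a)) v f"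
  by (simp add: hev_def map_poly_map_poly rhom_0 comp_def)

lemma rhom_eval_mpoly: "rhom (eval_mpoly Q)"
  by (simp add: rhom_def eval_mpoly_add eval_mpoly_mult)

lemma hev_ident: "hev (\<lambda>a. a) v p = poly p v"
  by (simp add: hev_def map_poly_idI)

lemma rhom_ident: "rhom (\<lambda>a. a)"
  by (simp add: rhom_def)

lemma poly_toK: "poly (map_poly toK a) (toK X) = toK (poly a X)"
  using rhom_hev_comp[OF rhom_toK rhom_ident, of X a] by (simp add: hev_ident) (simp add: hev_def)

definition poly_solutions :: "nat \<Rightarrow> (nat, complex poly fract) mpoly set \<Rightarrow> (nat \<Rightarrow> complex poly) set" where
  "poly_solutions n C = {Q \<in> {..<n} \<rightarrow>\<^sub>E UNIV. (\<lambda>i\<in>{..<n}. toK (Q i)) \<in> rational_points n C}"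

text \<open>Relations over K become identities between complex polynomials by clearing denominators
  in the multiplication table and in the minimal polynomials. The locus \<open>\<Theta> = 0\<close>
  is finite because the function behind \<open>\<Theta>\<close> lies outside the prime ideal of the
  curve, so the bound on zeros applies to it.\<close>

theorem exists_curve_points:
  fixes C :: "(nat, complex poly fract) mpoly set"
  assumes curve: "irreducible_affine_curve n C" and deg: "has_degree n C d"
  shows "\<exists>lam w f q s xc fx \<Theta>. curve_points n d lam w f q s (poly_solutions n C) xc fx \<Theta> \<and>
    finite {Q \<in> poly_solutions n C. \<Theta> Q = 0}"
proof -
  define J where "J = full_idl {..<n} C"
  have prime: "primeideal C (mpoly_ring {..<n})" and dim: "ring_krull_dim (mpoly_ring {..<n} Quot C) = 1"
    using curve by (auto simp: irreducible_affine_curve_def)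
  have prJ: "prime_idl J" unfolding J_def by (rule prime_full_idl[OF prime])
  then have idlJ: "idl J" and oneJ: "1 \<notin> J" by (auto simp: prime_idl_def)
  have dep: "\<not> alg_indep J [y, x]" for x y
    unfolding J_def by (rule not_alg_indep_pair[OF _ uncountable_fract prime dim]) simp
  obtain lamK N where lamK: "\<And>j. j < n \<Longrightarrow> lamK j \<in> range (\<lambda>c. toK [:c:])"
    and N: "\<And>D. N \<le> D \<Longrightarrow> mpolys_upto {..<n} (Suc D) \<subseteq> pushed J {..<n} (\<Sum>j<n. kap (lamK j) * var j) D"
    using noether_line[OF idlJ oneJ dep infinite_cst, of n] by blast
  have "\<forall>j. \<exists>c. j < n \<longrightarrow> lamK j = toK [:c:]" using lamK by blast
  then obtain lam where lam: "\<And>j. j < n \<Longrightarrow> lamK j = toK [:lam j:]" by metis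
  define x where "x = (\<Sum>j<n. kap (lamK j) * var j)"
  define aev where "aev = hev kap x"
  interpret curve_coord n C d lamK N J x aev
    by (rule curve_coord.intro[OF prime dim deg of_nat_fract_nonzero J_def x_def aev_def N[folded x_def]])
  have d1: "1 \<le> d" using hilbert_linear by blast
  obtain w where w: "w 0 = 0" "\<And>j. j < d \<Longrightarrow> Poly_Mapping.keys (w j) \<subseteq> {..<n} \<and> mdeg (w j) \<le> j"
    and ind: "lin_indep d (\<lambda>j. mon (w j))"
    using exists_monomial_basis[OF d1 le_refl] by blast
  have W: "mon (w j) \<in> V d" if "j < d" for j using w(2)[OF that] that by (intro mon_upto) auto
  define rel where "rel = (\<lambda>i l a b. a \<noteq> 0 \<and> aev a * (var i * mon (w l)) - (\<Sum>m<d. aev (b m) * mon (w m)) \<in> J)"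
  have "\<exists>a b. rel i l a b" if "i < n" "l < d" for i l
  proof -
    have "var i * mon (w l) \<in> V (1 + d)" using that by (intro upto_mult var_upto W) auto
    then show ?thesis using in_span_full[OF ind W] unfolding in_span_def rel_def by blast
  qed
  then obtain a b where "\<And>i l. i < n \<Longrightarrow> l < d \<Longrightarrow> rel i l (a i l) (b i l)" by metis
  then have ab: "\<And>i l. i < n \<Longrightarrow> l < d \<Longrightarrow> a i l \<noteq> 0"
    "\<And>i l. i < n \<Longrightarrow> l < d \<Longrightarrow> aev (a i l) * (var i * mon (w l)) - (\<Sum>m<d. aev (b i l m) * mon (w m)) \<in> J"
    unfolding rel_def by blast+
  let ?IL = "{..<n} \<times> {..<d}"
  define q0 where "q0 = (\<Prod>(i, l)\<in>?IL. a i l)"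
  have q0: "q0 \<noteq> 0" unfolding q0_def using ab(1) by (auto simp: prod_zero_iff)
  define b0 where "b0 = (\<lambda>i l m. (\<Prod>(i', l')\<in>?IL - {(i, l)}. a i' l') * b i l m)"
  have tab0: "aev q0 * (var i * mon (w l)) - (\<Sum>m<d. aev (b0 i l m) * mon (w m)) \<in> J" if il: "i < n" "l < d" for i l
  proof -
    define h where "h = (\<Prod>(i', l')\<in>?IL - {(i, l)}. a i' l')"
    have "q0 = a i l * h" unfolding q0_def h_def using il by (subst prod.remove[of _ "(i, l)"]) auto
    then have "aev q0 * (var i * mon (w l)) - (\<Sum>m<d. aev (b0 i l m) * mon (w m)) =
        aev h * (aev (a i l) * (var i * mon (w l)) - (\<Sum>m<d. aev (b i l m) * mon (w m)))"
      by (simp add: b0_def h_def[symmetric] rhom_mult[OF raev] sum_distrib_left algebra_simps)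
    then show ?thesis using idl_mult[OF idlJ ab(2)[OF il]] by simp
  qed
  define A0 where "A0 = insert q0 ((\<lambda>(i, l, m). b0 i l m) ` ({..<n} \<times> {..<d} \<times> {..<d}))"
  have "finite A0" by (simp add: A0_def)
  from common_denominator_poly[OF this] obtain D0 where
    D0: "D0 \<noteq> 0" "\<And>p. p \<in> A0 \<Longrightarrow> smult (toK D0) p \<in> range (map_poly toK)" by blast
  have "smult (toK D0) q0 \<in> range (map_poly toK)" by (rule D0(2)) (simp add: A0_def)
  then obtain q where q: "smult (toK D0) q0 = map_poly toK q" by blast
  have "b0 i l m \<in> A0" if "i < n" "l < d" "m < d" for i l m
    unfolding A0_def using that by (intro insertI2 image_eqI[of _ _ "(i, l, m)"]) auto
  then have "smult (toK D0) (b0 i l m) \<in> range (map_poly toK)" if "i < n" "l < d" "m < d" for i l m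
    using D0(2) that by blast
  then obtain s where s: "\<And>i l m. i < n \<Longrightarrow> l < d \<Longrightarrow> m < d \<Longrightarrow> smult (toK D0) (b0 i l m) = map_poly toK (s i l m)"
    unfolding image_iff by metis
  have aev_smult: "aev (smult c p) = kap c * aev p" for c p
    unfolding aev_def by (rule hev_smult[OF rhom_kap])
  have tab: "aev (map_poly toK q) * (var i * mon (w l)) - (\<Sum>m<d. aev (map_poly toK (s i l m)) * mon (w m)) \<in> J"
    if il: "i < n" "l < d" for i l
  proof -
    have "aev (map_poly toK q) * (var i * mon (w l)) - (\<Sum>m<d. aev (map_poly toK (s i l m)) * mon (w m)) =
        kap (toK D0) * (aev q0 * (var i * mon (w l)) - (\<Sum>m<d. aev (b0 i l m) * mon (w m)))"
      by (simp add: q[symmetric] s[OF il, symmetric] aev_smult sum_distrib_left algebra_simps)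
    then show ?thesis using idl_mult[OF idlJ tab0[OF il]] by simp
  qed
  have qJ: "aev (map_poly toK q) \<notin> J"
  proof
    assume "aev (map_poly toK q) \<in> J"
    then have "smult (toK D0) q0 = 0" unfolding q[symmetric] by (rule x_transcendental)
    then show False using D0(1) q0 by simp
  qed
  have "\<exists>F. hev aev (var i) (map_poly (map_poly toK) F) \<in> J \<and> hev aev (var i) (pderiv (map_poly (map_poly toK) F)) \<notin> J"
    if i: "i < n" for i
  proof -
    obtain g where g: "hev aev (var i) g \<in> J" "hev aev (var i) (pderiv g) \<notin> J"
      using minimal_polynomial[OF var_upto[of i "{..<n}" 1]] i by auto
    have fin: "finite (range (coeff g))"
    proof (rule finite_subset)
      show "range (coeff g) \<subseteq> insert 0 (coeff g ` {..degree g})"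
        by (auto simp: image_iff) (metis atMost_iff le_degree)
    qed simp
    obtain D where D: "D \<noteq> 0" "\<And>p. p \<in> range (coeff g) \<Longrightarrow> smult (toK D) p \<in> range (map_poly toK)"
      using common_denominator_poly[OF fin] by blast
    have "coeffs_in (range (map_poly toK)) (smult [:toK D:] g)"
      unfolding coeffs_in_def using D(2) by simp
    then obtain F where F: "smult [:toK D:] g = map_poly (map_poly toK) F"
      using coeffs_in_range[OF rhom_map_poly[OF rhom_toK]] by blast
    have sm: "hev aev (var i) (smult [:toK D:] p) = kap (toK D) * hev aev (var i) p" for p
      by (simp add: hev_smult[OF raev] aev_const)
    have "hev aev (var i) (map_poly (map_poly toK) F) \<in> J"
      unfolding F[symmetric] sm by (rule idl_mult[OF idlJ g(1)])
    moreover have "hev aev (var i) (pderiv (map_poly (map_poly toK) F)) \<notin> J"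
      unfolding F[symmetric] pderiv_smult sm using g(2) D(1) by (simp add: kap_mult_mem_iff[OF idlJ])
    ultimately show ?thesis by blast
  qed
  then have "\<forall>i. \<exists>F. i < n \<longrightarrow> hev aev (var i) (map_poly (map_poly toK) F) \<in> J \<and>
      hev aev (var i) (pderiv (map_poly (map_poly toK) F)) \<notin> J" by blast
  then obtain f where f: "\<And>i. i < n \<Longrightarrow> hev aev (var i) (map_poly (map_poly toK) (f i)) \<in> J"
    "\<And>i. i < n \<Longrightarrow> hev aev (var i) (pderiv (map_poly (map_poly toK) (f i))) \<notin> J" by metis
  define xc where "xc = (\<lambda>Q. \<Sum>i<n. smult (lam i) (Q i))"
  define fx where "fx = (\<lambda>i X. map_poly (\<lambda>a. poly a X) (f i))"
  define \<Theta> where "\<Theta> = (\<lambda>Q. poly q (xc Q) * (\<Prod>i<n. poly (pderiv (fx i (xc Q))) (Q i)))"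
  define S where "S = poly_solutions n C"
  define pt where "pt = (\<lambda>Q :: nat \<Rightarrow> complex poly. \<lambda>i\<in>{..<n}. toK (Q i))"
  \<comment> \<open>Evaluation at the K-rational point given by \<open>Q\<close>; it turns
    membership in \<open>J\<close> into an identity between polynomials in \<open>t\<close>.\<close>
  define E where "E = (\<lambda>Q. eval_mpoly (ext0 {..<n} (pt Q)))"
  have rE: "rhom (E Q)" for Q unfolding E_def by (rule rhom_eval_mpoly)
  have E_restr: "E Q p = eval_mpoly (pt Q) (restr {..<n} p)" for Q p
    by (simp add: E_def eval_ext0)
  have EJ: "E Q p = 0" if "Q \<in> S" "p \<in> J" for Q p
    using that unfolding E_restr by (auto simp: S_def poly_solutions_def rational_points_def zero_locus_def J_def full_idl_def pt_def)
  have E_kap: "E Q (kap c) = c" for Q c by (simp add: E_def)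
  have E_var: "E Q (var i) = toK (Q i)" if "i < n" for Q i
    using that by (simp add: E_def ext0_def pt_def)
  have E_x: "E Q x = toK (xc Q)" for Q
    unfolding x_def xc_def rhom_sum[OF rE] rhom_sum[OF rhom_toK]
  proof (rule sum.cong[OF refl])
    fix j assume "j \<in> {..<n}"
    moreover have "toK [:lam j:] * toK (Q j) = toK (smult (lam j) (Q j))"
      by (simp flip: rhom_mult[OF rhom_toK])
    ultimately show "E Q (kap (lamK j) * var j) = toK (smult (lam j) (Q j))"
      by (simp add: rhom_mult[OF rE] E_kap E_var lam)
  qed
  have E_aev: "E Q (aev (map_poly toK p)) = toK (poly p (xc Q))" for Q p
  proof -
    have "E Q (aev (map_poly toK p)) = hev (\<lambda>c. E Q (kap c)) (E Q x) (map_poly toK p)"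
      unfolding aev_def by (rule rhom_hev_comp[OF rE rhom_kap])
    then show ?thesis by (simp add: E_kap hev_ident E_x poly_toK)
  qed
  have E_mon: "E Q (mon (w j)) = toK (eval_monom Q (w j))" if "j < d" for Q j
  proof -
    have "E Q (mon (w j)) = eval_monom (\<lambda>i. toK (Q i)) (w j)"
    proof -
      have "eval_monom (ext0 {..<n} (pt Q)) (w j) = eval_monom (\<lambda>i. toK (Q i)) (w j)"
        unfolding eval_monom_def
      proof (rule prod.cong[OF refl])
        fix i assume "i \<in> Poly_Mapping.keys (w j)"
        then have "i < n" using w(2)[OF that] by auto
        then show "ext0 {..<n} (pt Q) i ^ Poly_Mapping.lookup (w j) i = toK (Q i) ^ Poly_Mapping.lookup (w j) i"
          by (simp add: ext0_def pt_def)
      qed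
      then show ?thesis by (simp add: E_def)
    qed
    then show ?thesis by (simp add: rhom_eval_monom[OF rhom_toK])
  qed
  have rp: "rhom (\<lambda>a. poly a Z)" for Z :: "complex poly" by (simp add: rhom_def)
  have E_hev: "E Q (hev aev (var i) (map_poly (map_poly toK) F)) = toK (poly (map_poly (\<lambda>a. poly a (xc Q)) F) (Q i))"
    if "i < n" for Q i F
  proof -
    have "E Q (hev aev (var i) (map_poly (map_poly toK) F)) = hev (\<lambda>p. E Q (aev p)) (toK (Q i)) (map_poly (map_poly toK) F)"
      using rhom_hev_comp[OF rE raev, of Q "var i"] E_var[OF that] by simp
    also have "\<dots> = hev (\<lambda>a. E Q (aev (map_poly toK a))) (toK (Q i)) F"
      using rE raev by (intro hev_map_poly rhom_map_poly rhom_toK) (simp add: rhom_def)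
    also have "\<dots> = hev (\<lambda>a. toK (poly a (xc Q))) (toK (Q i)) F" by (simp only: E_aev)
    also have "\<dots> = toK (hev (\<lambda>a. poly a (xc Q)) (Q i) F)"
      by (rule rhom_hev_comp[OF rhom_toK rp, symmetric])
    finally show ?thesis by (simp add: hev_def)
  qed
  have pt_inj: "inj_on pt S"
  proof (rule inj_onI)
    fix Q Q' assume Q: "Q \<in> S" "Q' \<in> S" "pt Q = pt Q'"
    have "Q i = Q' i" if "i \<in> {..<n}" for i
      using fun_cong[OF Q(3), of i] that by (simp add: pt_def)
    moreover have "Q \<in> {..<n} \<rightarrow>\<^sub>E UNIV" "Q' \<in> {..<n} \<rightarrow>\<^sub>E UNIV" using Q(1,2) by (auto simp: S_def poly_solutions_def)
    ultimately show "Q = Q'" by (intro PiE_ext)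
  qed
  have zeros: "finite {Q \<in> S. E Q P = 0} \<and> card {Q \<in> S. E Q P = 0} \<le> d * m"
    if P: "restr {..<n} P \<in> V m" "restr {..<n} P \<notin> J" for P m
  proof -
    let ?Z = "{Q \<in> rational_points n C. eval_mpoly Q (restr {..<n} P) = 0}"
    have Z: "finite ?Z" "card ?Z \<le> d * m" using card_zeros_le[OF P] by auto
    have sub: "pt ` {Q \<in> S. E Q P = 0} \<subseteq> ?Z"
      by (auto simp: E_restr S_def poly_solutions_def pt_def)
    have inj: "inj_on pt {Q \<in> S. E Q P = 0}" by (rule inj_on_subset[OF pt_inj]) auto
    have "card {Q \<in> S. E Q P = 0} \<le> card ?Z" by (rule card_inj_on_le[OF inj sub Z(1)])
    moreover have "finite {Q \<in> S. E Q P = 0}" using finite_imageD[OF finite_subset[OF sub Z(1)] inj] .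
    ultimately show ?thesis using Z(2) by simp
  qed
  have "curve_points n d lam w f q s S xc fx \<Theta>"
  proof
    show "1 \<le> d" by (rule d1)
    show "Poly_Mapping.keys (w j) \<subseteq> {..<n} \<and> mdeg (w j) \<le> j" if "j < d" for j by (rule w(2)[OF that])
    show "w 0 = 0" by (rule w(1))
    show "S \<subseteq> {..<n} \<rightarrow>\<^sub>E UNIV" by (auto simp: S_def poly_solutions_def)
    show "poly (fx i (xc Q)) (Q i) = 0" if "Q \<in> S" "i < n" for Q i
      using EJ[OF that(1) f(1)[OF that(2)]] unfolding E_hev[OF that(2)] fx_def by simp
    show "poly q (xc Q) * Q i * eval_monom Q (w l) = (\<Sum>m<d. poly (s i l m) (xc Q) * eval_monom Q (w m))"
      if Q: "Q \<in> S" and il: "i < n" "l < d" for Q i l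
    proof -
      have "E Q (aev (map_poly toK q) * (var i * mon (w l)) - (\<Sum>m<d. aev (map_poly toK (s i l m)) * mon (w m))) =
          toK (poly q (xc Q) * (Q i * eval_monom Q (w l)) - (\<Sum>m<d. poly (s i l m) (xc Q) * eval_monom Q (w m)))"
        using il by (simp add: rhom_diff[OF rE] rhom_mult[OF rE] rhom_sum[OF rE] E_aev E_var E_mon
            rhom_diff[OF rhom_toK] rhom_mult[OF rhom_toK] rhom_sum[OF rhom_toK])
      then show ?thesis using EJ[OF Q tab[OF il]] by (simp add: mult.assoc)
    qed
    show "finite {Q \<in> S. (\<Sum>j<d. \<Sum>i\<le>D - j. p i j * xc Q ^ i * eval_monom Q (w j)) = 0} \<and>
        card {Q \<in> S. (\<Sum>j<d. \<Sum>i\<le>D - j. p i j * xc Q ^ i * eval_monom Q (w j)) = 0} \<le> d * D"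
      if D: "d \<le> D" and p: "\<exists>j<d. \<exists>i. i + j \<le> D \<and> p i j \<noteq> 0" for D p
    proof -
      define P where "P = (\<Sum>j<d. \<Sum>i\<le>D - j. kap (toK (p i j)) * x ^ i * mon (w j))"
      have PV: "P \<in> V D"
        unfolding P_def
      proof (intro upto_sum)
        fix j i assume ji: "j \<in> {..<d}" "i \<in> {..D - j}"
        have "mon (w j) \<in> V j" using w(2)[of j] ji by (intro mon_upto) auto
        then have "kap (toK (p i j)) * x ^ i * mon (w j) \<in> V (1 * i + j)"
          by (intro upto_mult upto_kap_mult upto_power x_upto)
        then show "kap (toK (p i j)) * x ^ i * mon (w j) \<in> V D" using ji D by (auto intro: upto_mono)
      qed
      have "P \<notin> J"
      proof
        assume PJ: "P \<in> J"
        define c where "c = (\<lambda>j. \<Sum>i\<le>D - j. monom (toK (p i j)) i)"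
        have "P = (\<Sum>j<d. aev (c j) * mon (w j))"
          by (simp add: P_def c_def rhom_sum[OF raev] aev_monom sum_distrib_right)
        then have c0: "\<forall>j<d. c j = 0" using PJ ind unfolding lin_indep_def by simp
        obtain j i where ji: "j < d" "i + j \<le> D" "p i j \<noteq> 0" using p by blast
        have "coeff (c j) i = toK (p i j)" using ji(2) by (simp add: c_def coeff_sum)
        then show False using c0 ji by simp
      qed
      moreover have "restr {..<n} P = P" by (rule restr_id[OF upto_imp_mpolys[OF PV]])
      moreover have "E Q P = toK (\<Sum>j<d. \<Sum>i\<le>D - j. p i j * xc Q ^ i * eval_monom Q (w j))" for Q
        by (simp add: P_def rhom_mult[OF rE] rhom_sum[OF rE] rhom_power[OF rE] E_kap E_x E_mon
            rhom_mult[OF rhom_toK] rhom_sum[OF rhom_toK] rhom_power[OF rhom_toK])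
      ultimately show ?thesis using zeros[of P D] PV by simp
    qed
  qed (simp_all add: xc_def fx_def \<Theta>_def)
  moreover have "finite {Q \<in> S. \<Theta> Q = 0}"
  proof -
    define \<theta> where "\<theta> = aev (map_poly toK q) * (\<Prod>i<n. hev aev (var i) (pderiv (map_poly (map_poly toK) (f i))))"
    have "\<theta> \<notin> J"
      using qJ prime_idl_prod[OF _ prJ, of "{..<n}"] f(2) unfolding \<theta>_def by (simp add: prime_idl_mult[OF prJ])
    moreover have "\<theta> - restr {..<n} \<theta> \<in> J"
    proof (rule diff_restr[OF idlJ])
      show "var i \<in> J" if "i \<notin> {..<n}" for i
        unfolding J_def using that J_upto_C[OF idl_0[OF idlJ] upto_0] by (intro var_full_idl)
    qed
    ultimately have "restr {..<n} \<theta> \<notin> J" using idl_cong[OF idlJ] by blast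
    moreover obtain m where "restr {..<n} \<theta> \<in> V m" using mpolys_imp_upto[OF restr_in] by blast
    ultimately have fin: "finite {Q \<in> S. E Q \<theta> = 0}" using zeros by blast
    have "E Q \<theta> = toK (\<Theta> Q)" for Q
    proof -
      have "E Q (hev aev (var i) (pderiv (map_poly (map_poly toK) (f i)))) = toK (poly (pderiv (fx i (xc Q))) (Q i))"
        if "i < n" for i
        using E_hev[OF that, of Q "pderiv (f i)"]
        by (simp add: fx_def pderiv_map_poly[OF rp] pderiv_map_poly[OF rhom_map_poly[OF rhom_toK]])
      then show ?thesis
        by (simp add: \<theta>_def \<Theta>_def rhom_mult[OF rE] rhom_prod[OF rE] E_aev rhom_mult[OF rhom_toK] rhom_prod[OF rhom_toK])
    qed
    then show ?thesis using fin by simp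
  qed
  ultimately show ?thesis unfolding S_def by blast
qed

section \<open>The space of polynomial points\<close>

lemma irreducible_in_closure_of:
  assumes "irreducible_in T Z" shows "irreducible_in T (T closure_of Z)"
  unfolding irreducible_in_def
proof (intro conjI allI impI)
  have Z: "Z \<subseteq> topspace T" "Z \<noteq> {}" using assms by (auto simp: irreducible_in_def)
  show "T closure_of Z \<subseteq> topspace T" by (rule closure_of_subset_topspace)
  have sub: "Z \<subseteq> T closure_of Z" by (rule closure_of_subset[OF Z(1)])
  then show "T closure_of Z \<noteq> {}" using Z(2) by blast
  fix A B assume AB: "closedin T A \<and> closedin T B \<and> T closure_of Z \<subseteq> A \<union> B"
  then have "Z \<subseteq> A \<union> B" using sub by blast
  then have "Z \<subseteq> A \<or> Z \<subseteq> B" using assms AB by (simp add: irreducible_in_def)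
  then show "T closure_of Z \<subseteq> A \<or> T closure_of Z \<subseteq> B" using AB closure_of_minimal[of Z _ T] by blast
qed

lemma closedin_irreducible_component:
  assumes "Z \<in> irreducible_components T" shows "closedin T Z"
proof -
  have Z: "irreducible_in T Z" "\<And>Y. irreducible_in T Y \<Longrightarrow> Z \<subseteq> Y \<Longrightarrow> Y = Z"
    using assms by (auto simp: irreducible_components_def)
  then have "Z \<subseteq> T closure_of Z" by (intro closure_of_subset) (simp add: irreducible_in_def)
  then have "T closure_of Z = Z" by (intro Z(2) irreducible_in_closure_of Z(1))
  then show ?thesis by (metis closedin_closure_of)
qed

text \<open>The hypothesis \<open>fibres\<close> supplies \<open>p\<close> and \<open>xs\<close> for
  each finite family separately, since the point \<open>t0\<close> behind them has to be adapted to
  the members. It speaks of infinite members only, because \<open>\<Theta>\<close> may vanish on a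
  finite set.\<close>

theorem dim_and_components_of_finite_fibres:
  fixes X :: "('i \<Rightarrow> complex) set"
  assumes I: "finite I" and X: "closedin (zariski I) X" and k: "1 \<le> k"
    and fibres: "\<And>\<Z>. finite \<Z> \<Longrightarrow> (\<And>Z. Z \<in> \<Z> \<Longrightarrow> Z \<subseteq> X \<and> infinite Z) \<Longrightarrow>
      \<exists>p xs. p \<in> mpolys I \<and> set xs \<subseteq> mpolys I \<and> length xs = k \<and> (\<forall>Z\<in>\<Z>. \<exists>Q\<in>Z. eval_mpoly Q p \<noteq> 0) \<and>
        (\<forall>v. finite {Q \<in> X. eval_mpoly Q p \<noteq> 0 \<and> map (eval_mpoly Q) xs = v} \<and>
          card {Q \<in> X. eval_mpoly Q p \<noteq> 0 \<and> map (eval_mpoly Q) xs = v} \<le> M)"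
  defines "T \<equiv> subtopology (zariski I) X"
  shows "space_krull_dim T \<le> enat k"
    and "finite {Z \<in> irreducible_components T. space_krull_dim (subtopology T Z) = enat k} \<and>
      card {Z \<in> irreducible_components T. space_krull_dim (subtopology T Z) = enat k} \<le> M"
proof -
  have closedT: "closedin (zariski I) Z" if "closedin T Z" for Z
    using that X unfolding T_def by (rule closedin_trans_full)
  have irrT: "irreducible_in (zariski I) Z \<and> Z \<subseteq> X" if "irreducible_in T Z" for Z
    using irreducible_in_subtopology[of "zariski I" X Z] that
    by (auto simp: T_def irreducible_in_def[of "subtopology (zariski I) X"])
  define G where "G = (\<lambda>\<Z> p xs. p \<in> mpolys I \<and> set xs \<subseteq> mpolys I \<and> length xs = k \<and>
    (\<forall>Z\<in>\<Z>. \<exists>Q\<in>Z. eval_mpoly Q p \<noteq> 0) \<and>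
    (\<forall>v. finite {Q \<in> X. eval_mpoly Q p \<noteq> 0 \<and> map (eval_mpoly Q) xs = v} \<and>
      card {Q \<in> X. eval_mpoly Q p \<noteq> 0 \<and> map (eval_mpoly Q) xs = v} \<le> M))"
  have G: "\<exists>p xs. G \<Z> p xs" if "finite \<Z>" "\<And>Z. Z \<in> \<Z> \<Longrightarrow> Z \<subseteq> X \<and> infinite Z" for \<Z>
    unfolding G_def by (rule fibres[OF that])
  show "space_krull_dim T \<le> enat k"
    unfolding space_krull_dim_def chain_dim_def
  proof (rule Sup_least, clarify)
    fix m and Z :: "nat \<Rightarrow> ('i \<Rightarrow> complex) set"
    assume Z: "\<forall>i\<le>m. Z i \<in> {Z. closedin T Z \<and> irreducible_in T Z}" "\<forall>i<m. Z i \<subset> Z (Suc i)"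
    show "enat m \<le> enat k"
    proof (cases m)
      case (Suc l)
      have irr: "irreducible_in (zariski I) (Z m) \<and> Z m \<subseteq> X" using Z(1) by (intro irrT) simp
      have ne: "Z l \<noteq> {}" "Z l \<subset> Z m" using Z Suc by (auto simp: irreducible_in_def)
      have "infinite (Z m)" using irreducible_infinite[OF I _ ne] irr by blast
      then obtain p xs where "G {Z m} p xs" using G[of "{Z m}"] irr by blast
      then have p: "p \<in> mpolys I" "set xs \<subseteq> mpolys I" "length xs = k" "\<exists>Q\<in>Z m. eval_mpoly Q p \<noteq> 0"
        "\<And>v. finite {Q \<in> X. eval_mpoly Q p \<noteq> 0 \<and> map (eval_mpoly Q) xs = v}"
        by (simp_all add: G_def)
      from p(4) obtain Q where "Q \<in> Z m" "eval_mpoly Q p \<noteq> 0" by blast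
      with Z closedT irrT p irr have "m \<le> length xs"
        by (intro chain_length_le_of_finite_fibres[THEN conjunct1, OF I, of m Z X p Q xs]) auto
      then show ?thesis using p(3) by simp
    qed simp
  qed
  let ?C = "{Z \<in> irreducible_components T. space_krull_dim (subtopology T Z) = enat k}"
  have comp: "closedin (zariski I) Z" "irreducible_in (zariski I) Z" "Z \<subseteq> X"
    "\<And>Z'. Z' \<in> ?C \<Longrightarrow> Z \<subseteq> Z' \<Longrightarrow> Z = Z'" if "Z \<in> ?C" for Z
    using that closedT[OF closedin_irreducible_component, of Z] irrT[of Z]
    by (auto simp: irreducible_components_def)
  have chain: "\<exists>W. (\<forall>j\<le>k. closedin (zariski I) (W j) \<and> irreducible_in (zariski I) (W j)) \<and>
      (\<forall>j<k. W j \<subset> W (Suc j)) \<and> W k = Z" if Z: "Z \<in> ?C" for Z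
  proof -
    have "chain_dim {Y. closedin (subtopology T Z) Y \<and> irreducible_in (subtopology T Z) Y} = enat k"
      using Z by (simp add: space_krull_dim_def)
    then have "enat k \<le> chain_dim {Y. closedin (subtopology T Z) Y \<and> irreducible_in (subtopology T Z) Y}" by simp
    then obtain W where W0: "\<And>j. j \<le> k \<Longrightarrow> W j \<in> {Y. closedin (subtopology T Z) Y \<and> irreducible_in (subtopology T Z) Y}"
      and W1: "\<And>j. j < k \<Longrightarrow> W j \<subset> W (Suc j)"
      by (rule chain_dim_obtain) (use k in auto)
    then have W: "\<And>j. j \<le> k \<Longrightarrow> closedin (subtopology T Z) (W j) \<and> irreducible_in (subtopology T Z) (W j)"
      "\<And>j. j < k \<Longrightarrow> W j \<subset> W (Suc j)" by auto
    have clZ: "closedin T Z" using Z by (auto intro: closedin_irreducible_component)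
    have W': "closedin (zariski I) (W j) \<and> irreducible_in (zariski I) (W j) \<and> W j \<subseteq> Z" if "j \<le> k" for j
    proof (intro conjI)
      show "closedin (zariski I) (W j)" using W(1)[OF that] clZ by (blast intro: closedT closedin_trans_full)
      show "irreducible_in (zariski I) (W j)" using W(1)[OF that] irrT irreducible_in_subtopology by blast
      show "W j \<subseteq> Z" using W(1)[OF that] closedin_subset by fastforce
    qed
    \<comment> \<open>The chain may end strictly inside \<open>Z\<close>; its top is replaced by
      \<open>Z\<close> itself.\<close>
    define W0 where "W0 = W(k := Z)"
    have "W0 j \<subset> W0 (Suc j)" if "j < k" for j
      using W(2)[OF that] W'[of k] that by (cases "Suc j = k") (auto simp: W0_def)
    then show ?thesis using W' comp[OF Z] by (intro exI[of _ W0]) (auto simp: W0_def)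
  qed
  have inf: "infinite Z" if Z: "Z \<in> ?C" for Z
  proof -
    obtain W where W: "\<And>j. j \<le> k \<Longrightarrow> irreducible_in (zariski I) (W j)" "\<And>j. j < k \<Longrightarrow> W j \<subset> W (Suc j)" "W k = Z"
      using chain[OF Z] by blast
    have "W (k - 1) \<noteq> {}" using W(1)[of "k - 1"] by (simp add: irreducible_in_def)
    moreover have "W (k - 1) \<subset> Z" using W(2)[of "k - 1"] W(3) k by simp
    ultimately show ?thesis using comp(2)[OF Z] by (intro irreducible_infinite[OF I]) auto
  qed
  show "finite ?C \<and> card ?C \<le> M"
  \<comment> \<open>Finiteness and the bound follow together from the same bound for all finite
    subfamilies.\<close>
  proof (rule finite_if_finite_subsets_card_bdd)
    fix \<Z> assume \<Z>: "\<Z> \<subseteq> ?C" "finite \<Z>"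
    then have "\<exists>p xs. G \<Z> p xs" using comp(3) inf by (intro G) blast+
    then obtain p xs where "G \<Z> p xs" by blast
    then have p: "p \<in> mpolys I" "set xs \<subseteq> mpolys I" "length xs = k"
      "\<And>Z. Z \<in> \<Z> \<Longrightarrow> \<exists>Q\<in>Z. eval_mpoly Q p \<noteq> 0"
      "\<And>v. finite {Q \<in> X. eval_mpoly Q p \<noteq> 0 \<and> map (eval_mpoly Q) xs = v}"
      "\<And>v. card {Q \<in> X. eval_mpoly Q p \<noteq> 0 \<and> map (eval_mpoly Q) xs = v} \<le> M"
      unfolding G_def by blast+
    show "card \<Z> \<le> M"
    proof (rule card_components_le_of_fibres[OF I \<Z>(2) _ _ _ p(1) p(4) p(2) p(5) p(6)])
      show "closedin (zariski I) Z \<and> irreducible_in (zariski I) Z \<and> Z \<subseteq> X" if "Z \<in> \<Z>" for Z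
        using comp(1-3)[of Z] that \<Z>(1) by blast
      show "Z = Z'" if "Z \<in> \<Z>" "Z' \<in> \<Z>" "Z \<subseteq> Z'" for Z Z'
        using comp(4)[of Z Z'] that \<Z>(1) by blast
      show "alg_indep (van I Z) xs" if "Z \<in> \<Z>" for Z
      proof -
        have ZC: "Z \<in> ?C" using that \<Z>(1) by blast
        obtain W where W: "\<And>j. j \<le> k \<Longrightarrow> closedin (zariski I) (W j) \<and> irreducible_in (zariski I) (W j)"
          "\<And>j. j < k \<Longrightarrow> W j \<subset> W (Suc j)" "W k = Z" using chain[OF ZC] by blast
        obtain Q where Q: "Q \<in> Z" "eval_mpoly Q p \<noteq> 0" using p(4)[OF \<open>Z \<in> \<Z>\<close>] by blast
        have "W k \<subseteq> X" "Q \<in> W k" using W(3) Q(1) comp(3)[OF ZC] by simp_all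
        from chain_length_le_of_finite_fibres[where m = k and Z = W and X = X, OF I W(1,2) this(1) p(1) this(2) Q(2) p(2,5)]
        have "alg_indep (van I (W k)) xs" using p(3) by simp
        then show ?thesis using W(3) by simp
      qed
    qed
  qed
qed

text \<open>Polynomials in \<open>t\<close> whose coefficients are polynomial functions of the
  vector \<open>v\<close>, encoded by one polynomial \<open>P\<close> with coefficients in the ring
  of polynomials in \<open>t\<close>.\<close>

definition poly_family :: "'i set \<Rightarrow> (('i \<Rightarrow> 'k) \<Rightarrow> 'k::comm_ring_1 poly) \<Rightarrow> bool" where
  "poly_family I g \<longleftrightarrow> (\<exists>P\<in>mpolys I. \<forall>v. g v = eval_mpoly (\<lambda>i. [:v i:]) P)"

lemma poly_family_const: "poly_family I (\<lambda>_. c)"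
  unfolding poly_family_def using upto_imp_mpolys[OF kap_upto] by (intro bexI[of _ "kap c"]) auto

lemma poly_family_coord: "i \<in> I \<Longrightarrow> poly_family I (\<lambda>v. [:v i:])"
  unfolding poly_family_def by (intro bexI[of _ "var i"]) (auto intro: upto_imp_mpolys var_upto)

lemma poly_family_add: "poly_family I g \<Longrightarrow> poly_family I h \<Longrightarrow> poly_family I (\<lambda>v. g v + h v)"
  unfolding poly_family_def by (metis eval_mpoly_add mpolys_add)

lemma poly_family_mult: "poly_family I g \<Longrightarrow> poly_family I h \<Longrightarrow> poly_family I (\<lambda>v. g v * h v)"
  unfolding poly_family_def by (metis eval_mpoly_mult mpolys_mult)

lemma poly_family_sum: "(\<And>a. a \<in> A \<Longrightarrow> poly_family I (g a)) \<Longrightarrow> poly_family I (\<lambda>v. \<Sum>a\<in>A. g a v)"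
  by (induction A rule: infinite_finite_induct) (auto simp: poly_family_const poly_family_add)

lemma poly_family_prod: "(\<And>a. a \<in> A \<Longrightarrow> poly_family I (g a)) \<Longrightarrow> poly_family I (\<lambda>v. \<Prod>a\<in>A. g a v)"
  by (induction A rule: infinite_finite_induct) (auto simp: poly_family_const poly_family_mult)

lemma poly_family_power: "poly_family I g \<Longrightarrow> poly_family I (\<lambda>v. g v ^ e)"
  by (induction e) (auto simp: poly_family_const poly_family_mult)

lemma poly_family_smult: "poly_family I g \<Longrightarrow> poly_family I (\<lambda>v. smult c (g v))"
  using poly_family_mult[OF poly_family_const[of I "[:c:]"]] by simp

lemma poly_family_poly: "poly_family I g \<Longrightarrow> poly_family I (\<lambda>v. poly F (g v))"
  by (induction F) (auto simp: poly_family_const poly_family_mult poly_family_add)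

lemma poly_family_poly_map_poly:
  "poly_family I g \<Longrightarrow> poly_family I h \<Longrightarrow> poly_family I (\<lambda>v. poly (map_poly (\<lambda>a. poly a (g v)) F) (h v))"
  by (induction F) (auto simp: map_poly_pCons poly_family_const poly_family_mult poly_family_add poly_family_poly)

text \<open>A linear functional acts on the coefficients of \<open>P\<close> alone, since monomials
  in the \<open>v i\<close> are constant in \<open>t\<close>. It is used for coefficients, for
  values at \<open>t0\<close> and for remainders modulo a power of \<open>t - t0\<close>.\<close>

lemma poly_family_functional:
  fixes g :: "('i \<Rightarrow> 'k::comm_ring_1) \<Rightarrow> 'k poly" and L :: "'k poly \<Rightarrow> 'k"
  assumes g: "poly_family I g" and L: "\<And>p q. L (p + q) = L p + L q" "\<And>c p. L (smult c p) = c * L p"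
  shows "\<exists>p\<in>mpolys I. \<forall>v. L (g v) = eval_mpoly v p"
proof -
  obtain P where P: "P \<in> mpolys I" "\<And>v. g v = eval_mpoly (\<lambda>i. [:v i:]) P"
    using g unfolding poly_family_def by blast
  have L0: "L 0 = 0" using L(1)[of 0 0] by simp
  have Lsum: "L (sum h A) = (\<Sum>a\<in>A. L (h a))" for h :: "('i \<Rightarrow>\<^sub>0 nat) \<Rightarrow> 'k poly" and A
    by (induction A rule: infinite_finite_induct) (auto simp: L0 L(1))
  have mon: "eval_monom (\<lambda>i. [:v i:]) m = [:eval_monom v m:]" for v :: "'i \<Rightarrow> 'k" and m
    by (rule rhom_eval_monom[symmetric, of "\<lambda>c. [:c:]"]) (simp add: rhom_def)
  define p where "p = (\<Sum>m\<in>Poly_Mapping.keys P. Poly_Mapping.single m (L (Poly_Mapping.lookup P m)))"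
  have "p \<in> mpolys I"
  proof -
    have "Poly_Mapping.keys p \<subseteq> Poly_Mapping.keys P"
      by (auto simp: p_def in_keys_iff lookup_sum lookup_single when_def)
    then show ?thesis using P(1) by (auto simp: mpolys_def)
  qed
  moreover have "L (g v) = eval_mpoly v p" for v
    by (simp add: P(2) eval_mpoly_def[of _ P] Lsum mon L(2) mult.commute p_def eval_sum eval_mpoly_single)
  ultimately show ?thesis by blast
qed

definition poly_vector :: "nat \<Rightarrow> nat \<Rightarrow> (nat \<times> nat \<Rightarrow> complex) \<Rightarrow> nat \<Rightarrow> complex poly" where
  "poly_vector n b v = (\<lambda>i\<in>{..<n}. \<Sum>j<b. monom (v (i, j)) j)"

lemma poly_family_poly_vector:
  assumes "i < n" shows "poly_family ({..<n} \<times> {..<b}) (\<lambda>v. poly_vector n b v i)"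
proof -
  have "poly_vector n b v i = (\<Sum>j<b. [:v (i, j):] * monom 1 j)" for v
    using assms by (simp add: poly_vector_def smult_monom)
  moreover have "poly_family ({..<n} \<times> {..<b}) (\<lambda>v. \<Sum>j<b. [:v (i, j):] * monom 1 j)"
    using assms by (intro poly_family_sum poly_family_mult poly_family_coord poly_family_const) simp
  ultimately show ?thesis by (simp only:)
qed

lemma coeff_vector_poly_vector:
  assumes "v \<in> affine_space ({..<n} \<times> {..<b})" shows "coeff_vector n b (poly_vector n b v) = v"
proof
  fix ij show "coeff_vector n b (poly_vector n b v) ij = v ij"
  proof (cases "ij \<in> {..<n} \<times> {..<b}")
    case False
    then show ?thesis using PiE_arb[OF assms False] by (simp add: coeff_vector_def)
  qed (auto simp: coeff_vector_def poly_vector_def coeff_sum)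
qed

lemma poly_vector_coeff_vector:
  assumes "Q \<in> {..<n} \<rightarrow>\<^sub>E UNIV" "\<And>i. i < n \<Longrightarrow> degree (Q i) < b"
  shows "poly_vector n b (coeff_vector n b Q) = Q"
proof
  fix i show "poly_vector n b (coeff_vector n b Q) i = Q i"
  proof (cases "i < n")
    case True
    have "poly_vector n b (coeff_vector n b Q) i = (\<Sum>j<b. monom (coeff (Q i) j) j)"
      using True by (simp add: poly_vector_def coeff_vector_def)
    also have "\<dots> = Q i"
      using assms(2)[OF True] by (intro poly_eqI) (auto simp: coeff_sum coeff_eq_0)
    finally show ?thesis .
  qed (use assms(1) in \<open>auto simp: poly_vector_def PiE_def extensional_def\<close>)
qed

lemma degree_poly_vector:
  assumes "1 \<le> b" "i < n" shows "degree (poly_vector n b v i) < b"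
proof -
  have "coeff (poly_vector n b v i) j = 0" if "b - 1 < j" for j
    using that assms by (auto simp: poly_vector_def coeff_sum)
  then have "degree (poly_vector n b v i) \<le> b - 1" by (intro degree_le) blast
  then show ?thesis using assms(1) by simp
qed

lemma coeff_vector_image:
  assumes b: "1 \<le> b"
  shows "coeff_vector n b ` poly_points n C b =
    {v \<in> affine_space ({..<n} \<times> {..<b}). poly_vector n b v \<in> poly_solutions n C}"
proof (intro equalityI subsetI)
  fix v assume "v \<in> coeff_vector n b ` poly_points n C b"
  then obtain Q where Q: "v = coeff_vector n b Q" "Q \<in> poly_points n C b" by blast
  then have "poly_vector n b v = Q" by (auto simp: poly_points_def intro: poly_vector_coeff_vector)
  then show "v \<in> {v \<in> affine_space ({..<n} \<times> {..<b}). poly_vector n b v \<in> poly_solutions n C}"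
    using Q by (auto simp: poly_points_def poly_solutions_def toK_def coeff_vector_def)
next
  fix v assume v: "v \<in> {v \<in> affine_space ({..<n} \<times> {..<b}). poly_vector n b v \<in> poly_solutions n C}"
  then have "v = coeff_vector n b (poly_vector n b v)" by (simp add: coeff_vector_poly_vector)
  moreover have "poly_vector n b v \<in> poly_points n C b"
    using v degree_poly_vector[OF b] by (auto simp: poly_points_def poly_solutions_def toK_def)
  ultimately show "v \<in> coeff_vector n b ` poly_points n C b" by (rule image_eqI)
qed

lemma closedin_poly_points:
  assumes "1 \<le> b" "C \<subseteq> mpolys {..<n}"
  shows "closedin (zariski ({..<n} \<times> {..<b})) (coeff_vector n b ` poly_points n C b)"
proof -
  let ?I = "{..<n} \<times> {..<b}" and ?a = "poly_vector n b"
  define X where "X = {v \<in> affine_space ?I. ?a v \<in> poly_solutions n C}"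
  \<comment> \<open>\<open>S\<close> consists of all equations of \<open>X\<close>, so the work is
    in one inclusion: a zero of \<open>S\<close> satisfies each \<open>f\<close> in
    \<open>C\<close>, because the coefficients in \<open>t\<close> of a denominator-free multiple of
    \<open>f\<close> are given by members of \<open>S\<close>.\<close>
  define S where "S = {p \<in> mpolys ?I. \<forall>v\<in>X. eval_mpoly v p = 0}"
  have "v \<in> X" if v: "v \<in> zero_locus ?I S" for v
  proof -
    have "eval_mpoly (\<lambda>i\<in>{..<n}. toK (?a v i)) f = 0" if f: "f \<in> C" for f
    proof -
      obtain D where D: "D \<noteq> 0" "\<And>c. c \<in> Poly_Mapping.lookup f ` Poly_Mapping.keys f \<Longrightarrow> toK D * c \<in> range toK"
        using common_denominator[of "Poly_Mapping.lookup f ` Poly_Mapping.keys f"] by auto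
      then have "\<forall>m. \<exists>c. m \<in> Poly_Mapping.keys f \<longrightarrow> toK D * Poly_Mapping.lookup f m = toK c" by blast
      then obtain c where c: "\<And>m. m \<in> Poly_Mapping.keys f \<Longrightarrow> toK D * Poly_Mapping.lookup f m = toK (c m)"
        by metis
      define G where "G = (\<lambda>v. \<Sum>m\<in>Poly_Mapping.keys f. c m * (\<Prod>i\<in>Poly_Mapping.keys m. ?a v i ^ Poly_Mapping.lookup m i))"
      have keys: "i < n" if "m \<in> Poly_Mapping.keys f" "i \<in> Poly_Mapping.keys m" for m i
        using f assms(2) that by (auto simp: mpolys_def)
      have G: "toK (G u) = toK D * eval_mpoly (\<lambda>i\<in>{..<n}. toK (?a u i)) f" for u
      proof -
        have "toK (c m * (\<Prod>i\<in>Poly_Mapping.keys m. ?a u i ^ Poly_Mapping.lookup m i)) =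
            toK D * (Poly_Mapping.lookup f m * eval_monom (\<lambda>i\<in>{..<n}. toK (?a u i)) m)"
          if m: "m \<in> Poly_Mapping.keys f" for m
        proof -
          have "eval_monom (\<lambda>i\<in>{..<n}. toK (?a u i)) m = toK (\<Prod>i\<in>Poly_Mapping.keys m. ?a u i ^ Poly_Mapping.lookup m i)"
            unfolding eval_monom_def rhom_prod[OF rhom_toK] rhom_power[OF rhom_toK]
            using keys[OF m] by (intro prod.cong) auto
          then show ?thesis by (simp add: rhom_mult[OF rhom_toK] c[OF m, symmetric] mult.assoc)
        qed
        then show ?thesis by (simp add: G_def rhom_sum[OF rhom_toK] eval_mpoly_def sum_distrib_left)
      qed
      have famG: "poly_family ?I G"
        unfolding G_def using keys
        by (intro poly_family_sum poly_family_mult poly_family_const poly_family_prod poly_family_power poly_family_poly_vector)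
      have "coeff (G v) k = 0" for k
      proof -
        obtain p where p: "p \<in> mpolys ?I" "\<And>u. coeff (G u) k = eval_mpoly u p"
          using poly_family_functional[OF famG, of "\<lambda>p. coeff p k"] by auto
        have "G u = 0" if "u \<in> X" for u
        proof -
          have "toK (G u) = 0"
            using that f by (simp add: G X_def poly_solutions_def rational_points_def zero_locus_def)
          then show ?thesis by simp
        qed
        then have "p \<in> S" using p by (auto simp: S_def simp flip: p(2))
        then show ?thesis using v p(2) by (simp add: zero_locus_def)
      qed
      then have "G v = 0" by (intro poly_eqI) simp
      then show ?thesis using G[of v] D(1) by (simp add: rhom_0[OF rhom_toK])
    qed
    then have "(\<lambda>i\<in>{..<n}. toK (?a v i)) \<in> zero_locus {..<n} C" by (simp add: zero_locus_def)
    moreover have "?a v \<in> {..<n} \<rightarrow>\<^sub>E UNIV" by (simp add: poly_vector_def)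
    moreover have "v \<in> affine_space ?I" using v by (simp add: zero_locus_def)
    ultimately show ?thesis by (simp add: X_def poly_solutions_def rational_points_def)
  qed
  moreover have "v \<in> zero_locus ?I S" if "v \<in> X" for v
    using that by (simp add: S_def zero_locus_def) (simp add: X_def)
  ultimately have "X = zero_locus ?I S" by (intro equalityI subsetI)
  then have "closedin (zariski ?I) X" unfolding closedin_zariski by (intro exI[of _ S]) (auto simp: S_def)
  then show ?thesis unfolding coeff_vector_image[OF assms(1)] X_def .
qed

lemma nat_ceiling_divide:
  assumes "1 \<le> b" "1 \<le> d"
  defines "k \<equiv> nat \<lceil>real b / real d\<rceil>"
  shows "1 \<le> k \<and> b \<le> k * d \<and> (k - 1) * d < b"
proof -
  have pos: "0 < real b / real d" using assms by simp
  then have "real k = of_int \<lceil>real b / real d\<rceil>" by (simp add: k_def)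
  then have k: "real b / real d \<le> real k" "real k < real b / real d + 1" by linarith+
  then have "0 < real k" using pos by linarith
  then have 1: "1 \<le> k" by simp
  have "real b \<le> real (k * d)" "real ((k - 1) * d) < real b"
    using k assms(1,2) 1 by (simp_all add: field_simps of_nat_diff)
  then show ?thesis using 1 by (simp only: of_nat_le_iff of_nat_less_iff)
qed

theorem poly_points_bound:
  fixes C :: "(nat, complex poly fract) mpoly set"
  assumes curve: "irreducible_affine_curve n C" and deg: "has_degree n C d" and b: "1 \<le> b"
  defines "T \<equiv> poly_points_space n C b" and "k \<equiv> nat \<lceil>real b / real d\<rceil>"
  shows "space_krull_dim T \<le> enat k \<and>
    finite {Z \<in> irreducible_components T. space_krull_dim (subtopology T Z) = enat k} \<and>
    card {Z \<in> irreducible_components T. space_krull_dim (subtopology T Z) = enat k} \<le> 2 * b * d ^ 3"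
proof -
  let ?I = "{..<n} \<times> {..<b}" and ?a = "poly_vector n b" and ?X = "coeff_vector n b ` poly_points n C b"
  obtain lam w f q s xc fx \<Theta> where cp: "curve_points n d lam w f q s (poly_solutions n C) xc fx \<Theta>"
    and fin\<Theta>: "finite {Q \<in> poly_solutions n C. \<Theta> Q = 0}"
    using exists_curve_points[OF curve deg] by blast
  interpret curve_points n d lam w f q s "poly_solutions n C" xc fx \<Theta> by (rule cp)
  have k: "1 \<le> k" "b \<le> k * d" "(k - 1) * d < b" using nat_ceiling_divide[OF b d] by (auto simp: k_def)
  have X: "?X = {v \<in> affine_space ?I. ?a v \<in> poly_solutions n C}" by (rule coeff_vector_image[OF b])
  have inj: "inj_on ?a ?X" by (rule inj_on_inverseI[of _ "coeff_vector n b"]) (auto simp: X coeff_vector_poly_vector)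
  have fam_xc: "poly_family ?I (\<lambda>v. xc (?a v))"
    unfolding xc_def by (intro poly_family_sum poly_family_smult poly_family_poly_vector) simp
  have pderiv_fx: "pderiv (fx i Y) = map_poly (\<lambda>a. poly a Y) (pderiv (f i))" for i Y
    unfolding fx_def by (rule pderiv_map_poly) (simp add: rhom_def)
  have fam_\<Theta>: "poly_family ?I (\<lambda>v. \<Theta> (?a v))"
    unfolding \<Theta>_def pderiv_fx
    by (intro poly_family_mult poly_family_prod poly_family_poly poly_family_poly_map_poly fam_xc poly_family_poly_vector) simp
  have closed: "closedin (zariski ?I) ?X"
  proof (rule closedin_poly_points[OF b])
    interpret primeideal C "mpoly_ring {..<n}" using curve by (simp add: irreducible_affine_curve_def)
    show "C \<subseteq> mpolys {..<n}" using a_subset by (simp add: mpoly_ring_def)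
  qed
  have fibres: "\<exists>p xs. p \<in> mpolys ?I \<and> set xs \<subseteq> mpolys ?I \<and> length xs = k \<and> (\<forall>Z\<in>\<Z>. \<exists>v\<in>Z. eval_mpoly v p \<noteq> 0) \<and>
      (\<forall>y. finite {v \<in> ?X. eval_mpoly v p \<noteq> 0 \<and> map (eval_mpoly v) xs = y} \<and>
        card {v \<in> ?X. eval_mpoly v p \<noteq> 0 \<and> map (eval_mpoly v) xs = y} \<le> 2 * b * d ^ 3)"
    if \<Z>: "finite \<Z>" "\<And>Z. Z \<in> \<Z> \<Longrightarrow> Z \<subseteq> ?X \<and> infinite Z" for \<Z>
  proof -
    \<comment> \<open>\<open>\<Theta>\<close> vanishes at only finitely many polynomial points, so
      an infinite \<open>Z\<close> has a point where it does not.\<close>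
    have "\<exists>v\<in>Z. \<Theta> (?a v) \<noteq> 0" if Z: "Z \<in> \<Z>" for Z
    proof (rule ccontr)
      assume "\<not> ?thesis"
      then have "?a ` Z \<subseteq> {Q \<in> poly_solutions n C. \<Theta> Q = 0}" using \<Z>(2)[OF Z] unfolding X by blast
      then have "finite (?a ` Z)" using fin\<Theta> finite_subset by blast
      then show False using \<Z>(2)[OF Z] inj finite_imageD inj_on_subset by blast
    qed
    then obtain v0 where v0: "\<And>Z. Z \<in> \<Z> \<Longrightarrow> v0 Z \<in> Z" "\<And>Z. Z \<in> \<Z> \<Longrightarrow> \<Theta> (?a (v0 Z)) \<noteq> 0" by metis
    have "finite (\<Union>Z\<in>\<Z>. {t. poly (\<Theta> (?a (v0 Z))) t = 0})"
      using \<Z>(1) v0(2) by (intro finite_UN_I poly_roots_finite) auto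
    \<comment> \<open>One \<open>t0\<close> avoids the roots of the finitely many nonzero
      polynomials \<open>\<Theta> (?a (v0 Z))\<close>, so the inequation at \<open>t0\<close> holds
      somewhere on every member.\<close>
    then obtain t0 where t0: "t0 \<notin> (\<Union>Z\<in>\<Z>. {t. poly (\<Theta> (?a (v0 Z))) t = 0})"
      using ex_new_if_finite[OF infinite_UNIV_char_0] by blast
    obtain p where p: "p \<in> mpolys ?I" "\<And>v. poly (\<Theta> (?a v)) t0 = eval_mpoly v p"
      using poly_family_functional[OF fam_\<Theta>, of "\<lambda>p. poly p t0"] by auto
    \<comment> \<open>The \<open>k\<close> functions \<open>xs\<close> are the coefficients of the
      remainder of \<open>xc\<close> modulo \<open>m\<close>, which depend linearly on
      \<open>xc\<close>.\<close>
    define m where "m = [:-t0, 1:] ^ k"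
    have degm: "degree m = k" unfolding m_def by (simp add: degree_linear_power)
    have "\<exists>r\<in>mpolys ?I. \<forall>v. coeff (xc (?a v) mod m) j = eval_mpoly v r" for j
      by (rule poly_family_functional[OF fam_xc]) (simp_all add: poly_mod_add_left mod_smult_left)
    then obtain r where r: "\<And>j. r j \<in> mpolys ?I" "\<And>j v. coeff (xc (?a v) mod m) j = eval_mpoly v (r j)" by metis
    define xs where "xs = map r [0..<k]"
    have fibre: "finite {v \<in> ?X. eval_mpoly v p \<noteq> 0 \<and> map (eval_mpoly v) xs = y} \<and>
        card {v \<in> ?X. eval_mpoly v p \<noteq> 0 \<and> map (eval_mpoly v) xs = y} \<le> 2 * b * d ^ 3" (is "finite ?F \<and> card ?F \<le> _") for y
    proof -
      define u where "u = (\<Sum>j<k. monom (y ! j) j)"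
      let ?G = "{Q \<in> poly_solutions n C. (\<forall>i<n. degree (Q i) < b) \<and> poly (\<Theta> Q) t0 \<noteq> 0 \<and> xc Q mod m = u}"
      have G: "finite ?G" "card ?G \<le> 2 * b * d ^ 3" using card_fibre_le[OF b k(2,3)] unfolding m_def by auto
      have "xc (?a v) mod m = u" if v: "map (eval_mpoly v) xs = y" for v
      proof (rule poly_eqI)
        fix j
        show "coeff (xc (?a v) mod m) j = coeff u j"
        proof (cases "j < k")
          case True
          then show ?thesis using v by (auto simp: r(2) u_def coeff_sum xs_def)
        next
          case False
          have "degree (xc (?a v) mod m) < k" using degree_mod_less[of m "xc (?a v)"] degm k(1)
            by (cases "xc (?a v) mod m = 0") (auto simp: m_def)
          then show ?thesis using False by (simp add: coeff_eq_0 u_def coeff_sum)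
        qed
      qed
      then have sub: "?a ` ?F \<subseteq> ?G" using degree_poly_vector[OF b] unfolding X by (auto simp: p(2))
      have injF: "inj_on ?a ?F" by (rule inj_on_subset[OF inj]) blast
      show ?thesis
        using finite_imageD[OF finite_subset[OF sub G(1)] injF] card_inj_on_le[OF injF sub G(1)] G(2) by simp
    qed
    show ?thesis
    proof (intro exI conjI ballI allI)
      show "p \<in> mpolys ?I" by (rule p(1))
      show "set xs \<subseteq> mpolys ?I" "length xs = k" using r(1) by (auto simp: xs_def)
      show "\<exists>v\<in>Z. eval_mpoly v p \<noteq> 0" if "Z \<in> \<Z>" for Z
        using v0(1)[OF that] t0 that by (intro bexI[of _ "v0 Z"]) (auto simp flip: p(2))
    qed (use fibre in blast)+
  qed
  have I: "finite ?I" by simp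
  note dim = dim_and_components_of_finite_fibres[where I = ?I and X = ?X and k = k and M = "2 * b * d ^ 3", OF I closed k(1)]
  show ?thesis
    unfolding T_def poly_points_space_def
  proof (rule conjI)
    show "space_krull_dim (subtopology (zariski ?I) ?X) \<le> enat k" by (rule dim(1)) (rule fibres)
    show "finite {Z \<in> irreducible_components (subtopology (zariski ?I) ?X).
          space_krull_dim (subtopology (subtopology (zariski ?I) ?X) Z) = enat k} \<and>
        card {Z \<in> irreducible_components (subtopology (zariski ?I) ?X).
          space_krull_dim (subtopology (subtopology (zariski ?I) ?X) Z) = enat k} \<le> 2 * b * d ^ 3"
      by (rule dim(2)) (rule fibres)
  qed
qed

theorem theorem3:
  shows "\<exists>c::real. c > 0 \<and>
    (\<forall>(n::nat) (C :: (nat, complex poly fract) mpoly set) (d::nat).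
       irreducible_affine_curve n C \<longrightarrow> has_degree n C d \<longrightarrow>
       (\<forall>b::nat. b \<ge> 1 \<longrightarrow>
          (let X = poly_points_space n C b;
               e = enat (nat \<lceil>real b / real d\<rceil>);
               \<Z> = {Z \<in> irreducible_components X. space_krull_dim (subtopology X Z) = e}
           in space_krull_dim X \<le> e \<and>
              finite \<Z> \<and> real (card \<Z>) \<le> c * real d ^ 3 * real b)))"
\<comment> \<open>The constant 2 is the one in \<open>D = 2 * b * d\<close>, the degree of the
  auxiliary polynomial.\<close>
proof (intro exI[of _ 2] conjI allI impI)
  fix n d b :: nat and C :: "(nat, complex poly fract) mpoly set"
  assume "irreducible_affine_curve n C" "has_degree n C d" "1 \<le> b"
  note bound = poly_points_bound[OF this]
  have "real N \<le> 2 * real d ^ 3 * real b" if "N \<le> 2 * b * d ^ 3" for N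
  proof -
    have "real N \<le> real (2 * b * d ^ 3)" using that by (simp only: of_nat_le_iff)
    then show ?thesis by (simp add: mult_ac)
  qed
  then show "let X = poly_points_space n C b; e = enat (nat \<lceil>real b / real d\<rceil>);
      \<Z> = {Z \<in> irreducible_components X. space_krull_dim (subtopology X Z) = e}
    in space_krull_dim X \<le> e \<and> finite \<Z> \<and> real (card \<Z>) \<le> 2 * real d ^ 3 * real b"
    unfolding Let_def using bound by blast
qed simp

end
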